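(* Let $1<\alpha<2$, let $S$ be one of the spaces $l^p_{(\beta_i)}$ ($1\le p<\infty$), $l^\infty_{(\beta_i)}$, $\mathbb R^{\mathbb N}$, and let $\mu$ be a Borel probability measure on $(S,\mathcal B(S))$. Suppose that for each $i\in\mathbb N$ there is a $\sigma_{i^c}$-measurable function $0\le\rho(\cdot\,|\,\sigma_{i^c})$ on $\mathbb R$ with $\mu(dy\,|\,\sigma_{i^c})=\rho(y\,|\,\sigma_{i^c})\,dy$, $\mu$-a.e., and that for every compact $K\subset\mathbb R$ there is a constant $L_i<\infty$ (which may depend on $i$) with $\operatorname{ess\,sup}_{y\in K}\rho(y\,|\,\sigma_{i^c})\le L_i$, $\mu$-a.e. (the essential supremum being with respect to Lebesgue measure). Let $(\mathcal E_{(\alpha)},\mathcal D(\mathcal E_{(\alpha)}))$ be the closed Markovian symmetric form on $L^2(S;\mu)$ obtained as the closure of $\mathcal E_{(\alpha)}$ on $\mathcal FC_0^\infty$, and let $X_i:S\ni\mathbf x\mapsto x_i\in\mathbb R$. (i) Let $S=l^p_{(\beta_i)}$, $1\le p<\infty$. If there exist a positive $l^p$ sequence $\{\gamma_i^{-1/p}\}_{i\in\mathbb N}$ and an $M_0<\infty$ such that $$\mu\Big(\bigcup_{M\in\mathbb N}\{|X_i|\le M\,\beta_i^{-1/p}\gamma_i^{-1/p},\ \forall i\in\mathbb N\}\Big)=1,$$ $$\sum_{i=1}^\infty\big(\beta_i^{1/p}\gamma_i^{1/p}\big)^{\alpha+1}\mu\big(\beta_i^{1/p}|X_i|>M_0\,\gamma_i^{-1/p}\big)<\infty,$$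 $$\lim_{M\to\infty}M^{-\alpha}\sum_{i=1}^\infty L_{M,i}\,\big(\beta_i^{1/p}\gamma_i^{1/p}\big)^{\alpha}\mu\big(\beta_i^{1/p}|X_i|>M\,\gamma_i^{-1/p}\big)<\infty,$$ then $(\mathcal E_{(\alpha)},\mathcal D(\mathcal E_{(\alpha)}))$ is a strictly quasi-regular Dirichlet form, where for $M,i\in\mathbb N$, $L_{M,i}<\infty$ is the constant bounding the conditional density on the compact set $K_{M,i}=[-6M\beta_i^{-1/p}\gamma_i^{-1/p},\,6M\beta_i^{-1/p}\gamma_i^{-1/p}]$, i.e. $\operatorname{ess\,sup}_{y\in K_{M,i}}\rho(y\,|\,\sigma_{i^c})\le L_{M,i}$, $\mu$-a.e. (ii) Let $S=l^\infty_{(\beta_i)}$. If there exists a sequence $\{\gamma_i\}_{i\in\mathbb N}$ with $0<\gamma_1\le\gamma_2\le\cdots\to\infty$ such that $$\sum_{i=1}^\infty(\beta_i\gamma_i)^{\alpha+1}\mu\big(\beta_i|X_i|>M_0\,\gamma_i^{-1}\big)<\infty\quad\text{for some }M_0<\infty,$$ $$\lim_{M\to\infty}M^{-\alpha}\sum_{i=1}^\infty L_{M,i}\,(\beta_i\gamma_i)^{\alpha}\mu\big(\beta_i|X_i|>M\,\gamma_i^{-1}\big)<\infty,$$ $$\mu\Big(\bigcup_{M\in\mathbb N}\{|X_i|\le M\,\beta_i^{-1}\gamma_i^{-1},\ \forall i\in\mathbb N\}\Big)=1,$$ then $(\mathcal E_{(\alpha)},\mathcal D(\mathcal E_{(\alpha)}))$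 is a strictly quasi-regular Dirichlet form, where for $M,i\in\mathbb N$, $L_{M,i}<\infty$ is the constant bounding the conditional density on the compact set $K_{M,i}=[-6M\beta_i^{-1}\gamma_i^{-1},\,6M\beta_i^{-1}\gamma_i^{-1}]$, i.e. $\operatorname{ess\,sup}_{y\in K_{M,i}}\rho(y\,|\,\sigma_{i^c})\le L_{M,i}$, $\mu$-a.e. (iii) Let $S=\mathbb R^{\mathbb N}$. If there exists a sequence $\{\gamma_i\}_{i\in\mathbb N}$ with $\gamma_i>0$ for all $i$ and $$\lim_{M\to\infty}M^{-\alpha}\sum_{i=1}^\infty L_{M,i}\,\gamma_i^{-\alpha}\mu\big(|X_i|>M\,\gamma_i\big)<\infty,$$ then $(\mathcal E_{(\alpha)},\mathcal D(\mathcal E_{(\alpha)}))$ is a strictly quasi-regular Dirichlet form, where for $M,i\in\mathbb N$, $L_{M,i}<\infty$ is the constant bounding the conditional density on the compact set $K_{M,i}=[-6M\gamma_i,\,6M\gamma_i]$, i.e. $\operatorname{ess\,sup}_{y\in K_{M,i}}\rho(y\,|\,\sigma_{i^c})\le L_{M,i}$, $\mu$-a.e.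
   Context: **State spaces.** For $p\in[1,\infty)$ and weights $\beta_i>0$, $i\in\mathbb N$, $l^p_{(\beta_i)}=\{\mathbf x=(x_1,x_2,\dots)\in\mathbb R^{\mathbb N}:\|\mathbf x\|=(\sum_{i}\beta_i|x_i|^p)^{1/p}<\infty\}$; $l^\infty_{(\beta_i)}=\{\mathbf x\in\mathbb R^{\mathbb N}:\|\mathbf x\|=\sup_i\beta_i|x_i|<\infty\}$; $\mathbb R^{\mathbb N}$ carries the product metric $d(\mathbf x,\mathbf x')=\sum_{k\ge1}2^{-k}\frac{\|\mathbf x-\mathbf x'\|_k}{\|\mathbf x-\mathbf x'\|_k+1}$ with $\|\mathbf x\|_k=(\sum_{i=1}^k x_i^2)^{1/2}$. $\mathcal B(S)$ is the Borel $\sigma$-field of $S$. **Conditional distributions.** For $i\in\mathbb N$, $\sigma_{i^c}$ is the sub-$\sigma$-field of $\mathcal B(S)$ generated by the sets $\{\mathbf x\in S: x_{j_1}\in B_1,\dots,x_{j_n}\in B_n\}$ with $n\in\mathbb N$, $j_k\ne i$, $B_k$ Borel in $\mathbb R$. $\mu(\cdot\,|\,\sigma_{i^c})$ is the conditional probability of the $i$-th coordinate, i.e. the $\sigma_{i^c}$-measurable function with values in the probability distributions on $\mathbb R$ characterized by $\mu(\{\mathbf x:x_i\in A\}\cap B)=\int_B\mu(A\,|\,\sigma_{i^c})\,\mu(d\mathbf x)$ for all Borel $A\subset\mathbb R$ and $B\in\sigma_{i^c}$. **Function spaces.** $L^2(S;\mu)$ is the usual real $L^2$ space. $\mathcal FC_0^\infty\subset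 L^2(S;\mu)$ is the space of $\mu$-equivalence classes of functions $f\in C_0^\infty(\mathbb R^n\to\mathbb R)$, $n\in\mathbb N$, where such $f$ is regarded as the function $\mathbf x\mapsto f(x_1,\dots,x_n)$ on $S$. **The forms.** For $\mathbf x\in S$ write $\mathbf x\setminus x_i=(x_1,\dots,x_{i-1},x_{i+1},\dots)$. For $y_i\neq y_i'$ in $\mathbb R$, $$\Phi_\alpha(u,v;y_i,y_i',\mathbf x\setminus x_i)=\frac{1}{|y_i-y_i'|^{\alpha+1}}\{u(x_1,\dots,x_{i-1},y_i,x_{i+1},\dots)-u(x_1,\dots,x_{i-1},y_i',x_{i+1},\dots)\}\{v(x_1,\dots,x_{i-1},y_i,x_{i+1},\dots)-v(x_1,\dots,x_{i-1},y_i',x_{i+1},\dots)\},$$ $$\mathcal E^{(i)}_{(\alpha)}(u,v)=\int_S\Big\{\int_{\mathbb R}I_{\{y_i\ne x_i\}}(y_i)\,\Phi_\alpha(u,v;y_i,x_i,\mathbf x\setminus x_i)\,\mu(dy_i\,|\,\sigma_{i^c})\Big\}\mu(d\mathbf x),\qquad \mathcal E_{(\alpha)}(u,v)=\sum_{i\in\mathbb N}\mathcal E^{(i)}_{(\alpha)}(u,v).$$ If for each $i\in\mathbb N$ the conditional distribution $\mu(\cdot\,|\,\sigma_{i^c})$ has, $\mu$-a.e., a density $\rho(\cdot\,|\,\sigma_{i^c})$ with respect to Lebesgue measure which on every compact $K\subset\mathbb R$ is essentially bounded by a constant $L_i<\infty$ ($\mu$-a.e.), this form is well-defined, Markovian and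 closable on $\mathcal FC_0^\infty$ in $L^2(S;\mu)$; its closure is denoted $(\mathcal E_{(\alpha)},\mathcal D(\mathcal E_{(\alpha)}))$ and is a symmetric Dirichlet form. **Quasi-regularity (Ma–Röckner).** Let $(\mathcal E,\mathcal D(\mathcal E))$ be a symmetric Dirichlet form on $L^2(S;\mu)$, $\mathcal E_1=\mathcal E+(\cdot,\cdot)_{L^2}$. An $\mathcal E$-nest is an increasing sequence of closed sets $F_k\subset S$ such that $\bigcup_k\{u\in\mathcal D(\mathcal E):u=0\ \mu\text{-a.e. on }S\setminus F_k\}$ is dense in $\mathcal D(\mathcal E)$ for the $\mathcal E_1$-norm; a set is $\mathcal E$-exceptional if it is contained in $\bigcap_k(S\setminus F_k)$ for some $\mathcal E$-nest; a function is $\mathcal E$-quasi-continuous if it is continuous on each $F_k$ of some $\mathcal E$-nest. The form is quasi-regular if: (a) there is an $\mathcal E$-nest of compact sets; (b) there is a subset of $\mathcal D(\mathcal E)$, dense for the norm $\|\cdot\|_{L^2}+\sqrt{\mathcal E}$, whose elements have $\mathcal E$-quasi-continuous $\mu$-versions; (c) there are $u_n\in\mathcal D(\mathcal E)$, $n\in\mathbb N$, with $\mathcal E$-quasi-continuous $\mu$-versions $\tilde u_n$ and an $\mathcal E$-exceptional set $\mathcal N$ such that $\{\tilde u_n\}$ separates the points of $S\setminus\mathcal N$. It is *strictly* quasi-regular (Ma–Röckner, Definition V-2.11) if (a)–(c) hold with "$\mathcal E$-nest" replaced throughout by "strict $\mathcal E$-nest", and with $\{\tilde u_n\}$ (extended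 by $\tilde u_n(\triangle)=0$) separating the points of $(S\cup\{\triangle\})\setminus\mathcal N$, $\triangle$ an adjoined isolated point. Here a strict $\mathcal E$-nest is an increasing sequence of closed sets $F_k$ with $\int_S e_{S\setminus F_k}\,\phi\,d\mu\downarrow0$, where $\phi\in L^2(S;\mu)$ is a fixed strictly positive function and, for open $U$, $e_U$ is the supremum, over all $1$-excessive $h\in\mathcal D(\mathcal E)$ with $h\le1$, of the $1$-reduced function $h_U$ of $h$ on $U$ (the smallest $1$-excessive function that is $\ge h$ $\mu$-a.e. on $U$). *)

theory Defs
  imports "HOL-Probability.Probability"
begin

section \<open>State spaces\<close>

text \<open>Sequences are indexed from 0, so the coordinates \<open>x\<^sub>1, x\<^sub>2, \<dots>\<close> are \<open>x 0, x 1, \<dots>\<close>.\<close>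

definition lp_norm :: "real \<Rightarrow> (nat \<Rightarrow> real) \<Rightarrow> (nat \<Rightarrow> real) \<Rightarrow> real" where
  "lp_norm p \<beta> x = (\<Sum>i. \<beta> i * \<bar>x i\<bar> powr p) powr (1 / p)"

definition lp_space :: "real \<Rightarrow> (nat \<Rightarrow> real) \<Rightarrow> (nat \<Rightarrow> real) set" where
  "lp_space p \<beta> = {x. summable (\<lambda>i. \<beta> i * \<bar>x i\<bar> powr p)}"

definition lp_topology :: "real \<Rightarrow> (nat \<Rightarrow> real) \<Rightarrow> (nat \<Rightarrow> real) topology" where
  "lp_topology p \<beta> =
     Metric_space.mtopology (lp_space p \<beta>) (\<lambda>x y. lp_norm p \<beta> (\<lambda>i. x i - y i))"

definition linf_norm :: "(nat \<Rightarrow> real) \<Rightarrow> (nat \<Rightarrow> real) \<Rightarrow> real" where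
  "linf_norm \<beta> x = enn2real (SUP i. ennreal (\<beta> i * \<bar>x i\<bar>))"

definition linf_space :: "(nat \<Rightarrow> real) \<Rightarrow> (nat \<Rightarrow> real) set" where
  "linf_space \<beta> = {x. (SUP i. ennreal (\<beta> i * \<bar>x i\<bar>)) < \<infinity>}"

definition linf_topology :: "(nat \<Rightarrow> real) \<Rightarrow> (nat \<Rightarrow> real) topology" where
  "linf_topology \<beta> =
     Metric_space.mtopology (linf_space \<beta>) (\<lambda>x y. linf_norm \<beta> (\<lambda>i. x i - y i))"

definition RN_dist :: "(nat \<Rightarrow> real) \<Rightarrow> (nat \<Rightarrow> real) \<Rightarrow> real" where
  "RN_dist x y = (\<Sum>k. (1 / 2) ^ Suc k *
      (L2_set (\<lambda>i. x i - y i) {..<Suc k} / (L2_set (\<lambda>i. x i - y i) {..<Suc k} + 1)))"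

definition RN_topology :: "(nat \<Rightarrow> real) topology" where
  "RN_topology = Metric_space.mtopology UNIV RN_dist"

lemma powr_convex_nonneg:
  fixes p c s t :: real
  assumes p: "1 \<le> p" and c: "0 < c" "c < 1" and st: "0 \<le> s" "0 \<le> t"
  shows "(c * s + (1 - c) * t) powr p \<le> c * s powr p + (1 - c) * t powr p"
proof -
  have small: "(a * r) powr p \<le> a * r powr p" if "0 < a" "a < 1" "0 \<le> r" for a r :: real
  proof -
    have "a powr p \<le> a"
      using that p powr_mono'[of 1 p a] by simp
    then show ?thesis
      using that by (simp add: powr_mult mult_right_mono)
  qed
  consider "s = 0" | "t = 0" | "0 < s" "0 < t" using st by fastforce
  then show ?thesis
  proof cases
    case 3
    then show ?thesis
      using convex_onD[OF powr_convex[OF p], of "1 - c" s t] c by simp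
  qed (use small[of c s] small[of "1 - c" t] c st p in auto)
qed

lemma lp_sum_bound:
  assumes p: "1 \<le> p" and b: "\<forall>i. 0 < \<beta> i"
    and x: "x \<in> lp_space p \<beta>" and y: "y \<in> lp_space p \<beta>"
  shows "(\<lambda>i. x i + y i) \<in> lp_space p \<beta>"
    and "lp_norm p \<beta> (\<lambda>i. x i + y i) \<le> lp_norm p \<beta> x + lp_norm p \<beta> y"
proof -
  have ge: "0 \<le> \<beta> i * \<bar>z\<bar> powr p" for i z
    using b[rule_format, of i] by simp
  have bound: "summable (\<lambda>i. \<beta> i * \<bar>x i + y i\<bar> powr p) \<and>
      (\<Sum>i. \<beta> i * \<bar>x i + y i\<bar> powr p) \<le> (A + B) powr p"
    if A: "0 < A" "lp_norm p \<beta> x \<le> A" and B: "0 < B" "lp_norm p \<beta> y \<le> B" for A B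
  proof -
    have le1: "(\<Sum>i. \<beta> i * \<bar>z i\<bar> powr p) \<le> C powr p"
      if "z \<in> lp_space p \<beta>" "0 < C" "lp_norm p \<beta> z \<le> C" for z C
    proof -
      have "(\<Sum>i. \<beta> i * \<bar>z i\<bar> powr p) \<ge> 0"
        using that ge by (intro suminf_nonneg) (auto simp: lp_space_def)
      then have "(\<Sum>i. \<beta> i * \<bar>z i\<bar> powr p) = lp_norm p \<beta> z powr p"
        using p by (auto simp: lp_norm_def powr_powr)
      also have "\<dots> \<le> C powr p"
        using that p by (intro powr_mono2) (auto simp: lp_norm_def)
      finally show ?thesis .
    qed
    define c where "c = A / (A + B)"
    have c: "0 < c" "c < 1" "1 - c = B / (A + B)"
      using A B by (auto simp: c_def field_simps)
    define g where "g i = (A + B) powr p * (c * (\<beta> i * \<bar>x i\<bar> powr p / A powr p)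
                                + (1 - c) * (\<beta> i * \<bar>y i\<bar> powr p / B powr p))" for i
    have pt: "\<beta> i * \<bar>x i + y i\<bar> powr p \<le> g i" for i
    proof -
      have "\<bar>x i + y i\<bar> \<le> (A + B) * (c * (\<bar>x i\<bar> / A) + (1 - c) * (\<bar>y i\<bar> / B))"
      proof -
        have "(A + B) * (c * (\<bar>x i\<bar> / A) + (1 - c) * (\<bar>y i\<bar> / B))
            = ((A + B) * c / A) * \<bar>x i\<bar> + ((A + B) * (1 - c) / B) * \<bar>y i\<bar>"
          by (simp add: algebra_simps)
        also have "\<dots> = \<bar>x i\<bar> + \<bar>y i\<bar>"
          using A B unfolding c(3) by (simp add: c_def)
        finally show ?thesis by simp
      qed
      then have "\<bar>x i + y i\<bar> powr p \<le> ((A + B) * (c * (\<bar>x i\<bar> / A) + (1 - c) * (\<bar>y i\<bar> / B))) powr p"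
        using p by (intro powr_mono2) auto
      also have "\<dots> = (A + B) powr p * (c * (\<bar>x i\<bar> / A) + (1 - c) * (\<bar>y i\<bar> / B)) powr p"
        by (rule powr_mult)
      also have "\<dots> \<le> (A + B) powr p * (c * (\<bar>x i\<bar> / A) powr p + (1 - c) * (\<bar>y i\<bar> / B) powr p)"
        using c A B powr_convex_nonneg[OF p, of c "\<bar>x i\<bar> / A" "\<bar>y i\<bar> / B"]
        by (intro mult_left_mono) auto
      also have "\<dots> = (A + B) powr p * (c * (\<bar>x i\<bar> powr p / A powr p) + (1 - c) * (\<bar>y i\<bar> powr p / B powr p))"
        using A B by (simp add: powr_divide)
      finally have "\<beta> i * \<bar>x i + y i\<bar> powr p \<le>
        \<beta> i * ((A + B) powr p * (c * (\<bar>x i\<bar> powr p / A powr p) + (1 - c) * (\<bar>y i\<bar> powr p / B powr p)))"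
        using b[rule_format, of i] by (intro mult_left_mono) auto
      then show ?thesis unfolding g_def by (simp add: algebra_simps)
    qed
    have sx: "summable (\<lambda>i. \<beta> i * \<bar>x i\<bar> powr p)" and sy: "summable (\<lambda>i. \<beta> i * \<bar>y i\<bar> powr p)"
      using x y by (auto simp: lp_space_def)
    have sg: "g sums ((A + B) powr p * (c * ((\<Sum>i. \<beta> i * \<bar>x i\<bar> powr p) / A powr p)
                   + (1 - c) * ((\<Sum>i. \<beta> i * \<bar>y i\<bar> powr p) / B powr p)))"
      unfolding g_def using sx sy
      by (intro sums_mult sums_add sums_divide summable_sums)
    have s: "summable (\<lambda>i. \<beta> i * \<bar>x i + y i\<bar> powr p)"
      using ge pt
      by (intro summable_comparison_test'[OF sums_summable[OF sg], of 0]) (simp add: abs_of_nonneg)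
    have "(\<Sum>i. \<beta> i * \<bar>x i + y i\<bar> powr p) \<le> suminf g"
      using pt s sums_summable[OF sg] by (intro suminf_le) auto
    also have "\<dots> = (A + B) powr p * (c * ((\<Sum>i. \<beta> i * \<bar>x i\<bar> powr p) / A powr p)
                   + (1 - c) * ((\<Sum>i. \<beta> i * \<bar>y i\<bar> powr p) / B powr p))"
      using sg by (simp add: sums_iff)
    also have "\<dots> \<le> (A + B) powr p * (c * 1 + (1 - c) * 1)"
      using le1[OF x A] le1[OF y B] A B c
      by (intro mult_left_mono add_mono) auto
    finally show ?thesis using s by simp
  qed
  have n: "0 \<le> lp_norm p \<beta> z" for z by (simp add: lp_norm_def)
  have 1: "summable (\<lambda>i. \<beta> i * \<bar>x i + y i\<bar> powr p)"
    using bound[of "lp_norm p \<beta> x + 1" "lp_norm p \<beta> y + 1"] n[of x] n[of y] by auto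
  then show "(\<lambda>i. x i + y i) \<in> lp_space p \<beta>" by (simp add: lp_space_def)
  show "lp_norm p \<beta> (\<lambda>i. x i + y i) \<le> lp_norm p \<beta> x + lp_norm p \<beta> y"
  proof (rule field_le_epsilon)
    fix e :: real assume e: "0 < e"
    let ?A = "lp_norm p \<beta> x + e / 2" and ?B = "lp_norm p \<beta> y + e / 2"
    have "(\<Sum>i. \<beta> i * \<bar>x i + y i\<bar> powr p) \<le> (?A + ?B) powr p"
      using bound[of ?A ?B] n[of x] n[of y] e by auto
    then have "lp_norm p \<beta> (\<lambda>i. x i + y i) \<le> ((?A + ?B) powr p) powr (1 / p)"
      unfolding lp_norm_def using p ge 1 by (intro powr_mono2 suminf_nonneg) auto
    also have "\<dots> = ?A + ?B"
      using p n[of x] n[of y] e by (simp add: powr_powr)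
    finally show "lp_norm p \<beta> (\<lambda>i. x i + y i) \<le> lp_norm p \<beta> x + lp_norm p \<beta> y + e" by simp
  qed
qed

lemma Metric_space_lp:
  assumes p: "1 \<le> p" and b: "\<forall>i. 0 < \<beta> i"
  shows "Metric_space (lp_space p \<beta>) (\<lambda>x y. lp_norm p \<beta> (\<lambda>i. x i - y i))"
proof
  have diff: "(\<lambda>i. x i - y i) \<in> lp_space p \<beta>" if "x \<in> lp_space p \<beta>" "y \<in> lp_space p \<beta>" for x y
    using lp_sum_bound(1)[OF p b that(1), of "\<lambda>i. - y i"] that(2) by (simp add: lp_space_def)
  fix x y z
  show "0 \<le> lp_norm p \<beta> (\<lambda>i. x i - y i)" by (simp add: lp_norm_def)
  show "lp_norm p \<beta> (\<lambda>i. x i - y i) = lp_norm p \<beta> (\<lambda>i. y i - x i)"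
    by (simp add: lp_norm_def abs_minus_commute)
  assume x: "x \<in> lp_space p \<beta>" and y: "y \<in> lp_space p \<beta>"
  have "lp_norm p \<beta> (\<lambda>i. x i - y i) = 0 \<longleftrightarrow> (\<forall>i. \<beta> i * \<bar>x i - y i\<bar> powr p = 0)"
    unfolding lp_norm_def using diff[OF x y] b
    by (simp add: suminf_eq_zero_iff lp_space_def less_imp_le)
  also have "\<dots> \<longleftrightarrow> x = y"
    using b by (auto simp: fun_eq_iff less_le)
  finally show "lp_norm p \<beta> (\<lambda>i. x i - y i) = 0 \<longleftrightarrow> x = y" .
  assume z: "z \<in> lp_space p \<beta>"
  show "lp_norm p \<beta> (\<lambda>i. x i - z i)
      \<le> lp_norm p \<beta> (\<lambda>i. x i - y i) + lp_norm p \<beta> (\<lambda>i. y i - z i)"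
    using lp_sum_bound(2)[OF p b diff[OF x y] diff[OF y z]] by simp
qed


lemma Metric_space_linf:
  assumes b: "\<forall>i. 0 < \<beta> i"
  shows "Metric_space (linf_space \<beta>) (\<lambda>x y. linf_norm \<beta> (\<lambda>i. x i - y i))"
proof
  let ?S = "\<lambda>x y. SUP i. ennreal (\<beta> i * \<bar>x i - y i\<bar>)"
  have tri: "?S x z \<le> ?S x y + ?S y z" for x y z :: "nat \<Rightarrow> real"
  proof (rule SUP_least)
    fix i
    have "\<beta> i * \<bar>x i - z i\<bar> \<le> \<beta> i * \<bar>x i - y i\<bar> + \<beta> i * \<bar>y i - z i\<bar>"
      using b[rule_format, of i] mult_left_mono[of "\<bar>x i - z i\<bar>" "\<bar>x i - y i\<bar> + \<bar>y i - z i\<bar>" "\<beta> i"]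
      by (simp add: distrib_left)
    then have "ennreal (\<beta> i * \<bar>x i - z i\<bar>)
        \<le> ennreal (\<beta> i * \<bar>x i - y i\<bar>) + ennreal (\<beta> i * \<bar>y i - z i\<bar>)"
      using b[rule_format, of i] by (simp flip: ennreal_plus)
    also have "\<dots> \<le> ?S x y + ?S y z"
      by (intro add_mono SUP_upper) auto
    finally show "ennreal (\<beta> i * \<bar>x i - z i\<bar>) \<le> ?S x y + ?S y z" .
  qed
  have fin: "?S x y < \<infinity>" if "x \<in> linf_space \<beta>" "y \<in> linf_space \<beta>" for x y
  proof -
    have "?S x y \<le> ?S x (\<lambda>_. 0) + ?S (\<lambda>_. 0) y" by (rule tri)
    also have "\<dots> < \<infinity>" using that by (simp add: linf_space_def)
    finally show ?thesis .
  qed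
  fix x y z
  show "0 \<le> linf_norm \<beta> (\<lambda>i. x i - y i)" by (simp add: linf_norm_def)
  show "linf_norm \<beta> (\<lambda>i. x i - y i) = linf_norm \<beta> (\<lambda>i. y i - x i)"
    by (simp add: linf_norm_def abs_minus_commute)
  assume x: "x \<in> linf_space \<beta>" and y: "y \<in> linf_space \<beta>"
  have "linf_norm \<beta> (\<lambda>i. x i - y i) = 0 \<longleftrightarrow> ?S x y = 0"
    using less_imp_neq[OF fin[OF x y]] unfolding linf_norm_def enn2real_eq_0_iff infinity_ennreal_def by blast
  also have "\<dots> \<longleftrightarrow> (\<forall>i. ennreal (\<beta> i * \<bar>x i - y i\<bar>) = 0)"
    by (simp add: SUP_eq_iff bot_ennreal[symmetric] SUP_bot_conv)
  also have "\<dots> \<longleftrightarrow> x = y"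
    using b by (simp add: fun_eq_iff ennreal_eq_0_iff not_less[symmetric] zero_less_mult_iff)
  finally show "linf_norm \<beta> (\<lambda>i. x i - y i) = 0 \<longleftrightarrow> x = y" .
  assume z: "z \<in> linf_space \<beta>"
  have "enn2real (?S x z) \<le> enn2real (?S x y + ?S y z)"
    using tri fin[OF x y] fin[OF y z] by (intro enn2real_mono) auto
  also have "\<dots> = enn2real (?S x y) + enn2real (?S y z)"
    using fin[OF x y] fin[OF y z] by (intro enn2real_plus) auto
  finally show "linf_norm \<beta> (\<lambda>i. x i - z i)
      \<le> linf_norm \<beta> (\<lambda>i. x i - y i) + linf_norm \<beta> (\<lambda>i. y i - z i)"
    by (simp add: linf_norm_def)
qed

lemma Metric_space_RN: "Metric_space UNIV RN_dist"
proof
  define N where "N k x y = L2_set (\<lambda>i. x i - y i) {..<Suc k}" for k and x y :: "nat \<Rightarrow> real"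
  define q where "q k x y = N k x y / (N k x y + 1)" for k x y
  have d: "RN_dist x y = (\<Sum>k. (1 / 2) ^ Suc k * q k x y)" for x y
    by (simp add: RN_dist_def q_def N_def)
  have N0: "0 \<le> N k x y" for k x y by (simp add: N_def)
  have q: "0 \<le> q k x y" "q k x y \<le> 1" for k x y
    using N0[of k x y] by (auto simp: q_def divide_simps)
  have s: "summable (\<lambda>k. (1 / 2) ^ Suc k * q k x y)" for x y
    by (rule summable_comparison_test'[of "\<lambda>k. (1 / 2) ^ Suc k" 0])
       (use q in \<open>auto simp: abs_mult summable_geometric_iff mult_left_le intro: summable_mult\<close>)
  have Ntri: "N k x z \<le> N k x y + N k y z" for k x y z
    using L2_set_triangle_ineq[of "\<lambda>i. x i - y i" "\<lambda>i. y i - z i" "{..<Suc k}"]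
    by (simp add: N_def)
  have qtri: "q k x z \<le> q k x y + q k y z" for k x y z
  proof -
    let ?a = "N k x y" and ?b = "N k y z"
    have "q k x z \<le> (?a + ?b) / (?a + ?b + 1)"
      using Ntri[of k x z y] N0[of k x z] N0[of k x y] N0[of k y z]
      by (simp add: q_def divide_simps algebra_simps)
    also have "\<dots> = ?a / (?a + ?b + 1) + ?b / (?a + ?b + 1)"
      by (simp add: add_divide_distrib)
    also have "\<dots> \<le> q k x y + q k y z"
      unfolding q_def using N0[of k x y] N0[of k y z]
      by (intro add_mono divide_left_mono mult_pos_pos) auto
    finally show ?thesis .
  qed
  fix x y z
  show "0 \<le> RN_dist x y" unfolding d using q s by (intro suminf_nonneg) auto
  show "RN_dist x y = RN_dist y x"
    by (simp add: RN_dist_def L2_set_def power2_commute)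
  have "RN_dist x y = 0 \<longleftrightarrow> (\<forall>k. q k x y = 0)"
    unfolding d using s q by (subst suminf_eq_zero_iff) auto
  also have "\<dots> \<longleftrightarrow> (\<forall>k. N k x y = 0)"
    using N0 by (auto simp: q_def add_nonneg_eq_0_iff)
  also have "\<dots> \<longleftrightarrow> x = y"
    by (auto simp: N_def L2_set_eq_0_iff fun_eq_iff)
  finally show "RN_dist x y = 0 \<longleftrightarrow> x = y" .
  have "RN_dist x z \<le> (\<Sum>k. (1 / 2) ^ Suc k * q k x y + (1 / 2) ^ Suc k * q k y z)"
    unfolding d using s summable_add[OF s s] qtri
    by (intro suminf_le) (auto simp: distrib_left[symmetric])
  also have "\<dots> = RN_dist x y + RN_dist y z"
    unfolding d using s by (intro suminf_add[symmetric])
  finally show "RN_dist x z \<le> RN_dist x y + RN_dist y z" .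
qed

lemma topspace_state_spaces:
  "1 \<le> p \<Longrightarrow> \<forall>i. 0 < \<beta> i \<Longrightarrow> topspace (lp_topology p \<beta>) = lp_space p \<beta>"
  "\<forall>i. 0 < \<beta> i \<Longrightarrow> topspace (linf_topology \<beta>) = linf_space \<beta>"
  "topspace RN_topology = UNIV"
  by (simp_all add: lp_topology_def linf_topology_def RN_topology_def Metric_space_lp
      Metric_space_linf Metric_space_RN Metric_space.topspace_mtopology)

definition borel_field :: "'a topology \<Rightarrow> 'a measure" where
  "borel_field T = sigma (topspace T) {U. openin T U}"

section \<open>Conditional distributions of one coordinate\<close>

definition compl_field :: "(nat \<Rightarrow> real) set \<Rightarrow> nat \<Rightarrow> (nat \<Rightarrow> real) measure" where
  "compl_field S i =
     sigma S {{x \<in> S. \<forall>j\<in>J. x j \<in> B j} | J B. finite J \<and> i \<notin> J \<and> (\<forall>j\<in>J. B j \<in> sets borel)}"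

definition cond_distribution ::
    "(nat \<Rightarrow> real) measure \<Rightarrow> nat \<Rightarrow> ((nat \<Rightarrow> real) \<Rightarrow> real measure) \<Rightarrow> bool" where
  "cond_distribution \<mu> i k \<longleftrightarrow>
     k \<in> compl_field (space \<mu>) i \<rightarrow>\<^sub>M prob_algebra borel \<and>
     (\<forall>A\<in>sets borel. \<forall>B\<in>sets (compl_field (space \<mu>) i).
        measure \<mu> ({x \<in> space \<mu>. x i \<in> A} \<inter> B) = (\<integral>x. indicator B x * measure (k x) A \<partial>\<mu>))"

definition cond_density ::
    "(nat \<Rightarrow> real) measure \<Rightarrow> nat \<Rightarrow> ((nat \<Rightarrow> real) \<Rightarrow> real measure)
      \<Rightarrow> ((nat \<Rightarrow> real) \<Rightarrow> real \<Rightarrow> real) \<Rightarrow> bool" where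
  "cond_density \<mu> i k r \<longleftrightarrow>
     (\<forall>x\<in>space \<mu>. \<forall>y. 0 \<le> r x y) \<and>
     (\<forall>x\<in>space \<mu>. r x \<in> borel_measurable borel) \<and>
     (\<forall>y. (\<lambda>x. r x y) \<in> borel_measurable (compl_field (space \<mu>) i)) \<and>
     (AE x in \<mu>. k x = density lborel (\<lambda>y. ennreal (r x y)))"

definition density_bound ::
    "(nat \<Rightarrow> real) measure \<Rightarrow> ((nat \<Rightarrow> real) \<Rightarrow> real \<Rightarrow> real) \<Rightarrow> real set \<Rightarrow> real \<Rightarrow> bool" where
  "density_bound \<mu> r K L \<longleftrightarrow>
     (AE x in \<mu>. esssup (restrict_space lborel K) (\<lambda>y. ereal (r x y)) \<le> ereal L)"

section \<open>Smooth cylinder functions\<close>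

text \<open>A function on \<open>\<real>\<^sup>n\<close> is identified with the function on all sequences which depends on the
  first \<open>n\<close> coordinates only; continuity in the product topology is then continuity on \<open>\<real>\<^sup>n\<close>.\<close>

definition partial_diff :: "nat \<Rightarrow> ((nat \<Rightarrow> real) \<Rightarrow> real) \<Rightarrow> (nat \<Rightarrow> real) \<Rightarrow> real" where
  "partial_diff i f x = deriv (\<lambda>t. f (x(i := t))) (x i)"

definition C0_infinity :: "nat \<Rightarrow> ((nat \<Rightarrow> real) \<Rightarrow> real) set" where
  "C0_infinity n = {f.
     (\<forall>x y. (\<forall>i<n. x i = y i) \<longrightarrow> f x = f y) \<and>
     (\<forall>js. set js \<subseteq> {..<n} \<longrightarrow>
        continuous_on UNIV (foldr partial_diff js f) \<and>
        (\<forall>i<n. \<forall>x. (\<lambda>t. foldr partial_diff js f (x(i := t))) differentiable (at (x i)))) \<and>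
     (\<exists>R. \<forall>x. f x \<noteq> 0 \<longrightarrow> (\<forall>i<n. \<bar>x i\<bar> \<le> R))}"

text \<open>For \<open>m < n\<close>, a nonzero function in \<open>C0_infinity m\<close> is not compactly supported as a function on
  \<open>\<real>\<^sup>n\<close>, so the union over \<open>n\<close> is not closed under addition. The linear space of smooth cylinder
  functions on which the form acts therefore consists of the finite sums.\<close>

definition FC0 :: "((nat \<Rightarrow> real) \<Rightarrow> real) set" where
  "FC0 = {\<lambda>x. \<Sum>k<m. f k x | (m::nat) f. \<forall>k<m. \<exists>n\<ge>1. f k \<in> C0_infinity n}"

section \<open>Square integrable functions\<close>

text \<open>Elements of \<open>L\<^sup>2\<close> are handled through representatives; form domains are closed under
  almost everywhere equality.\<close>

definition L2_fun :: "'a measure \<Rightarrow> ('a \<Rightarrow> real) set" where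
  "L2_fun M = {f \<in> borel_measurable M. integrable M (\<lambda>x. (f x)\<^sup>2)}"

definition L2_inner :: "'a measure \<Rightarrow> ('a \<Rightarrow> real) \<Rightarrow> ('a \<Rightarrow> real) \<Rightarrow> real" where
  "L2_inner M f g = (\<integral>x. f x * g x \<partial>M)"

definition L2_dist :: "'a measure \<Rightarrow> ('a \<Rightarrow> real) \<Rightarrow> ('a \<Rightarrow> real) \<Rightarrow> real" where
  "L2_dist M f g = sqrt (L2_inner M (\<lambda>x. f x - g x) (\<lambda>x. f x - g x))"

definition form_dist :: "(('a \<Rightarrow> real) \<Rightarrow> ('a \<Rightarrow> real) \<Rightarrow> real) \<Rightarrow> ('a \<Rightarrow> real) \<Rightarrow> ('a \<Rightarrow> real) \<Rightarrow> real" where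
  "form_dist E u v = sqrt (E (\<lambda>x. u x - v x) (\<lambda>x. u x - v x))"

definition form1 ::
    "'a measure \<Rightarrow> (('a \<Rightarrow> real) \<Rightarrow> ('a \<Rightarrow> real) \<Rightarrow> real) \<Rightarrow> ('a \<Rightarrow> real) \<Rightarrow> ('a \<Rightarrow> real) \<Rightarrow> real" where
  "form1 M E u v = E u v + L2_inner M u v"

section \<open>Closure of a form\<close>

definition approximates ::
    "'a measure \<Rightarrow> ('a \<Rightarrow> real) set \<Rightarrow> (('a \<Rightarrow> real) \<Rightarrow> ('a \<Rightarrow> real) \<Rightarrow> real)
      \<Rightarrow> (nat \<Rightarrow> 'a \<Rightarrow> real) \<Rightarrow> ('a \<Rightarrow> real) \<Rightarrow> bool" where
  "approximates M C E f u \<longleftrightarrow>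
     (\<forall>n. f n \<in> C) \<and>
     (\<forall>e>0. \<exists>N. \<forall>m\<ge>N. \<forall>n\<ge>N. form_dist E (f m) (f n) < e) \<and>
     (\<lambda>n. L2_dist M (f n) u) \<longlonglongrightarrow> 0"

definition closure_dom ::
    "'a measure \<Rightarrow> ('a \<Rightarrow> real) set \<Rightarrow> (('a \<Rightarrow> real) \<Rightarrow> ('a \<Rightarrow> real) \<Rightarrow> real) \<Rightarrow> ('a \<Rightarrow> real) set" where
  "closure_dom M C E = {u \<in> L2_fun M. \<exists>f. approximates M C E f u}"

text \<open>The limit exists and does not depend on the approximating sequences when the form is closable.\<close>

definition closure_form ::
    "'a measure \<Rightarrow> ('a \<Rightarrow> real) set \<Rightarrow> (('a \<Rightarrow> real) \<Rightarrow> ('a \<Rightarrow> real) \<Rightarrow> real)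
      \<Rightarrow> ('a \<Rightarrow> real) \<Rightarrow> ('a \<Rightarrow> real) \<Rightarrow> real" where
  "closure_form M C E u v =
     (THE l. \<forall>f g. approximates M C E f u \<and> approximates M C E g v \<longrightarrow>
        (\<lambda>n. E (f n) (g n)) \<longlonglongrightarrow> l)"

section \<open>The non-local forms\<close>

definition Phi ::
    "real \<Rightarrow> nat \<Rightarrow> ((nat \<Rightarrow> real) \<Rightarrow> real) \<Rightarrow> ((nat \<Rightarrow> real) \<Rightarrow> real)
      \<Rightarrow> real \<Rightarrow> real \<Rightarrow> (nat \<Rightarrow> real) \<Rightarrow> real" where
  "Phi \<alpha> i u v y y' x =
     1 / \<bar>y - y'\<bar> powr (\<alpha> + 1) * (u (x(i := y)) - u (x(i := y'))) * (v (x(i := y)) - v (x(i := y')))"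

definition pre_form_i ::
    "real \<Rightarrow> (nat \<Rightarrow> real) measure \<Rightarrow> (nat \<Rightarrow> (nat \<Rightarrow> real) \<Rightarrow> real measure) \<Rightarrow> nat
      \<Rightarrow> ((nat \<Rightarrow> real) \<Rightarrow> real) \<Rightarrow> ((nat \<Rightarrow> real) \<Rightarrow> real) \<Rightarrow> real" where
  "pre_form_i \<alpha> \<mu> \<kappa> i u v =
     (\<integral>x. (\<integral>y. indicator {y. y \<noteq> x i} y * Phi \<alpha> i u v y (x i) x \<partial>\<kappa> i x) \<partial>\<mu>)"

definition pre_form ::
    "real \<Rightarrow> (nat \<Rightarrow> real) measure \<Rightarrow> (nat \<Rightarrow> (nat \<Rightarrow> real) \<Rightarrow> real measure)
      \<Rightarrow> ((nat \<Rightarrow> real) \<Rightarrow> real) \<Rightarrow> ((nat \<Rightarrow> real) \<Rightarrow> real) \<Rightarrow> real" where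
  "pre_form \<alpha> \<mu> \<kappa> u v = (\<Sum>i. pre_form_i \<alpha> \<mu> \<kappa> i u v)"

definition jump_dom ::
    "real \<Rightarrow> (nat \<Rightarrow> real) measure \<Rightarrow> (nat \<Rightarrow> (nat \<Rightarrow> real) \<Rightarrow> real measure)
      \<Rightarrow> ((nat \<Rightarrow> real) \<Rightarrow> real) set" where
  "jump_dom \<alpha> \<mu> \<kappa> = closure_dom \<mu> FC0 (pre_form \<alpha> \<mu> \<kappa>)"

definition jump_form ::
    "real \<Rightarrow> (nat \<Rightarrow> real) measure \<Rightarrow> (nat \<Rightarrow> (nat \<Rightarrow> real) \<Rightarrow> real measure)
      \<Rightarrow> ((nat \<Rightarrow> real) \<Rightarrow> real) \<Rightarrow> ((nat \<Rightarrow> real) \<Rightarrow> real) \<Rightarrow> real" where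
  "jump_form \<alpha> \<mu> \<kappa> = closure_form \<mu> FC0 (pre_form \<alpha> \<mu> \<kappa>)"

section \<open>Symmetric Dirichlet forms\<close>

definition symmetric_Dirichlet_form ::
    "'a measure \<Rightarrow> ('a \<Rightarrow> real) set \<Rightarrow> (('a \<Rightarrow> real) \<Rightarrow> ('a \<Rightarrow> real) \<Rightarrow> real) \<Rightarrow> bool" where
  "symmetric_Dirichlet_form M D E \<longleftrightarrow>
     D \<subseteq> L2_fun M \<and>
     (\<forall>u\<in>D. \<forall>v\<in>L2_fun M. (AE x in M. u x = v x) \<longrightarrow> v \<in> D) \<and>
     (\<forall>u\<in>D. \<forall>v\<in>D. \<forall>a b. (\<lambda>x. a * u x + b * v x) \<in> D) \<and>
     (\<forall>f\<in>L2_fun M. \<forall>e>0. \<exists>u\<in>D. L2_dist M f u < e) \<and>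
     (\<forall>u\<in>D. \<forall>u'\<in>D. \<forall>v\<in>D. (AE x in M. u x = u' x) \<longrightarrow> E u v = E u' v) \<and>
     (\<forall>u\<in>D. \<forall>v\<in>D. E u v = E v u) \<and>
     (\<forall>u\<in>D. \<forall>v\<in>D. \<forall>w\<in>D. \<forall>a b. E (\<lambda>x. a * u x + b * v x) w = a * E u w + b * E v w) \<and>
     (\<forall>u\<in>D. 0 \<le> E u u) \<and>
     (\<forall>f. (\<forall>n. f n \<in> D) \<and>
          (\<forall>e>0. \<exists>N. \<forall>m\<ge>N. \<forall>n\<ge>N. form_dist (form1 M E) (f m) (f n) < e) \<longrightarrow>
          (\<exists>u\<in>D. (\<lambda>n. form_dist (form1 M E) (f n) u) \<longlonglongrightarrow> 0)) \<and>
     (\<forall>u\<in>D. (\<lambda>x. min 1 (max 0 (u x))) \<in> D \<and>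
            E (\<lambda>x. min 1 (max 0 (u x))) (\<lambda>x. min 1 (max 0 (u x))) \<le> E u u)"

section \<open>Excessive functions and reduced functions\<close>

text \<open>\<open>(T\<^sub>t)\<close> is the strongly continuous contraction semigroup of the form: its resolvent
  \<open>g = \<integral>\<^sub>0\<^sup>\<infinity> exp (- a t) T\<^sub>t f dt\<close> is the solution \<open>g \<in> D\<close> of \<open>E(g,v) + a (g,v) = (f,v)\<close>
  for all \<open>v \<in> D\<close>.\<close>

definition is_semigroup_of ::
    "'a measure \<Rightarrow> ('a \<Rightarrow> real) set \<Rightarrow> (('a \<Rightarrow> real) \<Rightarrow> ('a \<Rightarrow> real) \<Rightarrow> real)
      \<Rightarrow> (real \<Rightarrow> ('a \<Rightarrow> real) \<Rightarrow> 'a \<Rightarrow> real) \<Rightarrow> bool" where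
  "is_semigroup_of M D E T \<longleftrightarrow>
     (\<forall>t>0. \<forall>f\<in>L2_fun M. T t f \<in> L2_fun M) \<and>
     (\<forall>t>0. \<forall>f\<in>L2_fun M. \<forall>g\<in>L2_fun M. \<forall>a b.
        AE x in M. T t (\<lambda>z. a * f z + b * g z) x = a * T t f x + b * T t g x) \<and>
     (\<forall>t>0. \<forall>f\<in>L2_fun M. L2_inner M (T t f) (T t f) \<le> L2_inner M f f) \<and>
     (\<forall>s>0. \<forall>t>0. \<forall>f\<in>L2_fun M. AE x in M. T (s + t) f x = T s (T t f) x) \<and>
     (\<forall>f\<in>L2_fun M. ((\<lambda>t. L2_dist M (T t f) f) \<longlongrightarrow> 0) (at_right 0)) \<and>
     (\<forall>a>0. \<forall>f\<in>L2_fun M. \<exists>g\<in>D.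
        (\<forall>v\<in>D. E g v + a * L2_inner M g v = L2_inner M f v) \<and>
        (\<forall>h\<in>L2_fun M. (LINT t:{0<..}|lborel. exp (- a * t) * L2_inner M (T t f) h) = L2_inner M g h))"

definition one_excessive ::
    "'a measure \<Rightarrow> ('a \<Rightarrow> real) set \<Rightarrow> (('a \<Rightarrow> real) \<Rightarrow> ('a \<Rightarrow> real) \<Rightarrow> real) \<Rightarrow> ('a \<Rightarrow> real) \<Rightarrow> bool" where
  "one_excessive M D E u \<longleftrightarrow> u \<in> L2_fun M \<and>
     (\<exists>T. is_semigroup_of M D E T \<and> (\<forall>t>0. AE x in M. exp (- t) * T t u x \<le> u x))"

definition is_reduced ::
    "'a measure \<Rightarrow> ('a \<Rightarrow> real) set \<Rightarrow> (('a \<Rightarrow> real) \<Rightarrow> ('a \<Rightarrow> real) \<Rightarrow> real)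
      \<Rightarrow> 'a set \<Rightarrow> ('a \<Rightarrow> real) \<Rightarrow> ('a \<Rightarrow> real) \<Rightarrow> bool" where
  "is_reduced M D E U h g \<longleftrightarrow>
     one_excessive M D E g \<and> (AE x in M. x \<in> U \<longrightarrow> h x \<le> g x) \<and>
     (\<forall>w. one_excessive M D E w \<and> (AE x in M. x \<in> U \<longrightarrow> h x \<le> w x) \<longrightarrow> (AE x in M. g x \<le> w x))"

text \<open>The supremum over an uncountable family is taken in the lattice of almost everywhere classes,
  not pointwise.\<close>

definition is_ess_Sup :: "'a measure \<Rightarrow> ('a \<Rightarrow> real) set \<Rightarrow> ('a \<Rightarrow> real) \<Rightarrow> bool" where
  "is_ess_Sup M G e \<longleftrightarrow>
     e \<in> borel_measurable M \<and> (\<forall>g\<in>G. AE x in M. g x \<le> e x) \<and>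
     (\<forall>w\<in>borel_measurable M. (\<forall>g\<in>G. AE x in M. g x \<le> w x) \<longrightarrow> (AE x in M. e x \<le> w x))"

definition is_equilibrium ::
    "'a measure \<Rightarrow> ('a \<Rightarrow> real) set \<Rightarrow> (('a \<Rightarrow> real) \<Rightarrow> ('a \<Rightarrow> real) \<Rightarrow> real)
      \<Rightarrow> 'a set \<Rightarrow> ('a \<Rightarrow> real) \<Rightarrow> bool" where
  "is_equilibrium M D E U e \<longleftrightarrow>
     is_ess_Sup M {g. \<exists>h\<in>D. one_excessive M D E h \<and> (AE x in M. h x \<le> 1) \<and> is_reduced M D E U h g} e"

section \<open>Strict quasi-regularity\<close>

definition strict_nest ::
    "'a topology \<Rightarrow> 'a measure \<Rightarrow> ('a \<Rightarrow> real) \<Rightarrow> ('a \<Rightarrow> real) set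
      \<Rightarrow> (('a \<Rightarrow> real) \<Rightarrow> ('a \<Rightarrow> real) \<Rightarrow> real) \<Rightarrow> (nat \<Rightarrow> 'a set) \<Rightarrow> bool" where
  "strict_nest T M \<phi> D E F \<longleftrightarrow>
     incseq F \<and> (\<forall>k. closedin T (F k)) \<and>
     (\<exists>e. (\<forall>k. is_equilibrium M D E (topspace T - F k) (e k)) \<and>
          decseq (\<lambda>k. \<integral>x. e k x * \<phi> x \<partial>M) \<and> (\<lambda>k. \<integral>x. e k x * \<phi> x \<partial>M) \<longlonglongrightarrow> 0)"

definition strictly_exceptional ::
    "'a topology \<Rightarrow> 'a measure \<Rightarrow> ('a \<Rightarrow> real) \<Rightarrow> ('a \<Rightarrow> real) set
      \<Rightarrow> (('a \<Rightarrow> real) \<Rightarrow> ('a \<Rightarrow> real) \<Rightarrow> real) \<Rightarrow> 'a set \<Rightarrow> bool" where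
  "strictly_exceptional T M \<phi> D E N \<longleftrightarrow>
     (\<exists>F. strict_nest T M \<phi> D E F \<and> N \<subseteq> (\<Inter>k. topspace T - F k))"

definition strictly_quasi_continuous ::
    "'a topology \<Rightarrow> 'a measure \<Rightarrow> ('a \<Rightarrow> real) \<Rightarrow> ('a \<Rightarrow> real) set
      \<Rightarrow> (('a \<Rightarrow> real) \<Rightarrow> ('a \<Rightarrow> real) \<Rightarrow> real) \<Rightarrow> ('a \<Rightarrow> real) \<Rightarrow> bool" where
  "strictly_quasi_continuous T M \<phi> D E f \<longleftrightarrow>
     (\<exists>F. strict_nest T M \<phi> D E F \<and> (\<forall>k. continuous_map (subtopology T (F k)) euclideanreal f))"

text \<open>In the last condition \<open>None\<close> is the adjoined point, at which all functions vanish.\<close>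

definition strictly_quasi_regular ::
    "'a topology \<Rightarrow> 'a measure \<Rightarrow> ('a \<Rightarrow> real) \<Rightarrow> ('a \<Rightarrow> real) set
      \<Rightarrow> (('a \<Rightarrow> real) \<Rightarrow> ('a \<Rightarrow> real) \<Rightarrow> real) \<Rightarrow> bool" where
  "strictly_quasi_regular T M \<phi> D E \<longleftrightarrow>
     (\<exists>F. strict_nest T M \<phi> D E F \<and> (\<forall>k. compactin T (F k))) \<and>
     (\<exists>A\<subseteq>D. (\<forall>u\<in>D. \<forall>e>0. \<exists>a\<in>A. L2_dist M u a + form_dist E u a < e) \<and>
             (\<forall>a\<in>A. \<exists>v. strictly_quasi_continuous T M \<phi> D E v \<and> (AE x in M. v x = a x))) \<and>
     (\<exists>u v N. (\<forall>n::nat. u n \<in> D \<and> strictly_quasi_continuous T M \<phi> D E (v n) \<and>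
                         (AE x in M. v n x = u n x)) \<and>
              strictly_exceptional T M \<phi> D E N \<and>
              (\<forall>z\<in>insert None (Some ` (topspace T - N)). \<forall>w\<in>insert None (Some ` (topspace T - N)).
                 z \<noteq> w \<longrightarrow> (\<exists>n. case_option 0 (v n) z \<noteq> case_option 0 (v n) w)))"

definition strictly_quasi_regular_Dirichlet_form ::
    "'a topology \<Rightarrow> 'a measure \<Rightarrow> ('a \<Rightarrow> real) \<Rightarrow> ('a \<Rightarrow> real) set
      \<Rightarrow> (('a \<Rightarrow> real) \<Rightarrow> ('a \<Rightarrow> real) \<Rightarrow> real) \<Rightarrow> bool" where
  "strictly_quasi_regular_Dirichlet_form T M \<phi> D E \<longleftrightarrow>
     symmetric_Dirichlet_form M D E \<and> strictly_quasi_regular T M \<phi> D E"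

end

theory Submission
  imports Defs
begin

text \<open>A sequence of bounded energy which converges in \<open>L\<^sup>2\<close> has convex combinations which converge to the
same limit in energy, since almost minimal elements of the convex hulls of its tails form a Cauchy
sequence. Products of plateau functions of the rescaled coordinates have bounded energy under the tail
conditions and converge to 1 almost everywhere. Hence 1 belongs to the domain, has energy 0, and is
approximated in energy by functions \<open>v\<^sub>k\<close> which vanish outside of boxes; the conditions on the sides make
the boxes compact. The reduced function of 1 on the complement of such a box is dominated in energy by
\<open>1 - v\<^sub>k\<close>, and therefore finite unions of boxes form a strict nest.

The semigroup in the definition of excessive functions is the limit of powers of the resolvent. Closability
follows from Fatou's lemma, and the jump measure of each coordinate is symmetric because a coordinate and
its conditionally independent copy are exchangeable.\<close>

section \<open>Semi-inner products\<close>

text \<open>What the three spaces have to supply is isolated in \<open>exhausted\<close>: cutoffs in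
  the domain that vanish off sets \<open>K k\<close> and tend to 1 in the \<open>E_1\<close>-norm.
  As \<open>e_U\<close> is a supremum over excessive \<open>h <= 1\<close>, the competitor 1 turns
  it into a single reduced function, which is why strictness comes together with ordinary
  quasi-regularity. The spaces differ in which boxes are compact. In the weighted sequence spaces
  only multiples of one fixed box are used, so all coordinates share one scale and the energies of
  infinitely many cutoffs must be summable. In the product space every box is compact, so the scale
  may vary with the coordinate. The exponents in the hypotheses are those of one cutoff at radius
  \<open>r\<close>: long jumps cost \<open>r^-(\<alpha>+1)\<close>, and jumps into a region with
  density at most \<open>L\<close> cost \<open>L r^-\<alpha>\<close> by scaling. A further obstacle
  is that the Borel field of \<open>l^\<infinity>\<close> exceeds the one generated by the
  coordinates, so density of the cylinder functions in \<open>L^2\<close> has to be drawn from the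
  compact sets.\<close>

definition Cauchy_wrt :: "(('a => real) => ('a => real) => real) => (nat => 'a => real) => bool" where
 "Cauchy_wrt B f \<longleftrightarrow> (\<forall>e>0. EX N. \<forall>m\<ge>N. \<forall>n\<ge>N. form_dist B (f m) (f n) < e)"

text \<open>Midpoints are all that the parallelogram identity asks for.\<close>

definition mid_convex :: "('a => real) set => bool" where
 "mid_convex K \<longleftrightarrow> (\<forall>u\<in>K. \<forall>v\<in>K. (%x. (1/2) * u x + (1/2) * v x) \<in> K)"

text \<open>Definiteness is left out because functions stand for their almost everywhere classes:
  \<open>B u u = 0\<close> need not force \<open>u\<close> to be the zero function. Limits and
  solutions are therefore unique only up to distance 0.\<close>

locale semi_ip =
 fixes H :: "('a => real) set" and B :: "('a => real) => ('a => real) => real"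
 assumes lincomb: "u \<in> H ==> v \<in> H ==> (%x. a * u x + b * v x) \<in> H"
  and sym: "u \<in> H ==> v \<in> H ==> B u v = B v u"
  and lin: "u \<in> H ==> v \<in> H ==> w \<in> H ==> B (%x. a * u x + b * v x) w = a * B u w + b * B v w"
  and nonneg: "u \<in> H ==> 0 <= B u u"
begin

lemma mem_add: "u \<in> H ==> v \<in> H ==> (%x. u x + v x) \<in> H"
 using lincomb[of u v 1 1] by simp

lemma mem_diff: "u \<in> H ==> v \<in> H ==> (%x. u x - v x) \<in> H"
 using lincomb[of u v 1 "-1"] by simp

lemma mem_scale: "u \<in> H ==> (%x. a * u x) \<in> H"
 using lincomb[of u u a 0] by simp

lemma mem_zero: "u \<in> H ==> (%x. 0) \<in> H"
 using lincomb[of u u 0 0] by simp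

lemmas mem = mem_add mem_diff mem_scale

lemma addL: "u \<in> H ==> v \<in> H ==> w \<in> H ==> B (%x. u x + v x) w = B u w + B v w"
 using lin[of u v w 1 1] by simp

lemma diffL: "u \<in> H ==> v \<in> H ==> w \<in> H ==> B (%x. u x - v x) w = B u w - B v w"
 using lin[of u v w 1 "-1"] by simp

lemma scaleL: "u \<in> H ==> w \<in> H ==> B (%x. a * u x) w = a * B u w"
 using lin[of u u w a 0] by simp

lemma zeroL: "w \<in> H ==> B (%x. 0) w = 0"
 using lin[of w w w 0 0] by simp

lemma addR: "u \<in> H ==> v \<in> H ==> w \<in> H ==> B w (%x. u x + v x) = B w u + B w v"
 using addL[of u v w] by (simp add: sym mem)

lemma diffR: "u \<in> H ==> v \<in> H ==> w \<in> H ==> B w (%x. u x - v x) = B w u - B w v"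
 using diffL[of u v w] by (simp add: sym mem)

lemma scaleR: "u \<in> H ==> w \<in> H ==> B w (%x. a * u x) = a * B w u"
 using scaleL[of u w a] by (simp add: sym mem)

lemma zeroR: "w \<in> H ==> B w (%x. 0) = 0"
 using zeroL[of w] by (simp add: sym[of w] mem_zero)

lemmas bilin = addL diffL scaleL addR diffR scaleR zeroL zeroR

lemma square_add: "u \<in> H ==> v \<in> H ==>
  B (%x. u x + v x) (%x. u x + v x) = B u u + 2 * B u v + B v v"
 by (simp add: bilin mem sym[of v u])

lemma square_diff: "u \<in> H ==> v \<in> H ==>
  B (%x. u x - v x) (%x. u x - v x) = B u u - 2 * B u v + B v v"
 by (simp add: bilin mem sym[of v u])

lemma square_scale: "u \<in> H ==> B (%x. a * u x) (%x. a * u x) = a\<^sup>2 * B u u"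
 by (simp add: bilin mem power2_eq_square)

definition nrm :: "('a => real) => real" where "nrm u = sqrt (B u u)"

lemma nrm_nonneg: "u \<in> H ==> 0 <= nrm u"
 using nonneg by (simp add: nrm_def)

lemma nrm_sq: "u \<in> H ==> (nrm u)\<^sup>2 = B u u"
 using nonneg by (simp add: nrm_def)

lemma dist_nrm: "form_dist B u v = nrm (%x. u x - v x)"
 by (simp add: form_dist_def nrm_def)

lemma Cauchy_Schwarz_sq:
 assumes u: "u \<in> H" and v: "v \<in> H"
 shows "(B u v)\<^sup>2 <= B u u * B v v"
proof -
 have q: "0 <= B u u - 2 * t * B u v + t\<^sup>2 * B v v" for t
  using nonneg[OF mem_diff[OF u mem_scale[OF v, of t]]] u v
  by (simp add: square_diff mem square_scale scaleR)
 show ?thesis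
 proof (cases "B v v = 0")
  case True
  have "B u v = 0"
  proof (rule ccontr)
   assume n: "B u v ~= 0"
   \<comment> \<open>With \<open>B v v = 0\<close> the quadratic in \<open>t\<close> is affine; this
     \<open>t\<close> gives it the value -1.\<close>
   show False using q[of "(B u u + 1) / (2 * B u v)"] n True by simp
  qed
  then show ?thesis using nonneg[OF u] nonneg[OF v] by simp
 next
  case False
  then have p: "0 < B v v" using nonneg[OF v] by simp
  have "0 <= B u u - (B u v)\<^sup>2 / B v v"
   using q[of "B u v / B v v"] p by (simp add: power2_eq_square field_simps)
  then show ?thesis using p by (simp add: field_simps)
 qed
qed

lemma Cauchy_Schwarz:
 assumes u: "u \<in> H" and v: "v \<in> H"
 shows "\<bar>B u v\<bar> <= nrm u * nrm v"
 using Cauchy_Schwarz_sq[OF u v] real_sqrt_le_mono[of "(B u v)\<^sup>2" "B u u * B v v"]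
 by (simp add: nrm_def real_sqrt_mult)

lemma nrm_triangle:
 assumes u: "u \<in> H" and v: "v \<in> H"
 shows "nrm (%x. u x + v x) <= nrm u + nrm v"
proof (rule power2_le_imp_le)
 show "(nrm (%x. u x + v x))\<^sup>2 <= (nrm u + nrm v)\<^sup>2"
  using Cauchy_Schwarz[OF u v] u v
  by (simp add: nrm_sq mem square_add power2_sum)
qed (use nrm_nonneg u v in auto)

lemma nrm_scale: "u \<in> H ==> nrm (%x. a * u x) = \<bar>a\<bar> * nrm u"
 by (simp add: nrm_def square_scale real_sqrt_mult)

lemma dist_nonneg: "u \<in> H ==> v \<in> H ==> 0 <= form_dist B u v"
 by (simp add: dist_nrm nrm_nonneg mem)

lemma dist_self: "u \<in> H ==> form_dist B u u = 0"
 by (simp add: form_dist_def zeroL mem_zero)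

lemma dist_commute: "u \<in> H ==> v \<in> H ==> form_dist B u v = form_dist B v u"
 unfolding form_dist_def by (simp add: square_diff sym[of v u])

lemma dist_triangle:
 assumes "u \<in> H" "v \<in> H" "w \<in> H"
 shows "form_dist B u w <= form_dist B u v + form_dist B v w"
 using nrm_triangle[of "%x. u x - v x" "%x. v x - w x"] assms by (simp add: dist_nrm mem)

lemma nrm_diff_le: "u \<in> H ==> v \<in> H ==> \<bar>nrm u - nrm v\<bar> <= form_dist B u v"
proof -
 assume u: "u \<in> H" and v: "v \<in> H"
 have "nrm u <= nrm (%x. u x - v x) + nrm v"
  using nrm_triangle[OF mem_diff[OF u v] v] by simp
 moreover have "nrm v <= nrm (%x. v x - u x) + nrm u"
  using nrm_triangle[OF mem_diff[OF v u] u] by simp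
 ultimately show ?thesis using dist_commute[OF u v] by (simp add: dist_nrm)
qed

lemma dist_lincomb:
 assumes "u \<in> H" "v \<in> H" "u' \<in> H" "v' \<in> H"
 shows "form_dist B (%x. a * u x + b * v x) (%x. a * u' x + b * v' x)
   <= \<bar>a\<bar> * form_dist B u u' + \<bar>b\<bar> * form_dist B v v'"
proof -
 have e: "(%x. a * u x + b * v x - (a * u' x + b * v' x))
   = (%x. a * (u x - u' x) + b * (v x - v' x))"
  by (auto simp: algebra_simps)
 show ?thesis
  using nrm_triangle[of "%x. a * (u x - u' x)" "%x. b * (v x - v' x)"] assms
  by (simp add: dist_nrm e mem nrm_scale)
qed

lemma tendsto_dist:
 assumes f: "!!n. f n \<in> H" and g: "!!n. g n \<in> H" and u: "u \<in> H" and v: "v \<in> H"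
  and l: "(%n. form_dist B (f n) u) \<longlonglongrightarrow> 0" "(%n. form_dist B (g n) v) \<longlonglongrightarrow> 0"
 shows "(%n. form_dist B (f n) (g n)) \<longlonglongrightarrow> form_dist B u v"
proof (rule LIM_zero_cancel, rule Lim_null_comparison)
 show "(%n. form_dist B (f n) u + form_dist B (g n) v) \<longlonglongrightarrow> 0" using tendsto_add[OF l] by simp
 have "\<bar>form_dist B (f n) (g n) - form_dist B u v\<bar> <= form_dist B (f n) u + form_dist B (g n) v" for n
  using dist_triangle[OF f[of n] u g[of n]] dist_triangle[OF u v g[of n]]
   dist_triangle[OF u f[of n] v] dist_triangle[OF f[of n] g[of n] v]
   dist_commute[OF f[of n] u] dist_commute[OF g[of n] v] by linarith
 then show "\<forall>\<^sub>F n in sequentially. norm (form_dist B (f n) (g n) - form_dist B u v)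
   <= form_dist B (f n) u + form_dist B (g n) v" by simp
qed

lemma tendsto_nrm:
 assumes f: "!!n. f n \<in> H" and u: "u \<in> H" and l: "(%n. form_dist B (f n) u) \<longlonglongrightarrow> 0"
 shows "(%n. nrm (f n)) \<longlonglongrightarrow> nrm u"
proof (rule LIM_zero_cancel, rule Lim_null_comparison[OF _ l])
 show "\<forall>\<^sub>F n in sequentially. norm (nrm (f n) - nrm u) <= form_dist B (f n) u"
  using nrm_diff_le[OF f u] by simp
qed

lemma dist_le_Lim:
 assumes f: "!!n. f n \<in> H" and g: "!!n. g n \<in> H" and u: "u \<in> H" and v: "v \<in> H"
  and l: "(%n. form_dist B (f n) u) \<longlonglongrightarrow> 0" "(%n. form_dist B (g n) v) \<longlonglongrightarrow> 0"
  and b: "!!n. form_dist B (f n) (g n) <= c n" and c: "c \<longlonglongrightarrow> c'"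
 shows "form_dist B u v <= c'"
 using tendsto_dist[OF f g u v l] c by (rule LIMSEQ_le) (use b in blast)

lemma tendsto_lincomb:
 assumes f: "!!n. f n \<in> H" and g: "!!n. g n \<in> H" and u: "u \<in> H" and v: "v \<in> H"
  and l: "(%n. form_dist B (f n) u) \<longlonglongrightarrow> 0" "(%n. form_dist B (g n) v) \<longlonglongrightarrow> 0"
 shows "(%n. form_dist B (%x. a * f n x + b * g n x) (%x. a * u x + b * v x)) \<longlonglongrightarrow> 0"
proof (rule Lim_null_comparison)
 have "(%n. \<bar>a\<bar> * form_dist B (f n) u + \<bar>b\<bar> * form_dist B (g n) v) \<longlonglongrightarrow> \<bar>a\<bar> * 0 + \<bar>b\<bar> * 0"
  by (intro tendsto_intros l)
 then show "(%n. \<bar>a\<bar> * form_dist B (f n) u + \<bar>b\<bar> * form_dist B (g n) v) \<longlonglongrightarrow> 0" by simp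
 have "norm (form_dist B (%x. a * f n x + b * g n x) (%x. a * u x + b * v x))
   <= \<bar>a\<bar> * form_dist B (f n) u + \<bar>b\<bar> * form_dist B (g n) v" for n
  using dist_lincomb[OF f[of n] g[of n] u v, of a b] dist_nonneg[OF lincomb[OF f[of n] g[of n]] lincomb[OF u v], of a b a b]
  by simp
 then show "\<forall>\<^sub>F n in sequentially. norm (form_dist B (%x. a * f n x + b * g n x) (%x. a * u x + b * v x))
   <= \<bar>a\<bar> * form_dist B (f n) u + \<bar>b\<bar> * form_dist B (g n) v" by simp
qed

lemma tendsto_unique_dist:
 assumes f: "!!n. f n \<in> H" and u: "u \<in> H" and v: "v \<in> H"
  and l: "(%n. form_dist B (f n) u) \<longlonglongrightarrow> 0" "(%n. form_dist B (f n) v) \<longlonglongrightarrow> 0"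
 shows "form_dist B u v = 0"
 using dist_le_Lim[OF f f u v l, of "%_. 0" 0] dist_self[OF f] dist_nonneg[OF u v] by simp

lemma tendsto_B:
 assumes f: "!!n. f n \<in> H" and g: "!!n. g n \<in> H" and u: "u \<in> H" and v: "v \<in> H"
  and l: "(%n. form_dist B (f n) u) \<longlonglongrightarrow> 0" "(%n. form_dist B (g n) v) \<longlonglongrightarrow> 0"
 shows "(%n. B (f n) (g n)) \<longlonglongrightarrow> B u v"
proof -
 have b: "\<bar>B (f n) (g n) - B u v\<bar> \<le>
   form_dist B (f n) u * form_dist B (g n) v + form_dist B (f n) u * nrm v + nrm u * form_dist B (g n) v" for n
 proof -
  have "B (f n) (g n) - B u v = B (%x. f n x - u x) (%x. g n x - v x)
    + B (%x. f n x - u x) v + B u (%x. g n x - v x)"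
   using f g u v by (simp add: bilin mem)
  then show ?thesis
   using Cauchy_Schwarz[of "%x. f n x - u x" "%x. g n x - v x"]
    Cauchy_Schwarz[of "%x. f n x - u x" v] Cauchy_Schwarz[of u "%x. g n x - v x"] f g u v
   by (simp add: dist_nrm mem)
 qed
 have "(%n. form_dist B (f n) u * form_dist B (g n) v + form_dist B (f n) u * nrm v + nrm u * form_dist B (g n) v)
   \<longlonglongrightarrow> 0 * 0 + 0 * nrm v + nrm u * 0"
  by (intro tendsto_intros l)
 then have z: "(%n. form_dist B (f n) u * form_dist B (g n) v + form_dist B (f n) u * nrm v + nrm u * form_dist B (g n) v)
   \<longlonglongrightarrow> 0" by simp
 have "(%n. B (f n) (g n) - B u v) \<longlonglongrightarrow> 0"
  using b by (intro Lim_null_comparison[OF _ z]) simp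
 then show ?thesis by (rule LIM_zero_cancel)
qed

lemma Cauchy_lincomb:
 assumes f: "!!n. f n \<in> H" and g: "!!n. g n \<in> H" and cf: "Cauchy_wrt B f" and cg: "Cauchy_wrt B g"
 shows "Cauchy_wrt B (%n x. a * f n x + b * g n x)"
 unfolding Cauchy_wrt_def
proof (intro allI impI)
 fix e :: real assume e: "0 < e"
 define d where "d = e / (2 * (\<bar>a\<bar> + \<bar>b\<bar> + 1))"
 have d: "0 < d" using e by (simp add: d_def)
 obtain N1 where N1: "!!m n. m >= N1 ==> n >= N1 ==> form_dist B (f m) (f n) < d"
  using cf d unfolding Cauchy_wrt_def by meson
 obtain N2 where N2: "!!m n. m >= N2 ==> n >= N2 ==> form_dist B (g m) (g n) < d"
  using cg d unfolding Cauchy_wrt_def by meson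
 show "EX N. \<forall>m\<ge>N. \<forall>n\<ge>N. form_dist B (%x. a * f m x + b * g m x) (%x. a * f n x + b * g n x) < e"
 proof (intro exI[of _ "max N1 N2"] allI impI)
  fix m n assume mn: "m >= max N1 N2" "n >= max N1 N2"
  have "form_dist B (%x. a * f m x + b * g m x) (%x. a * f n x + b * g n x)
    <= \<bar>a\<bar> * form_dist B (f m) (f n) + \<bar>b\<bar> * form_dist B (g m) (g n)"
   by (intro dist_lincomb f g)
  also have "\<dots> <= \<bar>a\<bar> * d + \<bar>b\<bar> * d"
   using N1[of m n] N2[of m n] mn by (intro add_mono mult_left_mono) auto
  also have "\<dots> = e * ((\<bar>a\<bar> + \<bar>b\<bar>) / (2 * (\<bar>a\<bar> + \<bar>b\<bar> + 1)))"
   by (simp add: d_def algebra_simps add_divide_distrib)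
  also have "\<dots> < e * 1"
   using e by (intro mult_strict_left_mono) (auto simp: divide_simps)
  finally show "form_dist B (%x. a * f m x + b * g m x) (%x. a * f n x + b * g n x) < e" by simp
 qed
qed

text \<open>Almost minimal elements of a decreasing sequence of convex sets form a Cauchy sequence, by
 the parallelogram identity. This replaces weak compactness in all that follows.\<close>

lemma almost_minimizers_Cauchy:
 assumes K: "!!n. K n \<subseteq> H" "decseq K" "!!n. mid_convex (K n)" and c: "!!n. \<exists>u\<in>K n. B u u <= c"
 obtains w m where "!!n. w n \<in> K n" "!!n u. u \<in> K n ==> m n <= B u u"
  "!!n. B (w n) (w n) < m n + 1 / real (Suc n)" "!!n. m n <= c" "Cauchy_wrt B w"
proof -
 define m where "m n = Inf ((%u. B u u) ` K n)" for n
 have bdd: "bdd_below ((%u. B u u) ` K n)" for n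
  using K(1) nonneg by (intro bdd_belowI[of _ 0]) auto
 have m1: "m n <= B u u" if "u \<in> K n" for n u
  unfolding m_def using that bdd by (intro cINF_lower) auto
 have m2: "m n <= c" for n using c[of n] m1[of _ n] by force
 have m3: "m n <= m k" if "n <= k" for n k
  unfolding m_def using c[of k] bdd decseqD[OF K(2) that] by (intro cINF_superset_mono) auto
 have "\<exists>u\<in>K n. B u u < m n + 1 / real (Suc n)" for n
  using cINF_less_iff[of "K n" "%u. B u u" "m n + 1 / real (Suc n)"] c[of n] bdd[of n]
  by (auto simp: m_def)
 then obtain w where w: "!!n. w n \<in> K n" "!!n. B (w n) (w n) < m n + 1 / real (Suc n)" by metis
 have wH: "w n \<in> H" for n using w(1) K(1) by blast
 \<comment> \<open>The midpoint of \<open>w n\<close> and \<open>w k\<close> lies in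
   \<open>K n\<close>, because \<open>K\<close> decreases, and so has energy at least
   \<open>m n\<close>. The parallelogram identity then leaves \<open>2 * (m k - m n)\<close> and
   twice the slack of each of the two elements.\<close>
 have par: "B (%x. w n x - w k x) (%x. w n x - w k x) <= 2 * (m k - m n) + 4 / real (Suc n)" if nk: "n <= k" for n k
 proof -
  have "w k \<in> K n" using w(1)[of k] decseqD[OF K(2) nk] by blast
  then have "(%x. (1/2) * w n x + (1/2) * w k x) \<in> K n"
   using K(3)[of n] w(1)[of n] unfolding mid_convex_def by blast
  from m1[OF this] have "m n <= (B (w n) (w n) + 2 * B (w n) (w k) + B (w k) (w k)) / 4"
   unfolding square_add[OF mem_scale[OF wH] mem_scale[OF wH]] square_scale[OF wH]
    scaleL[OF wH mem_scale[OF wH]] scaleR[OF wH wH]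
   by (simp add: power2_eq_square field_simps)
  moreover have "1 / real (Suc k) <= 1 / real (Suc n)" using nk by (simp add: frac_le)
  ultimately show ?thesis
   using w(2)[of n] w(2)[of k] wH[of n] wH[of k] by (simp add: square_diff)
 qed
 have "incseq m" using m3 by (auto simp: incseq_def)
 then obtain L where "m \<longlonglongrightarrow> L" using incseq_convergent[of m c] m2 by blast
 then have cm: "Cauchy m" by (auto intro: LIMSEQ_imp_Cauchy)
 have "Cauchy_wrt B w"
  unfolding Cauchy_wrt_def
 proof (intro allI impI)
  fix e :: real assume e: "0 < e"
  obtain N1 where N1: "!!i j. i >= N1 ==> j >= N1 ==> \<bar>m i - m j\<bar> < e\<^sup>2 / 4"
   using cm e unfolding Cauchy_def dist_real_def by (metis divide_pos_pos zero_less_numeral zero_less_power)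
  obtain N2 :: nat where N2: "4 / real (Suc n) < e\<^sup>2 / 2" if "n >= N2" for n
  proof -
   obtain N2 :: nat where "8 / e\<^sup>2 < real N2" using reals_Archimedean2 by blast
   then have "8 / e\<^sup>2 < real (Suc n)" if "n >= N2" for n using that by linarith
   then show thesis using e by (intro that[of N2]) (auto simp: field_simps)
  qed
  have ord: "form_dist B (w n) (w k) < e" if "n <= k" "n >= max N1 N2" for n k
  proof -
   have "B (%x. w n x - w k x) (%x. w n x - w k x) < e\<^sup>2"
   proof -
    have "\<bar>m k - m n\<bar> < e\<^sup>2 / 4" using N1[of k n] that by auto
    then have "m k - m n < e\<^sup>2 / 4" by linarith
    moreover have "4 / real (Suc n) < e\<^sup>2 / 2" using N2[of n] that by auto
    moreover have "2 * a + t < e\<^sup>2" if "a < e\<^sup>2 / 4" "t < e\<^sup>2 / 2" for a t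
     using that by (simp add: field_simps)
    ultimately show ?thesis using par[OF that(1)] by (meson le_less_trans)
   qed
   then have "form_dist B (w n) (w k) < sqrt (e\<^sup>2)"
    unfolding form_dist_def by (rule real_sqrt_less_mono)
   then show ?thesis using e by simp
  qed
  show "EX N. \<forall>m\<ge>N. \<forall>n\<ge>N. form_dist B (w m) (w n) < e"
  proof (intro exI[of _ "max N1 N2"] allI impI)
   fix i j assume "i >= max N1 N2" "j >= max N1 N2"
   then show "form_dist B (w i) (w j) < e"
    using ord[of i j] ord[of j i] dist_commute[OF wH[of i] wH[of j]] by (cases "i <= j") auto
  qed
 qed
 with w m1 m2 show thesis by (rule_tac that[of w m]) auto
qed

end

locale semi_hilbert = semi_ip +
 assumes complete: "(!!n. f n \<in> H) ==> Cauchy_wrt B f ==> \<exists>u\<in>H. (%n. form_dist B (f n) u) \<longlonglongrightarrow> 0"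
begin

text \<open>For a constant sequence of sets the almost minimizers form a minimizing Cauchy sequence,
  and completeness supplies a limit. Closedness is asked for every limit, since there may be several
  at distance 0 from each other.\<close>

lemma minimizer_exists:
 assumes K: "K \<subseteq> H" "mid_convex K" "K ~= {}"
  and cl: "!!w u. (!!n. w n \<in> K) ==> u \<in> H ==> (%n. form_dist B (w n) u) \<longlonglongrightarrow> 0 ==> u \<in> K"
 obtains e where "e \<in> K" "!!u. u \<in> K ==> B e e <= B u u"
proof -
 obtain u0 where "u0 \<in> K" using K by blast
 obtain w m where w: "!!n. w n \<in> K" "!!n u. u \<in> K ==> m n <= B u u"
  "!!n. B (w n) (w n) < m n + 1 / real (Suc n)" "Cauchy_wrt B w"
 proof (rule almost_minimizers_Cauchy[of "%_. K" "B u0 u0"])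
  show "\<exists>u\<in>K. B u u <= B u0 u0" using \<open>u0 \<in> K\<close> by blast
 qed (use K in \<open>auto simp: decseq_def\<close>)
 have wH: "w n \<in> H" for n using w(1) K(1) by blast
 obtain e where e: "e \<in> H" "(%n. form_dist B (w n) e) \<longlonglongrightarrow> 0" using complete[OF wH w(4)] by blast
 have "B e e <= B u u" if u: "u \<in> K" for u
 proof (rule LIMSEQ_le)
  show "(%n. B (w n) (w n)) \<longlonglongrightarrow> B e e" by (rule tendsto_B) (use wH e in auto)
  show "(%n. B u u + 1 / real (Suc n)) \<longlonglongrightarrow> B u u"
   using tendsto_add[OF tendsto_const[of "B u u"] LIMSEQ_inverse_real_of_nat] by (simp add: inverse_eq_divide)
  show "EX N. \<forall>n\<ge>N. B (w n) (w n) <= B u u + 1 / real (Suc n)"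
  proof (intro exI[of _ 0] allI impI)
   fix n show "B (w n) (w n) <= B u u + 1 / real (Suc n)"
    using w(2)[OF u, of n] w(3)[of n] by linarith
  qed
 qed
 with cl[OF w(1) e] show thesis by (rule that)
qed

text \<open>The representing element is a multiple of the element \<open>e\<close> of least norm on
  the affine hyperplane where \<open>\<l>\<close> equals 1: minimality makes \<open>e\<close>
  orthogonal to the kernel of \<open>\<l>\<close>, and every vector splits into a multiple of
  \<open>e\<close> and a part in that kernel.\<close>

lemma Riesz_representation:
 assumes lin': "!!u v a b. u \<in> H ==> v \<in> H ==> \<l> (%x. a * u x + b * v x) = a * \<l> u + b * \<l> v"
  and bnd: "!!u. u \<in> H ==> \<bar>\<l> u\<bar> <= C * nrm u" and ne: "H ~= {}"
 obtains g where "g \<in> H" "!!v. v \<in> H ==> B g v = \<l> v"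
proof (cases "\<forall>v\<in>H. \<l> v = 0")
 case True
 then show thesis using ne mem_zero zeroL by (intro that[of "%x. 0"]) auto
next
 case False
 then obtain v0 where v0: "v0 \<in> H" "\<l> v0 ~= 0" by blast
 let ?K = "{u \<in> H. \<l> u = 1}"
 have sc: "\<l> (%x. a * u x) = a * \<l> u" if "u \<in> H" for a u using lin'[OF that that, of a 0] by simp
 have df: "\<l> (%x. u x - v x) = \<l> u - \<l> v" if "u \<in> H" "v \<in> H" for u v using lin'[OF that, of 1 "-1"] by simp
 obtain e where e: "e \<in> ?K" "!!u. u \<in> ?K ==> B e e <= B u u"
 proof (rule minimizer_exists[of ?K])
  show "mid_convex ?K" unfolding mid_convex_def
  proof (intro ballI)
   fix u v assume "u \<in> ?K" "v \<in> ?K"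
   then show "(%x. (1/2) * u x + (1/2) * v x) \<in> ?K"
    using lincomb[of u v "1/2" "1/2"] lin'[of u v "1/2" "1/2"] by simp
  qed
  have "(%x. (1 / \<l> v0) * v0 x) \<in> ?K" using v0 sc[of v0 "1 / \<l> v0"] mem_scale[of v0 "1 / \<l> v0"] by simp
  then show "?K ~= {}" by blast
  fix w u assume w: "!!n. w n \<in> ?K" and u: "u \<in> H" and l: "(%n. form_dist B (w n) u) \<longlonglongrightarrow> 0"
  have "\<bar>1 - \<l> u\<bar> <= C * form_dist B (w n) u" for n
   using bnd[of "%x. w n x - u x"] w[of n] u by (simp add: df dist_nrm mem)
  then have "\<bar>1 - \<l> u\<bar> <= C * 0"
   by (intro LIMSEQ_le_const[OF tendsto_mult_left[OF l]]) auto
  then show "u \<in> ?K" using u by simp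
 qed auto
 have eH: "e \<in> H" "\<l> e = 1" using e by auto
 have orth: "B e v = 0" if v: "v \<in> H" "\<l> v = 0" for v
 proof -
  have q: "0 <= 2 * t * B e v + t\<^sup>2 * B v v" for t
  proof -
   have "(%x. e x + t * v x) \<in> ?K" using eH v lin'[of e v 1 t] lincomb[of e v 1 t] by simp
   from e(2)[OF this] show ?thesis
    using eH v by (simp add: square_add mem bilin square_scale algebra_simps power2_eq_square)
  qed
  show ?thesis
  proof (rule ccontr)
   assume n: "B e v ~= 0"
   \<comment> \<open>Nearly the vertex of the parabola; the added 1 keeps the denominator positive
     when \<open>B v v = 0\<close>.\<close>
   define t where "t = - B e v / (B v v + 1)"
   have p: "0 < B v v + 1" using nonneg[OF v(1)] by simp
   have "2 * t * B e v + t\<^sup>2 * B v v = (B e v)\<^sup>2 * (- 2 / (B v v + 1) + B v v / (B v v + 1)\<^sup>2)"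
    by (simp add: t_def power2_eq_square algebra_simps)
   also have "- 2 / (B v v + 1) + B v v / (B v v + 1)\<^sup>2 = (- 2 * (B v v + 1) + B v v) / (B v v + 1)\<^sup>2"
    using p by (simp add: power2_eq_square divide_simps)
   also have "\<dots> < 0" using nonneg[OF v(1)] p by (intro divide_neg_pos) auto
   then have "(B e v)\<^sup>2 * ((- 2 * (B v v + 1) + B v v) / (B v v + 1)\<^sup>2) < 0"
    using n by (intro mult_pos_neg) auto
   finally show False using q[of t] by simp
  qed
 qed
 \<comment> \<open>Boundedness of the functional stands in for definiteness: vectors of norm 0 are
   killed by \<open>\<l>\<close>, but \<open>\<l> e = 1\<close>.\<close>
 have c: "B e e > 0"
 proof (rule ccontr)
  assume "\<not> ?thesis"
  then have "nrm e = 0" using nonneg[OF eH(1)] by (simp add: nrm_def)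
  then show False using bnd[OF eH(1)] eH by simp
 qed
 have "B (%x. (1 / B e e) * e x) v = \<l> v" if v: "v \<in> H" for v
 proof -
  have "B e (%x. v x - \<l> v * e x) = 0"
   using v eH sc[of e "\<l> v"] by (intro orth) (auto simp: mem df)
  then have "B e v = \<l> v * B e e" using v eH by (simp add: bilin mem)
  then show ?thesis using scaleL[OF eH(1) v, of "1 / B e e"] c by simp
 qed
 then show thesis using that mem_scale[OF eH(1), of "1 / B e e"] by blast
qed

end

section \<open>Square integrable functions\<close>

lemma L2_measurable: "f \<in> L2_fun M ==> f \<in> borel_measurable M"
 by (simp add: L2_fun_def)

lemma L2_integrable_sq: "f \<in> L2_fun M ==> integrable M (%x. (f x)\<^sup>2)"
 by (simp add: L2_fun_def)

lemma L2_integrable_mult: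
 assumes f: "f \<in> L2_fun M" and g: "g \<in> L2_fun M"
 shows "integrable M (%x. f x * g x)"
proof (rule Bochner_Integration.integrable_bound)
 show "integrable M (%x. (f x)\<^sup>2 + (g x)\<^sup>2)"
  using f g by (simp add: L2_fun_def)
 show "(%x. f x * g x) \<in> borel_measurable M"
  using f g by (intro borel_measurable_times L2_measurable)
 show "AE x in M. norm (f x * g x) <= norm ((f x)\<^sup>2 + (g x)\<^sup>2)"
 proof (rule AE_I2)
  fix x
  have "0 <= (\<bar>f x\<bar> - \<bar>g x\<bar>)\<^sup>2" "0 <= (f x)\<^sup>2" "0 <= (g x)\<^sup>2" by simp_all
  then show "norm (f x * g x) <= norm ((f x)\<^sup>2 + (g x)\<^sup>2)"
   by (auto simp: power2_diff abs_mult intro: order_trans[of _ "2 * \<bar>f x\<bar> * \<bar>g x\<bar>"])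
 qed
qed

lemma L2_lincomb:
 assumes f: "f \<in> L2_fun M" and g: "g \<in> L2_fun M"
 shows "(%x. a * f x + b * g x) \<in> L2_fun M"
proof -
 have "integrable M (%x. a\<^sup>2 * (f x)\<^sup>2 + (2 * a * b) * (f x * g x) + b\<^sup>2 * (g x)\<^sup>2)"
  using L2_integrable_mult[OF f g] f g by (simp add: L2_fun_def)
 moreover have "(%x. (a * f x + b * g x)\<^sup>2) =
   (%x. a\<^sup>2 * (f x)\<^sup>2 + (2 * a * b) * (f x * g x) + b\<^sup>2 * (g x)\<^sup>2)"
  by (auto simp: power2_eq_square algebra_simps)
 ultimately show ?thesis
  using L2_measurable[OF f] L2_measurable[OF g] by (simp add: L2_fun_def)
qed

lemma L2_semi_ip: "semi_ip (L2_fun M) (L2_inner M)"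
proof
 fix u v w :: "'a => real" and a b :: real
 assume u: "u \<in> L2_fun M" and v: "v \<in> L2_fun M"
 show "(%x. a * u x + b * v x) \<in> L2_fun M" using u v by (rule L2_lincomb)
 show "L2_inner M u v = L2_inner M v u" by (simp add: L2_inner_def mult.commute)
 assume w: "w \<in> L2_fun M"
 have "L2_inner M (%x. a * u x + b * v x) w = (\<integral>x. a * (u x * w x) + b * (v x * w x) \<partial>M)"
  unfolding L2_inner_def by (intro Bochner_Integration.integral_cong) (auto simp: algebra_simps)
 also have "\<dots> = a * L2_inner M u w + b * L2_inner M v w"
  using L2_integrable_mult[OF u w] L2_integrable_mult[OF v w] by (simp add: L2_inner_def)
 finally show "L2_inner M (%x. a * u x + b * v x) w = a * L2_inner M u w + b * L2_inner M v w" .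
next
 fix u show "0 <= L2_inner M u u" by (simp add: L2_inner_def)
qed

lemma L2_dist_form: "L2_dist M = form_dist (L2_inner M)"
 by (simp add: fun_eq_iff L2_dist_def form_dist_def)

lemma L2_dominated:
 assumes "f \<in> borel_measurable M" "g \<in> L2_fun M" "AE x in M. \<bar>f x\<bar> <= \<bar>g x\<bar>"
 shows "f \<in> L2_fun M"
proof -
 have "integrable M (%x. (f x)\<^sup>2)"
 proof (rule Bochner_Integration.integrable_bound[OF L2_integrable_sq[OF assms(2)]])
  show "(%x. (f x)\<^sup>2) \<in> borel_measurable M" using assms by simp
  show "AE x in M. norm ((f x)\<^sup>2) <= norm ((g x)\<^sup>2)"
   using assms(3) by eventually_elim (simp add: abs_le_square_iff)
 qed
 then show ?thesis using assms by (simp add: L2_fun_def)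
qed

lemma L2_inner_cong_AE:
 assumes "f \<in> L2_fun M" "f' \<in> L2_fun M" "g \<in> L2_fun M" "g' \<in> L2_fun M"
  "AE x in M. f x = f' x" "AE x in M. g x = g' x"
 shows "L2_inner M f g = L2_inner M f' g'"
 unfolding L2_inner_def using assms
 by (intro integral_cong_AE) (auto simp: L2_fun_def)

lemma L2_dist_zero_iff:
 assumes f: "f \<in> L2_fun M" and g: "g \<in> L2_fun M"
 shows "L2_dist M f g = 0 \<longleftrightarrow> (AE x in M. f x = g x)"
proof -
 have "(%x. f x - g x) \<in> L2_fun M" using semi_ip.mem_diff[OF L2_semi_ip f g] .
 then have "integrable M (%x. (f x - g x)\<^sup>2)" by (rule L2_integrable_sq)
 then have "(\<integral>x. (f x - g x)\<^sup>2 \<partial>M) = 0 \<longleftrightarrow> (AE x in M. (f x - g x)\<^sup>2 = 0)"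
  by (rule integral_nonneg_eq_0_iff_AE) auto
 then show ?thesis by (simp add: L2_dist_def L2_inner_def power2_eq_square)
qed

locale prob_L2 = prob_space M for M :: "'a measure"
begin

lemma bounded_L2:
 assumes "f \<in> borel_measurable M" "AE x in M. \<bar>f x\<bar> <= K"
 shows "f \<in> L2_fun M"
proof -
 have "AE x in M. norm ((f x)\<^sup>2) <= K\<^sup>2"
  using assms(2) by eventually_elim (simp add: abs_le_square_iff[symmetric])
 then have "integrable M (%x. (f x)\<^sup>2)" using assms(1) by (intro integrable_const_bound) auto
 then show ?thesis using assms by (simp add: L2_fun_def)
qed

lemma const_L2: "(%x. c) \<in> L2_fun M"
 by (rule bounded_L2[of _ "\<bar>c\<bar>"]) auto

lemma L2_integrable: "f \<in> L2_fun M ==> integrable M f"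
 using L2_integrable_mult[OF _ const_L2[of 1]] by simp

lemma L1_le_L2:
 assumes f: "f \<in> L2_fun M"
 shows "(\<integral>x. \<bar>f x\<bar> \<partial>M) <= sqrt (L2_inner M f f)"
proof -
 interpret semi_ip "L2_fun M" "L2_inner M" by (rule L2_semi_ip)
 have a: "(%x. \<bar>f x\<bar>) \<in> L2_fun M" using f by (auto simp: L2_fun_def)
 have "\<bar>L2_inner M (%x. \<bar>f x\<bar>) (%x. 1)\<bar> <= nrm (%x. \<bar>f x\<bar>) * nrm (%x. 1)"
  by (rule Cauchy_Schwarz[OF a const_L2])
 also have "nrm (%x. 1) = 1" by (simp add: nrm_def L2_inner_def prob_space)
 also have "nrm (%x. \<bar>f x\<bar>) = sqrt (L2_inner M f f)" by (simp add: nrm_def L2_inner_def)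
 finally show ?thesis by (simp add: L2_inner_def)
qed

lemma L2_AE_subseq:
 assumes f: "!!n. f n \<in> L2_fun M" and u: "u \<in> L2_fun M" and l: "(%n. L2_dist M (f n) u) \<longlonglongrightarrow> 0"
 obtains r :: "nat => nat" where "strict_mono r" "AE x in M. (%n. f (r n) x) \<longlonglongrightarrow> u x"
proof -
 interpret semi_ip "L2_fun M" "L2_inner M" by (rule L2_semi_ip)
 have "(%n. \<integral>x. norm (f n x - u x) \<partial>M) \<longlonglongrightarrow> 0"
 proof (rule Lim_null_comparison[OF _ l], rule always_eventually, rule allI)
  fix n show "norm (\<integral>x. norm (f n x - u x) \<partial>M) <= L2_dist M (f n) u"
   using L1_le_L2[OF mem_diff[OF f[of n] u]] by (simp add: L2_dist_def)
 qed
 from tendsto_L1_AE_subseq[OF L2_integrable[OF mem_diff[OF f u]] this]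
 obtain r :: "nat => nat" where "strict_mono r" "AE x in M. (%n. f (r n) x - u x) \<longlonglongrightarrow> 0" by blast
 then show thesis by (intro that[of r]) (auto simp: LIM_zero_iff)
qed

text \<open>On a probability space the \<open>L^2\<close>-norm dominates the
  \<open>L^1\<close>-norm, so some subsequence converges almost everywhere; Fatou's lemma carries
  the Cauchy estimate over to its limit.\<close>

lemma L2_complete:
 assumes f: "!!n. f n \<in> L2_fun M" and c: "Cauchy_wrt (L2_inner M) f"
 shows "\<exists>u\<in>L2_fun M. (%n. L2_dist M (f n) u) \<longlonglongrightarrow> 0"
proof -
 interpret semi_ip "L2_fun M" "L2_inner M" by (rule L2_semi_ip)
 have "EX N. \<forall>i\<ge>N. \<forall>j\<ge>N. (LINT x|M. norm (f i x - f j x)) < e" if "e > 0" for e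
 proof -
  have "(LINT x|M. norm (f i x - f j x)) <= form_dist (L2_inner M) (f i) (f j)" for i j
   using L1_le_L2[OF mem_diff[OF f[of i] f[of j]]] by (simp add: form_dist_def)
  then show ?thesis using c that unfolding Cauchy_wrt_def by (meson le_less_trans)
 qed
 from cauchy_L1_AE_cauchy_subseq[OF L2_integrable[OF f] this]
 obtain r where r: "strict_mono r" "AE x in M. Cauchy (%i. f (r i) x)" by blast
 define u where "u x = lim (%i. f (r i) x)" for x
 have um: "u \<in> borel_measurable M"
  unfolding u_def using L2_measurable[OF f] by measurable
 have ru: "AE x in M. (%i. f (r i) x) \<longlonglongrightarrow> u x"
  using r(2) by eventually_elim (simp add: u_def Cauchy_convergent convergent_LIMSEQ_iff[symmetric])
 \<comment> \<open>Fatou along the subsequence. The bound yields both that \<open>f n - u\<close> is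
   square integrable and that it is small.\<close>
 have key: "(\<integral>\<^sup>+x. ennreal ((f n x - u x)\<^sup>2) \<partial>M) <= ennreal (e\<^sup>2)"
  if e: "e > 0" and N: "!!m. m >= N ==> form_dist (L2_inner M) (f n) (f m) < e" for n N e
 proof -
  have "(\<integral>\<^sup>+x. ennreal ((f n x - u x)\<^sup>2) \<partial>M) = (\<integral>\<^sup>+x. liminf (%i. ennreal ((f n x - f (r i) x)\<^sup>2)) \<partial>M)"
  proof (rule nn_integral_cong_AE, use ru in eventually_elim)
   fix x assume "(%i. f (r i) x) \<longlonglongrightarrow> u x"
   then have "(%i. ennreal ((f n x - f (r i) x)\<^sup>2)) \<longlonglongrightarrow> ennreal ((f n x - u x)\<^sup>2)"
    by (intro tendsto_ennrealI tendsto_intros)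
   then show "ennreal ((f n x - u x)\<^sup>2) = liminf (%i. ennreal ((f n x - f (r i) x)\<^sup>2))"
    by (metis lim_imp_Liminf trivial_limit_sequentially)
  qed
  also have "\<dots> <= liminf (%i. \<integral>\<^sup>+x. ennreal ((f n x - f (r i) x)\<^sup>2) \<partial>M)"
   using L2_measurable[OF f] by (intro nn_integral_liminf) auto
  also have "\<dots> <= liminf (%i. ennreal (e\<^sup>2))"
  proof (rule Liminf_mono, rule eventually_sequentiallyI[of N])
   fix i assume "N <= i"
   then have "N <= r i" using seq_suble[OF r(1), of i] by linarith
   have m: "(%x. f n x - f (r i) x) \<in> L2_fun M" using mem_diff[OF f f] .
   have "L2_inner M (%x. f n x - f (r i) x) (%x. f n x - f (r i) x) <= e\<^sup>2"
    using N[OF \<open>N <= r i\<close>] nonneg[OF m] e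
    by (auto simp: form_dist_def real_less_lsqrt dest!: less_imp_le intro: real_sqrt_le_iff[THEN iffD1])
   then show "(\<integral>\<^sup>+x. ennreal ((f n x - f (r i) x)\<^sup>2) \<partial>M) <= ennreal (e\<^sup>2)"
    using L2_integrable_sq[OF m]
    by (subst nn_integral_eq_integral) (auto simp: L2_inner_def power2_eq_square intro: ennreal_leI)
  qed
  finally show ?thesis by (simp add: Liminf_const)
 qed
 have diff: "(%x. f n x - u x) \<in> L2_fun M \<and> form_dist (L2_inner M) (f n) u <= e"
  if e: "e > 0" and N: "!!m. m >= N ==> form_dist (L2_inner M) (f n) (f m) < e" for n N e
 proof -
  have i: "integrable M (%x. (f n x - u x)\<^sup>2)"
   using le_less_trans[OF key[OF that] ennreal_less_top] um L2_measurable[OF f[of n]]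
   by (intro integrableI_bounded) auto
  then have "ennreal (\<integral>x. (f n x - u x)\<^sup>2 \<partial>M) <= ennreal (e\<^sup>2)"
   using key[OF that] by (subst (asm) nn_integral_eq_integral) auto
  then have "(\<integral>x. (f n x - u x)\<^sup>2 \<partial>M) <= e\<^sup>2" by simp
  then have "form_dist (L2_inner M) (f n) u <= sqrt (e\<^sup>2)"
   unfolding form_dist_def L2_inner_def by (intro real_sqrt_le_mono) (simp add: power2_eq_square)
  then show ?thesis using i um L2_measurable[OF f[of n]] e by (simp add: L2_fun_def)
 qed
 obtain N where N: "!!m n. m >= N ==> n >= N ==> form_dist (L2_inner M) (f m) (f n) < 1"
  using c zero_less_one unfolding Cauchy_wrt_def by meson
 have "(%x. f N x - u x) \<in> L2_fun M" using diff[of 1 N N] N by auto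
 from mem_diff[OF f[of N] this] have uL: "u \<in> L2_fun M" by simp
 have "(%n. L2_dist M (f n) u) \<longlonglongrightarrow> 0"
 proof (rule LIMSEQ_I)
  fix e :: real assume e: "0 < e"
  then obtain N where N: "!!m n. m >= N ==> n >= N ==> form_dist (L2_inner M) (f m) (f n) < e / 2"
   using c half_gt_zero unfolding Cauchy_wrt_def by meson
  have "norm (L2_dist M (f n) u - 0) < e" if "n >= N" for n
   using diff[of "e/2" N n] N[of n] that e dist_nonneg[OF f[of n] uL] by (simp add: L2_dist_form)
  then show "EX no. \<forall>n\<ge>no. norm (L2_dist M (f n) u - 0) < e" by blast
 qed
 with uL show ?thesis by blast
qed

sublocale L2: semi_hilbert "L2_fun M" "L2_inner M"
 rewrites "form_dist (L2_inner M) = L2_dist M"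
proof -
 show "semi_hilbert (L2_fun M) (L2_inner M)"
  using L2_semi_ip L2_complete
  by (simp add: semi_hilbert_def semi_hilbert_axioms_def L2_dist_form)
qed (simp add: L2_dist_form)

text \<open>The premise \<open>P\<close> serves inequalities that hold only on a set, such as the
  constraint \<open>1 <= w\<close> on \<open>U\<close> in the definition of reduced
  functions.\<close>

lemma L2_limit_nonneg:
 assumes f: "!!n. f n \<in> L2_fun M" and u: "u \<in> L2_fun M" and l: "(%n. L2_dist M (f n) u) \<longlonglongrightarrow> 0"
  and p: "!!n. AE x in M. P x --> 0 <= f n x"
 shows "AE x in M. P x --> 0 <= u x"
proof -
 obtain r :: "nat => nat" where r: "strict_mono r" "AE x in M. (%n. f (r n) x) \<longlonglongrightarrow> u x"
  using L2_AE_subseq[OF f u l] .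
 have "AE x in M. ALL n. P x --> 0 <= f (r n) x"
  unfolding AE_all_countable using p by blast
 then show ?thesis using r(2)
 proof eventually_elim
  case (elim x)
  then show ?case using LIMSEQ_le_const[of "%n. f (r n) x" "u x" 0] by auto
 qed
qed

lemma L2_limit_mono:
 assumes f: "!!n. f n \<in> L2_fun M" and u: "u \<in> L2_fun M" and lf: "(%n. L2_dist M (f n) u) \<longlonglongrightarrow> 0"
  and g: "!!n. g n \<in> L2_fun M" and v: "v \<in> L2_fun M" and lg: "(%n. L2_dist M (g n) v) \<longlonglongrightarrow> 0"
  and p: "!!n. AE x in M. P x --> f n x <= g n x"
 shows "AE x in M. P x --> u x <= v x"
proof -
 have "(%n. L2_dist M (%x. g n x - f n x) (%x. v x - u x)) \<longlonglongrightarrow> 0"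
 proof (rule Lim_null_comparison)
  show "(%n. L2_dist M (g n) v + L2_dist M (f n) u) \<longlonglongrightarrow> 0" using tendsto_add[OF lg lf] by simp
  show "\<forall>\<^sub>F n in sequentially. norm (L2_dist M (%x. g n x - f n x) (%x. v x - u x)) <= L2_dist M (g n) v + L2_dist M (f n) u"
   using L2.dist_lincomb[of "g _" "f _" v u 1 "-1"] f g u v
   by (intro always_eventually allI) (auto simp: L2.dist_nonneg L2.mem)
 qed
 from L2_limit_nonneg[OF L2.mem_diff[OF g f] L2.mem_diff[OF v u] this, of P] p show ?thesis by simp
qed

lemma L2_bounded_convergence:
 assumes f: "!!n. f n \<in> borel_measurable M" and u: "u \<in> borel_measurable M"
  and l: "AE x in M. (%n. f n x) \<longlonglongrightarrow> u x" and b: "!!n. AE x in M. \<bar>f n x\<bar> <= \<bar>g x\<bar>" and g: "g \<in> L2_fun M"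
 shows "u \<in> L2_fun M" "(%n. L2_dist M (f n) u) \<longlonglongrightarrow> 0"
proof -
 have bu: "AE x in M. \<bar>u x\<bar> <= \<bar>g x\<bar>"
 proof -
  have "AE x in M. ALL n. \<bar>f n x\<bar> <= \<bar>g x\<bar>" using b by (simp add: AE_all_countable)
  then show ?thesis using l
   by eventually_elim (auto intro: LIMSEQ_le_const2 tendsto_rabs)
 qed
 show uL: "u \<in> L2_fun M" by (rule L2_dominated[OF u g bu])
 have "(%n. \<integral>x. (f n x - u x)\<^sup>2 \<partial>M) \<longlonglongrightarrow> (\<integral>x. 0 \<partial>M)"
 proof (rule integral_dominated_convergence)
  show "integrable M (%x. 4 * (g x)\<^sup>2)" using L2_integrable_sq[OF g] by simp
  show "AE x in M. (%n. (f n x - u x)\<^sup>2) \<longlonglongrightarrow> 0"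
   using l
  proof eventually_elim
   fix x assume "(%n. f n x) \<longlonglongrightarrow> u x"
   then have "(%n. (f n x - u x)\<^sup>2) \<longlonglongrightarrow> (u x - u x)\<^sup>2" by (intro tendsto_intros)
   then show "(%n. (f n x - u x)\<^sup>2) \<longlonglongrightarrow> 0" by simp
  qed
  fix n show "AE x in M. norm ((f n x - u x)\<^sup>2) <= 4 * (g x)\<^sup>2"
   using b[of n] bu
  proof eventually_elim
   fix x assume "\<bar>f n x\<bar> <= \<bar>g x\<bar>" "\<bar>u x\<bar> <= \<bar>g x\<bar>"
   then have "\<bar>f n x - u x\<bar> <= \<bar>2 * g x\<bar>" by linarith
   then have "(f n x - u x)\<^sup>2 <= (2 * g x)\<^sup>2" by (simp only: abs_le_square_iff)
   then show "norm ((f n x - u x)\<^sup>2) <= 4 * (g x)\<^sup>2" by (simp add: power_mult_distrib)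
  qed
 qed (use f u in auto)
 then have "(%n. sqrt (\<integral>x. (f n x - u x)\<^sup>2 \<partial>M)) \<longlonglongrightarrow> sqrt 0" by (intro tendsto_real_sqrt) simp
 then show "(%n. L2_dist M (f n) u) \<longlonglongrightarrow> 0" by (simp add: L2_dist_def L2_inner_def power2_eq_square)
qed

text \<open>The positive part of \<open>f - g\<close> is an admissible test function, and its inner
  product with \<open>f - g\<close> is its own squared norm.\<close>

lemma L2_le_if_inner_le:
 assumes f: "f \<in> L2_fun M" and g: "g \<in> L2_fun M"
  and t: "!!z. z \<in> L2_fun M ==> (!!x. 0 <= z x) ==> L2_inner M f z <= L2_inner M g z"
 shows "AE x in M. f x <= g x"
proof -
 let ?z = "%x. max 0 (f x - g x)"
 have z: "?z \<in> L2_fun M"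
  using f g by (intro L2_dominated[OF _ L2.mem_diff[OF f g]]) (auto simp: L2_fun_def)
 have "L2_inner M (%x. f x - g x) ?z <= 0"
  using t[OF z] f g z by (simp add: L2.bilin)
 also have "L2_inner M (%x. f x - g x) ?z = L2_inner M ?z ?z"
  unfolding L2_inner_def by (intro Bochner_Integration.integral_cong) (auto simp: max_def)
 finally have "L2_inner M ?z ?z = 0" using L2.nonneg[OF z] by simp
 then have "L2_dist M ?z (%x. 0) = 0" by (simp add: L2_dist_def)
 then have "AE x in M. ?z x = 0" using L2_dist_zero_iff[OF z const_L2] by simp
 then show ?thesis by eventually_elim (simp add: max_def split: if_splits)
qed

lemma L2_inner_mono:
 assumes "f \<in> L2_fun M" "g \<in> L2_fun M" "z \<in> L2_fun M" "AE x in M. f x <= g x" "AE x in M. 0 <= z x"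
 shows "L2_inner M f z <= L2_inner M g z"
proof -
 have "AE x in M. f x * z x <= g x * z x"
  using assms(4,5) by eventually_elim (rule mult_right_mono)
 then show ?thesis
  unfolding L2_inner_def by (intro integral_mono_AE L2_integrable_mult assms)
qed

end

section \<open>Closed forms\<close>

text \<open>A predicate on sets, so that the generic \<open>hull\<close> yields the convex hull as
  \<open>cvx hull S\<close>.\<close>

definition cvx :: "('a => real) set => bool" where
 "cvx S \<longleftrightarrow> (\<forall>u\<in>S. \<forall>v\<in>S. ALL a b. 0 <= a \<and> 0 <= b \<and> a + b = 1 --> (%x. a * u x + b * v x) \<in> S)"

lemma cvxI:
 "(!!u v a b. u \<in> S ==> v \<in> S ==> 0 <= a ==> 0 <= b ==> a + b = 1 ==> (%x. a * u x + b * v x) \<in> S) ==> cvx S"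
 by (simp add: cvx_def)

lemma cvxD:
 "cvx S ==> u \<in> S ==> v \<in> S ==> 0 <= a ==> 0 <= b ==> a + b = 1 ==> (%x. a * u x + b * v x) \<in> S"
 by (simp add: cvx_def)

lemma cvx_imp_mid_convex: "cvx S ==> mid_convex S"
 unfolding mid_convex_def by (intro ballI cvxD) auto

lemma cvx_hull: "cvx (cvx hull S)"
 by (rule hull_in) (auto simp: cvx_def)

lemma (in semi_ip) cvx_dist_le: "w \<in> H ==> cvx {u \<in> H. form_dist B u w <= r}"
proof (rule cvxI)
 fix u v and a b :: real
 assume w: "w \<in> H" and uv: "u \<in> {u \<in> H. form_dist B u w <= r}" "v \<in> {u \<in> H. form_dist B u w <= r}"
  and ab: "0 <= a" "0 <= b" "a + b = 1"
 have "(%x. a * w x + b * w x) = w" using ab by (simp add: distrib_right[symmetric])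
 then have "form_dist B (%x. a * u x + b * v x) w <= \<bar>a\<bar> * form_dist B u w + \<bar>b\<bar> * form_dist B v w"
  using dist_lincomb[of u v w w a b] uv w by simp
 also have "\<dots> <= a * r + b * r" using uv ab by (intro add_mono mult_mono) (auto simp: dist_nonneg w)
 also have "\<dots> = r" using ab by (simp add: distrib_right[symmetric])
 finally show "(%x. a * u x + b * v x) \<in> {u \<in> H. form_dist B u w <= r}" using uv by (simp add: lincomb)
qed

lemma (in semi_ip) cvx_energy_le: "cvx {u \<in> H. B u u <= c}"
proof (cases "\<exists>u\<in>H. B u u <= c")
 case True
 then obtain u where u: "u \<in> H" "B u u <= c" by blast
 then have c: "0 <= c" using nonneg[OF u(1)] by linarith
 have "B u u <= c \<longleftrightarrow> form_dist B u (%x. 0) <= sqrt c" if "u \<in> H" for u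
  by (simp add: form_dist_def)
 then have "{u \<in> H. B u u <= c} = {v \<in> H. form_dist B v (%x. 0) <= sqrt c}" by blast
 then show ?thesis using cvx_dist_le[OF mem_zero[OF u(1)]] by simp
next
 case False
 then have "{u \<in> H. B u u <= c} = {}" by blast
 then show ?thesis by (simp only: cvx_def) blast
qed

text \<open>Density in \<open>L^2\<close> is postponed to \<open>dirichlet_form\<close> because its
  proof for the jump forms already relies on the consequences of completeness drawn here: first the
  constant 1 must be known to lie in the domain.\<close>

locale closed_form = prob_L2 M for M :: "'a measure" +
 fixes D :: "('a => real) set" and E :: "('a => real) => ('a => real) => real"
 assumes D_L2: "D \<subseteq> L2_fun M"
  and D_AE: "u \<in> D ==> v \<in> L2_fun M ==> AE x in M. u x = v x ==> v \<in> D"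
  and E_AE: "u \<in> D ==> u' \<in> D ==> v \<in> D ==> AE x in M. u x = u' x ==> E u v = E u' v"
  and E_ip: "semi_ip D E"
  and D_ne: "D ~= {}"
  and D_complete: "(!!n. f n \<in> D) ==> Cauchy_wrt (form1 M E) f ==>
    \<exists>u\<in>D. (%n. form_dist (form1 M E) (f n) u) \<longlonglongrightarrow> 0"
begin

sublocale E: semi_ip D E by (rule E_ip)

lemma DL: "u \<in> D ==> u \<in> L2_fun M" using D_L2 by blast

text \<open>The inner product in which the resolvent equation with step \<open>h\<close> is a Riesz
  representation. All \<open>h > 0\<close> give equivalent norms, so completeness passes from
  \<open>form1\<close> to each of them.\<close>

definition Eh :: "real => ('a => real) => ('a => real) => real" where
 "Eh h u v = h * E u v + L2_inner M u v"

lemma Eh_1: "Eh 1 = form1 M E"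
 by (simp add: fun_eq_iff Eh_def form1_def)

lemma Eh_semi_ip: assumes "0 < h" shows "semi_ip D (Eh h)"
proof
 fix u v w :: "'a => real" and a b :: real
 assume u: "u \<in> D" and v: "v \<in> D"
 show "(%x. a * u x + b * v x) \<in> D" using E.lincomb[OF u v] .
 show "Eh h u v = Eh h v u" using u v by (simp add: Eh_def E.sym[of u v] L2.sym[of u v] DL)
 assume w: "w \<in> D"
 show "Eh h (%x. a * u x + b * v x) w = a * Eh h u w + b * Eh h v w"
  using u v w by (simp add: Eh_def E.lin L2.lin DL algebra_simps)
next
 fix u assume "u \<in> D" then show "0 <= Eh h u u"
  using E.nonneg[of u] L2.nonneg[OF DL[of u]] assms by (simp add: Eh_def)
qed

lemma dist_Eh_le:
 assumes u: "u \<in> D" and v: "v \<in> D" and h: "0 < h" "0 < k"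
 shows "form_dist (Eh h) u v <= sqrt (max 1 (h / k)) * form_dist (Eh k) u v"
proof -
 let ?w = "%x. u x - v x"
 have w: "?w \<in> D" using u v by (rule E.mem_diff)
 have "h * E ?w ?w <= max 1 (h / k) * (k * E ?w ?w)"
  using mult_right_mono[of "h / k" "max 1 (h / k)" "k * E ?w ?w"] E.nonneg[OF w] h by simp
 moreover have "L2_inner M ?w ?w <= max 1 (h / k) * L2_inner M ?w ?w"
  using mult_right_mono[of 1 "max 1 (h / k)" "L2_inner M ?w ?w"] L2.nonneg[OF DL[OF w]] by simp
 ultimately have "Eh h ?w ?w <= max 1 (h / k) * Eh k ?w ?w"
  by (simp add: Eh_def distrib_left)
 then show ?thesis by (simp add: form_dist_def real_sqrt_mult[symmetric])
qed

lemma Eh_semi_hilbert: assumes h: "0 < h" shows "semi_hilbert D (Eh h)"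
proof -
 interpret h: semi_ip D "Eh h" by (rule Eh_semi_ip[OF h])
 show ?thesis
 proof
  fix f assume f: "!!n. f n \<in> D" and c: "Cauchy_wrt (Eh h) f"
  let ?K = "sqrt (max 1 (1 / h))" and ?K' = "sqrt (max 1 h)"
  have K: "0 < ?K" by (simp add: less_max_iff_disj)
  have "Cauchy_wrt (form1 M E) f"
   unfolding Cauchy_wrt_def
  proof (intro allI impI)
   fix e :: real assume e: "0 < e"
   obtain N where N: "!!m n. m >= N ==> n >= N ==> form_dist (Eh h) (f m) (f n) < e / ?K"
    using c e K unfolding Cauchy_wrt_def by (meson divide_pos_pos)
   have "form_dist (form1 M E) (f m) (f n) < e" if "m >= N" "n >= N" for m n
   proof -
    have "form_dist (form1 M E) (f m) (f n) <= ?K * form_dist (Eh h) (f m) (f n)"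
     using dist_Eh_le[OF f f zero_less_one h, of m n] by (simp add: Eh_1)
    also have "\<dots> < ?K * (e / ?K)" using N[OF that] K by (intro mult_strict_left_mono)
    finally show ?thesis using K by simp
   qed
   then show "EX N. \<forall>m\<ge>N. \<forall>n\<ge>N. form_dist (form1 M E) (f m) (f n) < e" by blast
  qed
  from D_complete[OF f this] obtain u where u: "u \<in> D" "(%n. form_dist (form1 M E) (f n) u) \<longlonglongrightarrow> 0" by blast
  have "(%n. form_dist (Eh h) (f n) u) \<longlonglongrightarrow> 0"
  proof (rule Lim_null_comparison)
   show "(%n. ?K' * form_dist (form1 M E) (f n) u) \<longlonglongrightarrow> 0" using tendsto_mult_left[OF u(2), of ?K'] by simp
   show "\<forall>\<^sub>F n in sequentially. norm (form_dist (Eh h) (f n) u) <= ?K' * form_dist (form1 M E) (f n) u"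
    using dist_Eh_le[OF f u(1) h zero_less_one] h.dist_nonneg[OF f u(1)] by (simp add: Eh_1)
  qed
  with u(1) show "\<exists>u\<in>D. (%n. form_dist (Eh h) (f n) u) \<longlonglongrightarrow> 0" by blast
 qed
qed

sublocale E1: semi_hilbert D "form1 M E"
 using Eh_semi_hilbert[of 1] by (simp add: Eh_1)

lemma E1_ge: assumes u: "u \<in> D" shows "E u u <= form1 M E u u" "L2_inner M u u <= form1 M E u u"
 using E.nonneg[OF u] L2.nonneg[OF DL[OF u]] by (auto simp: form1_def)

lemma dist_le_E1:
 assumes u: "u \<in> D" and v: "v \<in> D"
 shows "form_dist E u v <= form_dist (form1 M E) u v" "L2_dist M u v <= form_dist (form1 M E) u v"
 using E1_ge[OF E.mem_diff[OF u v]] by (auto simp: form_dist_def L2_dist_def intro: real_sqrt_le_mono)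

lemma E1_le_sum:
 assumes u: "u \<in> D" and v: "v \<in> D"
 shows "form_dist (form1 M E) u v <= form_dist E u v + L2_dist M u v"
 unfolding form_dist_def L2_dist_def form1_def
 using E.nonneg[OF E.mem_diff[OF u v]] L2.nonneg[OF DL[OF E.mem_diff[OF u v]]]
 by (rule sqrt_add_le_add_sqrt)

lemma tendsto_E1_imp:
 assumes f: "!!n. f n \<in> D" and u: "u \<in> D" and l: "(%n. form_dist (form1 M E) (f n) u) \<longlonglongrightarrow> 0"
 shows "(%n. form_dist E (f n) u) \<longlonglongrightarrow> 0" "(%n. L2_dist M (f n) u) \<longlonglongrightarrow> 0"
proof -
 show "(%n. form_dist E (f n) u) \<longlonglongrightarrow> 0"
  using dist_le_E1(1)[OF f u] E.dist_nonneg[OF f u] by (intro Lim_null_comparison[OF _ l]) simp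
 show "(%n. L2_dist M (f n) u) \<longlonglongrightarrow> 0"
  using dist_le_E1(2)[OF f u] L2.dist_nonneg[OF DL[OF f] DL[OF u]] by (intro Lim_null_comparison[OF _ l]) simp
qed

lemma E_cong_AE:
 assumes "u \<in> D" "u' \<in> D" "v \<in> D" "v' \<in> D" "AE x in M. u x = u' x" "AE x in M. v x = v' x"
 shows "E u v = E u' v'"
 using E_AE[of u u' v] E_AE[of v v' u'] assms by (simp add: E.sym)

lemma form_dist_cong_AE:
 assumes "u \<in> D" "u' \<in> D" "v \<in> D" "v' \<in> D" "AE x in M. u x = u' x" "AE x in M. v x = v' x"
 shows "form_dist (form1 M E) u v = form_dist (form1 M E) u' v'"
proof -
 have "AE x in M. u x - v x = u' x - v' x" using assms(5,6) by eventually_elim simp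
 then show ?thesis using assms(1-4) E_cong_AE[of "%x. u x - v x" "%x. u' x - v' x" "%x. u x - v x" "%x. u' x - v' x"]
  L2_inner_cong_AE[of "%x. u x - v x" M "%x. u' x - v' x" "%x. u x - v x" "%x. u' x - v' x"]
  by (simp add: form_dist_def form1_def E.mem_diff DL)
qed

proposition bounded_energy_limit:
 assumes f: "!!n. f n \<in> D" and c: "!!n. E (f n) (f n) <= c"
  and u: "u \<in> L2_fun M" and l: "(%n. L2_dist M (f n) u) \<longlonglongrightarrow> 0"
 shows "u \<in> D" "E u u <= c"
  "EX w. (ALL n. w n \<in> cvx hull (range f)) \<and> (%n. form_dist (form1 M E) (w n) u) \<longlonglongrightarrow> 0"
proof -
 define K where "K n = cvx hull (f ` {n..})" for n
 have KD: "K n \<subseteq> {w \<in> D. E w w <= c}" for n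
  unfolding K_def by (rule hull_minimal) (use f c E.cvx_energy_le in auto)
 \<comment> \<open>\<open>L^2\<close>-balls around \<open>u\<close> are convex, so the hull of a
   late tail stays as close to \<open>u\<close> as the tail itself. This is what identifies the
   limit in energy with \<open>u\<close>.\<close>
 have KL: "K n \<subseteq> {w \<in> L2_fun M. L2_dist M w u <= r}" if "!!m. m >= n ==> L2_dist M (f m) u <= r" for n r
  unfolding K_def by (rule hull_minimal) (use f that DL L2.cvx_dist_le[OF u] in auto)
 have Kf: "f n \<in> K n" for n unfolding K_def by (rule hull_inc) auto
 have "Bseq (%n. L2.nrm (f n))"
  using L2.tendsto_nrm[OF DL[OF f] u l] convergentI convergent_imp_Bseq by blast
 then obtain B where B: "!!n. \<bar>L2.nrm (f n)\<bar> <= B" by (auto simp: Bseq_def)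
 have bd: "form1 M E (f n) (f n) <= c + B\<^sup>2" for n
 proof -
  have "L2_inner M (f n) (f n) = (L2.nrm (f n))\<^sup>2" using L2.nrm_sq[OF DL[OF f]] by simp
  also have "\<dots> <= B\<^sup>2" using B[of n] by (metis abs_le_square_iff abs_ge_self abs_idempotent order_trans)
  finally show ?thesis using c[of n] by (simp add: form1_def)
 qed
 obtain w m where w: "!!n. w n \<in> K n" "Cauchy_wrt (form1 M E) w"
 proof (rule E1.almost_minimizers_Cauchy[of K "c + B\<^sup>2"])
  show "decseq K" unfolding K_def decseq_def by (intro allI impI hull_mono) auto
  show "mid_convex (K n)" for n unfolding K_def by (intro cvx_imp_mid_convex cvx_hull)
  show "\<exists>u\<in>K n. form1 M E u u <= c + B\<^sup>2" for n using Kf bd by blast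
 qed (use KD in auto)
 have wD: "w n \<in> D" "E (w n) (w n) <= c" for n using w(1) KD by blast+
 obtain v where v: "v \<in> D" "(%n. form_dist (form1 M E) (w n) v) \<longlonglongrightarrow> 0"
  using D_complete[OF wD(1) w(2)] by blast
 have lu: "(%n. L2_dist M (w n) u) \<longlonglongrightarrow> 0"
 proof (rule LIMSEQ_I)
  fix e :: real assume e: "0 < e"
  then obtain N where N: "!!n. n >= N ==> L2_dist M (f n) u < e / 2"
   using order_tendstoD(2)[OF l, of "e/2"] by (auto simp: eventually_sequentially)
  have "L2_dist M (w n) u <= e / 2" if "n >= N" for n
   using KL[of n "e / 2"] w(1)[of n] N that by (auto simp: less_imp_le)
  then have "norm (L2_dist M (w n) u - 0) < e" if "n >= N" for n
   using that e L2.dist_nonneg[OF DL[OF wD(1)] u, of n] by fastforce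
  then show "EX no. \<forall>n\<ge>no. norm (L2_dist M (w n) u - 0) < e" by blast
 qed
 have "L2_dist M v u = 0"
  using L2.tendsto_unique_dist[OF DL[OF wD(1)] DL[OF v(1)] u tendsto_E1_imp(2)[OF wD(1) v] lu] .
 then have vu: "AE x in M. v x = u x" using L2_dist_zero_iff[OF DL[OF v(1)] u] by simp
 show uD: "u \<in> D" using D_AE[OF v(1) u vu] .
 have lE: "(%n. form_dist (form1 M E) (w n) u) \<longlonglongrightarrow> 0"
 proof -
  have "form_dist (form1 M E) (w n) v = form_dist (form1 M E) (w n) u" for n
   by (rule form_dist_cong_AE[OF wD(1) wD(1) v(1) uD _ vu]) simp
  then show ?thesis using v(2) by simp
 qed
 show "E u u <= c"
  using E.tendsto_B[OF wD(1) wD(1) uD uD tendsto_E1_imp(1)[OF wD(1) uD lE] tendsto_E1_imp(1)[OF wD(1) uD lE]] wD(2)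
  by (intro LIMSEQ_le_const2) auto
 have "K n \<subseteq> cvx hull (range f)" for n unfolding K_def by (rule hull_mono) auto
 then show "EX w. (ALL n. w n \<in> cvx hull (range f)) \<and> (%n. form_dist (form1 M E) (w n) u) \<longlonglongrightarrow> 0"
  using w(1) lE by blast
qed

end

locale dirichlet_form = closed_form +
 assumes D_dense: "f \<in> L2_fun M ==> 0 < e ==> \<exists>u\<in>D. L2_dist M f u < e"
  and clamp: "u \<in> D ==> (%x. min 1 (max 0 (u x))) \<in> D"
   "u \<in> D ==> E (%x. min 1 (max 0 (u x))) (%x. min 1 (max 0 (u x))) <= E u u"
begin

text \<open>Rescaling turns the clamp at height 1 into a clamp at height \<open>n + 1\<close> with
  the same energy bound, and at each point the upper clamp is eventually inactive.\<close>

lemma pos_part: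
 assumes u: "u \<in> D"
 shows "(%x. max 0 (u x)) \<in> D" "E (%x. max 0 (u x)) (%x. max 0 (u x)) <= E u u"
proof -
 define f where "f n x = real (Suc n) * min 1 (max 0 (u x / real (Suc n)))" for n x
 have s: "(%x. (1 / real (Suc n)) * u x) \<in> D" for n using E.mem_scale[OF u] .
 have f: "f n \<in> D" for n
  using E.mem_scale[OF clamp(1)[OF s[of n]], of "real (Suc n)"] by (simp add: f_def[abs_def])
 have c: "E (f n) (f n) <= E u u" for n
 proof -
  have "E (f n) (f n) = (real (Suc n))\<^sup>2 * E (%x. min 1 (max 0 ((1 / real (Suc n)) * u x))) (%x. min 1 (max 0 ((1 / real (Suc n)) * u x)))"
   using E.square_scale[OF clamp(1)[OF s[of n]], of "real (Suc n)"] by (simp add: f_def[abs_def])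
  also have "\<dots> <= (real (Suc n))\<^sup>2 * E (%x. (1 / real (Suc n)) * u x) (%x. (1 / real (Suc n)) * u x)"
   by (intro mult_left_mono clamp(2)[OF s]) auto
  also have "\<dots> = E u u" unfolding E.square_scale[OF u] by (simp add: power_divide)
  finally show ?thesis .
 qed
 have "(%n. f n x) \<longlonglongrightarrow> max 0 (u x)" for x
 proof (rule tendsto_eventually)
  obtain N :: nat where N: "u x < real N" using reals_Archimedean2 by blast
  have "f n x = max 0 (u x)" if "n >= N" for n
  proof -
   have "u x < real (Suc n)" using N that by linarith
   then show ?thesis by (auto simp: f_def max_def min_def divide_simps)
  qed
  then show "\<forall>\<^sub>F n in sequentially. f n x = max 0 (u x)" by (auto simp: eventually_sequentially)
 qed
 moreover have "\<bar>f n x\<bar> <= \<bar>u x\<bar>" for n x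
  by (auto simp: f_def max_def min_def divide_simps)
 ultimately have lim: "(%x. max 0 (u x)) \<in> L2_fun M" "(%n. L2_dist M (f n) (%x. max 0 (u x))) \<longlonglongrightarrow> 0"
  using L2_bounded_convergence[of f "%x. max 0 (u x)" u] L2_measurable[OF DL[OF f]] L2_measurable[OF DL[OF u]] DL[OF u]
  by auto
 show "(%x. max 0 (u x)) \<in> D" "E (%x. max 0 (u x)) (%x. max 0 (u x)) <= E u u"
  using bounded_energy_limit[OF f c lim] by auto
qed

lemma neg_part: "u \<in> D ==> (%x. max 0 (- u x)) \<in> D"
 using pos_part(1)[OF E.mem_scale[of u "-1"]] by simp

text \<open>For every \<open>s > 0\<close> the positive part of \<open>u^+ - s u^-\<close> is again
  \<open>u^+\<close>, so passing from \<open>u^+\<close> to \<open>u^+ - s u^-\<close> cannot lower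
  the energy. For small \<open>s\<close> the first-order term of the difference decides the
  sign.\<close>

lemma E_pos_neg:
 assumes u: "u \<in> D" shows "E (%x. max 0 (u x)) (%x. max 0 (- u x)) <= 0"
proof -
 let ?p = "%x. max 0 (u x)" and ?n = "%x. max 0 (- u x)"
 have p: "?p \<in> D" and n: "?n \<in> D" using pos_part(1) neg_part u by auto
 have s: "2 * E ?p ?n <= s * E ?n ?n" if "0 < s" for s
 proof -
  have m: "(%x. ?p x - s * ?n x) \<in> D" by (intro E.mem p n)
  have "(%x. max 0 (?p x - s * ?n x)) = ?p"
   using that by (auto simp: max_def not_le mult_less_0_iff mult_nonneg_nonpos)
  then have "E ?p ?p <= E (%x. ?p x - s * ?n x) (%x. ?p x - s * ?n x)"
   using pos_part(2)[OF m] by simp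
  also have "\<dots> = E ?p ?p - 2 * (s * E ?p ?n) + s\<^sup>2 * E ?n ?n"
   using E.square_diff[OF p E.mem_scale[OF n]] by (simp add: E.square_scale[OF n] E.scaleR[OF n p])
  finally have "s * (2 * E ?p ?n) <= s * (s * E ?n ?n)" by (simp add: power2_eq_square)
  then show ?thesis using that by (simp only: mult_le_cancel_left_pos)
 qed
 show ?thesis
 proof (rule field_le_epsilon)
  fix e :: real assume e: "0 < e"
  have N: "0 <= E ?n ?n" using E.nonneg[OF n] .
  have "2 * E ?p ?n <= (e / (E ?n ?n + 1)) * E ?n ?n" using s[of "e / (E ?n ?n + 1)"] e N by simp
  also have "\<dots> <= e" using e N by (simp add: divide_simps)
  finally show "E ?p ?n <= 0 + e" using e by linarith
 qed
qed

text \<open>Weak maximum principle: test with the negative part.\<close>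

lemma nonneg_if_superharmonic:
 assumes u: "u \<in> D" and h: "0 < h"
  and t: "!!v. v \<in> D ==> (!!x. 0 <= v x) ==> 0 <= h * E u v + L2_inner M u v"
 shows "AE x in M. 0 <= u x"
proof -
 let ?p = "%x. max 0 (u x)" and ?n = "%x. max 0 (- u x)"
 have p: "?p \<in> D" and n: "?n \<in> D" using pos_part(1) neg_part u by auto
 have ue: "u = (%x. ?p x - ?n x)" by (auto simp: max_def)
 have "E u ?n = E ?p ?n - E ?n ?n" by (subst ue) (rule E.diffL[OF p n n])
 moreover have "L2_inner M u ?n = - L2_inner M ?n ?n"
  unfolding L2_inner_def integral_minus[symmetric]
  by (intro Bochner_Integration.integral_cong) (auto simp: max_def)
 ultimately have "L2_inner M ?n ?n <= h * E ?p ?n - h * E ?n ?n"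
  using t[OF n] by (simp add: right_diff_distrib)
 moreover have "h * E ?p ?n <= 0" using E_pos_neg[OF u] h by (simp add: mult_le_0_iff)
 moreover have "0 <= h * E ?n ?n" using E.nonneg[OF n] h by simp
 ultimately have "L2_inner M ?n ?n = 0" using L2.nonneg[OF DL[OF n]] by linarith
 then have "L2_dist M ?n (%x. 0) = 0" by (simp add: L2_dist_def)
 then have "AE x in M. ?n x = 0" using L2_dist_zero_iff[OF DL[OF n] const_L2] by simp
 then show ?thesis by eventually_elim (simp add: max_def split: if_splits)
qed

end

section \<open>Resolvents and semigroups\<close>

context dirichlet_form
begin

text \<open>\<open>R h = (1 - h A)\<^sup>-\<^sup>1\<close>, where \<open>A\<close> is the generator; \<open>gen f g\<close> means \<open>A f = g\<close>.\<close>

definition R :: "real => ('a => real) => 'a => real" where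
 "R h f = (SOME u. u \<in> D \<and> (\<forall>v\<in>D. h * E u v + L2_inner M u v = L2_inner M f v))"

definition gen :: "('a => real) => ('a => real) => bool" where
 "gen f g \<longleftrightarrow> f \<in> D \<and> g \<in> L2_fun M \<and> (\<forall>v\<in>D. E f v = - L2_inner M g v)"

lemma R_props:
 assumes f: "f \<in> L2_fun M" and h: "0 < h"
 shows R_D: "R h f \<in> D" and R_eq: "!!v. v \<in> D ==> h * E (R h f) v + L2_inner M (R h f) v = L2_inner M f v"
proof -
 interpret h: semi_hilbert D "Eh h" by (rule Eh_semi_hilbert[OF h])
 have "EX u. u \<in> D \<and> (\<forall>v\<in>D. h * E u v + L2_inner M u v = L2_inner M f v)"
 proof (rule h.Riesz_representation[of "L2_inner M f" "L2.nrm f"])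
  fix u v a b assume "u \<in> D" "v \<in> D"
  then show "L2_inner M f (%x. a * u x + b * v x) = a * L2_inner M f u + b * L2_inner M f v"
   using f by (simp add: L2.addR L2.scaleR L2.mem DL)
 next
  fix u assume u: "u \<in> D"
  have "L2.nrm u <= h.nrm u"
   unfolding L2.nrm_def h.nrm_def Eh_def using E.nonneg[OF u] h by simp
  then show "\<bar>L2_inner M f u\<bar> <= L2.nrm f * h.nrm u"
   using L2.Cauchy_Schwarz[OF f DL[OF u]] mult_left_mono[OF _ L2.nrm_nonneg[OF f]] by (meson order_trans)
 qed (use D_ne in \<open>auto simp: Eh_def\<close>)
 then have "R h f \<in> D \<and> (\<forall>v\<in>D. h * E (R h f) v + L2_inner M (R h f) v = L2_inner M f v)"
  unfolding R_def by (rule someI_ex)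
 then show "R h f \<in> D" "!!v. v \<in> D ==> h * E (R h f) v + L2_inner M (R h f) v = L2_inner M f v" by auto
qed

lemma R_L2: "f \<in> L2_fun M ==> 0 < h ==> R h f \<in> L2_fun M"
 using R_D DL by blast

text \<open>Testing the resolvent equation with its own solution. Contractivity, uniqueness and the
  error bounds of a single step all come from here.\<close>

lemma nrm_le_if_eq:
 assumes u: "u \<in> D" and f: "f \<in> L2_fun M" and h: "0 < h" and e: "h * E u u + L2_inner M u u = L2_inner M f u"
 shows "L2.nrm u <= L2.nrm f"
proof -
 have "0 <= h * E u u" using E.nonneg[OF u] h by simp
 then have "(L2.nrm u)\<^sup>2 <= L2_inner M f u" using e by (simp add: L2.nrm_sq DL[OF u])
 also have "\<dots> <= L2.nrm f * L2.nrm u" using L2.Cauchy_Schwarz[OF f DL[OF u]] by simp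
 finally show ?thesis
  using L2.nrm_nonneg[OF DL[OF u]] L2.nrm_nonneg[OF f]
  by (metis mult_le_cancel_right power2_eq_square less_le)
qed

lemma R_unique:
 assumes u: "u \<in> D" and f: "f \<in> L2_fun M" and h: "0 < h"
  and e: "!!v. v \<in> D ==> h * E u v + L2_inner M u v = L2_inner M f v"
 shows "L2_dist M u (R h f) = 0"
proof -
 let ?w = "%x. u x - R h f x"
 have w: "?w \<in> D" using u R_D[OF f h] by (rule E.mem_diff)
 have "L2.nrm ?w <= L2.nrm (%x. 0)"
 proof (rule nrm_le_if_eq[OF w const_L2 h])
  show "h * E ?w ?w + L2_inner M ?w ?w = L2_inner M (%x. 0) ?w"
   using e[OF w] R_eq[OF f h w] by (simp add: E.diffL[OF u R_D[OF f h] w] L2.diffL[OF DL[OF u] R_L2[OF f h] DL[OF w]] L2.zeroL DL[OF w] right_diff_distrib)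
 qed
 then show ?thesis using L2.dist_nonneg[OF DL[OF u] R_L2[OF f h]]
  by (simp add: L2.dist_nrm L2.nrm_def L2.zeroL const_L2)
qed

lemma R_lincomb:
 assumes f: "f \<in> L2_fun M" and g: "g \<in> L2_fun M" and h: "0 < h"
 shows "L2_dist M (%x. a * R h f x + b * R h g x) (R h (%x. a * f x + b * g x)) = 0"
proof (rule R_unique[OF E.lincomb[OF R_D[OF f h] R_D[OF g h]] L2.lincomb[OF f g] h])
 fix v assume v: "v \<in> D"
 have "h * (a * E (R h f) v + b * E (R h g) v) + (a * L2_inner M (R h f) v + b * L2_inner M (R h g) v)
   = a * (h * E (R h f) v + L2_inner M (R h f) v) + b * (h * E (R h g) v + L2_inner M (R h g) v)"
  by (simp add: algebra_simps)
 then show "h * E (%x. a * R h f x + b * R h g x) v + L2_inner M (%x. a * R h f x + b * R h g x) v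
   = L2_inner M (%x. a * f x + b * g x) v"
  using f g v R_D[OF f h] R_D[OF g h] R_eq[OF f h v] R_eq[OF g h v]
  by (simp add: E.lin L2.lin DL)
qed

lemma R_nrm: "f \<in> L2_fun M ==> 0 < h ==> L2.nrm (R h f) <= L2.nrm f"
 using nrm_le_if_eq[OF R_D _ _ R_eq[OF _ _ R_D]] by blast

lemma R_nonexp:
 assumes f: "f \<in> L2_fun M" and g: "g \<in> L2_fun M" and h: "0 < h"
 shows "L2_dist M (R h f) (R h g) <= L2_dist M f g"
proof -
 have "L2.nrm (%x. R h f x - R h g x) <= L2.nrm (%x. f x - g x)"
 proof (rule nrm_le_if_eq[OF E.mem_diff[OF R_D[OF f h] R_D[OF g h]] L2.mem_diff[OF f g] h])
  let ?w = "%x. R h f x - R h g x"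
  have w: "?w \<in> D" using E.mem_diff[OF R_D[OF f h] R_D[OF g h]] .
  show "h * E ?w ?w + L2_inner M ?w ?w = L2_inner M (%x. f x - g x) ?w"
   using R_eq[OF f h w] R_eq[OF g h w] f g w
   by (simp add: E.diffL[OF R_D[OF f h] R_D[OF g h] w] L2.diffL[OF R_L2[OF f h] R_L2[OF g h] DL[OF w]]
     L2.diffL[OF f g DL[OF w]] right_diff_distrib)
 qed
 then show ?thesis by (simp add: L2.dist_nrm)
qed

lemma R_mono:
 assumes f: "f \<in> L2_fun M" and g: "g \<in> L2_fun M" and h: "0 < h" and le: "AE x in M. f x <= g x"
 shows "AE x in M. R h f x <= R h g x"
proof -
 have "AE x in M. 0 <= R h g x - R h f x"
 proof (rule nonneg_if_superharmonic[OF E.mem_diff[OF R_D[OF g h] R_D[OF f h]] h])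
  fix v assume v: "v \<in> D" "!!x. 0 <= v x"
  have "L2_inner M f v <= L2_inner M g v" using v by (intro L2_inner_mono f g le) (auto simp: DL)
  then show "0 <= h * E (%x. R h g x - R h f x) v + L2_inner M (%x. R h g x - R h f x) v"
   using R_eq[OF f h v(1)] R_eq[OF g h v(1)]
   by (simp add: E.diffL[OF R_D[OF g h] R_D[OF f h] v(1)] L2.diffL[OF R_L2[OF g h] R_L2[OF f h] DL[OF v(1)]] right_diff_distrib)
 qed
 then show ?thesis by eventually_elim simp
qed

lemma gen_D: "gen f g ==> f \<in> D" and gen_L2: "gen f g ==> f \<in> L2_fun M" "gen f g ==> g \<in> L2_fun M"
 by (auto simp: gen_def DL)

text \<open>This is \<open>A R_h k = (R_h k - k) / h\<close>, read off from
  \<open>(1 - h A) R_h k = k\<close>.\<close>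

lemma gen_R_self:
 assumes k: "k \<in> L2_fun M" and h: "0 < h"
 shows "gen (R h k) (%x. (1 / h) * R h k x + (- 1 / h) * k x)"
 unfolding gen_def
proof (intro conjI ballI)
 show "R h k \<in> D" using R_D[OF k h] .
 show "(%x. (1 / h) * R h k x + (- 1 / h) * k x) \<in> L2_fun M" using L2.lincomb[OF R_L2[OF k h] k] .
 fix v assume v: "v \<in> D"
 show "E (R h k) v = - L2_inner M (%x. (1 / h) * R h k x + (- 1 / h) * k x) v"
  unfolding L2.lin[OF R_L2[OF k h] k DL[OF v]] using R_eq[OF k h v] h by (simp add: field_simps)
qed

lemma R_gen:
 assumes g: "gen f g" and h: "0 < h"
 shows "L2_dist M (%x. R h f x + (- h) * R h g x) f = 0"
proof -
 note fg = gen_L2[OF g]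
 have "L2_dist M f (R h (%x. 1 * f x + (- h) * g x)) = 0"
 proof (rule R_unique[OF gen_D[OF g] L2.lincomb[OF fg] h])
  fix v assume v: "v \<in> D"
  show "h * E f v + L2_inner M f v = L2_inner M (%x. 1 * f x + (- h) * g x) v"
   unfolding L2.lin[OF fg DL[OF v]] using g v by (simp add: gen_def)
 qed
 moreover have "L2_dist M (%x. 1 * R h f x + (- h) * R h g x) (R h (%x. 1 * f x + (- h) * g x)) = 0"
  by (rule R_lincomb[OF fg h])
 ultimately show ?thesis
  using L2.dist_triangle[OF L2.lincomb[OF R_L2[OF fg(1) h] R_L2[OF fg(2) h], of 1 "- h"] R_L2[OF L2.lincomb[OF fg, of 1 "-h"] h] fg(1)]
   L2.dist_commute[OF fg(1) R_L2[OF L2.lincomb[OF fg, of 1 "-h"] h]]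
   L2.dist_nonneg[OF L2.lincomb[OF R_L2[OF fg(1) h] R_L2[OF fg(2) h], of 1 "- h"] fg(1)]
  by simp
qed

lemma R_gen_AE:
 assumes g: "gen f g" and h: "0 < h"
 shows "AE x in M. R h f x = f x + h * R h g x"
proof -
 note fg = gen_L2[OF g]
 have "AE x in M. R h f x + (- h) * R h g x = f x"
  using R_gen[OF g h] L2_dist_zero_iff[OF L2.lincomb[OF R_L2[OF fg(1) h] R_L2[OF fg(2) h], of 1 "- h"] fg(1)] by simp
 then show ?thesis by eventually_elim (simp add: algebra_simps)
qed

lemma L2_dist_cong_AE:
 assumes "f \<in> L2_fun M" "f' \<in> L2_fun M" "g \<in> L2_fun M" "g' \<in> L2_fun M" "AE x in M. f x - g x = f' x - g' x"
 shows "L2_dist M f g = L2_dist M f' g'"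
 using L2_inner_cong_AE[of "%x. f x - g x" M "%x. f' x - g' x" "%x. f x - g x" "%x. f' x - g' x"] assms
 by (simp add: L2_dist_def L2.mem)

lemma R_gen_dist:
 assumes g: "gen f g" and h: "0 < h"
 shows "L2_dist M (R h f) f <= h * L2.nrm g"
proof -
 note fg = gen_L2[OF g]
 have "L2_dist M (R h f) f = L2_dist M (%x. h * R h g x) (%x. 0)"
  using R_gen_AE[OF g h] R_L2 fg h const_L2[of 0]
  by (intro L2_dist_cong_AE) (auto simp: L2.mem elim!: eventually_mono)
 also have "\<dots> = h * L2.nrm (R h g)"
  using L2.nrm_scale[OF R_L2[OF fg(2) h], of h] h by (simp add: L2.dist_nrm)
 also have "\<dots> <= h * L2.nrm g" using R_nrm[OF fg(2) h] h by simp
 finally show ?thesis .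
qed

lemma gen_R:
 assumes g: "gen f g" and h: "0 < h"
 shows "gen (R h f) (R h g)"
 unfolding gen_def
proof (intro conjI ballI)
 note fg = gen_L2[OF g]
 show "R h f \<in> D" "R h g \<in> L2_fun M" using R_D[OF fg(1) h] R_L2[OF fg(2) h] by auto
 fix v assume v: "v \<in> D"
 have "L2_inner M (R h f) v = L2_inner M (%x. 1 * f x + h * R h g x) v"
  using R_gen_AE[OF g h] R_L2 fg h v
  by (intro L2_inner_cong_AE L2.lincomb) (auto simp: DL elim!: eventually_mono)
 also have "\<dots> = L2_inner M f v + h * L2_inner M (R h g) v"
  unfolding L2.lin[OF fg(1) R_L2[OF fg(2) h] DL[OF v]] by simp
 finally have "h * E (R h f) v = h * (- L2_inner M (R h g) v)" using R_eq[OF fg(1) h v] by simp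
 then show "E (R h f) v = - L2_inner M (R h g) v" using h by (simp only: mult_left_cancel)
qed

text \<open>\<open>R h\<close> is one implicit Euler step. The difference between one step and two
  half steps solves a resolvent equation whose right-hand side is the second difference
  \<open>f - 2 w + z\<close> of the half steps, which is of order \<open>h^2\<close> when
  \<open>f\<close> lies in the domain of the squared generator.\<close>

lemma R_step_halving:
 assumes g: "gen f g" "gen g k" and h: "0 < h"
 shows "L2_dist M (R h f) (R (h / 2) (R (h / 2) f)) <= h\<^sup>2 / 4 * L2.nrm k"
proof -
 let ?s = "h / 2"
 let ?w = "R ?s f" let ?z = "R ?s ?w"
 have s: "0 < ?s" using h by simp
 note f = gen_L2(1)[OF g(1)] and gL = gen_L2(2)[OF g(1)]
 have w: "?w \<in> D" and wL: "?w \<in> L2_fun M" using R_D[OF f s] by (auto simp: DL)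
 have z: "?z \<in> D" and zL: "?z \<in> L2_fun M" using R_D[OF wL s] by (auto simp: DL)
 have u: "R h f \<in> D" and uL: "R h f \<in> L2_fun M" using R_D[OF f h] by (auto simp: DL)
 let ?d = "%x. (f x - ?w x) - (?w x - ?z x)"
 have d: "?d \<in> L2_fun M" using f wL zL by (intro L2.mem)
 have "L2.nrm (%x. R h f x - ?z x) <= L2.nrm ?d"
 proof (rule nrm_le_if_eq[OF E.mem_diff[OF u z] d h])
  let ?v = "%x. R h f x - ?z x"
  have v: "?v \<in> D" using E.mem_diff[OF u z] .
  \<comment> \<open>The equation of the second half step, doubled, since \<open>h\<close> is twice
    \<open>?s\<close>.\<close>
  have "h * E ?z ?v + L2_inner M ?z ?v = 2 * L2_inner M ?w ?v - L2_inner M ?z ?v"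
   using R_eq[OF wL s v] by simp
  moreover have "E ?v ?v = E (R h f) ?v - E ?z ?v" by (rule E.diffL[OF u z v])
  moreover have "L2_inner M ?v ?v = L2_inner M (R h f) ?v - L2_inner M ?z ?v" by (rule L2.diffL[OF uL zL DL[OF v]])
  moreover have "L2_inner M ?d ?v = (L2_inner M f ?v - L2_inner M ?w ?v) - (L2_inner M ?w ?v - L2_inner M ?z ?v)"
   unfolding L2.diffL[OF L2.mem_diff[OF f wL] L2.mem_diff[OF wL zL] DL[OF v]]
    L2.diffL[OF f wL DL[OF v]] L2.diffL[OF wL zL DL[OF v]] ..
  ultimately show "h * E ?v ?v + L2_inner M ?v ?v = L2_inner M ?d ?v"
   using R_eq[OF f h v] by (simp add: right_diff_distrib)
 qed
 also have "L2.nrm ?d = L2_dist M (%x. f x - ?w x) (%x. ?w x - ?z x)" by (simp add: L2.dist_nrm)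
 also have "\<dots> = L2_dist M (%x. ?s * R ?s (R ?s g) x) (%x. ?s * R ?s g x)"
 proof (intro L2_dist_cong_AE)
  show "AE x in M. f x - ?w x - (?w x - ?z x) = ?s * R ?s (R ?s g) x - ?s * R ?s g x"
   using R_gen_AE[OF g(1) s] R_gen_AE[OF gen_R[OF g(1) s] s] by eventually_elim simp
 qed (intro L2.mem f wL zL R_L2 gL s)+
 also have "\<dots> = ?s * L2_dist M (R ?s (R ?s g)) (R ?s g)"
  using L2.nrm_scale[OF L2.mem_diff[OF R_L2[OF R_L2[OF gL s] s] R_L2[OF gL s]], of ?s] s
  unfolding L2.dist_nrm right_diff_distrib[symmetric] by (simp only: abs_of_pos)
 also have "\<dots> <= ?s * (?s * L2.nrm k)"
  using order_trans[OF R_nonexp[OF R_L2[OF gL s] gL s] R_gen_dist[OF g(2) s]] h by (intro mult_left_mono) auto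
 also have "\<dots> = h\<^sup>2 / 4 * L2.nrm k" by (simp add: power2_eq_square)
 finally show ?thesis by (simp add: L2.dist_nrm)
qed

lemma Rk_L2: "f \<in> L2_fun M ==> 0 < h ==> (R h ^^ k) f \<in> L2_fun M"
 by (induction k) (auto simp: R_L2)

lemma Rk_nonexp:
 assumes f: "f \<in> L2_fun M" and g: "g \<in> L2_fun M" and h: "0 < h"
 shows "L2_dist M ((R h ^^ k) f) ((R h ^^ k) g) <= L2_dist M f g"
proof (induction k)
 case (Suc k)
 then show ?case using R_nonexp[OF Rk_L2[OF f h, of k] Rk_L2[OF g h, of k] h] by simp
qed simp

lemma Rk_nrm:
 assumes f: "f \<in> L2_fun M" and h: "0 < h"
 shows "L2.nrm ((R h ^^ k) f) <= L2.nrm f"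
proof (induction k)
 case (Suc k)
 then show ?case using R_nrm[OF Rk_L2[OF f h, of k] h] by simp
qed simp

lemma Rk_gen: "gen f g ==> 0 < h ==> gen ((R h ^^ k) f) ((R h ^^ k) g)"
 by (induction k) (auto simp: gen_R)

lemma Rk_lincomb:
 assumes f: "f \<in> L2_fun M" and g: "g \<in> L2_fun M" and h: "0 < h"
 shows "L2_dist M (%x. a * (R h ^^ k) f x + b * (R h ^^ k) g x) ((R h ^^ k) (%x. a * f x + b * g x)) = 0"
proof (induction k)
 case 0
 then show ?case using L2.dist_self[OF L2.lincomb[OF f g]] by simp
next
 case (Suc k)
 let ?f = "(R h ^^ k) f" and ?g = "(R h ^^ k) g" and ?l = "(R h ^^ k) (%x. a * f x + b * g x)"
 have L: "?f \<in> L2_fun M" "?g \<in> L2_fun M" "?l \<in> L2_fun M"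
  using Rk_L2[OF _ h] f g L2.lincomb[OF f g] by auto
 have 1: "L2_dist M (%x. a * R h ?f x + b * R h ?g x) (R h (%x. a * ?f x + b * ?g x)) = 0"
  using R_lincomb[OF L(1,2) h] .
 have 2: "L2_dist M (R h (%x. a * ?f x + b * ?g x)) (R h ?l) <= 0"
  using R_nonexp[OF L2.lincomb[OF L(1,2)] L(3) h, of a b] Suc by simp
 have "L2_dist M (%x. a * R h ?f x + b * R h ?g x) (R h ?l) <= 0"
  using 1 2 L2.dist_triangle[OF L2.lincomb[OF R_L2[OF L(1) h] R_L2[OF L(2) h]] R_L2[OF L2.lincomb[OF L(1,2)] h] R_L2[OF L(3) h], of a b a b] by simp
 then show ?case using L2.dist_nonneg[OF L2.lincomb[OF R_L2[OF L(1) h] R_L2[OF L(2) h]] R_L2[OF L(3) h], of a b] by simp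
qed

lemma Rk_gen_dist:
 assumes g: "gen f g" and h: "0 < h"
 shows "L2_dist M ((R h ^^ k) f) f <= real k * h * L2.nrm g"
proof (induction k)
 case 0 then show ?case using L2.dist_self[OF gen_L2(1)[OF g]] by simp
next
 case (Suc k)
 note f = gen_L2(1)[OF g]
 have "L2_dist M ((R h ^^ Suc k) f) f <= L2_dist M (R h ((R h ^^ k) f)) (R h f) + L2_dist M (R h f) f"
  using L2.dist_triangle[OF R_L2[OF Rk_L2[OF f h] h] R_L2[OF f h] f] by simp
 also have "\<dots> <= L2_dist M ((R h ^^ k) f) f + h * L2.nrm g"
  by (intro add_mono R_nonexp Rk_L2 f h R_gen_dist g)
 finally show ?case using Suc by (simp add: algebra_simps)
qed

text \<open>The one-step errors merely add up: later steps are contractions, and the resolvent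
  commutes with the generator, so the bound on the second generator image survives
  iteration.\<close>

lemma Rk_halving:
 assumes g: "gen f g" "gen g k" and h: "0 < h"
 shows "L2_dist M ((R h ^^ n) f) ((R (h / 2) ^^ (2 * n)) f) <= real n * (h\<^sup>2 / 4 * L2.nrm k)"
proof (induction n)
 case 0 then show ?case using L2.dist_self[OF gen_L2(1)[OF g(1)]] by simp
next
 case (Suc n)
 let ?s = "h / 2"
 have s: "0 < ?s" using h by simp
 let ?a = "(R h ^^ n) f" and ?b = "(R ?s ^^ (2 * n)) f"
 note f = gen_L2(1)[OF g(1)]
 note a = Rk_L2[OF f h, of n] and b = Rk_L2[OF f s, of "2 * n"]
 note kL = gen_L2(2)[OF g(2)]
 have "L2_dist M (R h ?a) (R ?s (R ?s ?b)) <= L2_dist M (R h ?a) (R ?s (R ?s ?a)) + L2_dist M (R ?s (R ?s ?a)) (R ?s (R ?s ?b))"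
  by (intro L2.dist_triangle R_L2 a b h s)
 also have "\<dots> <= h\<^sup>2 / 4 * L2.nrm k + L2_dist M ?a ?b"
 proof (rule add_mono)
  have "L2_dist M (R h ?a) (R ?s (R ?s ?a)) <= h\<^sup>2 / 4 * L2.nrm ((R h ^^ n) k)"
   by (rule R_step_halving[OF Rk_gen[OF g(1) h] Rk_gen[OF g(2) h] h])
  also have "\<dots> <= h\<^sup>2 / 4 * L2.nrm k" by (intro mult_left_mono Rk_nrm kL h) auto
  finally show "L2_dist M (R h ?a) (R ?s (R ?s ?a)) <= h\<^sup>2 / 4 * L2.nrm k" .
  show "L2_dist M (R ?s (R ?s ?a)) (R ?s (R ?s ?b)) <= L2_dist M ?a ?b"
   using R_nonexp[OF R_L2[OF a s] R_L2[OF b s] s] R_nonexp[OF a b s] by linarith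
 qed
 finally show ?case using Suc by (simp add: algebra_simps)
qed

text \<open>Taylor expansion of \<open>n\<close> Euler steps around time 0. The sum of the first
  \<open>n\<close> integers is bounded crudely by \<open>n^2\<close>, because the result is meant
  for differentiation, where any quadratic error will do.\<close>

lemma Rk_gen_second_order:
 assumes g: "gen f g" "gen g k" and h: "0 < h"
 shows "L2_dist M ((R h ^^ n) f) (%x. 1 * f x + (real n * h) * g x) <= (real n * h)\<^sup>2 * L2.nrm k"
proof -
 note f = gen_L2(1)[OF g(1)] and gL = gen_L2(2)[OF g(1)] and kL = gen_L2(2)[OF g(2)]
 have "L2_dist M ((R h ^^ n) f) (%x. 1 * f x + (real n * h) * g x) <= (\<Sum>j<n. real (Suc j)) * h\<^sup>2 * L2.nrm k"
 proof (induction n)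
  case 0 then show ?case using L2.dist_self[OF f] by simp
 next
  case (Suc n)
  let ?a = "(R h ^^ n) f" and ?g = "(R h ^^ n) g" and ?c = "%x. 1 * f x + (real n * h) * g x"
  have c: "?c \<in> L2_fun M" using L2.lincomb[OF f gL] .
  note a = Rk_L2[OF f h, of n] and gn = Rk_L2[OF gL h, of n]
  have "L2_dist M (R h ?a) (%x. 1 * f x + (real (Suc n) * h) * g x)
    = L2_dist M (%x. 1 * ?a x + h * R h ?g x) (%x. 1 * ?c x + h * g x)"
   using R_gen_AE[OF Rk_gen[OF g(1) h] h, of n] R_L2[OF a h] R_L2[OF gn h] a c gL f
   by (intro L2_dist_cong_AE L2.lincomb) (auto elim!: eventually_mono simp: algebra_simps)
  also have "\<dots> <= \<bar>1\<bar> * L2_dist M ?a ?c + \<bar>h\<bar> * L2_dist M (R h ?g) g"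
   by (intro L2.dist_lincomb a c R_L2 gn gL h)
  also have "\<dots> <= (\<Sum>j<n. real (Suc j)) * h\<^sup>2 * L2.nrm k + h * (real (Suc n) * h * L2.nrm k)"
  proof (rule add_mono)
   show "\<bar>1\<bar> * L2_dist M ?a ?c <= (\<Sum>j<n. real (Suc j)) * h\<^sup>2 * L2.nrm k" using Suc by simp
   have "L2_dist M (R h ?g) g <= real (Suc n) * h * L2.nrm k" using Rk_gen_dist[OF g(2) h, of "Suc n"] by simp
   then show "\<bar>h\<bar> * L2_dist M (R h ?g) g <= h * (real (Suc n) * h * L2.nrm k)"
    using h by (simp add: mult_left_mono)
  qed
  finally show ?case by (simp add: algebra_simps power2_eq_square)
 qed
 also have "\<dots> <= (real n * h)\<^sup>2 * L2.nrm k"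
 proof (intro mult_right_mono L2.nrm_nonneg kL)
  have "(\<Sum>j<n. real (Suc j)) <= (\<Sum>j<n. real n)" by (intro sum_mono) auto
  then show "(\<Sum>j<n. real (Suc j)) * h\<^sup>2 <= (real n * h)\<^sup>2"
   using mult_right_mono[of "\<Sum>j<n. real (Suc j)" "real n * real n" "h\<^sup>2"] by (simp add: power2_eq_square mult_ac)
 qed
 finally show ?thesis .
qed

text \<open>Testing the resolvent equation with \<open>R h f - f\<close> gives the squared distance
  as \<open>- h E (R h f) (R h f - f)\<close>, and nonnegativity of the energy of the difference
  bounds this by \<open>h E f f\<close>.\<close>

lemma R_dist_energy:
 assumes f: "f \<in> D" and h: "0 < h"
 shows "(L2_dist M (R h f) f)\<^sup>2 <= h * E f f"
proof -
 have r: "R h f \<in> D" using R_D[OF DL[OF f] h] .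
 let ?w = "%x. R h f x - f x"
 have w: "?w \<in> D" using E.mem_diff[OF r f] .
 have "(L2_dist M (R h f) f)\<^sup>2 = L2_inner M ?w ?w" using L2.nrm_sq[OF DL[OF w]] by (simp add: L2.dist_nrm)
 also have "\<dots> = - (h * E (R h f) ?w)"
  using R_eq[OF DL[OF f] h w] L2.diffL[OF DL[OF r] DL[OF f] DL[OF w]] by simp
 also have "- E (R h f) ?w <= E f f"
 proof -
  have 1: "E (%x. R h f x - f x) (%x. R h f x - f x) = E (R h f) (R h f) - 2 * E (R h f) f + E f f"
   by (rule E.square_diff[OF r f])
  have 2: "E (R h f) ?w = E (R h f) (R h f) - E (R h f) f" by (rule E.diffR[OF r f r])
  show ?thesis using 1 2 E.nonneg[OF w] E.nonneg[OF r] E.nonneg[OF f]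
   by linarith
 qed
 then have "h * (- E (R h f) ?w) <= h * E f f" using h by (intro mult_left_mono) auto
 then have "- (h * E (R h f) ?w) <= h * E f f" by simp
 finally show ?thesis .
qed

lemma R_strongly_continuous:
 assumes f: "f \<in> L2_fun M" shows "((%h. L2_dist M (R h f) f) \<longlongrightarrow> 0) (at_right 0)"
proof (rule tendstoI)
 fix e :: real assume e: "0 < e"
 obtain u where u: "u \<in> D" "L2_dist M f u < e / 3" using D_dense[OF f, of "e/3"] e by auto
 note uL = DL[OF u(1)]
 define d where "d = (e / 3)\<^sup>2 / (E u u + 1)"
 have p: "0 < E u u + 1" using E.nonneg[OF u(1)] by simp
 have d: "0 < d" using e p by (simp add: d_def)
 show "\<forall>\<^sub>F h in at_right 0. dist (L2_dist M (R h f) f) 0 < e"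
  unfolding eventually_at_right_field
 proof (intro exI[of _ d] conjI d allI impI)
  fix h :: real assume h: "0 < h" "h < d"
  have "(L2_dist M (R h u) u)\<^sup>2 <= h * E u u" by (rule R_dist_energy[OF u(1) h(1)])
  also have "\<dots> <= d * (E u u + 1)" using h E.nonneg[OF u(1)] by (intro mult_mono) auto
  also have "\<dots> = (e / 3)\<^sup>2" using p by (simp add: d_def)
  finally have 1: "L2_dist M (R h u) u <= e / 3" by (rule power2_le_imp_le) (use e in simp)
  have "L2_dist M (R h f) f <= L2_dist M (R h f) (R h u) + L2_dist M (R h u) f"
   by (intro L2.dist_triangle R_L2 f uL h)
  also have "L2_dist M (R h u) f <= L2_dist M (R h u) u + L2_dist M u f"
   by (intro L2.dist_triangle R_L2 f uL h)
  finally show "dist (L2_dist M (R h f) f) 0 < e"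
   using 1 u(2) R_nonexp[OF f uL h(1)] L2.dist_commute[OF uL f] L2.dist_nonneg[OF R_L2[OF f h(1)] f] by simp
 qed
qed

text \<open>Two resolvent steps with small \<open>h\<close> move \<open>f\<close> little, by strong
  continuity, and land in the domain of the squared generator; \<open>g\<close> and \<open>k\<close>
  are its first two images.\<close>

lemma gen2_dense:
 assumes f: "f \<in> L2_fun M" and e: "0 < e"
 obtains u g k where "gen u g" "gen g k" "L2_dist M f u < e"
proof -
 have "\<forall>\<^sub>F h in at_right 0. 0 < h \<and> L2_dist M (R h f) f < e / 2"
  using order_tendstoD(2)[OF R_strongly_continuous[OF f], of "e/2"] e
  by (auto simp: eventually_conj_iff eventually_at_right_less)
 then obtain h where h: "0 < h" "L2_dist M (R h f) f < e / 2"
  using eventually_happens trivial_limit_at_right_real by blast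
 let ?u = "R h (R h f)" and ?g1 = "%x. (1 / h) * R h f x + (- 1 / h) * f x"
 have g1: "gen (R h f) ?g1" by (rule gen_R_self[OF f h(1)])
 have g2: "gen ?u (R h ?g1)" by (rule gen_R[OF g1 h(1)])
 have g3: "gen (R h ?g1) (%x. (1 / h) * R h ?g1 x + (- 1 / h) * ?g1 x)"
  by (rule gen_R_self[OF gen_L2(2)[OF g1] h(1)])
 have L: "R h f \<in> L2_fun M" using R_L2[OF f h(1)] .
 have "L2_dist M f ?u <= L2_dist M f (R h f) + L2_dist M (R h f) ?u"
  by (intro L2.dist_triangle R_L2 f L h)
 also have "\<dots> < e"
  using h(2) R_nonexp[OF L f h(1)] L2.dist_commute[OF f L] L2.dist_commute[OF L R_L2[OF L h(1)]] by linarith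
 finally show thesis using that g2 g3 by blast
qed

end

section \<open>The semigroup as a limit of dyadic Euler steps\<close>

lemma (in semi_ip) geometric_Cauchy:
 assumes f: "!!n. f n \<in> H" and d: "!!n. form_dist B (f n) (f (Suc n)) <= C * (1/2) ^ n"
 shows "Cauchy_wrt B f"
proof -
 have C: "0 <= C" using order_trans[OF dist_nonneg[OF f f] d[of 0]] by simp
 have j: "form_dist B (f n) (f (n + j)) <= 2 * C * ((1/2) ^ n - (1/2) ^ (n + j))" for n j
 proof (induction j)
  case 0 then show ?case using dist_self[OF f] by simp
 next
  case (Suc j)
  have "form_dist B (f n) (f (n + Suc j)) <= form_dist B (f n) (f (n + j)) + form_dist B (f (n + j)) (f (Suc (n + j)))"
   using dist_triangle[OF f f f] by simp
  also have "\<dots> <= 2 * C * ((1/2) ^ n - (1/2) ^ (n + j)) + C * (1/2) ^ (n + j)"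
   using Suc d[of "n + j"] by simp
  finally show ?case by (simp add: algebra_simps)
 qed
 show ?thesis unfolding Cauchy_wrt_def
 proof (intro allI impI)
  fix e :: real assume e: "0 < e"
  obtain N where N: "(1/2::real) ^ N < e / (2 * C + 1)"
   using real_arch_pow_inv[of "e / (2 * C + 1)" "1/2"] e C by auto
  have o: "form_dist B (f m) (f n) < e" if "N <= m" "m <= n" for m n
  proof -
   have "form_dist B (f m) (f n) <= 2 * C * ((1/2) ^ m - (1/2) ^ n)" using j[of m "n - m"] that by simp
   also have "\<dots> <= 2 * C * (1/2) ^ N"
    using that C power_decreasing[of N m "1/2::real"] by (intro mult_left_mono) (auto intro: order_trans[of _ "(1/2) ^ m"])
   also have "\<dots> <= (2 * C + 1) * (1/2) ^ N" by (simp add: distrib_right)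
   also have "\<dots> < e" using N C by (simp add: field_simps)
   finally show ?thesis .
  qed
  show "EX N. \<forall>m\<ge>N. \<forall>n\<ge>N. form_dist B (f m) (f n) < e"
  proof (intro exI[of _ N] allI impI)
   fix m n assume "N <= m" "N <= n"
   then show "form_dist B (f m) (f n) < e"
    using o[of m n] o[of n m] dist_commute[OF f[of m] f[of n]] by (cases "m <= n") auto
  qed
 qed
qed

text \<open>Whole steps of length \<open>2^-n\<close> that fit into \<open>[0, t]\<close>. As
  \<open>t\<close> need not be dyadic, halving the step or adding two times is exact only up to one
  extra step.\<close>

definition steps :: "real => nat => nat" where "steps t n = nat \<lfloor>t * 2 ^ n\<rfloor>"

lemma steps_bounds:
 assumes "0 <= t" shows "real (steps t n) * (1/2) ^ n <= t" "t < (real (steps t n) + 1) * (1/2) ^ n"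
proof -
 have "real (steps t n) = of_int \<lfloor>t * 2 ^ n\<rfloor>" using assms by (simp add: steps_def)
 then have "real (steps t n) <= t * 2 ^ n" "t * 2 ^ n < real (steps t n) + 1" by linarith+
 then show "real (steps t n) * (1/2) ^ n <= t" "t < (real (steps t n) + 1) * (1/2) ^ n"
  by (simp_all add: power_one_over field_simps)
qed

lemma steps_Suc: "0 <= t ==> steps t (Suc n) = 2 * steps t n \<or> steps t (Suc n) = Suc (2 * steps t n)"
proof -
 assume t: "0 <= t"
 have "\<lfloor>2 * (t * 2 ^ n)\<rfloor> = 2 * \<lfloor>t * 2 ^ n\<rfloor> \<or> \<lfloor>2 * (t * 2 ^ n)\<rfloor> = 2 * \<lfloor>t * 2 ^ n\<rfloor> + 1" by linarith
 moreover have "0 <= \<lfloor>t * 2 ^ n\<rfloor>" using t by simp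
 ultimately show ?thesis unfolding steps_def by (simp add: mult_ac) linarith
qed

lemma steps_add: "0 <= s ==> 0 <= t ==>
  steps (s + t) n = steps s n + steps t n \<or> steps (s + t) n = Suc (steps s n + steps t n)"
proof -
 assume s: "0 <= s" and t: "0 <= t"
 have "\<lfloor>s * 2 ^ n + t * 2 ^ n\<rfloor> = \<lfloor>s * 2 ^ n\<rfloor> + \<lfloor>t * 2 ^ n\<rfloor> \<or> \<lfloor>s * 2 ^ n + t * 2 ^ n\<rfloor> = \<lfloor>s * 2 ^ n\<rfloor> + \<lfloor>t * 2 ^ n\<rfloor> + 1"
  by linarith
 moreover have "0 <= \<lfloor>s * 2 ^ n\<rfloor>" "0 <= \<lfloor>t * 2 ^ n\<rfloor>" using s t by simp_all
 ultimately show ?thesis unfolding steps_def by (simp add: distrib_right) linarith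
qed

lemma half_power_tendsto: "(%n. c * (1/2::real) ^ n) \<longlonglongrightarrow> 0"
 using tendsto_mult_left[OF LIMSEQ_realpow_zero[of "1/2::real"], of c] by simp

lemma steps_tendsto: assumes t: "0 <= t" shows "(%n. real (steps t n) * (1/2) ^ n) \<longlonglongrightarrow> t"
proof (rule tendsto_sandwich[of "%n. t - 1 * (1/2) ^ n" _ _ "%_. t"])
 show "(%n. t - 1 * (1/2) ^ n) \<longlonglongrightarrow> t" using tendsto_diff[OF tendsto_const[of t] half_power_tendsto[of 1]] by simp
 show "\<forall>\<^sub>F n in sequentially. t - 1 * (1/2) ^ n <= real (steps t n) * (1/2) ^ n"
  using steps_bounds(2)[OF t] by (intro always_eventually allI) (simp add: less_imp_le algebra_simps)
qed (use steps_bounds[OF t] in auto)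

context dirichlet_form
begin

text \<open>The implicit Euler scheme with step \<open>2^-n\<close>, run up to about time
  \<open>t\<close>.\<close>

definition A :: "nat => real => ('a => real) => 'a => real" where
 "A n t f = (R ((1/2) ^ n) ^^ steps t n) f"

lemma hn: "0 < (1/2::real) ^ n" by simp

lemma A_L2: "f \<in> L2_fun M ==> A n t f \<in> L2_fun M"
 unfolding A_def by (intro Rk_L2) auto

text \<open>Halving costs order \<open>4^-n\<close> for each of at most \<open>t 2^n\<close> steps,
  and a possible extra step costs order \<open>2^-n\<close>. The geometric bound makes the
  refinements a Cauchy sequence.\<close>

lemma A_step:
 assumes g: "gen f g" "gen g k" and t: "0 <= t"
 shows "L2_dist M (A n t f) (A (Suc n) t f) <= (t * L2.nrm k + L2.nrm g) * (1/2) ^ n"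
proof -
 let ?h = "(1/2::real) ^ n" and ?K = "steps t n"
 note f = gen_L2(1)[OF g(1)] and gL = gen_L2(2)[OF g(1)] and kL = gen_L2(2)[OF g(2)]
 have s: "(1/2) ^ Suc n = ?h / 2" by simp
 have hp: "0 < ?h / 2" by simp
 let ?b = "(R (?h / 2) ^^ (2 * ?K)) f"
 have b: "?b \<in> L2_fun M" using Rk_L2[OF f hp] .
 have 1: "L2_dist M (A n t f) ?b <= t * L2.nrm k * ?h"
 proof -
  have "L2_dist M (A n t f) ?b <= real ?K * (?h\<^sup>2 / 4 * L2.nrm k)"
   unfolding A_def by (rule Rk_halving[OF g hn])
  also have "\<dots> = (real ?K * ?h) * (?h / 4 * L2.nrm k)" by (simp add: power2_eq_square)
  also have "\<dots> <= t * (?h / 4 * L2.nrm k)"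
   using steps_bounds(1)[OF t] L2.nrm_nonneg[OF kL] by (intro mult_right_mono) auto
  also have "\<dots> <= t * (?h * L2.nrm k)"
   using t L2.nrm_nonneg[OF kL] by (intro mult_left_mono mult_right_mono) auto
  finally show ?thesis by (simp add: mult_ac)
 qed
 have 2: "L2_dist M ?b (A (Suc n) t f) <= L2.nrm g * ?h"
 proof (cases "steps t (Suc n) = 2 * ?K")
  case True
  then show ?thesis unfolding A_def s using L2.dist_self[OF b] L2.nrm_nonneg[OF gL] by simp
 next
  case False
  then have e: "A (Suc n) t f = R (?h / 2) ?b" unfolding A_def s using steps_Suc[OF t, of n] by simp
  have "L2_dist M (R (?h / 2) ?b) ?b <= ?h / 2 * L2.nrm ((R (?h / 2) ^^ (2 * ?K)) g)"
   by (rule R_gen_dist[OF Rk_gen[OF g(1) hp] hp])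
  also have "\<dots> <= ?h / 2 * L2.nrm g" by (intro mult_left_mono Rk_nrm gL hp) auto
  also have "\<dots> <= ?h * L2.nrm g" using L2.nrm_nonneg[OF gL] by (intro mult_right_mono) auto
  finally show ?thesis unfolding e using L2.dist_commute[OF b R_L2[OF b hp]] by (simp add: mult.commute)
 qed
 show ?thesis using L2.dist_triangle[OF A_L2[OF f] b A_L2[OF f], of n t "Suc n" t] 1 2
  by (simp add: distrib_right)
qed

lemma A_nonexp: "f \<in> L2_fun M ==> g \<in> L2_fun M ==> L2_dist M (A n t f) (A n t g) <= L2_dist M f g"
 unfolding A_def by (intro Rk_nonexp) auto

lemma A_Cauchy:
 assumes f: "f \<in> L2_fun M" and t: "0 <= t"
 shows "Cauchy_wrt (L2_inner M) (%n. A n t f)"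
 unfolding Cauchy_wrt_def L2_dist_form[symmetric]
proof (intro allI impI)
 fix e :: real assume e: "0 < e"
 obtain u g k where u: "gen u g" "gen g k" "L2_dist M f u < e / 3"
  using gen2_dense[OF f, of "e/3"] e by auto
 note uL = gen_L2(1)[OF u(1)]
 have "Cauchy_wrt (L2_inner M) (%n. A n t u)"
  by (rule L2.geometric_Cauchy[OF A_L2[OF uL] A_step[OF u(1,2) t]])
 then obtain N where N: "!!m n. m >= N ==> n >= N ==> L2_dist M (A m t u) (A n t u) < e / 3"
  using e unfolding Cauchy_wrt_def L2_dist_form[symmetric] by (meson divide_pos_pos zero_less_numeral)
 have "L2_dist M (A m t f) (A n t f) < e" if "m >= N" "n >= N" for m n
 proof -
  have "L2_dist M (A m t f) (A n t f) <= L2_dist M (A m t f) (A m t u) + (L2_dist M (A m t u) (A n t u) + L2_dist M (A n t u) (A n t f))"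
   by (intro order_trans[OF L2.dist_triangle add_left_mono[OF L2.dist_triangle]] A_L2 f uL)
  then show ?thesis using N[OF that] A_nonexp[OF f uL, of m t] A_nonexp[OF uL f, of n t] L2.dist_commute[OF f uL] u(3)
   by linarith
 qed
 then show "EX N. \<forall>m\<ge>N. \<forall>n\<ge>N. L2_dist M (A m t f) (A n t f) < e" by blast
qed

definition T :: "real => ('a => real) => 'a => real" where
 "T t f = (SOME u. u \<in> L2_fun M \<and> (%n. L2_dist M (A n t f) u) \<longlonglongrightarrow> 0)"

lemma T_props:
 assumes f: "f \<in> L2_fun M" and t: "0 <= t"
 shows T_L2: "T t f \<in> L2_fun M" and T_lim: "(%n. L2_dist M (A n t f) (T t f)) \<longlonglongrightarrow> 0"
proof -
 have "EX u. u \<in> L2_fun M \<and> (%n. L2_dist M (A n t f) u) \<longlonglongrightarrow> 0"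
  using L2_complete[OF A_L2[OF f] A_Cauchy[OF f t]] by blast
 then have "T t f \<in> L2_fun M \<and> (%n. L2_dist M (A n t f) (T t f)) \<longlonglongrightarrow> 0"
  unfolding T_def by (rule someI_ex)
 then show "T t f \<in> L2_fun M" "(%n. L2_dist M (A n t f) (T t f)) \<longlonglongrightarrow> 0" by auto
qed

lemma T_nonexp:
 assumes f: "f \<in> L2_fun M" and g: "g \<in> L2_fun M" and t: "0 <= t"
 shows "L2_dist M (T t f) (T t g) <= L2_dist M f g"
 by (rule L2.dist_le_Lim[OF A_L2[OF f] A_L2[OF g] T_L2[OF f t] T_L2[OF g t] T_lim[OF f t] T_lim[OF g t]
    A_nonexp[OF f g] tendsto_const])

lemma T_nrm:
 assumes f: "f \<in> L2_fun M" and t: "0 <= t"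
 shows "L2.nrm (T t f) <= L2.nrm f"
proof (rule LIMSEQ_le_const2[OF L2.tendsto_nrm[OF A_L2[OF f] T_L2[OF f t] T_lim[OF f t]]])
 show "EX N. \<forall>n\<ge>N. L2.nrm (A n t f) <= L2.nrm f"
  unfolding A_def using Rk_nrm[OF f hn] by blast
qed

lemma T_lincomb:
 assumes f: "f \<in> L2_fun M" and g: "g \<in> L2_fun M" and t: "0 <= t"
 shows "L2_dist M (%x. a * T t f x + b * T t g x) (T t (%x. a * f x + b * g x)) = 0"
proof -
 note fg = L2.lincomb[OF f g, of a b]
 have "L2_dist M (%x. a * T t f x + b * T t g x) (T t (%x. a * f x + b * g x)) <= 0"
 proof (rule L2.dist_le_Lim)
  show "(%n. L2_dist M (%x. a * A n t f x + b * A n t g x) (%x. a * T t f x + b * T t g x)) \<longlonglongrightarrow> 0"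
   by (intro L2.tendsto_lincomb A_L2 T_L2 T_lim f g t)
  show "L2_dist M (%x. a * A n t f x + b * A n t g x) (A n t (%x. a * f x + b * g x)) <= 0" for n
   unfolding A_def using Rk_lincomb[OF f g hn] by simp
  show "(%n. L2_dist M (A n t (%x. a * f x + b * g x)) (T t (%x. a * f x + b * g x))) \<longlonglongrightarrow> 0"
   by (rule T_lim[OF fg t])
 qed (auto intro!: L2.lincomb A_L2 T_L2 f g t fg)
 then show ?thesis using L2.dist_nonneg[OF L2.lincomb[OF T_L2[OF f t] T_L2[OF g t]] T_L2[OF fg t], of a b] by simp
qed

lemma T_gen_dist:
 assumes g: "gen f g" and t: "0 <= t"
 shows "L2_dist M (T t f) f <= t * L2.nrm g"
proof -
 note f = gen_L2(1)[OF g] and gL = gen_L2(2)[OF g]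
 have "L2_dist M (A n t f) f <= t * L2.nrm g" for n
  using Rk_gen_dist[OF g hn, of "steps t n" n] mult_right_mono[OF steps_bounds(1)[OF t, of n] L2.nrm_nonneg[OF gL]]
  unfolding A_def by linarith
 moreover have "(%n. L2_dist M f f) \<longlonglongrightarrow> 0" using L2.dist_self[OF f] by simp
 ultimately show ?thesis
  using L2.dist_le_Lim[OF A_L2[OF f] f T_L2[OF f t] f T_lim[OF f t], of "%_. t * L2.nrm g"] by simp
qed

lemma T_second_order:
 assumes g: "gen f g" "gen g k" and t: "0 <= t"
 shows "L2_dist M (T t f) (%x. 1 * f x + t * g x) <= t\<^sup>2 * L2.nrm k"
proof -
 note f = gen_L2(1)[OF g(1)] and gL = gen_L2(2)[OF g(1)] and kL = gen_L2(2)[OF g(2)]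
 show ?thesis
 proof (rule L2.dist_le_Lim[OF A_L2[OF f] L2.lincomb[OF f gL] T_L2[OF f t] L2.lincomb[OF f gL] T_lim[OF f t]])
 show "L2_dist M (A n t f) (%x. 1 * f x + (real (steps t n) * (1/2) ^ n) * g x) <= t\<^sup>2 * L2.nrm k" for n
 proof -
  have "(real (steps t n) * (1/2) ^ n)\<^sup>2 <= t\<^sup>2" using steps_bounds(1)[OF t, of n] by (intro power_mono) auto
  then have "(real (steps t n) * (1/2) ^ n)\<^sup>2 * L2.nrm k <= t\<^sup>2 * L2.nrm k" by (rule mult_right_mono[OF _ L2.nrm_nonneg[OF kL]])
  then show ?thesis using Rk_gen_second_order[OF g hn, of "steps t n" n] unfolding A_def by linarith
 qed
 show "(%n. L2_dist M (%x. 1 * f x + (real (steps t n) * (1/2) ^ n) * g x) (%x. 1 * f x + t * g x)) \<longlonglongrightarrow> 0"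
 proof -
  have "L2_dist M (%x. 1 * f x + s * g x) (%x. 1 * f x + t * g x) = \<bar>s - t\<bar> * L2.nrm g" for s
  proof -
   have "(%x. 1 * f x + s * g x - (1 * f x + t * g x)) = (%x. (s - t) * g x)" by (auto simp: algebra_simps)
   then show ?thesis using L2.nrm_scale[OF gL, of "s - t"] by (simp add: L2.dist_nrm)
  qed
  moreover have "(%n. \<bar>real (steps t n) * (1/2) ^ n - t\<bar> * L2.nrm g) \<longlonglongrightarrow> \<bar>t - t\<bar> * L2.nrm g"
   by (intro tendsto_intros steps_tendsto t)
  ultimately show ?thesis by simp
 qed
 show "(%n. t\<^sup>2 * L2.nrm k) \<longlonglongrightarrow> t\<^sup>2 * L2.nrm k" by simp
 qed
qed

lemma T_continuous_0:
 assumes f: "f \<in> L2_fun M" shows "((%t. L2_dist M (T t f) f) \<longlongrightarrow> 0) (at_right 0)"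
proof (rule tendstoI)
 fix e :: real assume e: "0 < e"
 obtain u g k where u: "gen u g" "gen g k" "L2_dist M f u < e / 3"
  using gen2_dense[OF f, of "e/3"] e by auto
 note uL = gen_L2(1)[OF u(1)] and gL = gen_L2(2)[OF u(1)]
 define d where "d = (e / 3) / (L2.nrm g + 1)"
 have p: "0 < L2.nrm g + 1" using L2.nrm_nonneg[OF gL] by simp
 have d: "0 < d" using e p by (simp add: d_def)
 show "\<forall>\<^sub>F t in at_right 0. dist (L2_dist M (T t f) f) 0 < e"
  unfolding eventually_at_right_field
 proof (intro exI[of _ d] conjI d allI impI)
  fix t :: real assume t: "0 < t" "t < d"
  have t0: "0 <= t" using t by simp
  have "L2_dist M (T t u) u <= t * L2.nrm g" by (rule T_gen_dist[OF u(1) t0])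
  also have "\<dots> <= d * (L2.nrm g + 1)" using t L2.nrm_nonneg[OF gL] by (intro mult_mono) auto
  also have "\<dots> = e / 3" by (metis d_def less_irrefl nonzero_eq_divide_eq p)
  finally have 1: "L2_dist M (T t u) u <= e / 3" .
  have "L2_dist M (T t f) f <= L2_dist M (T t f) (T t u) + L2_dist M (T t u) f"
   by (intro L2.dist_triangle T_L2 f uL t0)
  also have "L2_dist M (T t u) f <= L2_dist M (T t u) u + L2_dist M u f"
   by (intro L2.dist_triangle T_L2 f uL t0)
  finally show "dist (L2_dist M (T t f) f) 0 < e"
   using 1 u(3) T_nonexp[OF f uL t0] L2.dist_commute[OF uL f] L2.dist_nonneg[OF T_L2[OF f t0] f] by simp
 qed
qed

text \<open>At level \<open>n\<close> the two sides differ by at most one step, an error that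
  vanishes on the domain of the generator; contractivity and density do the rest.\<close>

lemma T_semigroup_dist:
 assumes f: "f \<in> L2_fun M" and s: "0 <= s" and t: "0 <= t"
 shows "L2_dist M (T (s + t) f) (T s (T t f)) = 0"
proof -
 have st: "0 <= s + t" using s t by simp
 have dom: "L2_dist M (T (s + t) u) (T s (T t u)) = 0" if g: "gen u g" for u g
 proof -
  note u = gen_L2(1)[OF g] and gL = gen_L2(2)[OF g]
  note Tu = T_L2[OF u t]
  have "L2_dist M (T (s + t) u) (T s (T t u)) <= 0"
  proof (rule L2.dist_le_Lim[OF A_L2[OF u] A_L2[OF A_L2[OF u]] T_L2[OF u st] T_L2[OF Tu s] T_lim[OF u st]])
   show "(%n. L2_dist M (A n s (A n t u)) (T s (T t u))) \<longlonglongrightarrow> 0"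
   proof (rule Lim_null_comparison)
    show "(%n. L2_dist M (A n t u) (T t u) + L2_dist M (A n s (T t u)) (T s (T t u))) \<longlonglongrightarrow> 0"
     using tendsto_add[OF T_lim[OF u t] T_lim[OF Tu s]] by simp
    show "\<forall>\<^sub>F n in sequentially. norm (L2_dist M (A n s (A n t u)) (T s (T t u)))
      <= L2_dist M (A n t u) (T t u) + L2_dist M (A n s (T t u)) (T s (T t u))"
    proof (rule always_eventually, rule allI)
     fix n
     show "norm (L2_dist M (A n s (A n t u)) (T s (T t u))) <= L2_dist M (A n t u) (T t u) + L2_dist M (A n s (T t u)) (T s (T t u))"
      using L2.dist_triangle[OF A_L2[OF A_L2[OF u]] A_L2[OF Tu] T_L2[OF Tu s], of n s n t n s]
       A_nonexp[OF A_L2[OF u] Tu, of n s n t] L2.dist_nonneg[OF A_L2[OF A_L2[OF u]] T_L2[OF Tu s], of n s n t] by simp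
    qed
   qed
   show "L2_dist M (A n (s + t) u) (A n s (A n t u)) <= L2.nrm g * (1/2) ^ n" for n
   proof -
    let ?h = "(1/2::real) ^ n"
    let ?b = "(R ?h ^^ (steps s n + steps t n)) u"
    have b: "?b \<in> L2_fun M" by (rule Rk_L2[OF u hn])
    have e: "A n s (A n t u) = ?b" by (simp add: A_def funpow_add)
    show ?thesis
    proof (cases "steps (s + t) n = steps s n + steps t n")
     case True
     then show ?thesis unfolding e using L2.dist_self[OF b] L2.nrm_nonneg[OF gL] by (simp add: A_def)
    next
     case False
     then have "A n (s + t) u = R ?h ?b" using steps_add[OF s t, of n] by (simp add: A_def)
     moreover have "L2_dist M (R ?h ?b) ?b <= ?h * L2.nrm ((R ?h ^^ (steps s n + steps t n)) g)"
      by (rule R_gen_dist[OF Rk_gen[OF g hn] hn])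
     moreover have "?h * L2.nrm ((R ?h ^^ (steps s n + steps t n)) g) <= ?h * L2.nrm g"
      by (intro mult_left_mono Rk_nrm gL hn) auto
     ultimately show ?thesis unfolding e by (simp only: mult.commute[of "L2.nrm g"] order_trans)
    qed
   qed
   show "(%n. L2.nrm g * (1/2) ^ n) \<longlonglongrightarrow> 0" by (rule half_power_tendsto)
  qed
  then show ?thesis using L2.dist_nonneg[OF T_L2[OF u st] T_L2[OF Tu s]] by simp
 qed
 have "L2_dist M (T (s + t) f) (T s (T t f)) <= 0"
 proof (rule field_le_epsilon)
  fix e :: real assume e: "0 < e"
  obtain u g k where u: "gen u g" "gen g k" "L2_dist M f u < e / 2"
   using gen2_dense[OF f, of "e/2"] e by auto
  note uL = gen_L2(1)[OF u(1)]
  have "L2_dist M (T (s + t) f) (T s (T t f)) <= L2_dist M (T (s + t) f) (T (s + t) u) + L2_dist M (T (s + t) u) (T s (T t f))"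
   by (intro L2.dist_triangle T_L2 f uL s t st)
  also have "L2_dist M (T (s + t) u) (T s (T t f)) <= L2_dist M (T (s + t) u) (T s (T t u)) + L2_dist M (T s (T t u)) (T s (T t f))"
   by (intro L2.dist_triangle T_L2 f uL s t st)
  also have "L2_dist M (T s (T t u)) (T s (T t f)) <= L2_dist M (T t u) (T t f)"
   by (intro T_nonexp T_L2 f uL s t)
  also have "L2_dist M (T t u) (T t f) <= L2_dist M u f" by (intro T_nonexp f uL t)
  finally show "L2_dist M (T (s + t) f) (T s (T t f)) <= 0 + e"
   using dom[OF u(1)] T_nonexp[OF f uL st] L2.dist_commute[OF uL f] u(3) by linarith
 qed
 then show ?thesis using L2.dist_nonneg[OF T_L2[OF f st] T_L2[OF T_L2[OF f t] s]] by simp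
qed

lemma T_increment:
 assumes f: "f \<in> L2_fun M" and s: "0 <= s" and t: "0 <= t"
 shows "L2_dist M (T (t + s) f) (T t f) <= L2_dist M (T s f) f"
proof -
 have "L2_dist M (T (t + s) f) (T t f) <= L2_dist M (T (t + s) f) (T t (T s f)) + L2_dist M (T t (T s f)) (T t f)"
  by (intro L2.dist_triangle T_L2 f s t add_nonneg_nonneg)
 then show ?thesis using T_semigroup_dist[OF f t s] T_nonexp[OF T_L2[OF f s] f t] by linarith
qed

lemma T_Taylor:
 assumes g: "gen f g" "gen g k" and s: "0 <= s" and t: "0 <= t"
 shows "L2_dist M (T (t + s) f) (%x. 1 * T t f x + s * T t g x) <= s\<^sup>2 * L2.nrm k"
proof -
 note f = gen_L2(1)[OF g(1)] and gL = gen_L2(2)[OF g(1)]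
 let ?c = "%x. 1 * f x + s * g x"
 have c: "?c \<in> L2_fun M" by (rule L2.lincomb[OF f gL])
 have l: "(%x. 1 * T t f x + s * T t g x) \<in> L2_fun M" by (rule L2.lincomb[OF T_L2[OF f t] T_L2[OF gL t]])
 have st: "0 <= t + s" using s t by simp
 have "L2_dist M (T (t + s) f) (%x. 1 * T t f x + s * T t g x)
   <= L2_dist M (T (t + s) f) (T t (T s f)) + L2_dist M (T t (T s f)) (%x. 1 * T t f x + s * T t g x)"
  by (intro L2.dist_triangle T_L2 f s t st l)
 also have "L2_dist M (T t (T s f)) (%x. 1 * T t f x + s * T t g x)
   <= L2_dist M (T t (T s f)) (T t ?c) + L2_dist M (T t ?c) (%x. 1 * T t f x + s * T t g x)"
  by (intro L2.dist_triangle T_L2 f s t st l c)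
 also have "L2_dist M (T t ?c) (%x. 1 * T t f x + s * T t g x) = 0"
  using T_lincomb[OF f gL t, of 1 s] L2.dist_commute[OF T_L2[OF c t] l] by simp
 finally show ?thesis
  using T_semigroup_dist[OF f t s] T_nonexp[OF T_L2[OF f s] c t] T_second_order[OF g s] by linarith
qed

lemma inner_diff_le:
 assumes "f \<in> L2_fun M" "g \<in> L2_fun M" "z \<in> L2_fun M"
 shows "\<bar>L2_inner M f z - L2_inner M g z\<bar> <= L2_dist M f g * L2.nrm z"
 using L2.Cauchy_Schwarz[OF L2.mem_diff[OF assms(1,2)] assms(3)] assms
 by (simp add: L2.diffL L2.dist_nrm)

end

section \<open>The Laplace transform of the semigroup\<close>

lemma DERIV_if_quadratic_error:
 fixes f :: "real => real"
 assumes "0 < r" "!!y. \<bar>y - x\<bar> < r ==> \<bar>f y - f x - (y - x) * d\<bar> <= C * (y - x)\<^sup>2"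
 shows "(f has_real_derivative d) (at x)"
 unfolding has_field_derivative_iff
proof (rule LIM_zero_cancel, rule Lim_null_comparison)
 have "((%y. C * \<bar>y - x\<bar>) \<longlongrightarrow> C * \<bar>x - x\<bar>) (at x)" by (intro tendsto_intros)
 then show "((%y. C * \<bar>y - x\<bar>) \<longlongrightarrow> 0) (at x)" by simp
 show "\<forall>\<^sub>F y in at x. norm ((f y - f x) / (y - x) - d) <= C * \<bar>y - x\<bar>"
  unfolding eventually_at
 proof (intro exI[of _ r] conjI assms(1) ballI impI)
  fix y assume y: "y ~= x \<and> dist y x < r"
  then have "\<bar>f y - f x - (y - x) * d\<bar> <= (C * \<bar>y - x\<bar>) * \<bar>y - x\<bar>"
   using assms(2)[of y] by (simp add: dist_real_def power2_eq_square abs_mult_self_eq mult.assoc)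
  moreover have "(f y - f x) / (y - x) - d = (f y - f x - (y - x) * d) / (y - x)"
   using y by (simp add: field_simps)
  ultimately show "norm ((f y - f x) / (y - x) - d) <= C * \<bar>y - x\<bar>"
   using y by (simp add: abs_divide divide_le_eq)
 qed
qed

lemma set_integrable_exp_decay:
 assumes a: "0 < (a::real)"
 shows "set_integrable lborel {0<..} (%t. exp (- a * t))" "(LINT t:{0<..}|lborel. exp (- a * t)) = 1 / a"
proof -
 let ?F = "%t. - exp (- a * t) / a"
 have F: "DERIV ?F x :> exp (- a * x)" for x
  using a by (auto intro!: derivative_eq_intros)
 have A: "((?F \<circ> real_of_ereal) \<longlongrightarrow> - (1 / a)) (at_right 0)"
  unfolding zero_ereal_def[symmetric] using a
  by (simp add: ereal_tendsto_simps zero_ereal_def) (auto intro!: tendsto_eq_intros)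
 have "filterlim (%x. - a * x) at_bot at_top"
  using a filterlim_tendsto_neg_mult_at_bot[OF tendsto_const[of "- a"] _ filterlim_ident] by simp
 then have "((%x. exp (- a * x)) \<longlongrightarrow> 0) at_top" by (rule filterlim_compose[OF exp_at_bot])
 then have "(?F \<longlongrightarrow> - 0 / a) at_top" using a by (intro tendsto_divide tendsto_minus tendsto_const) auto
 then have B: "((?F \<circ> real_of_ereal) \<longlongrightarrow> 0) (at_left \<infinity>)"
  by (simp add: ereal_tendsto_simps)
 note r = interval_integral_FTC_nonneg[of 0 \<infinity> ?F "%t. exp (- a * t)" "- (1 / a)" 0, OF _ F _ _ A B]
 have e: "einterval 0 \<infinity> = {0<..}" by (auto simp: einterval_def zero_ereal_def)
 show "set_integrable lborel {0<..} (%t. exp (- a * t))"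
  using r(1) by (simp add: e)
 show "(LINT t:{0<..}|lborel. exp (- a * t)) = 1 / a"
  using r(2) by (simp add: interval_lebesgue_integral_def e)
qed

lemma laplace_integrable:
 fixes \<psi> :: "real => real"
 assumes a: "0 < a" and c: "continuous_on {0<..} \<psi>" and b: "!!t. 0 < t ==> \<bar>\<psi> t\<bar> <= C"
 shows "set_integrable lborel {0<..} (%t. exp (- a * t) * \<psi> t)"
proof (rule set_integrable_bound)
 show "set_integrable lborel {0<..} (%t. C * exp (- a * t))"
  using set_integrable_exp_decay(1)[OF a] by simp
 have "continuous_on {0<..} (%t. exp (- a * t) * \<psi> t)" by (intro continuous_intros c)
 then show "set_borel_measurable lborel {0<..} (%t. exp (- a * t) * \<psi> t)"
  unfolding set_borel_measurable_def measurable_lborel2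
  by (intro borel_measurable_continuous_on_indicator) auto
 show "AE t in lborel. t \<in> {0<..} --> norm (exp (- a * t) * \<psi> t) <= norm (C * exp (- a * t))"
  using order_trans[OF b abs_ge_self] by (intro AE_I2) (auto simp: abs_mult mult.commute[of "exp _"] intro!: mult_right_mono)
qed

lemma laplace_bound:
 fixes \<psi> :: "real => real"
 assumes a: "0 < a" and c: "continuous_on {0<..} \<psi>" and b: "!!t. 0 < t ==> \<bar>\<psi> t\<bar> <= C"
 shows "\<bar>LINT t:{0<..}|lborel. exp (- a * t) * \<psi> t\<bar> <= C / a"
proof -
 note i = laplace_integrable[OF a c b]
 have e: "set_integrable lborel {0<..} (%t. C * exp (- a * t))"
  using set_integrable_exp_decay(1)[OF a] by simp
 have e': "set_integrable lborel {0<..} (%t. - C * exp (- a * t))"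
  using set_integrable_exp_decay(1)[OF a] by (intro set_integrable_mult_right) simp
 have v: "(LINT t:{0<..}|lborel. k * exp (- a * t)) = k / a" for k
  using set_integrable_exp_decay(2)[OF a] by simp
 have "(LINT t:{0<..}|lborel. exp (- a * t) * \<psi> t) <= (LINT t:{0<..}|lborel. C * exp (- a * t))"
 proof (rule set_integral_mono[OF i e])
  fix t :: real assume "t \<in> {0<..}"
  then show "exp (- a * t) * \<psi> t <= C * exp (- a * t)"
   using b[of t] by (simp add: mult.commute mult_right_mono abs_le_iff)
 qed
 moreover have "(LINT t:{0<..}|lborel. - C * exp (- a * t)) <= (LINT t:{0<..}|lborel. exp (- a * t) * \<psi> t)"
 proof (rule set_integral_mono[OF e' i])
  fix t :: real assume "t \<in> {0<..}"
  then have "- C <= \<psi> t" using b[of t] by auto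
  then have "- C * exp (- a * t) <= \<psi> t * exp (- a * t)" by (rule mult_right_mono) simp
  then show "- C * exp (- a * t) <= exp (- a * t) * \<psi> t" by (simp only: mult.commute)
 qed
 ultimately show ?thesis unfolding v by (simp add: abs_le_iff)
qed

context dirichlet_form
begin

text \<open>Formulated for an arbitrary semigroup, because it is applied both to \<open>T\<close>
  and to the unknown semigroup that witnesses excessivity. Contractivity and the semigroup law shift
  every increment back to time 0.\<close>

lemma semigroup_weakly_continuous:
 fixes S :: "real => ('a => real) => 'a => real"
 assumes L: "!!t f. 0 < t ==> f \<in> L2_fun M ==> S t f \<in> L2_fun M"
  and ne: "!!t f g. 0 < t ==> f \<in> L2_fun M ==> g \<in> L2_fun M ==> L2_dist M (S t f) (S t g) <= L2_dist M f g"
  and sg: "!!s t f. 0 < s ==> 0 < t ==> f \<in> L2_fun M ==> L2_dist M (S (s + t) f) (S s (S t f)) = 0"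
  and sc: "((%t. L2_dist M (S t f) f) \<longlongrightarrow> 0) (at_right 0)"
  and f: "f \<in> L2_fun M" and z: "z \<in> L2_fun M"
 shows "continuous_on {0<..} (%t. L2_inner M (S t f) z)"
proof -
 have inc: "L2_dist M (S t f) (S s f) <= L2_dist M (S (t - s) f) f" if st: "0 < s" "s < t" for s t
 proof -
  have p: "0 < t - s" and t: "0 < t" using st by auto
  have "L2_dist M (S t f) (S s f) <= L2_dist M (S t f) (S s (S (t - s) f)) + L2_dist M (S s (S (t - s) f)) (S s f)"
   by (intro L2.dist_triangle L f st t p)
  then show ?thesis using sg[OF st(1) p f] ne[OF st(1) L[OF p f] f] by simp
 qed
 show ?thesis
  unfolding continuous_on_iff
 proof (intro ballI allI impI)
  fix t e :: real assume t: "t \<in> {0<..}" and e: "0 < e"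
  have p: "0 < L2.nrm z + 1" using L2.nrm_nonneg[OF z] by simp
  have "\<forall>\<^sub>F s in at_right 0. L2_dist M (S s f) f < e / (L2.nrm z + 1)"
   using order_tendstoD(2)[OF sc] e p by simp
  then obtain d where d: "0 < d" "!!s. 0 < s ==> s < d ==> L2_dist M (S s f) f < e / (L2.nrm z + 1)"
   unfolding eventually_at_right_field by blast
  show "\<exists>d>0. \<forall>s\<in>{0<..}. dist s t < d --> dist (L2_inner M (S s f) z) (L2_inner M (S t f) z) < e"
  proof (intro exI[of _ d] conjI d(1) ballI impI)
   fix s assume s: "s \<in> {0<..}" "dist s t < d"
   have "L2_dist M (S s f) (S t f) < e / (L2.nrm z + 1)"
   proof (cases s t rule: linorder_cases)
    case less
    then show ?thesis using inc[of s t] d(2)[of "t - s"] s t L2.dist_commute[OF L[of s f] L[of t f]] f by (auto simp: dist_real_def)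
   next
    case equal
    then show ?thesis using L2.dist_self[OF L[of t f]] t f e p by simp
   next
    case greater
    then show ?thesis using inc[of t s] d(2)[of "s - t"] s t by (auto simp: dist_real_def)
   qed
   then have "L2_dist M (S s f) (S t f) * (L2.nrm z + 1) < e" using p by (simp add: pos_less_divide_eq)
   moreover have "L2_dist M (S s f) (S t f) * L2.nrm z <= L2_dist M (S s f) (S t f) * (L2.nrm z + 1)"
    using L2.dist_nonneg[OF L[of s f] L[of t f]] s t f by (intro mult_left_mono) auto
   ultimately show "dist (L2_inner M (S s f) z) (L2_inner M (S t f) z) < e"
    using inner_diff_le[of "S s f" "S t f" z] L s t f z by (simp add: dist_real_def)
  qed
 qed
qed

lemma T_weakly_continuous:
 assumes f: "f \<in> L2_fun M" and z: "z \<in> L2_fun M"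
 shows "continuous_on {0<..} (%t. L2_inner M (T t f) z)"
 by (rule semigroup_weakly_continuous[where S = T])
  (auto intro: T_L2 T_nonexp T_semigroup_dist T_continuous_0 f z)

lemma T_inner_bound:
 "f \<in> L2_fun M ==> z \<in> L2_fun M ==> 0 <= t ==> \<bar>L2_inner M (T t f) z\<bar> <= L2.nrm f * L2.nrm z"
 by (rule order_trans[OF L2.Cauchy_Schwarz[OF T_L2]])
  (auto intro!: mult_right_mono T_nrm L2.nrm_nonneg)

lemma T_DERIV:
 assumes g: "gen f g" "gen g k" and z: "z \<in> L2_fun M" and t: "0 < t"
 shows "((%t. L2_inner M (T t f) z) has_real_derivative L2_inner M (T t g) z) (at t)"
proof (rule DERIV_if_quadratic_error[where C = "2 * L2.nrm k * L2.nrm z", OF t])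
 note f = gen_L2(1)[OF g(1)] and gL = gen_L2(2)[OF g(1)] and kL = gen_L2(2)[OF g(2)]
 note nk = L2.nrm_nonneg[OF kL] and nz = L2.nrm_nonneg[OF z]
 have tay: "\<bar>L2_inner M (T (s + d) f) z - L2_inner M (T s f) z - d * L2_inner M (T s g) z\<bar> <= d\<^sup>2 * (L2.nrm k * L2.nrm z)"
  if sd: "0 <= s" "0 <= d" for s d
 proof -
  have sd': "0 <= s + d" using sd by simp
  have "\<bar>L2_inner M (T (s + d) f) z - L2_inner M (%x. 1 * T s f x + d * T s g x) z\<bar>
    <= L2_dist M (T (s + d) f) (%x. 1 * T s f x + d * T s g x) * L2.nrm z"
   by (intro inner_diff_le T_L2 L2.lincomb f gL z sd sd')
  also have "\<dots> <= d\<^sup>2 * L2.nrm k * L2.nrm z" by (intro mult_right_mono T_Taylor g sd nz)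
  also have "L2_inner M (%x. 1 * T s f x + d * T s g x) z = L2_inner M (T s f) z + d * L2_inner M (T s g) z"
   using L2.lin[OF T_L2[OF f sd(1)] T_L2[OF gL sd(1)] z, of 1 d] by simp
  finally show ?thesis by (simp add: algebra_simps)
 qed
 have lip: "\<bar>L2_inner M (T (s + d) g) z - L2_inner M (T s g) z\<bar> <= d * (L2.nrm k * L2.nrm z)"
  if sd: "0 <= s" "0 <= d" for s d
 proof -
  have sd': "0 <= s + d" using sd by simp
  have "\<bar>L2_inner M (T (s + d) g) z - L2_inner M (T s g) z\<bar> <= L2_dist M (T (s + d) g) (T s g) * L2.nrm z"
   by (intro inner_diff_le T_L2 gL z sd sd')
  also have "\<dots> <= d * L2.nrm k * L2.nrm z"
   by (intro mult_right_mono nz order_trans[OF T_increment[OF gL sd(2,1)] T_gen_dist[OF g(2) sd(2)]])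
  finally show ?thesis by (simp add: mult.assoc)
 qed
 fix y assume y: "\<bar>y - t\<bar> < t"
 let ?p = "%t. L2_inner M (T t f) z" and ?q = "%t. L2_inner M (T t g) z" and ?C = "L2.nrm k * L2.nrm z"
 have C: "0 <= ?C" using nk nz by simp
 show "\<bar>?p y - ?p t - (y - t) * ?q t\<bar> <= 2 * L2.nrm k * L2.nrm z * (y - t)\<^sup>2"
 proof (cases "t <= y")
  case True
  have "\<bar>?p y - ?p t - (y - t) * ?q t\<bar> <= (y - t)\<^sup>2 * ?C" using tay[of t "y - t"] True t by simp
  also have "\<dots> <= 2 * ((y - t)\<^sup>2 * ?C)" using mult_nonneg_nonneg[OF zero_le_power2[of "y - t"] C] by linarith
  finally show ?thesis by (simp add: mult_ac)
 next
  \<comment> \<open>For an earlier time the expansion starts at \<open>y\<close>, and the Lipschitz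
    bound moves the derivative from \<open>y\<close> to \<open>t\<close>; the two errors account for
    the factor 2.\<close>
  case False
  have 1: "\<bar>?p t - ?p y - (t - y) * ?q y\<bar> <= (t - y)\<^sup>2 * ?C" using tay[of y "t - y"] False y by simp
  have "\<bar>?q t - ?q y\<bar> <= (t - y) * ?C" using lip[of y "t - y"] False y by simp
  then have "(t - y) * \<bar>?q t - ?q y\<bar> <= (t - y) * ((t - y) * ?C)" using False by (intro mult_left_mono) auto
  then have 2: "\<bar>(t - y) * (?q t - ?q y)\<bar> <= (t - y)\<^sup>2 * ?C" using False by (simp add: abs_mult power2_eq_square mult.assoc)
  have "?p y - ?p t - (y - t) * ?q t = - (?p t - ?p y - (t - y) * ?q y) + (t - y) * (?q t - ?q y)"
   by (simp add: algebra_simps)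
  then have "\<bar>?p y - ?p t - (y - t) * ?q t\<bar> <= (t - y)\<^sup>2 * ?C + (t - y)\<^sup>2 * ?C" using 1 2 by linarith
  also have "\<dots> = 2 * L2.nrm k * L2.nrm z * (y - t)\<^sup>2" by (simp add: power2_commute mult_ac)
  finally show ?thesis .
 qed
qed

text \<open>With \<open>u = R (1 / a) f\<close> one has \<open>f = u - A u / a\<close>, so the
  integrand is the derivative of \<open>- exp (- a t) (T t u, z) / a\<close>, and the fundamental
  theorem of calculus leaves the value at 0.\<close>

lemma T_laplace_gen:
 assumes g: "gen f f1" and a: "0 < a" and z: "z \<in> L2_fun M"
 shows "(LINT t:{0<..}|lborel. exp (- a * t) * L2_inner M (T t f) z) = L2_inner M (R (1 / a) f) z / a"
proof -
 let ?h = "1 / a"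
 have h: "0 < ?h" using a by simp
 note f = gen_L2(1)[OF g] and f1 = gen_L2(2)[OF g]
 let ?u = "R ?h f" and ?u1 = "R ?h f1"
 have gu: "gen ?u ?u1" by (rule gen_R[OF g h])
 \<comment> \<open>\<open>T_DERIV\<close> asks for the domain of the squared generator, to which
   \<open>?u\<close> belongs since \<open>f\<close> is in the domain.\<close>
 obtain k where gk: "gen ?u1 k" using gen_R_self[OF f1 h] by blast
 note u = gen_L2(1)[OF gu] and u1 = gen_L2(2)[OF gu]
 have fe: "L2_inner M (T t f) z = L2_inner M (T t ?u) z - L2_inner M (T t ?u1) z / a" if t: "0 <= t" for t
 proof -
  have c: "(%x. 1 * ?u x + (- ?h) * ?u1 x) \<in> L2_fun M" by (rule L2.lincomb[OF u u1])
  have l: "(%x. 1 * T t ?u x + (- ?h) * T t ?u1 x) \<in> L2_fun M" by (intro L2.lincomb T_L2 u u1 t)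
  have "L2_dist M (T t f) (T t (%x. 1 * ?u x + (- ?h) * ?u1 x)) <= L2_dist M f (%x. 1 * ?u x + (- ?h) * ?u1 x)"
   by (rule T_nonexp[OF f c t])
  also have "\<dots> = 0"
   using R_gen[OF g h] L2.dist_commute[OF f c] by simp
  finally have "L2_dist M (T t f) (%x. 1 * T t ?u x + (- ?h) * T t ?u1 x) <= 0"
   using T_lincomb[OF u u1 t, of 1 "- ?h"] L2.dist_triangle[OF T_L2[OF f t] T_L2[OF c t] l]
    L2.dist_commute[OF T_L2[OF c t] l] by linarith
  then have "L2_dist M (T t f) (%x. 1 * T t ?u x + (- ?h) * T t ?u1 x) * L2.nrm z <= 0 * L2.nrm z"
   by (rule mult_right_mono[OF _ L2.nrm_nonneg[OF z]])
  then have "L2_inner M (T t f) z = L2_inner M (%x. 1 * T t ?u x + (- ?h) * T t ?u1 x) z"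
   using inner_diff_le[OF T_L2[OF f t] l z] by simp
  also have "\<dots> = L2_inner M (T t ?u) z - L2_inner M (T t ?u1) z / a"
   using L2.lin[OF T_L2[OF u t] T_L2[OF u1 t] z, of 1 "- ?h"] by simp
  finally show ?thesis .
 qed
 define F where "F t = - (exp (- a * t) * L2_inner M (T t ?u) z / a)" for t
 let ?f = "%t. exp (- a * t) * L2_inner M (T t f) z"
 have dF: "(F has_real_derivative ?f t) (at t)" if t: "0 < t" for t
 proof -
  have "((%t. - (exp (- a * t) * L2_inner M (T t ?u) z / a)) has_real_derivative
   - ((exp (- a * t) * (- a)) * L2_inner M (T t ?u) z + exp (- a * t) * L2_inner M (T t ?u1) z) / a) (at t)"
   using a t by (auto intro!: derivative_eq_intros T_DERIV[OF gu gk z] simp: field_simps)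
  also have "- ((exp (- a * t) * (- a)) * L2_inner M (T t ?u) z + exp (- a * t) * L2_inner M (T t ?u1) z) / a = ?f t"
  proof -
   have "a * L2_inner M (T t f) z = a * L2_inner M (T t ?u) z - L2_inner M (T t ?u1) z"
    using fe[of t] t a by (simp add: field_simps)
   then have "exp (- a * t) * (a * L2_inner M (T t f) z) = exp (- a * t) * (a * L2_inner M (T t ?u) z - L2_inner M (T t ?u1) z)"
    by (rule arg_cong)
   then show ?thesis using a by (simp add: field_simps)
  qed
  finally show ?thesis unfolding F_def .
 qed
 have cont: "continuous_on {0<..} (%t. L2_inner M (T t f) z)" by (rule T_weakly_continuous[OF f z])
 have ei: "einterval 0 \<infinity> = {0<..}" by (auto simp: einterval_def zero_ereal_def)
 have int: "set_integrable lborel (einterval 0 \<infinity>) ?f"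
  unfolding ei by (rule laplace_integrable[OF a cont T_inner_bound[OF f z]]) simp
 have "continuous_on {0<..} ?f" by (intro continuous_intros cont)
 then have cf: "isCont ?f t" if "0 < t" for t
  using that by (auto simp: continuous_on_eq_continuous_at)
 have l0: "((%t. L2_inner M (T t ?u) z) \<longlongrightarrow> L2_inner M ?u z) (at_right 0)"
 proof (rule LIM_zero_cancel, rule Lim_null_comparison)
  show "((%t. L2_dist M (T t ?u) ?u * L2.nrm z) \<longlongrightarrow> 0) (at_right 0)"
   using tendsto_mult_right[OF T_continuous_0[OF u], of "L2.nrm z"] by simp
  show "\<forall>\<^sub>F t in at_right 0. norm (L2_inner M (T t ?u) z - L2_inner M ?u z) <= L2_dist M (T t ?u) ?u * L2.nrm z"
   using eventually_at_right_less[of "0::real"]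
   by eventually_elim (use inner_diff_le[OF T_L2[OF u] u z] in auto)
 qed
 have "(F \<longlongrightarrow> - (exp (- a * 0) * L2_inner M ?u z / a)) (at_right 0)"
  unfolding F_def using a by (intro tendsto_intros l0) auto
 then have A: "((F \<circ> real_of_ereal) \<longlongrightarrow> - (L2_inner M ?u z / a)) (at_right 0)"
  by (simp add: ereal_tendsto_simps zero_ereal_def)
 have "(F \<longlongrightarrow> 0) at_top"
 proof (rule Lim_null_comparison)
  have "filterlim (%x. - a * x) at_bot at_top"
   using a filterlim_tendsto_neg_mult_at_bot[OF tendsto_const[of "- a"] _ filterlim_ident] by simp
  then have "((%x. exp (- a * x)) \<longlongrightarrow> 0) at_top" by (rule filterlim_compose[OF exp_at_bot])
  from tendsto_mult_right[OF this, of "L2.nrm ?u * L2.nrm z / a"]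
  show "((%x. exp (- a * x) * (L2.nrm ?u * L2.nrm z / a)) \<longlongrightarrow> 0) at_top" by simp
  show "\<forall>\<^sub>F x in at_top. norm (F x) <= exp (- a * x) * (L2.nrm ?u * L2.nrm z / a)"
   using eventually_ge_at_top[of 0]
  proof eventually_elim
   fix x :: real assume "0 <= x"
   then have "exp (- a * x) * (\<bar>L2_inner M (T x ?u) z\<bar> / a) <= exp (- a * x) * (L2.nrm ?u * L2.nrm z / a)"
    using T_inner_bound[OF u z] a by (intro mult_left_mono divide_right_mono) auto
   then show "norm (F x) <= exp (- a * x) * (L2.nrm ?u * L2.nrm z / a)"
    using a by (simp add: F_def abs_mult)
  qed
 qed
 then have B: "((F \<circ> real_of_ereal) \<longlongrightarrow> 0) (at_left \<infinity>)"
  by (simp add: ereal_tendsto_simps)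
 have "(LBINT t=0..\<infinity>. ?f t) = 0 - (- (L2_inner M ?u z / a))"
  by (rule interval_integral_FTC_integrable[OF _ _ _ int A B])
   (use dF cf in \<open>auto simp: has_real_derivative_iff_has_vector_derivative[symmetric] zero_ereal_def\<close>)
 then show ?thesis by (simp add: interval_lebesgue_integral_def ei)
qed

lemma T_laplace:
 assumes f: "f \<in> L2_fun M" and a: "0 < a" and z: "z \<in> L2_fun M"
 shows "(LINT t:{0<..}|lborel. exp (- a * t) * L2_inner M (T t f) z) = L2_inner M (R (1 / a) f) z / a"
proof -
 let ?I = "%f. LINT t:{0<..}|lborel. exp (- a * t) * L2_inner M (T t f) z"
 have h: "0 < 1 / a" using a by simp
 have "\<bar>?I f - L2_inner M (R (1 / a) f) z / a\<bar> <= 0"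
 proof (rule field_le_epsilon)
  fix e :: real assume e: "0 < e"
  \<comment> \<open>Both sides of the identity move by at most \<open>e / 2\<close> when
    \<open>f\<close> is replaced by an element at distance less than \<open>d\<close>.\<close>
  define d where "d = a * e / (2 * (L2.nrm z + 1))"
  have p: "0 < L2.nrm z + 1" using L2.nrm_nonneg[OF z] by simp
  have d: "0 < d" using e a p by (simp add: d_def)
  obtain u g k where u: "gen u g" "gen g k" "L2_dist M f u < d" using gen2_dense[OF f d] .
  note uL = gen_L2(1)[OF u(1)]
  have cf: "continuous_on {0<..} (%t. L2_inner M (T t f) z)" and cu: "continuous_on {0<..} (%t. L2_inner M (T t u) z)"
   using T_weakly_continuous f uL z by auto
  have "?I f - ?I u = (LINT t:{0<..}|lborel. exp (- a * t) * L2_inner M (T t f) z - exp (- a * t) * L2_inner M (T t u) z)"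
   by (intro set_integral_diff(2)[symmetric] laplace_integrable[OF a cf T_inner_bound[OF f z]] laplace_integrable[OF a cu T_inner_bound[OF uL z]]) simp_all
  also have "\<dots> = (LINT t:{0<..}|lborel. exp (- a * t) * (L2_inner M (T t f) z - L2_inner M (T t u) z))"
   by (simp add: right_diff_distrib)
  also have "\<bar>\<dots>\<bar> <= (L2_dist M f u * L2.nrm z) / a"
  proof (rule laplace_bound[OF a])
   show "continuous_on {0<..} (%t. L2_inner M (T t f) z - L2_inner M (T t u) z)" by (intro continuous_intros cf cu)
   fix t :: real assume "0 < t"
   then have t: "0 <= t" by simp
   show "\<bar>L2_inner M (T t f) z - L2_inner M (T t u) z\<bar> <= L2_dist M f u * L2.nrm z"
    using inner_diff_le[OF T_L2[OF f t] T_L2[OF uL t] z] mult_right_mono[OF T_nonexp[OF f uL t] L2.nrm_nonneg[OF z]] by linarith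
  qed
  finally have 1: "\<bar>?I f - ?I u\<bar> <= (L2_dist M f u * L2.nrm z) / a" .
  have "\<bar>L2_inner M (R (1 / a) f) z - L2_inner M (R (1 / a) u) z\<bar> <= L2_dist M f u * L2.nrm z"
   using inner_diff_le[OF R_L2[OF f h] R_L2[OF uL h] z] mult_right_mono[OF R_nonexp[OF f uL h] L2.nrm_nonneg[OF z]] by linarith
  then have 2: "\<bar>L2_inner M (R (1 / a) f) z / a - L2_inner M (R (1 / a) u) z / a\<bar> <= (L2_dist M f u * L2.nrm z) / a"
   using a by (simp add: diff_divide_distrib[symmetric] divide_right_mono)
  have "L2_dist M f u * L2.nrm z <= d * (L2.nrm z + 1)"
   using u(3) L2.nrm_nonneg[OF z] d by (intro mult_mono) auto
  also have "\<dots> = a * e / 2" using p unfolding d_def by (simp add: divide_simps)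
  finally have "(L2_dist M f u * L2.nrm z) / a <= e / 2" using a by (simp add: field_simps)
  then show "\<bar>?I f - L2_inner M (R (1 / a) f) z / a\<bar> <= 0 + e"
   using 1 2 T_laplace_gen[OF u(1) a z] by linarith
 qed
 then show ?thesis by simp
qed

proposition semigroup_exists: "is_semigroup_of M D E T"
 unfolding is_semigroup_of_def
proof (intro conjI allI impI ballI)
 fix t :: real assume "0 < t"
 then have t: "0 <= t" by simp
 fix f assume f: "f \<in> L2_fun M"
 show "T t f \<in> L2_fun M" using T_L2[OF f t] .
 show "L2_inner M (T t f) (T t f) <= L2_inner M f f"
  using T_nrm[OF f t] by (simp add: L2.nrm_def)
 fix g a b assume g: "g \<in> L2_fun M"
 have "AE x in M. a * T t f x + b * T t g x = T t (%x. a * f x + b * g x) x"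
  using T_lincomb[OF f g t, of a b] L2_dist_zero_iff[OF L2.lincomb[OF T_L2[OF f t] T_L2[OF g t]] T_L2[OF L2.lincomb[OF f g] t], of a b a b]
  by simp
 then show "AE x in M. T t (%x. a * f x + b * g x) x = a * T t f x + b * T t g x"
  by eventually_elim simp
next
 fix s t :: real and f assume "0 < s" "0 < t" and f: "f \<in> L2_fun M"
 then have s: "0 <= s" and t: "0 <= t" by simp_all
 show "AE x in M. T (s + t) f x = T s (T t f) x"
  using T_semigroup_dist[OF f s t] L2_dist_zero_iff[OF T_L2[OF f] T_L2[OF T_L2[OF f t] s]] s t by simp
next
 fix f assume f: "f \<in> L2_fun M"
 show "((%t. L2_dist M (T t f) f) \<longlongrightarrow> 0) (at_right 0)" by (rule T_continuous_0[OF f])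
 fix a :: real assume a: "0 < a"
 have h: "0 < 1 / a" using a by simp
 note r = R_D[OF f h]
 \<comment> \<open>The resolvent at \<open>a\<close> is \<open>R (1 / a)\<close> divided by
   \<open>a\<close>.\<close>
 let ?g = "%x. (1 / a) * R (1 / a) f x"
 show "\<exists>g\<in>D. (\<forall>v\<in>D. E g v + a * L2_inner M g v = L2_inner M f v) \<and>
   (\<forall>h\<in>L2_fun M. (LINT t:{0<..}|lborel. exp (- a * t) * L2_inner M (T t f) h) = L2_inner M g h)"
 proof (intro bexI[of _ ?g] conjI ballI)
  show "?g \<in> D" by (rule E.mem_scale[OF r])
  show "E ?g v + a * L2_inner M ?g v = L2_inner M f v" if v: "v \<in> D" for v
   unfolding E.scaleL[OF r v] L2.scaleL[OF DL[OF r] DL[OF v]] using R_eq[OF f h v] a by simp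
  show "(LINT t:{0<..}|lborel. exp (- a * t) * L2_inner M (T t f) z) = L2_inner M ?g z" if z: "z \<in> L2_fun M" for z
   unfolding L2.scaleL[OF DL[OF r] z] using T_laplace[OF f a z] by simp
 qed
qed

end

section \<open>Excessive and reduced functions\<close>

text \<open>The scalar counterpart of the Euler scheme: each resolvent step of an excessive function
  carries a factor \<open>1 - h\<close>, and together these become the discount
  \<open>exp (- t)\<close>.\<close>

lemma one_minus_half_power_steps_tendsto:
 assumes t: "0 <= t" shows "(%n. (1 - (1/2) ^ n) ^ steps t n) \<longlonglongrightarrow> exp (- t)"
proof -
 let ?h = "%n. (1/2::real) ^ n"
 have h0: "filterlim ?h (at 0) sequentially"
  unfolding filterlim_at by (auto intro!: LIMSEQ_realpow_zero)
 have "((%x. ln (1 - x)) has_real_derivative - 1) (at (0::real))"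
  by (auto intro!: derivative_eq_intros)
 then have "((%x. ln (1 - x) / x) \<longlongrightarrow> - 1) (at (0::real))" by (simp add: has_field_derivative_iff)
 from filterlim_compose[OF this h0] have l: "(%n. ln (1 - ?h n) / ?h n) \<longlonglongrightarrow> - 1" .
 have "(%n. exp ((real (steps t n) * ?h n) * (ln (1 - ?h n) / ?h n))) \<longlonglongrightarrow> exp (t * - 1)"
  by (intro tendsto_intros l steps_tendsto t)
 moreover have "\<forall>\<^sub>F n in sequentially. exp ((real (steps t n) * ?h n) * (ln (1 - ?h n) / ?h n)) = (1 - ?h n) ^ steps t n"
 \<comment> \<open>For \<open>n = 0\<close> the base \<open>1 - h\<close> is 0 and has no
   logarithm.\<close>
 proof (rule eventually_sequentiallyI[of 1])
  fix n :: nat assume "1 <= n"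
  then have "?h n <= ?h 1" by (rule power_decreasing) auto
  then have "?h n < 1" by simp
  then have "exp (real (steps t n) * ln (1 - ?h n)) = (1 - ?h n) ^ steps t n"
   by (simp add: exp_of_nat_mult)
  then show "exp ((real (steps t n) * ?h n) * (ln (1 - ?h n) / ?h n)) = (1 - ?h n) ^ steps t n" by simp
 qed
 ultimately show ?thesis using Lim_transform_eventually by fastforce
qed

context dirichlet_form
begin

text \<open>Excessivity in terms of the resolvent: with \<open>a = 1 / h - 1\<close> this says \<open>a G\<^sub>a\<^sub>+\<^sub>1 u \<le> u\<close>.\<close>

definition excessive_R :: "('a => real) => bool" where
 "excessive_R u \<longleftrightarrow> u \<in> L2_fun M \<and> (ALL h. 0 < h \<and> h < 1 --> (AE x in M. (1 - h) * R h u x <= u x))"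

lemma excessive_R_Rk:
 assumes u: "excessive_R u" and h: "0 < h" "h < 1"
 shows "AE x in M. (1 - h) ^ k * (R h ^^ k) u x <= u x"
proof (induction k)
 case 0 then show ?case by simp
next
 case (Suc k)
 have uL: "u \<in> L2_fun M" using u by (simp add: excessive_R_def)
 let ?w = "(R h ^^ k) u" and ?c = "(1 - h) ^ k"
 have w: "?w \<in> L2_fun M" by (rule Rk_L2[OF uL h(1)])
 have c: "(%x. ?c * ?w x + 0 * ?w x) \<in> L2_fun M" by (rule L2.lincomb[OF w w])
 have "AE x in M. R h (%x. ?c * ?w x + 0 * ?w x) x <= R h u x"
  using Suc by (intro R_mono[OF c uL h(1)]) simp
 moreover have "AE x in M. ?c * R h ?w x + 0 * R h ?w x = R h (%x. ?c * ?w x + 0 * ?w x) x"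
  using R_lincomb[OF w w h(1), of ?c 0] L2_dist_zero_iff[OF L2.lincomb[OF R_L2[OF w h(1)] R_L2[OF w h(1)]] R_L2[OF c h(1)], of ?c 0]
  by simp
 moreover have "AE x in M. (1 - h) * R h u x <= u x" using u h by (simp add: excessive_R_def)
 ultimately show ?case
 proof eventually_elim
  case (elim x)
  have "(1 - h) * (?c * R h ?w x) <= (1 - h) * R h u x" using elim h by (intro mult_left_mono) auto
  then show ?case using elim by (simp add: mult.assoc)
 qed
qed

text \<open>Iterating the resolvent inequality along the Euler scheme and letting the step tend to 0
  turns it into the semigroup inequality.\<close>

lemma excessive_R_imp_one_excessive:
 assumes u: "excessive_R u" shows "one_excessive M D E u"
 unfolding one_excessive_def
proof (intro conjI exI[of _ T] allI impI semigroup_exists)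
 show uL: "u \<in> L2_fun M" using u by (simp add: excessive_R_def)
 fix t :: real assume "0 < t"
 then have t: "0 <= t" by simp
 \<comment> \<open>The shifted index keeps the step strictly below 1.\<close>
 let ?c = "%n. (1 - (1/2) ^ Suc n) ^ steps t (Suc n) :: real"
 let ?f = "%n x. ?c n * A (Suc n) t u x"
 note TL = T_L2[OF uL t]
 have fL: "?f n \<in> L2_fun M" for n by (intro L2.mem_scale A_L2 uL)
 have "AE x in M. True --> exp (- t) * T t u x <= u x"
 proof (rule L2_limit_mono[of ?f _ "%_. u", OF fL L2.mem_scale[OF TL] _ uL uL])
  show "(%n. L2_dist M u u) \<longlonglongrightarrow> 0" using L2.dist_self[OF uL] by simp
  have "L2_dist M (?f n) (%x. exp (- t) * T t u x) <= \<bar>?c n\<bar> * L2_dist M (A (Suc n) t u) (T t u) + \<bar>?c n - exp (- t)\<bar> * L2.nrm (T t u)" for n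
  proof -
   have "(%x. ?c n * A (Suc n) t u x - exp (- t) * T t u x) =
     (%x. ?c n * (A (Suc n) t u x - T t u x) + (?c n - exp (- t)) * T t u x)" by (auto simp: algebra_simps)
   then show ?thesis
    using L2.nrm_triangle[of "%x. ?c n * (A (Suc n) t u x - T t u x)" "%x. (?c n - exp (- t)) * T t u x"]
     A_L2[OF uL] TL by (simp only: L2.dist_nrm L2.mem L2.nrm_scale)
  qed
  then have bn: "norm (L2_dist M (?f n) (%x. exp (- t) * T t u x)) <= \<bar>?c n\<bar> * L2_dist M (A (Suc n) t u) (T t u) + \<bar>?c n - exp (- t)\<bar> * L2.nrm (T t u)" for n
   unfolding real_norm_def abs_of_nonneg[OF L2.dist_nonneg[OF fL L2.mem_scale[OF TL]]] .
  have "(%n. \<bar>?c n\<bar> * L2_dist M (A (Suc n) t u) (T t u) + \<bar>?c n - exp (- t)\<bar> * L2.nrm (T t u))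
    \<longlonglongrightarrow> \<bar>exp (- t)\<bar> * 0 + \<bar>exp (- t) - exp (- t)\<bar> * L2.nrm (T t u)"
   by (intro tendsto_intros LIMSEQ_Suc[OF one_minus_half_power_steps_tendsto[OF t]] LIMSEQ_Suc[OF T_lim[OF uL t]])
  then have ln: "(%n. \<bar>?c n\<bar> * L2_dist M (A (Suc n) t u) (T t u) + \<bar>?c n - exp (- t)\<bar> * L2.nrm (T t u)) \<longlonglongrightarrow> 0"
   by (simp only: mult_zero_right diff_self abs_zero mult_zero_left add_0)
  show "(%n. L2_dist M (?f n) (%x. exp (- t) * T t u x)) \<longlonglongrightarrow> 0"
   by (rule Lim_null_comparison[OF always_eventually[OF allI[OF bn]] ln])
  fix n
  have "(1/2::real) ^ Suc n < 1" by (rule power_Suc_less_one) auto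
  then show "AE x in M. True --> ?f n x <= u x"
   using excessive_R_Rk[OF u, of "(1/2) ^ Suc n" "steps t (Suc n)"] by (simp add: A_def)
 qed
 then show "AE x in M. exp (- t) * T t u x <= u x" by simp
qed

text \<open>Any semigroup of the form has the same resolvent, so uniqueness of the semigroup is not needed.\<close>

lemma one_excessive_imp_excessive_R:
 assumes w: "one_excessive M D E w" shows "excessive_R w"
proof -
 have wL: "w \<in> L2_fun M" using w by (simp add: one_excessive_def)
 obtain S where S: "is_semigroup_of M D E S" and ex: "!!t. 0 < t ==> AE x in M. exp (- t) * S t w x <= w x"
  using w by (auto simp: one_excessive_def)
 have SL: "S t f \<in> L2_fun M" if "0 < t" "f \<in> L2_fun M" for t f using S that by (simp add: is_semigroup_of_def)
 have Slin: "AE x in M. S t (%z. a * f z + b * g z) x = a * S t f x + b * S t g x"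
  if "0 < t" "f \<in> L2_fun M" "g \<in> L2_fun M" for t f g a b using S that by (simp add: is_semigroup_of_def)
 have Scon: "L2_inner M (S t f) (S t f) <= L2_inner M f f" if "0 < t" "f \<in> L2_fun M" for t f
  using S that by (simp add: is_semigroup_of_def)
 have Ssg: "AE x in M. S (s + t) f x = S s (S t f) x" if "0 < s" "0 < t" "f \<in> L2_fun M" for s t f
  using S that by (simp add: is_semigroup_of_def)
 have cont: "continuous_on {0<..} (%t. L2_inner M (S t w) z)" if z: "z \<in> L2_fun M" for z
 proof (rule semigroup_weakly_continuous[OF SL _ _ _ wL z])
  fix t :: real and f g assume t: "0 < t" and f: "f \<in> L2_fun M" and g: "g \<in> L2_fun M"
  have l: "AE x in M. S t (%z. 1 * f z + (- 1) * g z) x = 1 * S t f x + (- 1) * S t g x" by (rule Slin[OF t f g])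
  have fg: "(%z. 1 * f z + (- 1) * g z) \<in> L2_fun M" by (rule L2.lincomb[OF f g])
  have "L2_inner M (%x. S t f x - S t g x) (%x. S t f x - S t g x)
    = L2_inner M (S t (%z. 1 * f z + (- 1) * g z)) (S t (%z. 1 * f z + (- 1) * g z))"
   using l SL[OF t fg] SL[OF t f] SL[OF t g]
   by (intro L2_inner_cong_AE L2.mem_diff) (auto elim!: eventually_mono)
  also have "\<dots> <= L2_inner M (%z. 1 * f z + (- 1) * g z) (%z. 1 * f z + (- 1) * g z)" by (rule Scon[OF t fg])
  finally show "L2_dist M (S t f) (S t g) <= L2_dist M f g" by (simp add: L2_dist_def)
 next
  fix s t :: real and f assume s: "0 < s" and t: "0 < t" and f: "f \<in> L2_fun M"
  show "L2_dist M (S (s + t) f) (S s (S t f)) = 0"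
   using Ssg[OF s t f] L2_dist_zero_iff[OF SL[OF add_pos_pos[OF s t] f] SL[OF s SL[OF t f]]] by simp
 next
  show "((%t. L2_dist M (S t w) w) \<longlongrightarrow> 0) (at_right 0)" using S wL by (simp add: is_semigroup_of_def)
 qed
 have bnd: "\<bar>L2_inner M (S t w) z\<bar> <= L2.nrm w * L2.nrm z" if t: "0 < t" and z: "z \<in> L2_fun M" for t z
 proof -
  have "L2.nrm (S t w) <= L2.nrm w" using Scon[OF t wL] by (simp add: L2.nrm_def)
  then show ?thesis using L2.Cauchy_Schwarz[OF SL[OF t wL] z] mult_right_mono[OF _ L2.nrm_nonneg[OF z]] order_trans by blast
 qed
 show ?thesis unfolding excessive_R_def
 proof (intro conjI wL allI impI)
  fix h :: real assume h: "0 < h \<and> h < 1"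
  define b where "b = 1 / h"
  have b: "1 < b" "0 < b" using h by (auto simp: b_def)
  have h': "0 < h" using h by simp
  obtain g where g: "g \<in> D" "!!v. v \<in> D ==> E g v + b * L2_inner M g v = L2_inner M w v"
   "!!z. z \<in> L2_fun M ==> (LINT t:{0<..}|lborel. exp (- b * t) * L2_inner M (S t w) z) = L2_inner M g z"
   using S wL b(2) unfolding is_semigroup_of_def by meson
  note gL = DL[OF g(1)]
  have "L2_dist M (%x. b * g x) (R h w) = 0"
  proof (rule R_unique[OF E.mem_scale[OF g(1)] wL h'])
   fix v assume v: "v \<in> D"
   show "h * E (%x. b * g x) v + L2_inner M (%x. b * g x) v = L2_inner M w v"
    unfolding E.scaleL[OF g(1) v] L2.scaleL[OF gL DL[OF v]] using g(2)[OF v] h' by (simp add: b_def)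
  qed
  then have rg: "AE x in M. b * g x = R h w x"
   using L2_dist_zero_iff[OF L2.mem_scale[OF gL] R_L2[OF wL h']] by simp
  \<comment> \<open>Here \<open>g\<close> is the integral of \<open>exp (- b t) S t w\<close>.
    Excessivity bounds \<open>S t w\<close> by \<open>exp t\<close> times \<open>w\<close>, hence
    the integral by \<open>w / (b - 1)\<close>. The comparison is made against nonnegative
    \<open>z\<close> because the exceptional null set depends on \<open>t\<close>.\<close>
  have "AE x in M. (b - 1) * g x <= w x"
  proof (rule L2_le_if_inner_le[OF L2.mem_scale[OF gL] wL])
   fix z assume z: "z \<in> L2_fun M" "!!x. 0 <= z x"
   have i1: "set_integrable lborel {0<..} (%t. exp (- b * t) * L2_inner M (S t w) z)"
    by (rule laplace_integrable[OF b(2) cont[OF z(1)] bnd[OF _ z(1)]])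
   have b1: "0 < b - 1" using b by simp
   have i2: "set_integrable lborel {0<..} (%t. L2_inner M w z * exp (- (b - 1) * t))"
    using set_integrable_exp_decay(1)[OF b1] by (intro set_integrable_mult_right) simp
   have "L2_inner M g z = (LINT t:{0<..}|lborel. exp (- b * t) * L2_inner M (S t w) z)" using g(3)[OF z(1)] by simp
   also have "\<dots> <= (LINT t:{0<..}|lborel. L2_inner M w z * exp (- (b - 1) * t))"
   proof (rule set_integral_mono[OF i1 i2])
    fix t :: real assume "t \<in> {0<..}"
    then have t: "0 < t" by simp
    have "L2_inner M (%x. exp (- t) * S t w x) z <= L2_inner M w z"
     using ex[OF t] z by (intro L2_inner_mono L2.mem_scale SL t wL) auto
    then have "exp (- t) * L2_inner M (S t w) z <= L2_inner M w z" by (simp add: L2.scaleL[OF SL[OF t wL] z(1)])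
    then have "exp (- (b - 1) * t) * (exp (- t) * L2_inner M (S t w) z) <= exp (- (b - 1) * t) * L2_inner M w z"
     by (rule mult_left_mono) simp
    also have "exp (- (b - 1) * t) * (exp (- t) * L2_inner M (S t w) z) = exp (- b * t) * L2_inner M (S t w) z"
     by (simp add: mult.assoc[symmetric] exp_add[symmetric] algebra_simps)
    finally show "exp (- b * t) * L2_inner M (S t w) z <= L2_inner M w z * exp (- (b - 1) * t)" by (simp only: mult.commute)
   qed
   also have "\<dots> = L2_inner M w z / (b - 1)" using set_integrable_exp_decay(2)[OF b1] by simp
   finally have "(b - 1) * L2_inner M g z <= L2_inner M w z" using b1 by (simp add: pos_le_divide_eq mult.commute)
   then show "L2_inner M (%x. (b - 1) * g x) z <= L2_inner M w z" by (simp add: L2.scaleL[OF gL z(1)])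
  qed
  then show "AE x in M. (1 - h) * R h w x <= w x" using rg
  proof eventually_elim
   case (elim x)
   have "(1 - h) * (b * g x) = (b - 1) * g x" using h' by (simp add: b_def field_simps)
   then show ?case using elim by simp
  qed
 qed
qed

text \<open>The function \<open>u - (1 - h) R h u\<close> solves the resolvent equation with the
  nonnegative functional \<open>h * form1 M E u\<close> on the right, so the maximum principle
  applies.\<close>

lemma superharmonic_imp_excessive_R:
 assumes u: "u \<in> D" and s: "!!v. v \<in> D ==> (!!x. 0 <= v x) ==> 0 <= form1 M E u v"
 shows "excessive_R u"
 unfolding excessive_R_def
proof (intro conjI DL[OF u] allI impI)
 fix h :: real assume "0 < h \<and> h < 1"
 then have h: "0 < h" by simp
 note r = R_D[OF DL[OF u] h]
 have m: "(%x. (1 - h) * R h u x) \<in> D" by (rule E.mem_scale[OF r])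
 have "AE x in M. 0 <= u x - (1 - h) * R h u x"
 proof (rule nonneg_if_superharmonic[OF E.mem_diff[OF u m] h])
  fix v assume v: "v \<in> D" "!!x. 0 <= v x"
  have "E (%x. u x - (1 - h) * R h u x) v = E u v - (1 - h) * E (R h u) v"
   unfolding E.diffL[OF u m v(1)] E.scaleL[OF r v(1)] ..
  moreover have "L2_inner M (%x. u x - (1 - h) * R h u x) v = L2_inner M u v - (1 - h) * L2_inner M (R h u) v"
   unfolding L2.diffL[OF DL[OF u] DL[OF m] DL[OF v(1)]] L2.scaleL[OF DL[OF r] DL[OF v(1)]] ..
  ultimately have "h * E (%x. u x - (1 - h) * R h u x) v + L2_inner M (%x. u x - (1 - h) * R h u x) v
    = h * (E u v - (1 - h) * E (R h u) v) + (L2_inner M u v - (1 - h) * L2_inner M (R h u) v)"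
   by simp
  also have "\<dots> = h * E u v + L2_inner M u v - (1 - h) * (h * E (R h u) v + L2_inner M (R h u) v)"
   by (simp add: algebra_simps)
  also have "\<dots> = h * form1 M E u v"
   unfolding R_eq[OF DL[OF u] h v(1)] by (simp add: form1_def algebra_simps)
  finally show "0 <= h * E (%x. u x - (1 - h) * R h u x) v + L2_inner M (%x. u x - (1 - h) * R h u x) v"
   using s[OF v] h by simp
 qed
 then show "AE x in M. (1 - h) * R h u x <= u x" by eventually_elim simp
qed

text \<open>Monotonicity of the resolvent compares the minimum with each of the two functions. The
  minimum is the competitor by which reduced functions are shown to be smallest.\<close>

lemma excessive_R_min:
 assumes u: "excessive_R u" and v: "excessive_R v" shows "excessive_R (%x. min (u x) (v x))"
proof -
 have uL: "u \<in> L2_fun M" and vL: "v \<in> L2_fun M" using u v by (auto simp: excessive_R_def)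
 have mL: "(%x. min (u x) (v x)) \<in> L2_fun M"
 proof (rule L2_dominated)
  show "(%x. \<bar>u x\<bar> + \<bar>v x\<bar>) \<in> L2_fun M"
   using uL vL by (intro L2.mem_add) (auto simp: L2_fun_def)
 qed (use uL vL in \<open>auto simp: L2_fun_def\<close>)
 show ?thesis unfolding excessive_R_def
 proof (intro conjI mL allI impI)
  fix h :: real assume h: "0 < h \<and> h < 1"
  have "AE x in M. R h (%x. min (u x) (v x)) x <= R h u x" "AE x in M. R h (%x. min (u x) (v x)) x <= R h v x"
   using h by (auto intro!: R_mono mL uL vL)
  moreover have "AE x in M. (1 - h) * R h u x <= u x" "AE x in M. (1 - h) * R h v x <= v x"
   using u v h by (auto simp: excessive_R_def)
  ultimately show "AE x in M. (1 - h) * R h (%x. min (u x) (v x)) x <= min (u x) (v x)"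
  proof eventually_elim
   case (elim x)
   have "(1 - h) * R h (%x. min (u x) (v x)) x <= (1 - h) * R h u x" "(1 - h) * R h (%x. min (u x) (v x)) x <= (1 - h) * R h v x"
    using elim h by (auto intro!: mult_left_mono)
   then show ?case using elim by simp
  qed
 qed
qed

text \<open>Approximate the function by \<open>(1 - h) R h v\<close>.\<close>

lemma dominated_excessive:
 assumes v: "excessive_R v" and e: "e \<in> D" and ve: "AE x in M. v x <= e x"
 shows "v \<in> D" "form1 M E v v <= form1 M E e e"
proof -
 have vL: "v \<in> L2_fun M" using v by (simp add: excessive_R_def)
 note eL = DL[OF e]
 define h where "h n = 1 / real (n + 2)" for n
 have h: "0 < h n" "h n < 1" for n by (auto simp: h_def)
 have h0: "h \<longlonglongrightarrow> 0"
  unfolding h_def using LIMSEQ_ignore_initial_segment[OF lim_1_over_n, of 2] by simp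
 define f where "f n x = (1 - h n) * R (h n) v x" for n x
 have r: "R (h n) v \<in> D" for n by (rule R_D[OF vL h(1)])
 have f: "f n \<in> D" for n unfolding f_def by (rule E.mem_scale[OF r])
 have fv: "AE x in M. f n x <= v x" for n using v h[of n] by (simp add: excessive_R_def f_def)
 \<comment> \<open>As \<open>f n <= v\<close>, this exhibits \<open>form1 M E (f n)\<close> as a
   positive functional. Replacing the argument \<open>f n\<close> by the larger \<open>e\<close> can
   only increase it, and Cauchy-Schwarz then bounds the \<open>E_1\<close>-norm of
   \<open>f n\<close> by that of \<open>e\<close>.\<close>
 have eq: "form1 M E (f n) z = ((1 - h n) / h n) * (L2_inner M v z - L2_inner M (f n) z)" if z: "z \<in> D" for n z
 proof -
  have "h n * form1 M E (f n) z = (1 - h n) * (h n * E (R (h n) v) z + L2_inner M (R (h n) v) z) - (1 - h n) * L2_inner M (f n) z"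
   unfolding form1_def f_def E.scaleL[OF r z] L2.scaleL[OF DL[OF r] DL[OF z]] by (simp add: algebra_simps)
  also have "\<dots> = (1 - h n) * (L2_inner M v z - L2_inner M (f n) z)"
   unfolding R_eq[OF vL h(1) z] by (simp add: right_diff_distrib)
  finally show ?thesis using h(1)[of n] by (simp add: field_simps)
 qed
 have fe: "form1 M E (f n) (f n) <= form1 M E e e" for n
 proof -
  have "L2_inner M (%x. v x - f n x) (f n) <= L2_inner M (%x. v x - f n x) e"
  proof -
   have "AE x in M. f n x <= e x" using fv[of n] ve by eventually_elim simp
   moreover have "AE x in M. 0 <= v x - f n x" using fv[of n] by eventually_elim simp
   ultimately have "L2_inner M (f n) (%x. v x - f n x) <= L2_inner M e (%x. v x - f n x)"
    by (intro L2_inner_mono DL f eL L2.mem_diff vL)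
   then show ?thesis by (simp add: L2_inner_def mult.commute)
  qed
  then have "L2_inner M v (f n) - L2_inner M (f n) (f n) <= L2_inner M v e - L2_inner M (f n) e"
   using L2.diffL[OF vL DL[OF f[of n]] DL[OF f[of n]]] L2.diffL[OF vL DL[OF f[of n]] eL] by simp
  then have "form1 M E (f n) (f n) <= form1 M E (f n) e"
   unfolding eq[OF f] eq[OF e] using h[of n] by (intro mult_left_mono) auto
  also have "\<dots> <= E1.nrm (f n) * E1.nrm e" using E1.Cauchy_Schwarz[OF f[of n] e] by simp
  finally have "E1.nrm (f n) * E1.nrm (f n) <= E1.nrm (f n) * E1.nrm e"
   using E1.nrm_sq[OF f[of n]] by (simp add: power2_eq_square)
  then have "E1.nrm (f n) <= E1.nrm e"
   using E1.nrm_nonneg[OF f[of n]] E1.nrm_nonneg[OF e] by (cases "E1.nrm (f n) = 0") auto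
  then show ?thesis by (simp add: E1.nrm_def)
 qed
 have lim: "(%n. L2_dist M (f n) v) \<longlonglongrightarrow> 0"
 proof (rule Lim_null_comparison)
  have "filterlim h (at_right 0) sequentially"
   unfolding filterlim_at by (auto intro: h0 simp: h always_eventually less_imp_neq[OF h(1), symmetric])
  from filterlim_compose[OF R_strongly_continuous[OF vL] this]
  have "(%n. L2_dist M (R (h n) v) v) \<longlonglongrightarrow> 0" .
  then have "(%n. L2_dist M (R (h n) v) v + h n * L2.nrm v) \<longlonglongrightarrow> 0 + 0 * L2.nrm v"
   by (intro tendsto_intros h0)
  then show "(%n. L2_dist M (R (h n) v) v + h n * L2.nrm v) \<longlonglongrightarrow> 0" by simp
  have "L2_dist M (f n) v <= L2_dist M (R (h n) v) v + h n * L2.nrm v" for n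
  proof -
   have rL: "R (h n) v \<in> L2_fun M" by (rule DL[OF r])
   have "L2_dist M (f n) v <= L2_dist M (f n) (R (h n) v) + L2_dist M (R (h n) v) v"
    by (intro L2.dist_triangle DL f r vL)
   also have "L2_dist M (f n) (R (h n) v) = h n * L2.nrm (R (h n) v)"
   proof -
    have "(%x. f n x - R (h n) v x) = (%x. (- h n) * R (h n) v x)" by (auto simp: f_def algebra_simps)
    then show ?thesis using L2.nrm_scale[OF rL, of "- h n"] h(1)[of n] by (simp add: L2.dist_nrm)
   qed
   also have "\<dots> <= h n * L2.nrm v" using R_nrm[OF vL h(1)] h(1)[of n] by (intro mult_left_mono) auto
   finally show ?thesis by simp
  qed
  then show "\<forall>\<^sub>F n in sequentially. norm (L2_dist M (f n) v) <= L2_dist M (R (h n) v) v + h n * L2.nrm v"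
   using L2.dist_nonneg[OF DL[OF f] vL] by simp
 qed
 have cE: "E (f n) (f n) <= form1 M E e e" for n using E1_ge(1)[OF f[of n]] fe[of n] by linarith
 show vD: "v \<in> D" by (rule bounded_energy_limit(1)[OF f cE vL lim])
 \<comment> \<open>\<open>bounded_energy_limit\<close> controls \<open>E\<close> alone. The
   \<open>L^2\<close>-part converges, so up to \<open>d\<close> it can be subtracted from the bound
   along a tail of the sequence.\<close>
 show "form1 M E v v <= form1 M E e e"
 proof (rule field_le_epsilon)
  fix d :: real assume d: "0 < d"
  have "(%n. L2_inner M (f n) (f n)) \<longlonglongrightarrow> L2_inner M v v" by (rule L2.tendsto_B[OF DL[OF f] DL[OF f] vL vL lim lim])
  then have "\<forall>\<^sub>F n in sequentially. L2_inner M v v - d < L2_inner M (f n) (f n)"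
   using d by (intro order_tendstoD(1)) auto
  then obtain N where N: "!!n. n >= N ==> L2_inner M v v - d < L2_inner M (f n) (f n)"
   by (auto simp: eventually_sequentially)
  have "E v v <= form1 M E e e - L2_inner M v v + d"
  proof (rule bounded_energy_limit(2)[of "%n. f (n + N)", OF f _ vL LIMSEQ_ignore_initial_segment[OF lim]])
   fix n show "E (f (n + N)) (f (n + N)) <= form1 M E e e - L2_inner M v v + d"
    using fe[of "n + N"] N[of "n + N"] by (simp add: form1_def)
  qed
  then show "form1 M E v v <= form1 M E e e + d" by (simp add: form1_def)
 qed
qed

text \<open>The reduced function of \<open>1\<close> is the element of minimal \<open>E\<^sub>1\<close>-norm among those \<open>\<ge> 1\<close> on \<open>U\<close>.\<close>

proposition reduced_one:
 assumes one: "(%x. 1) \<in> D"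
 obtains e where "e \<in> D" "is_reduced M D E U (%x. 1) e"
  "!!w. w \<in> D ==> AE x in M. x \<in> U --> 1 <= w x ==> form1 M E e e <= form1 M E w w"
proof -
 let ?K = "{w \<in> D. AE x in M. x \<in> U --> 1 <= w x}"
 obtain e where e: "e \<in> ?K" "!!w. w \<in> ?K ==> form1 M E e e <= form1 M E w w"
 proof (rule E1.minimizer_exists[of ?K])
  show "mid_convex ?K"
   unfolding mid_convex_def
  proof (intro ballI)
   fix u v assume u: "u \<in> ?K" and v: "v \<in> ?K"
   have "AE x in M. x \<in> U --> 1 <= (1/2) * u x + (1/2) * v x"
    using u v by (auto elim!: eventually_elim2)
   then show "(%x. (1/2) * u x + (1/2) * v x) \<in> ?K" using u v E.lincomb[of u v "1/2" "1/2"] by simp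
  qed
  show "?K ~= {}" using one by auto
  fix w u assume w: "!!n. w n \<in> ?K" and u: "u \<in> D" and l: "(%n. form_dist (form1 M E) (w n) u) \<longlonglongrightarrow> 0"
  have wD: "w n \<in> D" for n using w by blast
  have "AE x in M. x \<in> U --> 1 <= u x"
  proof (rule L2_limit_mono[of "%n x. 1" "%x. 1" w, OF const_L2 const_L2 _ DL[OF wD] DL[OF u] tendsto_E1_imp(2)[OF wD u l]])
   show "(%n. L2_dist M (%x. 1) (%x. 1)) \<longlonglongrightarrow> 0" using L2.dist_self[OF const_L2] by simp
  qed (use w in auto)
  then show "u \<in> ?K" using u by simp
 qed auto
 have eD: "e \<in> D" and eU: "AE x in M. x \<in> U --> 1 <= e x" using e(1) by auto
 have "excessive_R e"
 proof (rule superharmonic_imp_excessive_R[OF eD])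
  fix v assume v: "v \<in> D" "!!x. 0 <= v x"
  \<comment> \<open>Adding a nonnegative multiple of \<open>v\<close> keeps the constraint on
    \<open>U\<close>, so the first variation of the minimal norm in this direction is
    nonnegative.\<close>
  have q: "0 <= 2 * form1 M E e v + t * form1 M E v v" if t: "0 < t" for t
  proof -
   have m: "(%x. e x + t * v x) \<in> ?K"
    using eU v t E.lincomb[OF eD v(1), of 1 t] by (auto elim!: eventually_mono intro: add_increasing2)
   have "form1 M E e e <= form1 M E (%x. e x + t * v x) (%x. e x + t * v x)" by (rule e(2)[OF m])
   also have "\<dots> = form1 M E e e + t * (2 * form1 M E e v + t * form1 M E v v)"
    unfolding E1.square_add[OF eD E1.mem_scale[OF v(1)]] E1.scaleR[OF v(1) eD] E1.square_scale[OF v(1)]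
    by (simp add: algebra_simps power2_eq_square)
   finally show ?thesis using t by (simp add: zero_le_mult_iff)
  qed
  show "0 <= form1 M E e v"
  proof (rule field_le_epsilon)
   fix d :: real assume d: "0 < d"
   have n: "0 <= form1 M E v v" by (rule E1.nonneg[OF v(1)])
   have "0 <= 2 * form1 M E e v + d / (form1 M E v v + 1) * form1 M E v v" using q[of "d / (form1 M E v v + 1)"] d n by simp
   also have "d / (form1 M E v v + 1) * form1 M E v v <= d" using d n by (simp add: divide_simps)
   finally show "0 <= form1 M E e v + d" using d by linarith
  qed
 qed
 note exc = this
 have min: "AE x in M. e x <= w x" if w: "one_excessive M D E w" "AE x in M. x \<in> U --> 1 <= w x" for w
 proof -
  \<comment> \<open>A competing \<open>w\<close> is only known to be in \<open>L^2\<close>; its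
    minimum with \<open>e\<close> is excessive and dominated by \<open>e\<close>, hence in the
    domain with no larger \<open>E_1\<close>-norm. The midpoint of \<open>?m\<close> and
    \<open>e\<close> is admissible, so the parallelogram identity makes \<open>?m\<close> and
    \<open>e\<close> agree.\<close>
  let ?m = "%x. min (w x) (e x)"
  have m: "excessive_R ?m" by (rule excessive_R_min[OF one_excessive_imp_excessive_R[OF w(1)] exc])
  have me: "?m \<in> D" "form1 M E ?m ?m <= form1 M E e e" using dominated_excessive[OF m eD] by auto
  let ?c = "%x. (1/2) * ?m x + (1/2) * e x"
  have "?c \<in> ?K"
  proof -
   have "AE x in M. x \<in> U --> 1 <= ?c x" using eU w(2) by eventually_elim (auto simp: min_def)
   moreover have "?c \<in> D" by (rule E.lincomb[OF me(1) eD])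
   ultimately show ?thesis by blast
  qed
  from e(2)[OF this] have "form1 M E e e <= (form1 M E ?m ?m + 2 * form1 M E ?m e + form1 M E e e) / 4"
   unfolding E1.square_add[OF E1.mem_scale[OF me(1)] E1.mem_scale[OF eD]] E1.square_scale[OF me(1)] E1.square_scale[OF eD]
    E1.scaleL[OF me(1) E1.mem_scale[OF eD]] E1.scaleR[OF eD me(1)]
   by (simp add: power2_eq_square field_simps)
  moreover have "a - 2 * b + c <= 0" if "c <= (a + 2 * b + c) / 4" "a <= c" for a b c :: real
   using that by (simp add: field_simps)
  ultimately have "form1 M E (%x. ?m x - e x) (%x. ?m x - e x) <= 0"
   unfolding E1.square_diff[OF me(1) eD] using me(2) by blast
  then have "L2_inner M (%x. ?m x - e x) (%x. ?m x - e x) <= 0"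
   using E1_ge(2)[OF E.mem_diff[OF me(1) eD]] by linarith
  then have "L2_dist M ?m e = 0" using L2.dist_nonneg[OF DL[OF me(1)] DL[OF eD]] by (simp add: L2_dist_def)
  then have "AE x in M. ?m x = e x" using L2_dist_zero_iff[OF DL[OF me(1)] DL[OF eD]] by simp
  then show ?thesis by eventually_elim (simp add: min_def split: if_splits)
 qed
 show thesis
 proof (rule that[OF eD])
  show "is_reduced M D E U (%x. 1) e"
   unfolding is_reduced_def using excessive_R_imp_one_excessive[OF exc] eU min by blast
  show "!!w. w \<in> D ==> AE x in M. x \<in> U --> 1 <= w x ==> form1 M E e e <= form1 M E w w"
   using e(2) by blast
 qed
qed

lemma one_excessive_one:
 assumes one: "(%x. 1) \<in> D" and z: "E (%x. 1) (%x. 1) = 0"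
 shows "one_excessive M D E (%x. 1)"
proof (rule excessive_R_imp_one_excessive, rule superharmonic_imp_excessive_R[OF one])
 fix v assume v: "v \<in> D" "!!x. 0 <= v x"
 have "\<bar>E (%x. 1) v\<bar> <= E.nrm (%x. 1) * E.nrm v" by (rule E.Cauchy_Schwarz[OF one v(1)])
 then have "E (%x. 1) v = 0" using z by (simp add: E.nrm_def)
 moreover have "0 <= L2_inner M (%x. 1) v" using v by (simp add: L2_inner_def)
 ultimately show "0 <= form1 M E (%x. 1) v" by (simp add: form1_def)
qed

text \<open>Any admissible \<open>h\<close> is at most 1, so its reduced function lies below
  \<open>e\<close>; and 1 is itself admissible, so the essential supremum is attained at
  \<open>e\<close>.\<close>

lemma equilibrium_if_reduced_one:
 assumes one: "(%x. 1) \<in> D" and z: "E (%x. 1) (%x. 1) = 0" and e: "e \<in> D" "is_reduced M D E U (%x. 1) e"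
 shows "is_equilibrium M D E U e"
 unfolding is_equilibrium_def is_ess_Sup_def
proof (intro conjI ballI impI)
 let ?G = "{g. \<exists>h\<in>D. one_excessive M D E h \<and> (AE x in M. h x <= 1) \<and> is_reduced M D E U h g}"
 show "e \<in> borel_measurable M" by (rule L2_measurable[OF DL[OF e(1)]])
 fix g assume "g \<in> ?G"
 then obtain h where h: "AE x in M. h x <= 1" "is_reduced M D E U h g" by blast
 have "AE x in M. x \<in> U --> 1 <= e x" using e(2) by (simp add: is_reduced_def)
 with h(1) have "AE x in M. x \<in> U --> h x <= e x" by eventually_elim auto
 then show "AE x in M. g x <= e x" using h(2) e(2) unfolding is_reduced_def by blast
next
 fix w assume "\<forall>g\<in>{g. \<exists>h\<in>D. one_excessive M D E h \<and> (AE x in M. h x <= 1) \<and> is_reduced M D E U h g}. AE x in M. g x <= w x"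
 moreover have "e \<in> {g. \<exists>h\<in>D. one_excessive M D E h \<and> (AE x in M. h x <= 1) \<and> is_reduced M D E U h g}"
  using one one_excessive_one[OF one z] e(2) by auto
 ultimately show "AE x in M. e x <= w x" by blast
qed

text \<open>The reduced functions decrease because their constraint sets shrink. An
  \<open>E_1\<close>-bound contains an \<open>L^2\<close>-bound, and Cauchy-Schwarz against
  \<open>\<phi>\<close> sends the integrals to 0.\<close>

theorem strict_nest_criterion:
 assumes one: "(%x. 1) \<in> D" and z: "E (%x. 1) (%x. 1) = 0"
  and \<phi>: "\<phi> \<in> L2_fun M" "\<forall>x\<in>space M. 0 < \<phi> x"
  and F: "incseq F" "!!k. closedin X (F k)"
  and w: "!!k. w k \<in> D" "!!k. AE x in M. x \<in> topspace X - F k --> 1 <= w k x"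
  and lim: "(%k. form1 M E (w k) (w k)) \<longlonglongrightarrow> 0"
 shows "strict_nest X M \<phi> D E F"
proof -
 let ?U = "%k. topspace X - F k"
 have "EX e. e \<in> D \<and> is_reduced M D E (?U k) (%x. 1) e \<and> form1 M E e e <= form1 M E (w k) (w k)" for k
  using reduced_one[OF one, of "?U k"] w[of k] by metis
 then obtain e where e: "!!k. e k \<in> D" "!!k. is_reduced M D E (?U k) (%x. 1) (e k)"
  "!!k. form1 M E (e k) (e k) <= form1 M E (w k) (w k)" by metis
 have \<phi>0: "AE x in M. 0 <= \<phi> x" using \<phi>(2) by (intro AE_I2) (auto simp: less_imp_le)
 have "decseq (%k. \<integral>x. e k x * \<phi> x \<partial>M)"
 proof (rule decseq_SucI)
  fix k
  have "?U (Suc k) \<subseteq> ?U k" using F(1) by (auto simp: incseq_Suc_iff)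
  moreover have "AE x in M. x \<in> ?U k --> 1 <= e k x" using e(2)[of k] by (simp add: is_reduced_def)
  ultimately have "AE x in M. x \<in> ?U (Suc k) --> 1 <= e k x" by (auto elim!: eventually_mono)
  then have "AE x in M. e (Suc k) x <= e k x" using e(2)[of "Suc k"] e(2)[of k] unfolding is_reduced_def by blast
  then show "(\<integral>x. e (Suc k) x * \<phi> x \<partial>M) <= (\<integral>x. e k x * \<phi> x \<partial>M)"
   using L2_inner_mono[OF DL[OF e(1)] DL[OF e(1)] \<phi>(1) _ \<phi>0] by (simp add: L2_inner_def)
 qed
 moreover have "(%k. \<integral>x. e k x * \<phi> x \<partial>M) \<longlonglongrightarrow> 0"
 proof (rule Lim_null_comparison)
  have "(%k. sqrt (form1 M E (w k) (w k)) * L2.nrm \<phi>) \<longlonglongrightarrow> sqrt 0 * L2.nrm \<phi>" by (intro tendsto_intros lim)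
  then show "(%k. sqrt (form1 M E (w k) (w k)) * L2.nrm \<phi>) \<longlonglongrightarrow> 0" by simp
  have "\<bar>\<integral>x. e k x * \<phi> x \<partial>M\<bar> <= sqrt (form1 M E (w k) (w k)) * L2.nrm \<phi>" for k
  proof -
   have "L2_inner M (e k) (e k) <= form1 M E (w k) (w k)" using E1_ge(2)[OF e(1)[of k]] e(3)[of k] by linarith
   then have "L2.nrm (e k) <= sqrt (form1 M E (w k) (w k))" by (simp add: L2.nrm_def)
   then show ?thesis
    using L2.Cauchy_Schwarz[OF DL[OF e(1)] \<phi>(1), of k] mult_right_mono[OF _ L2.nrm_nonneg[OF \<phi>(1)]]
    unfolding L2_inner_def by (meson order_trans)
  qed
  then show "\<forall>\<^sub>F k in sequentially. norm (\<integral>x. e k x * \<phi> x \<partial>M) <= sqrt (form1 M E (w k) (w k)) * L2.nrm \<phi>" by simp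
 qed
 ultimately show ?thesis
  unfolding strict_nest_def using F equilibrium_if_reduced_one[OF one z e(1,2)] by blast
qed

end

section \<open>Closures of closable forms\<close>

lemma semi_ip_subset:
 assumes "semi_ip H B" "D \<subseteq> H" "!!u v a b. u \<in> D ==> v \<in> D ==> (%x. a * u x + b * v x) \<in> D"
 shows "semi_ip D B"
proof -
 interpret semi_ip H B by fact
 show ?thesis using assms(2,3) by unfold_locales (auto simp: subset_iff intro: sym lin nonneg)
qed

lemma semi_ip_sum:
 assumes "semi_ip H B" "semi_ip H B'" shows "semi_ip H (%u v. B u v + B' u v)"
proof -
 interpret a: semi_ip H B by fact
 interpret b: semi_ip H B' by fact
 show ?thesis
  by unfold_locales (auto simp: a.lincomb a.lin b.lin a.sym b.sym a.nonneg b.nonneg algebra_simps)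
qed

lemma (in semi_ip) Cauchy_energy_convergent:
 assumes f: "!!n. f n \<in> H" and c: "Cauchy_wrt B f" shows "convergent (%n. B (f n) (f n))"
proof -
 have "Cauchy (%n. nrm (f n))"
  unfolding Cauchy_def
 proof (intro allI impI)
  fix e :: real assume "0 < e"
  then obtain N where N: "!!m n. m >= N ==> n >= N ==> form_dist B (f m) (f n) < e"
   using c unfolding Cauchy_wrt_def by meson
  show "EX N. \<forall>m\<ge>N. \<forall>n\<ge>N. dist (nrm (f m)) (nrm (f n)) < e"
  proof (intro exI allI impI)
   fix m n assume "N <= m" "N <= n"
   then show "dist (nrm (f m)) (nrm (f n)) < e"
    using N[of m n] nrm_diff_le[OF f f, of m n] by (simp add: dist_real_def)
  qed
 qed
 then have "convergent (%n. nrm (f n))" by (simp add: Cauchy_convergent)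
 then have "convergent (%n. (nrm (f n))\<^sup>2)" by (auto simp: convergent_def intro: tendsto_power)
 then show ?thesis by (simp add: nrm_sq f)
qed

locale closable_form = prob_L2 M for M :: "'a measure" +
 fixes C :: "('a => real) set" and E0 :: "('a => real) => ('a => real) => real"
 assumes C_L2: "C \<subseteq> L2_fun M" and C_ne: "C ~= {}" and E0_ip: "semi_ip C E0"
  and closable: "(!!n. f n \<in> C) ==> Cauchy_wrt E0 f ==> (%n. L2_dist M (f n) (%x. 0)) \<longlonglongrightarrow> 0 ==>
    (%n. E0 (f n) (f n)) \<longlonglongrightarrow> 0"
begin

sublocale E0: semi_ip C E0 by (rule E0_ip)

abbreviation "D \<equiv> closure_dom M C E0"
abbreviation "E \<equiv> closure_form M C E0"
abbreviation "appr \<equiv> approximates M C E0"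

lemma CL: "f \<in> C ==> f \<in> L2_fun M" using C_L2 by blast

lemma apprD:
 assumes "appr f u" shows "!!n. f n \<in> C" "Cauchy_wrt E0 f" "(%n. L2_dist M (f n) u) \<longlonglongrightarrow> 0"
 using assms by (auto simp: approximates_def Cauchy_wrt_def)

lemma apprI: "(!!n. f n \<in> C) ==> Cauchy_wrt E0 f ==> (%n. L2_dist M (f n) u) \<longlonglongrightarrow> 0 ==> appr f u"
 by (auto simp: approximates_def Cauchy_wrt_def)

lemma appr_lincomb:
 assumes f: "appr f u" "u \<in> L2_fun M" and g: "appr g v" "v \<in> L2_fun M"
 shows "appr (%n x. a * f n x + b * g n x) (%x. a * u x + b * v x)"
proof (rule apprI)
 note C = apprD(1)[OF f(1)] apprD(1)[OF g(1)]
 show "(%x. a * f n x + b * g n x) \<in> C" for n by (rule E0.lincomb[OF C])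
 show "Cauchy_wrt E0 (%n x. a * f n x + b * g n x)"
  by (rule E0.Cauchy_lincomb[OF C apprD(2)[OF f(1)] apprD(2)[OF g(1)]])
 show "(%n. L2_dist M (%x. a * f n x + b * g n x) (%x. a * u x + b * v x)) \<longlonglongrightarrow> 0"
  by (rule L2.tendsto_lincomb[OF CL[OF C(1)] CL[OF C(2)] f(2) g(2) apprD(3)[OF f(1)] apprD(3)[OF g(1)]])
qed

lemma appr_const: assumes f: "f \<in> C" shows "appr (%_. f) f"
proof (rule apprI)
 show "(%n. L2_dist M f f) \<longlonglongrightarrow> 0" using L2.dist_self[OF CL[OF f]] by simp
 show "Cauchy_wrt E0 (%_. f)" using E0.dist_self[OF f] by (simp add: Cauchy_wrt_def)
qed (rule f)

lemma appr_cong_AE: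
 assumes f: "appr f u" and u: "u \<in> L2_fun M" "u' \<in> L2_fun M" "AE x in M. u x = u' x"
 shows "appr f u'"
proof (rule apprI)
 show "(%n. L2_dist M (f n) u') \<longlonglongrightarrow> 0"
 proof (rule Lim_null_comparison[OF _ apprD(3)[OF f]])
  have "L2_dist M (f n) u' <= L2_dist M (f n) u" for n
   using L2.dist_triangle[OF CL[OF apprD(1)[OF f]] u(1,2), of n] L2_dist_zero_iff[OF u(1,2)] u(3) by simp
  then show "\<forall>\<^sub>F n in sequentially. norm (L2_dist M (f n) u') <= L2_dist M (f n) u"
   using L2.dist_nonneg[OF CL[OF apprD(1)[OF f]] u(2)] by simp
 qed
qed (use apprD[OF f] in auto)

text \<open>Polarization reduces the mixed terms to energies, which converge along sequences that
  are Cauchy in energy.\<close>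

lemma E0_convergent:
 assumes f: "appr f u" "u \<in> L2_fun M" and g: "appr g v" "v \<in> L2_fun M"
 shows "convergent (%n. E0 (f n) (g n))"
proof -
 note fC = apprD(1)[OF f(1)] and gC = apprD(1)[OF g(1)]
 have "convergent (%n. E0 (%x. 1 * f n x + 1 * g n x) (%x. 1 * f n x + 1 * g n x))"
  "convergent (%n. E0 (%x. 1 * f n x + (-1) * g n x) (%x. 1 * f n x + (-1) * g n x))"
  by (intro E0.Cauchy_energy_convergent apprD[OF appr_lincomb[OF f g]])+
 then have "convergent (%n. 1/4 * (E0 (%x. f n x + g n x) (%x. f n x + g n x) - E0 (%x. f n x - g n x) (%x. f n x - g n x)))"
  by (intro convergent_mult convergent_diff convergent_const) simp_all
 moreover have "1/4 * (E0 (%x. f n x + g n x) (%x. f n x + g n x) - E0 (%x. f n x - g n x) (%x. f n x - g n x)) = E0 (f n) (g n)" for n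
  by (simp add: E0.square_add E0.square_diff fC gC)
 ultimately show ?thesis by simp
qed

lemma appr_unique:
 assumes f: "appr f u" "appr f' u" and u: "u \<in> L2_fun M"
 shows "(%n. form_dist E0 (f n) (f' n)) \<longlonglongrightarrow> 0"
proof -
 have a: "appr (%n x. 1 * f n x + (-1) * f' n x) (%x. 1 * u x + (-1) * u x)"
  by (rule appr_lincomb[OF f(1) u f(2) u])
 have "(%n. E0 (%x. 1 * f n x + (-1) * f' n x) (%x. 1 * f n x + (-1) * f' n x)) \<longlonglongrightarrow> 0"
  by (rule closable) (use apprD[OF a] in simp_all)
 then have "(%n. sqrt (E0 (%x. f n x - f' n x) (%x. f n x - f' n x))) \<longlonglongrightarrow> sqrt 0"
  by (intro tendsto_real_sqrt) simp
 then show ?thesis by (simp add: form_dist_def)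
qed

lemma bounded_energy_appr:
 assumes f: "appr f u" obtains K where "!!n. E0.nrm (f n) <= K" "0 <= K"
proof -
 have "convergent (%n. E0 (f n) (f n))" by (rule E0.Cauchy_energy_convergent[OF apprD(1,2)[OF f]])
 then have "Bseq (%n. E0 (f n) (f n))" by (rule convergent_imp_Bseq)
 then obtain K where K: "!!n. norm (E0 (f n) (f n)) <= K" "0 < K" by (auto simp: Bseq_def)
 show thesis
 proof (rule that[of "sqrt K"])
  show "E0.nrm (f n) <= sqrt K" for n unfolding E0.nrm_def using K(1)[of n] by (simp add: abs_le_iff)
 qed (use K in simp)
qed

text \<open>Makes the definite description in \<open>closure_form\<close> meaningful: two
  approximating sequences of the same function become close in energy by closability, while all
  energies stay bounded.\<close>

lemma E_lim:
 assumes f: "appr f u" and u: "u \<in> L2_fun M" and g: "appr g v" and v: "v \<in> L2_fun M"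
 shows "(%n. E0 (f n) (g n)) \<longlonglongrightarrow> E u v"
proof -
 obtain l where l: "(%n. E0 (f n) (g n)) \<longlonglongrightarrow> l" using E0_convergent[OF f u g v] by (auto simp: convergent_def)
 have all: "(%n. E0 (f' n) (g' n)) \<longlonglongrightarrow> l" if f': "appr f' u" and g': "appr g' v" for f' g'
 proof -
  obtain K1 where K1: "!!n. E0.nrm (f n) <= K1" "0 <= K1" by (rule bounded_energy_appr[OF f]) blast
  obtain K2 where K2: "!!n. E0.nrm (g' n) <= K2" "0 <= K2" by (rule bounded_energy_appr[OF g']) blast
  note C = apprD(1)[OF f] apprD(1)[OF f'] apprD(1)[OF g] apprD(1)[OF g']
  have "\<bar>E0 (f' n) (g' n) - E0 (f n) (g n)\<bar> <= form_dist E0 (f' n) (f n) * K2 + K1 * form_dist E0 (g' n) (g n)" for n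
  proof -
   have "E0 (f' n) (g' n) - E0 (f n) (g n) = E0 (%x. f' n x - f n x) (g' n) + E0 (f n) (%x. g' n x - g n x)"
    by (simp add: E0.diffL E0.diffR C E0.mem)
   moreover have "\<bar>E0 (%x. f' n x - f n x) (g' n)\<bar> <= form_dist E0 (f' n) (f n) * K2"
    unfolding E0.dist_nrm
    by (rule order_trans[OF E0.Cauchy_Schwarz mult_left_mono[OF K2(1)]]) (auto intro: E0.mem C E0.nrm_nonneg)
   moreover have "\<bar>E0 (f n) (%x. g' n x - g n x)\<bar> <= K1 * form_dist E0 (g' n) (g n)"
    unfolding E0.dist_nrm
    by (rule order_trans[OF E0.Cauchy_Schwarz mult_right_mono[OF K1(1)]]) (auto intro: E0.mem C E0.nrm_nonneg)
   ultimately show ?thesis by linarith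
  qed
  then have b: "norm (E0 (f' n) (g' n) - E0 (f n) (g n)) <= form_dist E0 (f' n) (f n) * K2 + K1 * form_dist E0 (g' n) (g n)" for n
   unfolding real_norm_def .
  have "(%n. form_dist E0 (f' n) (f n) * K2 + K1 * form_dist E0 (g' n) (g n)) \<longlonglongrightarrow> 0 * K2 + K1 * 0"
   by (intro tendsto_add tendsto_mult_left tendsto_mult_right appr_unique[OF f' f u] appr_unique[OF g' g v])
  then have z: "(%n. form_dist E0 (f' n) (f n) * K2 + K1 * form_dist E0 (g' n) (g n)) \<longlonglongrightarrow> 0"
   by (simp only: mult_zero_left mult_zero_right add_0)
  have "(%n. E0 (f' n) (g' n) - E0 (f n) (g n)) \<longlonglongrightarrow> 0"
   by (rule Lim_null_comparison[OF always_eventually[OF allI[OF b]] z])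
  from tendsto_add[OF this l] show ?thesis by simp
 qed
 have "E u v = l"
  unfolding closure_form_def
 proof (rule the_equality)
  show "ALL f g. appr f u \<and> appr g v --> (%n. E0 (f n) (g n)) \<longlonglongrightarrow> l" using all by blast
  show "l' = l" if "ALL f g. appr f u \<and> appr g v --> (%n. E0 (f n) (g n)) \<longlonglongrightarrow> l'" for l'
   using that f g l LIMSEQ_unique by blast
 qed
 with l show ?thesis by simp
qed

lemma D_iff: "u \<in> D \<longleftrightarrow> u \<in> L2_fun M \<and> (EX f. appr f u)"
 by (simp add: closure_dom_def)

lemma C_D: assumes f: "f \<in> C" shows "f \<in> D"
proof -
 have "EX g. appr g f" by (rule exI, rule appr_const[OF f])
 then show ?thesis using CL[OF f] by (simp add: D_iff)
qed

lemma E_eq_E0: assumes "f \<in> C" "g \<in> C" shows "E f g = E0 f g"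
 using E_lim[OF appr_const[OF assms(1)] CL[OF assms(1)] appr_const[OF assms(2)] CL[OF assms(2)]]
 by (simp add: LIMSEQ_const_iff)

lemma E_semi_ip: "semi_ip D E"
proof
 fix u v w a b assume u: "u \<in> D" and v: "v \<in> D"
 obtain f where f: "appr f u" "u \<in> L2_fun M" using u by (auto simp: D_iff)
 obtain g where g: "appr g v" "v \<in> L2_fun M" using v by (auto simp: D_iff)
 have fg: "appr (%n x. a * f n x + b * g n x) (%x. a * u x + b * v x)" "(%x. a * u x + b * v x) \<in> L2_fun M"
  using appr_lincomb[OF f g] L2.lincomb[OF f(2) g(2)] by auto
 show "(%x. a * u x + b * v x) \<in> D" unfolding D_iff using fg by (intro conjI exI)
 have "(%n. E0 (f n) (g n)) \<longlonglongrightarrow> E v u"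
  using E_lim[OF g f] E0.sym[OF apprD(1)[OF f(1)] apprD(1)[OF g(1)]] by simp
 then show "E u v = E v u" using E_lim[OF f g] LIMSEQ_unique by blast
 assume w: "w \<in> D"
 obtain h where h: "appr h w" "w \<in> L2_fun M" using w by (auto simp: D_iff)
 have "(%n. a * E0 (f n) (h n) + b * E0 (g n) (h n)) \<longlonglongrightarrow> a * E u w + b * E v w"
  by (intro tendsto_intros E_lim f g h)
 moreover have "(%n. a * E0 (f n) (h n) + b * E0 (g n) (h n)) \<longlonglongrightarrow> E (%x. a * u x + b * v x) w"
  using E_lim[OF fg h] by (simp add: E0.lin apprD(1)[OF f(1)] apprD(1)[OF g(1)] apprD(1)[OF h(1)])
 ultimately show "E (%x. a * u x + b * v x) w = a * E u w + b * E v w" using LIMSEQ_unique by blast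
next
 fix u assume u: "u \<in> D"
 obtain f where f: "appr f u" "u \<in> L2_fun M" using u by (auto simp: D_iff)
 show "0 <= E u u"
  by (rule LIMSEQ_le_const[OF E_lim[OF f f]]) (use E0.nonneg[OF apprD(1)[OF f(1)]] in auto)
qed

lemma D_sub_L2: "D \<subseteq> L2_fun M" by (auto simp: D_iff)

lemma form1_semi_ip: "semi_ip D (form1 M E)"
proof -
 interpret E: semi_ip D E by (rule E_semi_ip)
 have "semi_ip D (L2_inner M)" by (rule semi_ip_subset[OF L2_semi_ip D_sub_L2 E.lincomb])
 from semi_ip_sum[OF E_semi_ip this] show ?thesis by (simp add: form1_def[abs_def])
qed

lemma form1_dist_le:
 assumes u: "u \<in> D" and v: "v \<in> D"
 shows "form_dist E u v <= form_dist (form1 M E) u v" "L2_dist M u v <= form_dist (form1 M E) u v"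
  "form_dist (form1 M E) u v <= form_dist E u v + L2_dist M u v"
proof -
 interpret E: semi_ip D E by (rule E_semi_ip)
 have d: "(%x. u x - v x) \<in> D" by (rule E.mem_diff[OF u v])
 then have n: "0 <= E (%x. u x - v x) (%x. u x - v x)" "0 <= L2_inner M (%x. u x - v x) (%x. u x - v x)"
  using E.nonneg L2.nonneg D_sub_L2 by auto
 then show "form_dist E u v <= form_dist (form1 M E) u v" "L2_dist M u v <= form_dist (form1 M E) u v"
  by (auto simp: form_dist_def L2_dist_def form1_def)
 show "form_dist (form1 M E) u v <= form_dist E u v + L2_dist M u v"
  unfolding form_dist_def L2_dist_def form1_def using n by (rule sqrt_add_le_add_sqrt)
qed

lemma appr_form_dist:
 assumes f: "appr f u" and u: "u \<in> L2_fun M"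
 shows "(%n. form_dist E (f n) u) \<longlonglongrightarrow> 0" "(%n. form_dist (form1 M E) (f n) u) \<longlonglongrightarrow> 0"
proof -
 interpret E: semi_ip D E by (rule E_semi_ip)
 have uD: "u \<in> D" unfolding D_iff using f u by (intro conjI exI)
 note fC = apprD(1)[OF f]
 show 1: "(%n. form_dist E (f n) u) \<longlonglongrightarrow> 0"
 proof (rule LIMSEQ_I)
  fix e :: real assume e: "0 < e"
  obtain N where N: "!!m n. m >= N ==> n >= N ==> form_dist E0 (f m) (f n) < e / 2"
   using apprD(2)[OF f, unfolded Cauchy_wrt_def, rule_format, of "e / 2"] e by auto
  have "form_dist E (f n) u <= e / 2" if n: "n >= N" for n
  proof -
   have a: "appr (%m x. 1 * f n x + (-1) * f m x) (%x. 1 * f n x + (-1) * u x)"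
    by (rule appr_lincomb[OF appr_const[OF fC] CL[OF fC] f u])
   have L: "(%x. 1 * f n x + (-1) * u x) \<in> L2_fun M" by (rule L2.lincomb[OF CL[OF fC] u])
   have "(%m. form_dist E0 (f n) (f m)) \<longlonglongrightarrow> form_dist E (f n) u"
    using tendsto_real_sqrt[OF E_lim[OF a L a L]] by (simp add: form_dist_def)
   then show ?thesis
   proof (rule LIMSEQ_le_const2)
    show "EX N. \<forall>m\<ge>N. form_dist E0 (f n) (f m) <= e / 2" using N[OF n] less_imp_le by blast
   qed
  qed
  then have "norm (form_dist E (f n) u - 0) < e" if "n >= N" for n
   using E.dist_nonneg[OF C_D[OF fC] uD, of n] e that by fastforce
  then show "EX no. \<forall>n\<ge>no. norm (form_dist E (f n) u - 0) < e" by blast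
 qed
 show "(%n. form_dist (form1 M E) (f n) u) \<longlonglongrightarrow> 0"
 proof (rule Lim_null_comparison)
  show "(%n. form_dist E (f n) u + L2_dist M (f n) u) \<longlonglongrightarrow> 0" using tendsto_add[OF 1 apprD(3)[OF f]] by simp
  show "\<forall>\<^sub>F n in sequentially. norm (form_dist (form1 M E) (f n) u) <= form_dist E (f n) u + L2_dist M (f n) u"
   using form1_dist_le(3)[OF C_D[OF fC] uD] semi_ip.dist_nonneg[OF form1_semi_ip C_D[OF fC] uD] by simp
 qed
qed

lemma C_dense:
 assumes u: "u \<in> D" and e: "0 < e" obtains f where "f \<in> C" "form_dist (form1 M E) f u < e"
proof -
 obtain f where f: "appr f u" "u \<in> L2_fun M" using u by (auto simp: D_iff)
 from order_tendstoD(2)[OF appr_form_dist(2)[OF f] e] obtain n where "form_dist (form1 M E) (f n) u < e"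
  by (auto simp: eventually_sequentially)
 then show thesis using that apprD(1)[OF f(1)] by blast
qed

sublocale closed_form M D E
proof (intro closed_form.intro closed_form_axioms.intro)
 show "prob_L2 M" by unfold_locales
 show "D \<subseteq> L2_fun M" by (rule D_sub_L2)
 show "D ~= {}" using C_ne C_D by blast
 show "v \<in> D" if "u \<in> D" "v \<in> L2_fun M" "AE x in M. u x = v x" for u v
  using that appr_cong_AE by (auto simp: D_iff)
 show "E u v = E u' v" if a: "u \<in> D" "u' \<in> D" "v \<in> D" "AE x in M. u x = u' x" for u u' v
 proof -
  obtain f where f: "appr f u" "u \<in> L2_fun M" using a(1) by (auto simp: D_iff)
  obtain g where g: "appr g v" "v \<in> L2_fun M" using a(3) by (auto simp: D_iff)
  have u': "u' \<in> L2_fun M" using a(2) D_sub_L2 by blast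
  show ?thesis using E_lim[OF f g] E_lim[OF appr_cong_AE[OF f u' a(4)] u' g] LIMSEQ_unique by blast
 qed
 show "semi_ip D E" by (rule E_semi_ip)
 fix f assume f: "!!n. f n \<in> D" and c: "Cauchy_wrt (form1 M E) f"
 interpret E1: semi_ip D "form1 M E" by (rule form1_semi_ip)
 \<comment> \<open>Replacing each \<open>f n\<close> by an element of the core within
   \<open>1 / (n + 1)\<close> reduces completeness of the closure to that of
   \<open>L^2\<close>.\<close>
 have "\<exists>g\<in>C. form_dist (form1 M E) g (f n) < 1 / real (Suc n)" for n
  using C_dense[OF f[of n], of "1 / real (Suc n)"] by auto
 then obtain g where g: "!!n. g n \<in> C" "!!n. form_dist (form1 M E) (g n) (f n) < 1 / real (Suc n)" by metis
 have gf: "(%n. form_dist (form1 M E) (g n) (f n)) \<longlonglongrightarrow> 0"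
 proof (rule Lim_null_comparison[OF _ LIMSEQ_inverse_real_of_nat])
  show "\<forall>\<^sub>F n in sequentially. norm (form_dist (form1 M E) (g n) (f n)) <= inverse (real (Suc n))"
   using g(2) E1.dist_nonneg[OF C_D[OF g(1)] f] by (simp add: inverse_eq_divide less_imp_le)
 qed
 have cg: "Cauchy_wrt (form1 M E) g"
  unfolding Cauchy_wrt_def
 proof (intro allI impI)
  fix e :: real assume e: "0 < e"
  obtain N1 where N1: "!!m n. m >= N1 ==> n >= N1 ==> form_dist (form1 M E) (f m) (f n) < e / 3"
   using c e unfolding Cauchy_wrt_def by (meson divide_pos_pos zero_less_numeral)
  obtain N2 where N2: "!!n. n >= N2 ==> form_dist (form1 M E) (g n) (f n) < e / 3"
   using order_tendstoD(2)[OF gf, of "e/3"] e by (auto simp: eventually_sequentially)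
  show "EX N. \<forall>m\<ge>N. \<forall>n\<ge>N. form_dist (form1 M E) (g m) (g n) < e"
  proof (intro exI[of _ "max N1 N2"] allI impI)
   fix m n assume mn: "m >= max N1 N2" "n >= max N1 N2"
   have "form_dist (form1 M E) (g m) (g n) <= form_dist (form1 M E) (g m) (f m) + form_dist (form1 M E) (f m) (g n)"
    by (intro E1.dist_triangle C_D g f)
   also have "form_dist (form1 M E) (f m) (g n) <= form_dist (form1 M E) (f m) (f n) + form_dist (form1 M E) (f n) (g n)"
    by (intro E1.dist_triangle C_D g f)
   finally show "form_dist (form1 M E) (g m) (g n) < e"
    using N1[of m n] N2[of m] N2[of n] mn E1.dist_commute[OF f[of n] C_D[OF g(1)[of n]]] by simp
  qed
 qed
 have "Cauchy_wrt (L2_inner M) g"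
  using cg form1_dist_le(2)[OF C_D[OF g(1)] C_D[OF g(1)]]
  unfolding Cauchy_wrt_def L2_dist_form[symmetric] by (meson le_less_trans)
 from L2_complete[OF CL[OF g(1)] this] obtain u where u: "u \<in> L2_fun M" "(%n. L2_dist M (g n) u) \<longlonglongrightarrow> 0" by blast
 have "form_dist E0 (g m) (g n) <= form_dist (form1 M E) (g m) (g n)" for m n
  using form1_dist_le(1)[OF C_D[OF g(1)] C_D[OF g(1)], of m n] E_eq_E0[OF E0.mem_diff[OF g(1) g(1)] E0.mem_diff[OF g(1) g(1)]]
  by (simp add: form_dist_def)
 then have "Cauchy_wrt E0 g" using cg unfolding Cauchy_wrt_def by (meson le_less_trans)
 then have a: "appr g u" using g(1) u(2) by (intro apprI)
 have uD: "u \<in> D" unfolding D_iff using a u(1) by (intro conjI exI)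
 have "(%n. form_dist (form1 M E) (f n) u) \<longlonglongrightarrow> 0"
 proof (rule Lim_null_comparison)
  show "(%n. form_dist (form1 M E) (g n) (f n) + form_dist (form1 M E) (g n) u) \<longlonglongrightarrow> 0"
   using tendsto_add[OF gf appr_form_dist(2)[OF a u(1)]] by simp
  have "form_dist (form1 M E) (f n) u <= form_dist (form1 M E) (g n) (f n) + form_dist (form1 M E) (g n) u" for n
   using E1.dist_triangle[OF f[of n] C_D[OF g(1)[of n]] uD] E1.dist_commute[OF f[of n] C_D[OF g(1)[of n]]] by simp
  then show "\<forall>\<^sub>F n in sequentially. norm (form_dist (form1 M E) (f n) u) <= form_dist (form1 M E) (g n) (f n) + form_dist (form1 M E) (g n) u"
   using E1.dist_nonneg[OF f uD] by simp
 qed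
 with uD show "\<exists>u\<in>D. (%n. form_dist (form1 M E) (f n) u) \<longlonglongrightarrow> 0" by blast
qed

lemma C_dense_sum:
 assumes u: "u \<in> D" and e: "0 < e" obtains f where "f \<in> C" "L2_dist M u f + form_dist E u f < e"
proof -
 obtain f where f: "f \<in> C" "form_dist (form1 M E) f u < e / 2" using C_dense[OF u, of "e/2"] e by auto
 have "L2_dist M u f <= form_dist (form1 M E) f u" "form_dist E u f <= form_dist (form1 M E) f u"
  using dist_le_E1[OF u C_D[OF f(1)]] E1.dist_commute[OF u C_D[OF f(1)]] by auto
 then show thesis using that[OF f(1)] f(2) by linarith
qed

text \<open>The unit contraction is not smooth and leads out of the core, so it is reached through
  smooth contractions \<open>\<phi> n\<close>. The bounded energy argument is used twice: on
  elements of the core, then along a sequence approximating \<open>u\<close>.\<close>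

lemma closure_clamp:
 fixes \<phi> :: "nat => real => real"
 assumes contr: "!!n f. f \<in> C ==> (%x. \<phi> n (f x)) \<in> C" "!!n f. f \<in> C ==> E0 (%x. \<phi> n (f x)) (%x. \<phi> n (f x)) <= E0 f f"
  and lim: "!!t. (%n. \<phi> n t) \<longlonglongrightarrow> min 1 (max 0 t)" and bnd: "!!n t. \<bar>\<phi> n t\<bar> <= \<bar>t\<bar>"
  and u: "u \<in> D"
 shows "(%x. min 1 (max 0 (u x))) \<in> D" "E (%x. min 1 (max 0 (u x))) (%x. min 1 (max 0 (u x))) <= E u u"
proof -
 define c where "c v x = min 1 (max 0 (v x :: real))" for v :: "'a => real" and x
 have cL: "c v \<in> L2_fun M" if v: "v \<in> L2_fun M" for v
  unfolding c_def using v by (intro L2_dominated[OF _ v]) (auto simp: L2_fun_def min_def max_def)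
 have 1: "c f \<in> D \<and> E (c f) (c f) <= E0 f f" if f: "f \<in> C" for f
 proof -
  have m: "(%x. \<phi> n (f x)) \<in> borel_measurable M" for n by (rule L2_measurable[OF CL[OF contr(1)[OF f]]])
  have l: "(%n. L2_dist M (%x. \<phi> n (f x)) (c f)) \<longlonglongrightarrow> 0"
   by (rule L2_bounded_convergence(2)[OF m L2_measurable[OF cL[OF CL[OF f]]] _ _ CL[OF f]])
    (use lim bnd in \<open>auto simp: c_def\<close>)
  have e: "E (%x. \<phi> n (f x)) (%x. \<phi> n (f x)) <= E0 f f" for n
   using contr[OF f] E_eq_E0 by simp
  show ?thesis
   using bounded_energy_limit(1)[OF C_D[OF contr(1)[OF f]] e cL[OF CL[OF f]] l]
    bounded_energy_limit(2)[OF C_D[OF contr(1)[OF f]] e cL[OF CL[OF f]] l] by (rule conjI)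
 qed
 obtain f where f: "appr f u" "u \<in> L2_fun M" using u by (auto simp: D_iff)
 note fC = apprD(1)[OF f(1)]
 have l: "(%n. L2_dist M (c (f n)) (c u)) \<longlonglongrightarrow> 0"
 proof (rule Lim_null_comparison[OF _ apprD(3)[OF f(1)]])
  have "L2_inner M (%x. c (f n) x - c u x) (%x. c (f n) x - c u x) <= L2_inner M (%x. f n x - u x) (%x. f n x - u x)" for n
   unfolding L2_inner_def
  proof (intro integral_mono L2_integrable_mult L2.mem_diff cL f(2) CL[OF fC])
   fix x
   have "\<bar>c (f n) x - c u x\<bar> <= \<bar>f n x - u x\<bar>" by (auto simp: c_def min_def max_def)
   then show "(c (f n) x - c u x) * (c (f n) x - c u x) <= (f n x - u x) * (f n x - u x)"
    by (simp only: power2_eq_square[symmetric] abs_le_square_iff)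
  qed
  then have "L2_dist M (c (f n)) (c u) <= L2_dist M (f n) u" for n unfolding L2_dist_def by (rule real_sqrt_le_mono)
  then show "\<forall>\<^sub>F n in sequentially. norm (L2_dist M (c (f n)) (c u)) <= L2_dist M (f n) u"
   using L2.dist_nonneg[OF cL[OF CL[OF fC]] cL[OF f(2)]] by simp
 qed
 have *: "c u \<in> D \<and> E (c u) (c u) <= E u u + e" if e: "0 < e" for e
 proof -
  have "\<forall>\<^sub>F n in sequentially. E0 (f n) (f n) < E u u + e"
   using E_lim[OF f f] e by (intro order_tendstoD(2)) auto
  then obtain N where N: "!!n. n >= N ==> E0 (f n) (f n) < E u u + e" by (auto simp: eventually_sequentially)
  have b: "E (c (f (n + N))) (c (f (n + N))) <= E u u + e" for n using 1[OF fC[of "n + N"]] N[of "n + N"] by simp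
  have d: "c (f (n + N)) \<in> D" for n using 1[OF fC[of "n + N"]] by simp
  show ?thesis
   using bounded_energy_limit(1)[of "%n. c (f (n + N))", OF d b cL[OF f(2)] LIMSEQ_ignore_initial_segment[OF l]]
    bounded_energy_limit(2)[of "%n. c (f (n + N))", OF d b cL[OF f(2)] LIMSEQ_ignore_initial_segment[OF l]] by (rule conjI)
 qed
 have "c u \<in> D" using *[OF zero_less_one] by (rule conjunct1)
 moreover have "E (c u) (c u) <= E u u" by (rule field_le_epsilon) (use * in blast)
 ultimately have "c u \<in> D" "E (c u) (c u) <= E u u" by this+
 then show "(%x. min 1 (max 0 (u x))) \<in> D" "E (%x. min 1 (max 0 (u x))) (%x. min 1 (max 0 (u x))) <= E u u"
  unfolding c_def .
qed

end

lemma (in dirichlet_form) symmetric_Dirichlet_form: "symmetric_Dirichlet_form M D E"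
 unfolding symmetric_Dirichlet_form_def
proof (intro conjI)
 show "ALL f. (ALL n. f n \<in> D) \<and> (\<forall>e>0. EX N. \<forall>m\<ge>N. \<forall>n\<ge>N. form_dist (form1 M E) (f m) (f n) < e) -->
   (\<exists>u\<in>D. (%n. form_dist (form1 M E) (f n) u) \<longlonglongrightarrow> 0)"
  using D_complete unfolding Cauchy_wrt_def by blast
 show "\<forall>u\<in>D. \<forall>v\<in>L2_fun M. (AE x in M. u x = v x) --> v \<in> D"
  by (intro ballI impI) (rule D_AE)
 show "\<forall>u\<in>D. \<forall>v\<in>D. ALL a b. (%x. a * u x + b * v x) \<in> D"
  by (intro ballI allI) (rule E.lincomb)
 show "\<forall>f\<in>L2_fun M. \<forall>e>0. \<exists>u\<in>D. L2_dist M f u < e"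
  by (intro ballI allI impI) (rule D_dense)
 show "\<forall>u\<in>D. \<forall>u'\<in>D. \<forall>v\<in>D. (AE x in M. u x = u' x) --> E u v = E u' v"
  by (intro ballI impI) (rule E_AE)
 show "\<forall>u\<in>D. \<forall>v\<in>D. E u v = E v u"
  by (intro ballI) (rule E.sym)
 show "\<forall>u\<in>D. \<forall>v\<in>D. \<forall>w\<in>D. ALL a b. E (%x. a * u x + b * v x) w = a * E u w + b * E v w"
  by (intro ballI allI) (rule E.lin)
qed (simp_all add: D_L2 E.nonneg clamp)

section \<open>Smooth functions of one variable\<close>

text \<open>Quantifying over the derivative, instead of computing it, makes each closure property an
  induction on the order.\<close>

primrec Ck :: "nat => (real => real) => bool" where
 "Ck 0 f \<longleftrightarrow> continuous_on UNIV f"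
| "Ck (Suc k) f \<longleftrightarrow> (EX f'. (ALL x. (f has_real_derivative f' x) (at x)) \<and> Ck k f')"

lemma Ck_Suc_imp: "Ck (Suc k) f ==> Ck k f"
proof (induction k arbitrary: f)
 case 0
 then show ?case by (auto intro: continuous_at_imp_continuous_on DERIV_isCont)
next
 case (Suc k)
 from Suc.prems obtain f' where f': "!!x. (f has_real_derivative f' x) (at x)" "Ck (Suc k) f'"
  unfolding Ck.simps(2)[of "Suc k" f] by blast
 then show ?case using Suc.IH by auto
qed

lemma Ck_SucI: "(!!x. (f has_real_derivative f' x) (at x)) ==> Ck k f' ==> Ck (Suc k) f"
 by auto

lemma Ck_SucE:
 assumes "Ck (Suc k) f" obtains f' where "!!x. (f has_real_derivative f' x) (at x)" "Ck k f'" "Ck k f"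
 using assms Ck_Suc_imp[OF assms] by auto

lemma Ck_const: "Ck k (%x. c)"
proof (induction k arbitrary: c)
 case (Suc k)
 show ?case by (rule Ck_SucI[OF DERIV_const Suc])
qed simp

lemma Ck_ident: "Ck k (%x. x)"
proof (cases k)
 case (Suc n)
 have "Ck (Suc n) (%x. x)" by (rule Ck_SucI[OF DERIV_ident Ck_const])
 then show ?thesis using Suc by simp
qed simp

lemma Ck_add: "Ck k f ==> Ck k g ==> Ck k (%x. f x + g x)"
proof (induction k arbitrary: f g)
 case (Suc k)
 from Suc.prems(1) obtain f' where f: "!!x. (f has_real_derivative f' x) (at x)" "Ck k f'" "Ck k f" by (rule Ck_SucE) blast
 from Suc.prems(2) obtain g' where g: "!!x. (g has_real_derivative g' x) (at x)" "Ck k g'" "Ck k g" by (rule Ck_SucE) blast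
 show ?case by (rule Ck_SucI[OF DERIV_add[OF f(1) g(1)] Suc.IH[OF f(2) g(2)]])
qed (auto intro: continuous_intros)

lemma Ck_mult: "Ck k f ==> Ck k g ==> Ck k (%x. f x * g x)"
proof (induction k arbitrary: f g)
 case (Suc k)
 from Suc.prems(1) obtain f' where f: "!!x. (f has_real_derivative f' x) (at x)" "Ck k f'" "Ck k f" by (rule Ck_SucE) blast
 from Suc.prems(2) obtain g' where g: "!!x. (g has_real_derivative g' x) (at x)" "Ck k g'" "Ck k g" by (rule Ck_SucE) blast
 show ?case
  by (rule Ck_SucI[OF DERIV_mult[OF f(1) g(1)] Ck_add[OF Suc.IH[OF f(2) g(3)] Suc.IH[OF g(2) f(3)]]])
qed (auto intro: continuous_intros)

lemma Ck_compose: "Ck k h ==> Ck k f ==> Ck k (%x. h (f x))"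
proof (induction k arbitrary: h f)
 case 0
 then show ?case by (auto intro: continuous_on_compose2[of UNIV h])
next
 case (Suc k)
 from Suc.prems(2) obtain f' where f: "!!x. (f has_real_derivative f' x) (at x)" "Ck k f'" "Ck k f" by (rule Ck_SucE) blast
 from Suc.prems(1) obtain h' where h: "!!x. (h has_real_derivative h' x) (at x)" "Ck k h'" "Ck k h" by (rule Ck_SucE) blast
 show ?case
  by (rule Ck_SucI[OF DERIV_chain2[OF h(1) f(1)] Ck_mult[OF Suc.IH[OF h(2) f(3)] f(2)]])
qed

lemma Ck_inverse: "Ck k f ==> (!!x. f x ~= 0) ==> Ck k (%x. inverse (f x))"
proof (induction k arbitrary: f)
 case (Suc k)
 from Suc.prems(1) obtain f' where f: "!!x. (f has_real_derivative f' x) (at x)" "Ck k f'" "Ck k f" by (rule Ck_SucE) blast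
 have d: "((%x. inverse (f x)) has_real_derivative ((- 1) * ((inverse (f x) * f' x) * inverse (f x)))) (at x)" for x
  using DERIV_inverse'[OF f(1) Suc.prems(2)] by simp
 have i: "Ck k (%x. inverse (f x))" by (rule Suc.IH[OF f(3) Suc.prems(2)])
 show ?case by (rule Ck_SucI[OF d Ck_mult[OF Ck_const Ck_mult[OF Ck_mult[OF i f(2)] i]]])
qed (auto intro: continuous_intros)

lemma Ck_affine: "Ck k (%x. a * x + b)"
 by (intro Ck_add Ck_mult Ck_const Ck_ident)

lemma Ck_exp: "Ck k exp"
 by (induction k) (auto intro!: continuous_intros exI[of _ exp])

section \<open>A smooth plateau function\<close>

definition flat_exp :: "nat => real => real" where
 "flat_exp m t = (if t <= 0 then 0 else (1 / t) ^ m * exp (- (1 / t)))"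

lemma flat_exp_tendsto_0: "(flat_exp m \<longlongrightarrow> 0) (at_right 0)"
proof -
 have "((%t. (1 / t) ^ m / exp (1 / t)) \<longlongrightarrow> 0) (at_right (0::real))"
  using filterlim_compose[OF tendsto_power_div_exp_0 filterlim_inverse_at_top_right]
  by (simp add: inverse_eq_divide)
 moreover have "\<forall>\<^sub>F t in at_right (0::real). (1 / t) ^ m / exp (1 / t) = flat_exp m t"
  using eventually_at_right_less[of "0::real"] by eventually_elim (simp add: flat_exp_def exp_minus divide_inverse)
 ultimately show ?thesis by (rule Lim_transform_eventually)
qed

text \<open>The powers of \<open>1 / t\<close> are carried along because differentiation maps the
  family into its own span, with indices raised by one and two. Smoothness of all members is then a
  single induction.\<close>

lemma flat_exp_DERIV: "(flat_exp m has_real_derivative (flat_exp (m + 2) t + (- real m) * flat_exp (m + 1) t)) (at t)"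
proof (cases t "0::real" rule: linorder_cases)
 case less
 have "((%t. 0) has_real_derivative 0) (at t)" by simp
 then have "(flat_exp m has_real_derivative 0) (at t)"
  by (rule has_field_derivative_transform_within_open[of _ _ _ "{..<0}"]) (use less in \<open>auto simp: flat_exp_def\<close>)
 then show ?thesis using less by (simp add: flat_exp_def)
next
 case greater
 have "((%t. 1 / t) has_real_derivative (- 1 / t\<^sup>2)) (at t)"
  using greater by (auto intro!: derivative_eq_intros simp: power2_eq_square)
 note i = this
 have p: "((%t. (1 / t) ^ m) has_real_derivative (real m * (1 / t) ^ (m - 1) * (- 1 / t\<^sup>2))) (at t)"
  using DERIV_power[OF i, of m] by (simp add: mult_ac)
 have e: "((%t. exp (- (1 / t))) has_real_derivative (exp (- (1 / t)) * (1 / t\<^sup>2))) (at t)"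
  using DERIV_fun_exp[OF DERIV_minus[OF i]] by simp
 have "((%t. (1 / t) ^ m * exp (- (1 / t))) has_real_derivative
   (real m * (1 / t) ^ (m - 1) * (- 1 / t\<^sup>2)) * exp (- (1 / t)) + (exp (- (1 / t)) * (1 / t\<^sup>2)) * (1 / t) ^ m) (at t)"
  by (rule DERIV_mult[OF p e])
 also have "(real m * (1 / t) ^ (m - 1) * (- 1 / t\<^sup>2)) * exp (- (1 / t)) + (exp (- (1 / t)) * (1 / t\<^sup>2)) * (1 / t) ^ m
   = flat_exp (m + 2) t + (- real m) * flat_exp (m + 1) t"
 proof -
  define z where "z = 1 / t"
  have z: "- 1 / t\<^sup>2 = - (z * z)" "1 / t\<^sup>2 = z * z" by (simp_all add: z_def power2_eq_square)
  show ?thesis using greater unfolding z flat_exp_def z_def[symmetric]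
   by (cases m) (auto simp: algebra_simps)
 qed
 finally have "((%t. (1 / t) ^ m * exp (- (1 / t))) has_real_derivative (flat_exp (m + 2) t + (- real m) * flat_exp (m + 1) t)) (at t)" .
 then show ?thesis
  by (rule has_field_derivative_transform_within_open[of _ _ _ "{0<..}"]) (use greater in \<open>auto simp: flat_exp_def\<close>)
next
 case equal
 \<comment> \<open>At 0 the quotient from the right is the next member of the family, which tends to
   0, and from the left it vanishes identically.\<close>
 have r: "((%h. (flat_exp m h - flat_exp m 0) / h) \<longlongrightarrow> 0) (at_right 0)"
 proof (rule Lim_transform_eventually[OF flat_exp_tendsto_0[of "m + 1"]])
  show "\<forall>\<^sub>F h in at_right 0. flat_exp (m + 1) h = (flat_exp m h - flat_exp m 0) / h"
   using eventually_at_right_less[of "0::real"] by eventually_elim (simp add: flat_exp_def)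
 qed
 have l: "((%h. (flat_exp m h - flat_exp m 0) / h) \<longlongrightarrow> 0) (at_left 0)"
 proof (rule tendsto_eventually)
  have "\<forall>\<^sub>F h in at_left (0::real). h < 0" by (auto simp: eventually_at_filter)
  then show "\<forall>\<^sub>F h in at_left 0. (flat_exp m h - flat_exp m 0) / h = 0"
   by eventually_elim (simp add: flat_exp_def)
 qed
 have "((%h. (flat_exp m h - flat_exp m 0) / h) \<longlongrightarrow> 0) (at 0)"
  using l r by (simp add: filterlim_at_split)
 then have "(flat_exp m has_real_derivative 0) (at 0)" by (simp add: has_field_derivative_iff)
 then show ?thesis using equal by (simp add: flat_exp_def)
qed

lemma Ck_flat_exp: "Ck k (flat_exp m)"
proof (induction k arbitrary: m)
 case 0
 have "isCont (flat_exp m) t" for t using flat_exp_DERIV by (rule DERIV_isCont)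
 then show ?case by (simp add: continuous_at_imp_continuous_on)
next
 case (Suc k)
 have "Ck k (%t. flat_exp (m + 2) t + (- real m) * flat_exp (m + 1) t)"
  by (intro Ck_add Ck_mult Ck_const Suc)
 then show ?case by (rule Ck_SucI[OF flat_exp_DERIV])
qed

abbreviation "flat0 \<equiv> flat_exp 0"

lemma flat0_bounds: "0 <= flat0 t" "flat0 t <= 1" "t <= 0 ==> flat0 t = 0" "0 < t ==> 0 < flat0 t"
 by (auto simp: flat_exp_def)

text \<open>With \<open>c = a - t\<close> this provides smooth functions of \<open>t\<close> that
  tend to the indicator of the half-line \<open>t < a\<close>.\<close>

lemma flat0_tendsto_1: assumes "0 < c" shows "(%n. flat0 (real n * c)) \<longlonglongrightarrow> 1"
proof -
 have "(%n. (1 / c) * (1 / real n)) \<longlonglongrightarrow> (1 / c) * 0" by (intro tendsto_intros lim_1_over_n)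
 then have "(%n. exp (- ((1 / c) * (1 / real n)))) \<longlonglongrightarrow> exp (- ((1 / c) * 0))" by (intro tendsto_intros)
 then have "(%n. exp (- ((1 / c) * (1 / real n)))) \<longlonglongrightarrow> 1" by simp
 moreover have "\<forall>\<^sub>F n in sequentially. exp (- ((1 / c) * (1 / real n))) = flat0 (real n * c)"
 proof (rule eventually_sequentiallyI[of 1])
  fix n :: nat assume "1 <= n"
  then have "0 < real n * c" using assms by simp
  then show "exp (- ((1 / c) * (1 / real n))) = flat0 (real n * c)" by (simp add: flat_exp_def mult.commute)
 qed
 ultimately show ?thesis by (rule Lim_transform_eventually)
qed

definition smooth_step :: "real => real" where
 "smooth_step t = flat0 t * inverse (flat0 t + flat0 (1 - t))"

lemma flat0_sum_pos: "0 < flat0 t + flat0 (1 - t)"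
 using flat0_bounds(1)[of t] flat0_bounds(1)[of "1 - t"] flat0_bounds(4)[of t] flat0_bounds(4)[of "1 - t"]
 by (cases "0 < t") (auto intro: add_pos_nonneg add_nonneg_pos)

lemma smooth_step_bounds: "0 <= smooth_step t" "smooth_step t <= 1"
 "t <= 0 ==> smooth_step t = 0" "1 <= t ==> smooth_step t = 1"
 using flat0_bounds(1)[of t] flat0_bounds(1)[of "1 - t"] flat0_sum_pos[of t] flat0_bounds(3)[of t] flat0_bounds(3)[of "1 - t"]
 by (auto simp: smooth_step_def divide_simps)

lemma Ck_smooth_step: "Ck k smooth_step"
proof -
 have "Ck k (%t. flat0 (1 - t))" using Ck_compose[OF Ck_flat_exp Ck_affine[of k "-1" 1], of 0] by simp
 then have "Ck k (%t. flat0 t * inverse (flat0 t + flat0 (1 - t)))"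
  using flat0_sum_pos by (intro Ck_mult Ck_inverse Ck_add Ck_flat_exp) (auto simp: less_imp_neq[symmetric])
 then show ?thesis by (simp add: smooth_step_def[abs_def])
qed

text \<open>The affine maps place the two transitions on \<open>[1, 3]\<close> and
  \<open>[-3, -1]\<close>. The outer radius 3 is half of the 6 in the density bounds, which leaves
  room between the support of a cutoff and the region where no bound is known.\<close>

definition plateau :: "real => real" where
 "plateau t = smooth_step ((-1/2) * t + 3/2) * smooth_step ((1/2) * t + 3/2)"

lemma Ck_plateau: "Ck k plateau"
 unfolding plateau_def[abs_def] by (intro Ck_mult Ck_compose[OF Ck_smooth_step] Ck_affine)

lemma plateau_bounds: "0 <= plateau t" "plateau t <= 1" "\<bar>t\<bar> <= 1 ==> plateau t = 1" "3 <= \<bar>t\<bar> ==> plateau t = 0"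
proof -
 show "0 <= plateau t" "plateau t <= 1"
  by (auto simp: plateau_def smooth_step_bounds intro: mult_nonneg_nonneg mult_le_one)
 show "plateau t = 1" if "\<bar>t\<bar> <= 1"
  using that by (auto simp: plateau_def smooth_step_bounds(4) abs_le_iff)
 show "plateau t = 0" if "3 <= \<bar>t\<bar>"
  using that smooth_step_bounds(3)[of "(-1/2) * t + 3/2"] smooth_step_bounds(3)[of "(1/2) * t + 3/2"]
  by (auto simp: plateau_def abs_if split: if_splits)
qed

lemma plateau_Lipschitz: obtains c where "1 <= c" "!!s t. \<bar>plateau s - plateau t\<bar> <= c * \<bar>s - t\<bar>"
proof -
 obtain p' where p': "!!t. (plateau has_real_derivative p' t) (at t)" "continuous_on UNIV p'"
  using Ck_plateau[of "Suc 0"] by auto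
 have "bounded (p' ` {-3..3})"
  by (intro compact_imp_bounded compact_continuous_image continuous_on_subset[OF p'(2)]) auto
 then obtain B where "\<forall>y\<in>p' ` {-3..3}. norm y <= B" unfolding bounded_iff ..
 then have B: "!!t. t \<in> {-3..3} ==> \<bar>p' t\<bar> <= B" by simp
 define c where "c = max 1 B"
 have in3: "\<bar>plateau s - plateau t\<bar> <= c * \<bar>s - t\<bar>" if st: "s \<in> {-3..3}" "t \<in> {-3..3}" for s t
 proof -
  have "norm (plateau s - plateau t) <= c * norm (s - t)"
  proof (rule field_differentiable_bound[of "{-3..3}" plateau p'])
   show "(plateau has_field_derivative p' z) (at z within {-3..3})" for z
    using p'(1) has_field_derivative_at_within by blast
   show "norm (p' z) <= c" if "z \<in> {-3..3}" for z using B[OF that] by (simp add: c_def le_max_iff_disj)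
  qed (use st in auto)
  then show ?thesis by simp
 qed
 \<comment> \<open>The derivative bound comes from compactness of \<open>[-3, 3]\<close>. Outside
   the plateau function vanishes, so points may be projected to this interval without changing its
   values.\<close>
 define k where "k t = max (-3) (min 3 t)" for t :: real
 have pk: "plateau (k t) = plateau t" for t
  using plateau_bounds(4)[of t] plateau_bounds(4)[of 3] plateau_bounds(4)[of "-3"] by (auto simp: k_def max_def min_def)
 show thesis
 proof (rule that[of c])
  fix s t
  have "\<bar>plateau s - plateau t\<bar> <= c * \<bar>k s - k t\<bar>" using in3[of "k s" "k t"] by (simp add: pk) (simp add: k_def)
  also have "\<dots> <= c * \<bar>s - t\<bar>" by (intro mult_left_mono) (auto simp: k_def max_def min_def c_def)
  finally show "\<bar>plateau s - plateau t\<bar> <= c * \<bar>s - t\<bar>" .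
 qed (simp add: c_def)
qed

text \<open>A smooth approximation of the unit contraction, as a difference of two softplus functions.\<close>

definition softplus :: "real => real" where "softplus u = ln (1 + exp u)"

definition soft_clamp :: "nat => real => real" where
 "soft_clamp n t = (softplus (real (Suc n) * t) - softplus (real (Suc n) * t - real (Suc n))
   - softplus 0 + softplus (- real (Suc n))) / real (Suc n)"

definition sigmoid :: "real => real" where "sigmoid u = 1 - inverse (1 + exp u)"

lemma one_plus_exp_pos: "0 < 1 + exp (u::real)"
 by (intro add_pos_pos) auto

lemma softplus_DERIV: "(softplus has_real_derivative sigmoid u) (at u)"
proof -
 have p: "1 + exp u ~= 0" using one_plus_exp_pos[of u] by simp
 have "((%u. ln (1 + exp u)) has_real_derivative (exp u / (1 + exp u))) (at u)"
  using one_plus_exp_pos[of u] by (auto intro!: derivative_eq_intros simp: divide_inverse)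
 also have "exp u / (1 + exp u) = sigmoid u" unfolding sigmoid_def using p by (simp add: field_simps)
 finally show ?thesis by (simp add: softplus_def[abs_def])
qed

lemma Ck_softplus: "Ck k softplus"
proof (rule Ck_Suc_imp)
 have "Ck k (%u. 1 + (-1) * inverse (1 + exp u))"
  using one_plus_exp_pos by (intro Ck_add Ck_mult Ck_const Ck_inverse Ck_exp) (auto simp: less_imp_neq[symmetric])
 then have "Ck k sigmoid" by (simp add: sigmoid_def[abs_def])
 then show "Ck (Suc k) softplus" using softplus_DERIV by auto
qed

lemma sigmoid_bounds: "0 <= sigmoid u" "sigmoid u <= 1" "u <= v ==> sigmoid u <= sigmoid v"
proof -
 show "0 <= sigmoid u" "sigmoid u <= 1"
  using one_plus_exp_pos[of u] by (auto simp: sigmoid_def inverse_eq_divide divide_simps)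
 show "sigmoid u <= sigmoid v" if "u <= v"
  using that le_imp_inverse_le[of "1 + exp u" "1 + exp v"] one_plus_exp_pos[of u] by (simp add: sigmoid_def)
qed

lemma softplus_bounds: "max 0 u <= softplus u" "softplus u <= max 0 u + ln 2"
proof -
 have "ln (exp u) <= ln (1 + exp u)" by (subst ln_le_cancel_iff) (auto simp: one_plus_exp_pos)
 moreover have "0 <= ln (1 + exp u)" by (rule ln_ge_zero) simp
 ultimately show "max 0 u <= softplus u" by (simp add: softplus_def)
 have "1 + exp u <= 2 * exp (max 0 u)" by (auto simp: max_def)
 then have "ln (1 + exp u) <= ln (2 * exp (max 0 u))" by (subst ln_le_cancel_iff) (auto simp: one_plus_exp_pos)
 also have "\<dots> = max 0 u + ln 2" by (simp add: ln_mult)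
 finally show "softplus u <= max 0 u + ln 2" by (simp add: softplus_def)
qed

lemma Ck_soft_clamp: "Ck k (soft_clamp n)"
proof -
 let ?N = "real (Suc n)"
 have a: "Ck k (%t. softplus (?N * t + 0))" "Ck k (%t. softplus (?N * t + (- ?N)))"
  by (intro Ck_compose[OF Ck_softplus] Ck_affine)+
 have "Ck k (%t. (1 / ?N) * ((softplus (?N * t + 0) + (-1) * softplus (?N * t + (- ?N))) + (- softplus 0 + softplus (- ?N))))"
  by (intro Ck_mult Ck_const Ck_add a)
 moreover have "(%t. (1 / ?N) * ((softplus (?N * t + 0) + (-1) * softplus (?N * t + (- ?N))) + (- softplus 0 + softplus (- ?N)))) = soft_clamp n"
  by (rule ext) (simp add: soft_clamp_def, simp add: algebra_simps)
 ultimately show ?thesis by (rule subst[rotated])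
qed

text \<open>Fixing 0 is the condition under which composition stays within \<open>FC0\<close>; the
  additive constants in \<open>soft_clamp\<close> arrange it.\<close>

lemma soft_clamp_0: "soft_clamp n 0 = 0"
 by (simp add: soft_clamp_def)

text \<open>The derivative is the difference of two values of the sigmoid, the larger one first, and
  hence lies in \<open>[0, 1]\<close>.\<close>

lemma soft_clamp_contraction: "\<bar>soft_clamp n s - soft_clamp n t\<bar> <= \<bar>s - t\<bar>"
proof -
 let ?N = "real (Suc n)" let ?d = "%t. sigmoid (?N * t) - sigmoid (?N * t - ?N)"
 have N: "0 < ?N" by simp
 have 1: "((%t. softplus (?N * t)) has_real_derivative (sigmoid (?N * t) * ?N)) (at t)" for t
  by (rule DERIV_chain2[OF softplus_DERIV]) (auto intro!: derivative_eq_intros)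
 have 2: "((%t. softplus (?N * t - ?N)) has_real_derivative (sigmoid (?N * t - ?N) * ?N)) (at t)" for t
  by (rule DERIV_chain2[OF softplus_DERIV]) (auto intro!: derivative_eq_intros)
 have "(soft_clamp n has_real_derivative (sigmoid (?N * t) * ?N - sigmoid (?N * t - ?N) * ?N) / ?N) (at t)" for t
  unfolding soft_clamp_def[abs_def]
  by (rule DERIV_cdivide) (use DERIV_add[OF DERIV_diff[OF DERIV_diff[OF 1 2] DERIV_const[of "softplus 0"]] DERIV_const[of "softplus (- ?N)"], of t] in simp)
 then have d: "(soft_clamp n has_real_derivative ?d t) (at t)" for t
  using N by (simp add: left_diff_distrib[symmetric])
 have "norm (soft_clamp n s - soft_clamp n t) <= 1 * norm (s - t)"
 proof (rule field_differentiable_bound[of UNIV _ ?d])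
  fix z
  show "(soft_clamp n has_field_derivative ?d z) (at z within UNIV)" using d by simp
  have "sigmoid (?N * z - ?N) <= sigmoid (?N * z)" by (rule sigmoid_bounds(3)) simp
  then show "norm (?d z) <= 1" using sigmoid_bounds(1)[of "?N * z - ?N"] sigmoid_bounds(2)[of "?N * z"] by simp
 qed auto
 then show ?thesis by simp
qed

lemma soft_clamp_tendsto: "(%n. soft_clamp n t) \<longlonglongrightarrow> min 1 (max 0 t)"
proof (rule LIM_zero_cancel, rule Lim_null_comparison)
 show "(%n. (4 * ln 2) * (1 / real (Suc n))) \<longlonglongrightarrow> 0"
  using tendsto_mult_left[OF LIMSEQ_Suc[OF lim_1_over_n], of "4 * ln 2"] by simp
 have "norm (soft_clamp n t - min 1 (max 0 t)) <= (4 * ln 2) * (1 / real (Suc n))" for n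
 proof -
  let ?N = "real (Suc n)"
  have N: "0 < ?N" by simp
  have "?N * min 1 (max 0 t) = max 0 (?N * t) - max 0 (?N * t - ?N)"
   using N by (cases "t <= 0"; cases "t <= 1") (auto simp: max_def min_def mult_le_0_iff zero_le_mult_iff mult_le_cancel_left1)
  then have "?N * soft_clamp n t - ?N * min 1 (max 0 t) =
   (softplus (?N * t) - max 0 (?N * t)) - (softplus (?N * t - ?N) - max 0 (?N * t - ?N)) - softplus 0 + softplus (- ?N)"
   by (simp add: soft_clamp_def)
  \<comment> \<open>Each of the four softplus values deviates from the positive part by at most
    \<open>ln 2\<close>.\<close>
  also have "\<bar>\<dots>\<bar> <= 4 * ln 2"
   using softplus_bounds[of "?N * t"] softplus_bounds[of "?N * t - ?N"] softplus_bounds[of 0] softplus_bounds[of "- ?N"] by auto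
  finally have "?N * \<bar>soft_clamp n t - min 1 (max 0 t)\<bar> <= 4 * ln 2"
   unfolding right_diff_distrib[symmetric] abs_mult using N by simp
  then show ?thesis using N by (simp add: field_simps)
 qed
 then show "\<forall>\<^sub>F n in sequentially. norm (soft_clamp n t - min 1 (max 0 t)) <= (4 * ln 2) * (1 / real (Suc n))"
  by simp
qed

lemma soft_clamp_bound: "\<bar>soft_clamp n t\<bar> <= \<bar>t\<bar>"
 using soft_clamp_contraction[of n t 0] by (simp add: soft_clamp_0)

section \<open>Smooth cylinder functions\<close>

text \<open>Smoothness of finite order in all coordinates at once, with existential partial
  derivatives as in \<open>Ck\<close> and no reference to the number of variables. The latter is
  recorded by \<open>depends\<close>.\<close>

primrec cyl :: "nat => ((nat => real) => real) => bool" where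
 "cyl 0 f \<longleftrightarrow> continuous_on UNIV f"
| "cyl (Suc k) f \<longleftrightarrow> continuous_on UNIV f \<and>
   (ALL i. EX g. (ALL x. ((%t. f (x(i := t))) has_real_derivative g x) (at (x i))) \<and> cyl k g)"

lemma cyl_continuous: "cyl k f ==> continuous_on UNIV f"
 by (cases k) auto

lemma cyl_SucI:
 "continuous_on UNIV f ==> (!!i x. ((%t. f (x(i := t))) has_real_derivative g i x) (at (x i))) ==>
  (!!i. cyl k (g i)) ==> cyl (Suc k) f"
 by (simp del: fun_upd_apply) blast

lemma cyl_Suc_imp: "cyl (Suc k) f ==> cyl k f"
proof (induction k arbitrary: f)
 case (Suc k)
 from Suc.prems obtain g where g: "!!i x. ((%t. f (x(i := t))) has_real_derivative g i x) (at (x i))" "!!i. cyl (Suc k) (g i)"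
  unfolding cyl.simps(2)[of "Suc k"] by metis
 show ?case by (rule cyl_SucI[OF cyl_continuous[OF Suc.prems] g(1) Suc.IH[OF g(2)]])
qed auto

lemma cyl_SucE:
 assumes "cyl (Suc k) f"
 obtains g where "!!i x. ((%t. f (x(i := t))) has_real_derivative g i x) (at (x i))" "!!i. cyl k (g i)"
  "continuous_on UNIV f" "cyl k f"
proof -
 from assms obtain g where "!!i x. ((%t. f (x(i := t))) has_real_derivative g i x) (at (x i))" "!!i. cyl k (g i)"
  unfolding cyl.simps(2) by metis
 then show thesis using that cyl_Suc_imp[OF assms] cyl_continuous[OF assms] by blast
qed

lemma cyl_const: "cyl k (%x. c)"
proof (induction k arbitrary: c)
 case (Suc k)
 show ?case by (rule cyl_SucI[OF _ _ Suc[of 0]]) (auto intro: continuous_intros)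
qed (auto intro: continuous_intros)

lemma cyl_coord: "cyl k (%x. x j)"
proof (cases k)
 case (Suc n)
 have "cyl (Suc n) (%x. x j)"
 proof (rule cyl_SucI[OF continuous_on_product_coordinates])
  fix i and x :: "nat => real"
  show "((%t. (x(i := t)) j) has_real_derivative (if i = j then 1 else 0)) (at (x i))"
   by (cases "i = j") (auto intro!: derivative_eq_intros)
  show "cyl n (%x. if i = j then 1 else 0)" for i by (rule cyl_const)
 qed
 then show ?thesis using Suc by simp
qed (auto intro: continuous_on_product_coordinates)

lemma cyl_add: "cyl k f ==> cyl k g ==> cyl k (%x. f x + g x)"
proof (induction k arbitrary: f g)
 case (Suc k)
 from Suc.prems(1) obtain f' where f: "!!i x. ((%t. f (x(i := t))) has_real_derivative f' i x) (at (x i))" "!!i. cyl k (f' i)"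
  "continuous_on UNIV f" "cyl k f" by (rule cyl_SucE) blast
 from Suc.prems(2) obtain g' where g: "!!i x. ((%t. g (x(i := t))) has_real_derivative g' i x) (at (x i))" "!!i. cyl k (g' i)"
  "continuous_on UNIV g" "cyl k g" by (rule cyl_SucE) blast
 show ?case
  by (rule cyl_SucI[OF continuous_on_add[OF f(3) g(3)] DERIV_add[OF f(1) g(1)] Suc.IH[OF f(2) g(2)]])
qed (auto intro: continuous_intros)

lemma cyl_mult: "cyl k f ==> cyl k g ==> cyl k (%x. f x * g x)"
proof (induction k arbitrary: f g)
 case (Suc k)
 from Suc.prems(1) obtain f' where f: "!!i x. ((%t. f (x(i := t))) has_real_derivative f' i x) (at (x i))" "!!i. cyl k (f' i)"
  "continuous_on UNIV f" "cyl k f" by (rule cyl_SucE) blast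
 from Suc.prems(2) obtain g' where g: "!!i x. ((%t. g (x(i := t))) has_real_derivative g' i x) (at (x i))" "!!i. cyl k (g' i)"
  "continuous_on UNIV g" "cyl k g" by (rule cyl_SucE) blast
 have "((%t. f (x(i := t)) * g (x(i := t))) has_real_derivative (f' i x * g x + g' i x * f x)) (at (x i))" for i x
  using DERIV_mult[OF f(1)[where i = i and x = x] g(1)[where i = i and x = x]] by (simp add: fun_upd_triv)
 then show ?case
  by (rule cyl_SucI[OF continuous_on_mult[OF f(3) g(3)] _ cyl_add[OF Suc.IH[OF f(2) g(4)] Suc.IH[OF g(2) f(4)]]])
qed (auto intro: continuous_intros)

lemma cyl_compose: "Ck k h ==> cyl k f ==> cyl k (%x. h (f x))"
proof (induction k arbitrary: h f)
 case 0
 then show ?case by (auto intro: continuous_on_compose2[of UNIV h])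
next
 case (Suc k)
 from Suc.prems(2) obtain f' where f: "!!i x. ((%t. f (x(i := t))) has_real_derivative f' i x) (at (x i))" "!!i. cyl k (f' i)"
  "continuous_on UNIV f" "cyl k f" by (rule cyl_SucE) blast
 from Suc.prems(1) obtain h' where h: "!!x. (h has_real_derivative h' x) (at x)" "Ck k h'" "Ck k h" by (rule Ck_SucE) blast
 have c: "continuous_on UNIV (%x. h (f x))"
  by (rule continuous_on_compose2[of UNIV h]) (use h(1) f(3) in \<open>auto intro: continuous_at_imp_continuous_on DERIV_isCont\<close>)
 have "((%t. h (f (x(i := t)))) has_real_derivative (h' (f x) * f' i x)) (at (x i))" for i x
  using DERIV_chain2[OF h(1) f(1)[where i = i and x = x]] by (simp add: fun_upd_triv)
 then show ?case by (rule cyl_SucI[OF c _ cyl_mult[OF Suc.IH[OF h(2) f(4)] f(2)]])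
qed

lemma cyl_prod: "finite I ==> (!!i. i \<in> I ==> cyl k (f i)) ==> cyl k (%x. \<Prod>i\<in>I. f i x)"
 by (induction I rule: finite_induct) (auto intro: cyl_const cyl_mult)

definition depends :: "nat => ((nat => real) => real) => bool" where
 "depends n f \<longleftrightarrow> (ALL x y. (\<forall>i<n. x i = y i) --> f x = f y)"

lemma dependsD: "depends n f ==> (!!i. i < n ==> x i = y i) ==> f x = f y"
 by (simp add: depends_def)

lemma depends_mono: "depends n f ==> n <= m ==> depends m f"
 by (auto simp: depends_def)

definition bdd_support :: "nat => ((nat => real) => real) => bool" where
 "bdd_support n f \<longleftrightarrow> (EX R. ALL x. f x ~= 0 --> (\<forall>i<n. \<bar>x i\<bar> <= R))"

lemma partial_diff_depends: "depends n f ==> depends n (partial_diff i f)"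
 unfolding depends_def
proof (intro allI impI)
 fix x y :: "nat => real" assume f: "ALL x y. (\<forall>i<n. x i = y i) --> f x = f y" and xy: "\<forall>i<n. x i = y i"
 show "partial_diff i f x = partial_diff i f y"
 proof (cases "i < n")
  case True
  have "(%t. f (x(i := t))) = (%t. f (y(i := t)))" using f xy by auto
  then show ?thesis using xy True by (simp add: partial_diff_def)
 next
  case False
  have "f (x(i := t)) = f x" "f (y(i := t)) = f x" for t
   using f[rule_format, of "x(i := t)" x] f[rule_format, of "y(i := t)" x] xy False by auto
  then show ?thesis by (simp add: partial_diff_def)
 qed
qed

text \<open>The definition speaks of all words of partial derivatives, whereas closure properties
  want a recursion on the order. Uniqueness of derivatives identifies the existential derivatives of
  \<open>cyl\<close> with \<open>partial_diff\<close>.\<close>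

lemma C0_infinity_iff: "f \<in> C0_infinity n \<longleftrightarrow> depends n f \<and> (ALL k. cyl k f) \<and> bdd_support n f"
proof -
 let ?S = "%f. ALL js. set js \<subseteq> {..<n} --> continuous_on UNIV (foldr partial_diff js f) \<and>
   (\<forall>i<n. ALL x. (%t. foldr partial_diff js f (x(i := t))) differentiable (at (x i)))"
 have 1: "cyl k f" if "depends n f" "?S f" for k f
  using that
 proof (induction k arbitrary: f)
  case 0 then show ?case by (auto dest: spec[of _ "[]"])
 next
  case (Suc k)
  have c: "continuous_on UNIV f" using Suc.prems(2) by (auto dest: spec[of _ "[]"])
  define g where "g i = (if i < n then partial_diff i f else (%x. 0))" for i
  show ?case
  proof (rule cyl_SucI[OF c])
   fix i x
   show "((%t. f (x(i := t))) has_real_derivative g i x) (at (x i))"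
   proof (cases "i < n")
    case True
    then have "(%t. f (x(i := t))) differentiable (at (x i))" using Suc.prems(2)[rule_format, of "[]"] by simp
    then have "(%t. f (x(i := t))) field_differentiable (at (x i))" by (simp add: real_differentiable_def field_differentiable_def)
    then show ?thesis using True by (simp add: g_def partial_diff_def field_differentiable_derivI)
   next
    case False
    then have "(%t. f (x(i := t))) = (%t. f x)" by (intro ext dependsD[OF Suc.prems(1)]) auto
    then show ?thesis using False by (simp add: g_def)
   qed
  next
   fix i
   show "cyl k (g i)"
   proof (cases "i < n")
    case True
    have "?S (partial_diff i f)"
    proof (intro allI impI)
     fix js assume "set js \<subseteq> {..<n}"
     \<comment> \<open>In \<open>foldr\<close> the last letter of the word acts first.\<close>
     then have "set (js @ [i]) \<subseteq> {..<n}" using True by simp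
     from Suc.prems(2)[rule_format, OF this]
     show "continuous_on UNIV (foldr partial_diff js (partial_diff i f)) \<and>
       (\<forall>i'<n. ALL x. (%t. foldr partial_diff js (partial_diff i f) (x(i' := t))) differentiable (at (x i')))"
      by simp
    qed
    then show ?thesis unfolding g_def if_P[OF True] by (rule Suc.IH[OF partial_diff_depends[OF Suc.prems(1)]])
   qed (simp add: g_def cyl_const)
  qed
 qed
 have 2: "?S f" if f: "!!k. cyl k f" for f
 proof -
  have pd: "EX g. partial_diff i f = g \<and> cyl k g" if f: "cyl (Suc k) f" for i k f
  proof -
   obtain g where g: "!!i x. ((%t. f (x(i := t))) has_real_derivative g i x) (at (x i))" "!!i. cyl k (g i)"
    using f by (rule cyl_SucE) blast
   have "partial_diff i f = g i" unfolding partial_diff_def by (intro ext DERIV_imp_deriv g(1))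
   then show ?thesis using g(2) by auto
  qed
  have all: "cyl k (foldr partial_diff js f)" for js k
  proof (induction js arbitrary: k)
   case (Cons j js)
   then show ?case using pd[OF Cons[of "Suc k"], of j] by auto
  qed (simp add: f)
  show ?thesis
  proof (intro allI impI conjI)
   fix js show "continuous_on UNIV (foldr partial_diff js f)" by (rule cyl_continuous[OF all])
   fix i and x :: "nat => real"
   obtain g where "((%t. foldr partial_diff js f (x(i := t))) has_real_derivative g i x) (at (x i))"
    using all[of "Suc 0" js] by (rule cyl_SucE) blast
   then show "(%t. foldr partial_diff js f (x(i := t))) differentiable (at (x i))"
    by (auto simp: real_differentiable_def)
  qed
 qed
 show ?thesis
  unfolding C0_infinity_def mem_Collect_eq depends_def[symmetric] bdd_support_def[symmetric]
 proof
  assume a: "depends n f \<and> ?S f \<and> bdd_support n f"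
  then show "depends n f \<and> (ALL k. cyl k f) \<and> bdd_support n f" using 1[of f] by simp
 next
  assume a: "depends n f \<and> (ALL k. cyl k f) \<and> bdd_support n f"
  then have "?S f" by (intro 2) simp
  then show "depends n f \<and> ?S f \<and> bdd_support n f" using a by simp
 qed
qed

lemma C0I: "depends n f ==> (!!k. cyl k f) ==> bdd_support n f ==> f \<in> C0_infinity n"
 by (simp add: C0_infinity_iff)

lemma bdd_support_subset:
 "bdd_support n f ==> (!!x. g x ~= 0 ==> f x ~= 0) ==> bdd_support n g"
 unfolding bdd_support_def by blast

lemma bdd_support_Un:
 assumes "bdd_support n f" "bdd_support n g" "!!x. h x ~= 0 ==> f x ~= 0 \<or> g x ~= 0"
 shows "bdd_support n h"
proof -
 obtain R1 R2 where "!!x i. f x ~= 0 ==> i < n ==> \<bar>x i\<bar> <= R1" "!!x i. g x ~= 0 ==> i < n ==> \<bar>x i\<bar> <= R2"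
  using assms(1,2) unfolding bdd_support_def by blast
 then have "ALL x. h x ~= 0 --> (\<forall>i<n. \<bar>x i\<bar> <= max R1 R2)"
  using assms(3) by (meson le_max_iff_disj)
 then show ?thesis unfolding bdd_support_def by blast
qed

lemma C0_zero: "(%x. 0) \<in> C0_infinity n"
 by (intro C0I cyl_const) (auto simp: depends_def bdd_support_def)

lemma C0_add: "f \<in> C0_infinity n ==> g \<in> C0_infinity n ==> (%x. f x + g x) \<in> C0_infinity n"
 unfolding C0_infinity_iff
proof (elim conjE, intro conjI allI)
 assume "depends n f" "depends n g" then show "depends n (%x. f x + g x)" unfolding depends_def by metis
 show "bdd_support n (%x. f x + g x)" if "bdd_support n f" "bdd_support n g"
  using that by (rule bdd_support_Un) auto
qed (auto intro: cyl_add)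

lemma C0_scale: "f \<in> C0_infinity n ==> (%x. a * f x) \<in> C0_infinity n"
 unfolding C0_infinity_iff
proof (elim conjE, intro conjI allI)
 assume "depends n f" then show "depends n (%x. a * f x)" unfolding depends_def by metis
 show "bdd_support n (%x. a * f x)" if "bdd_support n f"
  using that by (rule bdd_support_subset) auto
qed (auto intro: cyl_mult cyl_const)

text \<open>The factor with more variables alone confines the support in all of them.\<close>

lemma C0_mult:
 assumes f: "f \<in> C0_infinity m" and g: "g \<in> C0_infinity n" and mn: "m <= n"
 shows "(%x. f x * g x) \<in> C0_infinity n"
proof (rule C0I)
 have "depends n f" "depends n g" using f g depends_mono[OF _ mn] by (auto simp: C0_infinity_iff)
 then show "depends n (%x. f x * g x)" unfolding depends_def by metis
 show "cyl k (%x. f x * g x)" for k using f g by (intro cyl_mult) (auto simp: C0_infinity_iff)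
 show "bdd_support n (%x. f x * g x)"
  by (rule bdd_support_subset[of n g]) (use g in \<open>auto simp: C0_infinity_iff\<close>)
qed

lemma FC0_single: "f \<in> C0_infinity n ==> 1 <= n ==> f \<in> FC0"
 unfolding FC0_def by (intro CollectI exI[of _ 1] exI[of _ "%_. f"]) auto

lemma FC0_zero: "(%x. 0) \<in> FC0"
 by (rule FC0_single[OF C0_zero order_refl])

lemma FC0_ex: "f \<in> FC0 ==> \<exists>(m::nat) h. f = (%x. \<Sum>k<m. h k x) \<and> (\<forall>k<m. \<exists>n\<ge>1. h k \<in> C0_infinity n)"
 unfolding FC0_def mem_Collect_eq .

lemma FC0_induct [consumes 1, case_names zero add]:
 assumes f: "f \<in> FC0" and z: "P (%x. 0)"
  and a: "!!f g n. f \<in> FC0 ==> P f ==> g \<in> C0_infinity n ==> 1 <= n ==> P (%x. f x + g x)"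
 shows "P f"
proof -
 obtain m :: nat and h where h: "f = (%x. \<Sum>k<m. h k x)" "\<forall>k<m. \<exists>n\<ge>1. h k \<in> C0_infinity n"
  using FC0_ex[OF f] by blast
 have "P (%x. \<Sum>k<j. h k x) \<and> (%x. \<Sum>k<j. h k x) \<in> FC0" if "j <= m" for j
  using that
 proof (induction j)
  case 0 then show ?case using z FC0_zero by simp
 next
  case (Suc j)
  obtain n where n: "1 <= n" "h j \<in> C0_infinity n" using h(2)[rule_format, of j] Suc.prems by auto
  have "(%x. \<Sum>k<Suc j. h k x) \<in> FC0"
   unfolding FC0_def using h(2) Suc.prems by (intro CollectI exI[of _ "Suc j"] exI[of _ h]) auto
  then show ?case using a[of "%x. \<Sum>k<j. h k x" "h j" n] Suc n by auto
 qed
 then show ?thesis using h(1) by auto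
qed

lemma FC0_add_single:
 assumes f: "f \<in> FC0" and g: "g \<in> C0_infinity n" "1 <= n"
 shows "(%x. f x + g x) \<in> FC0"
proof -
 obtain m :: nat and h where h: "f = (%x. \<Sum>k<m. h k x)" "\<forall>k<m. \<exists>n\<ge>1. h k \<in> C0_infinity n"
  using FC0_ex[OF f] by blast
 have "(%x. f x + g x) = (%x. \<Sum>k<Suc m. (h(m := g)) k x)" by (simp add: h(1))
 moreover have "\<forall>k<Suc m. \<exists>n\<ge>1. (h(m := g)) k \<in> C0_infinity n"
  using h(2) g by (auto simp: less_Suc_eq)
 ultimately show ?thesis unfolding FC0_def mem_Collect_eq by (intro exI[of _ "Suc m"] exI[of _ "h(m := g)"] conjI)
qed

lemma FC0_add: assumes f: "f \<in> FC0" and g: "g \<in> FC0" shows "(%x. f x + g x) \<in> FC0"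
 using g
proof (induction g rule: FC0_induct)
 case (add g h n)
 then show ?case using FC0_add_single[of "%x. f x + g x" h n] by (simp add: add.assoc)
qed (simp add: f)

lemma FC0_scale: assumes f: "f \<in> FC0" shows "(%x. a * f x) \<in> FC0"
 using f
proof (induction f rule: FC0_induct)
 case (add f h n)
 then show ?case using FC0_add_single[of "%x. a * f x" "%x. a * h x" n] by (simp add: distrib_left C0_scale)
qed (simp add: FC0_zero)

lemma FC0_lincomb: "f \<in> FC0 ==> g \<in> FC0 ==> (%x. a * f x + b * g x) \<in> FC0"
 by (intro FC0_add FC0_scale)

lemma FC0_mult: assumes f: "f \<in> FC0" and g: "g \<in> FC0" shows "(%x. f x * g x) \<in> FC0"
proof -
 have 1: "(%x. f x * h x) \<in> FC0" if h: "h \<in> C0_infinity n" "1 <= n" for h n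
  using f
 proof (induction f rule: FC0_induct)
  case (add f h' n')
  have "(%x. h' x * h x) \<in> C0_infinity (max n n')"
  proof (cases "n <= n'")
   case True
   then show ?thesis using C0_mult[OF h(1) \<open>h' \<in> C0_infinity n'\<close>] by (simp add: mult.commute max_absorb2)
  next
   case False
   then show ?thesis using C0_mult[OF \<open>h' \<in> C0_infinity n'\<close> h(1)] by (simp add: max_absorb1)
  qed
  from FC0_add_single[OF \<open>(%x. f x * h x) \<in> FC0\<close> this] show ?case using h(2) by (simp add: distrib_right le_max_iff_disj)
 qed (simp add: FC0_zero)
 show ?thesis using g
 proof (induction g rule: FC0_induct)
  case (add g h n)
  from FC0_add[OF \<open>(%x. f x * g x) \<in> FC0\<close> 1[OF \<open>h \<in> C0_infinity n\<close> \<open>1 <= n\<close>]] show ?case by (simp add: distrib_left)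
 qed (simp add: FC0_zero)
qed

text \<open>Summands are collected by their number of variables. Slot \<open>n\<close> holds
  functions of \<open>n + 1\<close> variables, as \<open>FC0\<close> starts with one
  variable.\<close>

lemma FC0_graded:
 assumes "f \<in> FC0"
 shows "EX F N0. (ALL n. F n \<in> C0_infinity (Suc n)) \<and> (\<forall>N\<ge>N0. f = (%x. \<Sum>n<N. F n x))"
 using assms
proof (induction f rule: FC0_induct)
 case zero
 show ?case by (intro exI[of _ "%n x. 0"]) (auto intro: C0_zero)
next
 case (add f g n)
 then obtain F N0 where F: "!!n. F n \<in> C0_infinity (Suc n)" "!!N. N >= N0 ==> f = (%x. \<Sum>n<N. F n x)" by blast
 obtain m where m: "n = Suc m" using \<open>1 <= n\<close> by (cases n) auto
 define G where "G = F(m := %x. F m x + g x)"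
 have "ALL n. G n \<in> C0_infinity (Suc n)" using F(1) C0_add[OF F(1)[of m]] \<open>g \<in> C0_infinity n\<close> m by (simp add: G_def)
 moreover have "(%x. f x + g x) = (%x. \<Sum>n<N. G n x)" if "N >= max N0 (Suc m)" for N
 proof (rule ext)
  fix x
  have "(\<Sum>n<N. G n x) = (\<Sum>n<N. F n x + (if n = m then g x else 0))"
   by (intro sum.cong) (auto simp: G_def)
  also have "\<dots> = f x + g x" using that F(2)[of N] by (simp add: sum.distrib)
  finally show "f x + g x = (\<Sum>n<N. G n x)" by simp
 qed
 ultimately show ?case by blast
qed

lemma FC0_props:
 assumes f: "f \<in> FC0"
 obtains n where "depends n f" "!!k. cyl k f"
proof -
 obtain F N where F: "!!n. F n \<in> C0_infinity (Suc n)" "f = (%x. \<Sum>n<N. F n x)" using FC0_graded[OF f] by blast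
 have "depends N f" unfolding depends_def
 proof (intro allI impI)
  fix x y :: "nat => real" assume "\<forall>i<N. x i = y i"
  moreover have "depends (Suc n) (F n)" for n using F(1) by (simp add: C0_infinity_iff)
  ultimately have "F n x = F n y" if "n < N" for n
   using that by (intro dependsD[of "Suc n" "F n"]) auto
  then show "f x = f y" unfolding F(2) by (intro sum.cong) auto
 qed
 moreover have "cyl k (%x. \<Sum>n<j. F n x)" for k j
 proof (induction j)
  case (Suc j)
  then show ?case using F(1)[of j] by (auto simp: C0_infinity_iff intro: cyl_add)
 qed (simp add: cyl_const)
 ultimately show thesis using that F(2) by blast
qed

text \<open>With \<open>S n\<close> the partial sums by number of variables, \<open>\<phi> (S (n + 1)) - \<phi> (S n)\<close> vanishes
 wherever the summand of order \<open>n\<close> does.\<close>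

lemma FC0_compose:
 assumes f: "f \<in> FC0" and \<phi>: "!!k. Ck k \<phi>" "\<phi> 0 = 0"
 shows "(%x. \<phi> (f x)) \<in> FC0"
proof -
 obtain F N where F: "!!n. F n \<in> C0_infinity (Suc n)" "f = (%x. \<Sum>n<N. F n x)" using FC0_graded[OF f] by blast
 define S where "S j x = (\<Sum>n<j. F n x)" for j x
 have dF: "depends m (F n)" if "n < m" for n m using F(1)[of n] depends_mono[of "Suc n" "F n" m] that by (auto simp: C0_infinity_iff)
 have dS: "depends m (S j)" if "j <= m" for j m
  unfolding depends_def S_def
 proof (intro allI impI sum.cong refl)
  fix x y :: "nat => real" and n assume "\<forall>i<m. x i = y i" "n \<in> {..<j}"
  then show "F n x = F n y" using that by (intro dependsD[OF dF, of n m]) auto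
 qed
 have cS: "cyl k (S j)" for k j
 proof (induction j)
  case (Suc j)
  then show ?case using F(1)[of j] by (auto simp: S_def[abs_def] C0_infinity_iff intro: cyl_add)
 qed (simp add: S_def[abs_def] cyl_const)
 have "(%x. \<phi> (S j x)) \<in> FC0" for j
 proof (induction j)
  case 0 then show ?case using \<phi>(2) FC0_zero by (simp add: S_def)
 next
  case (Suc j)
  let ?g = "%x. \<phi> (S (Suc j) x) + (-1) * \<phi> (S j x)"
  have "?g \<in> C0_infinity (Suc j)"
  proof (rule C0I)
   show "depends (Suc j) ?g"
    unfolding depends_def
   proof (intro allI impI)
    fix x y :: "nat => real" assume xy: "\<forall>i<Suc j. x i = y i"
    have "S (Suc j) x = S (Suc j) y" "S j x = S j y"
     using xy by (auto intro!: dependsD[OF dS[of "Suc j" "Suc j"]] dependsD[OF dS[of j "Suc j"]])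
    then show "?g x = ?g y" by simp
   qed
   show "cyl k ?g" for k by (intro cyl_add cyl_mult cyl_const cyl_compose[OF \<phi>(1)] cS)
   show "bdd_support (Suc j) ?g"
    by (rule bdd_support_subset[of _ "F j"]) (use F(1)[of j] in \<open>auto simp: C0_infinity_iff S_def\<close>)
  qed
  from FC0_add_single[OF Suc this] show ?case by simp
 qed
 then show ?thesis using F(2) by (simp add: S_def)
qed

lemma C0_bounded:
 assumes f: "f \<in> C0_infinity n" obtains B where "0 <= B" "!!x. \<bar>f x\<bar> <= B"
proof -
 obtain R where R: "!!x i. f x ~= 0 ==> i < n ==> \<bar>x i\<bar> <= R" using f unfolding C0_infinity_iff bdd_support_def by blast
 \<comment> \<open>Compact by Tychonoff's theorem: coordinates from \<open>n\<close> on are frozen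
   at 0, which leaves the values of \<open>f\<close> unchanged.\<close>
 define K where "K = (PiE UNIV (%i. if i < n then {-R..R} else {0::real}))"
 have "compactin (product_topology (%i. euclidean) UNIV) K"
  unfolding K_def by (subst compactin_PiE) auto
 then have "compact K" by (simp add: euclidean_product_topology)
 then have "bounded (f ` K)"
  using f by (intro compact_imp_bounded compact_continuous_image continuous_on_subset[OF cyl_continuous[of 0]]) (auto simp: C0_infinity_iff)
 then obtain B where B: "\<forall>y\<in>f ` K. norm y <= B" unfolding bounded_iff ..
 have "\<bar>f x\<bar> <= max 0 B" for x
 proof (cases "f x = 0")
  case False
  define x' where "x' i = (if i < n then x i else 0)" for i
  have e: "f x' = f x" using f by (intro dependsD[of n f]) (auto simp: C0_infinity_iff x'_def)
  then have "x' \<in> K" using R[of x] False by (auto simp: K_def x'_def abs_le_iff) (meson minus_le_iff)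
  then show ?thesis using B e by (metis imageI le_max_iff_disj real_norm_def)
 qed simp
 then show thesis by (rule that[of "max 0 B", OF max.cobounded1])
qed

lemma C0_partial_diff:
 assumes f: "f \<in> C0_infinity n"
 obtains g where "g \<in> C0_infinity n" "!!x. ((%t. f (x(i := t))) has_real_derivative g x) (at (x i))"
proof -
 have d: "EX g. (ALL x. ((%t. f (x(i := t))) has_real_derivative g x) (at (x i))) \<and> cyl k g" for k
 proof -
  have "cyl (Suc k) f" using f by (simp only: C0_infinity_iff)
  then obtain g where "!!i x. ((%t. f (x(i := t))) has_real_derivative g i x) (at (x i))" "!!i. cyl k (g i)"
   by (rule cyl_SucE) blast
  then show ?thesis by (intro exI[of _ "g i"]) simp
 qed
 then obtain g where g: "!!x. ((%t. f (x(i := t))) has_real_derivative g x) (at (x i))" by blast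
 have "cyl k g" for k
 proof -
  \<comment> \<open>The witnesses for different orders are derivatives of the same function, so they
    coincide and one \<open>g\<close> is smooth of every order.\<close>
  obtain g' where g': "!!x. ((%t. f (x(i := t))) has_real_derivative g' x) (at (x i))" "cyl k g'" using d by blast
  then have "g = g'" using DERIV_unique[OF g g'(1)] by blast
  then show ?thesis using g'(2) by simp
 qed
 moreover have "depends n g"
 proof -
  have "g = partial_diff i f" unfolding partial_diff_def by (intro ext DERIV_imp_deriv[symmetric] g)
  then show ?thesis using f partial_diff_depends by (simp add: C0_infinity_iff)
 qed
 moreover have "bdd_support n g"
 proof -
  obtain R where R: "!!x i. f x ~= 0 ==> i < n ==> \<bar>x i\<bar> <= R" using f unfolding C0_infinity_iff bdd_support_def by blast
  have "g x = 0" if "j < n" "R < \<bar>x j\<bar>" for x j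
  proof -
   have op: "open {t. R < \<bar>(x(i := t)) j\<bar>}"
    by (cases "i = j") (auto intro!: open_Collect_less continuous_intros)
   have z: "f (x(i := t)) = 0" if "R < \<bar>(x(i := t)) j\<bar>" for t using R[of "x(i := t)" j] \<open>j < n\<close> that by fastforce
   have "((%t. 0) has_real_derivative 0) (at (x i))" by simp
   then have "((%t. f (x(i := t))) has_real_derivative 0) (at (x i))"
    by (rule has_field_derivative_transform_within_open[OF _ op]) (use that z in auto)
   then show ?thesis using DERIV_unique[OF g] by blast
  qed
  then show ?thesis unfolding bdd_support_def by (metis not_le)
 qed
 ultimately show thesis using that g C0I by blast
qed

text \<open>The two properties that bound the jump energy in coordinate \<open>i\<close>: the
  squared increments are of order \<open>min 1 (y - z)^2\<close>, which tames the singularity as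
  \<open>\<alpha> < 2\<close>, and there are no increments between points beyond \<open>R\<close>,
  so that one compact density bound serves.\<close>

definition tame :: "nat => real => real => ((nat => real) => real) => bool" where
 "tame i B R f \<longleftrightarrow> 0 <= B \<and> 0 <= R \<and> (ALL x y z. \<bar>f (x(i := y)) - f (x(i := z))\<bar> <= B * min 1 \<bar>y - z\<bar>) \<and>
   (ALL x y z. R < \<bar>y\<bar> \<and> R < \<bar>z\<bar> --> f (x(i := y)) = f (x(i := z)))"

lemma C0_tame: assumes f: "f \<in> C0_infinity n" shows "EX B R. tame i B R f"
proof -
 obtain g where g: "g \<in> C0_infinity n" "!!x. ((%t. f (x(i := t))) has_real_derivative g x) (at (x i))"
  by (rule C0_partial_diff[OF f, of i]) blast
 obtain B1 where B1: "0 <= B1" "!!x. \<bar>f x\<bar> <= B1" by (rule C0_bounded[OF f]) blast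
 obtain B2 where B2: "0 <= B2" "!!x. \<bar>g x\<bar> <= B2" by (rule C0_bounded[OF g(1)]) blast
 obtain R where R: "!!x i. f x ~= 0 ==> i < n ==> \<bar>x i\<bar> <= R" using f unfolding C0_infinity_iff bdd_support_def by blast
 have lip: "\<bar>f (x(i := y)) - f (x(i := z))\<bar> <= B2 * \<bar>y - z\<bar>" for x y z
 proof -
  have "norm (f (x(i := y)) - f (x(i := z))) <= B2 * norm (y - z)"
  proof (rule field_differentiable_bound[of UNIV "%t. f (x(i := t))" "%t. g (x(i := t))"])
   fix t show "((%t. f (x(i := t))) has_field_derivative g (x(i := t))) (at t within UNIV)"
    using g(2)[of "x(i := t)"] by simp
  qed (use B2 in auto)
  then show ?thesis by simp
 qed
 have "tame i (2 * B1 + B2) (max 0 R) f"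
  unfolding tame_def
 proof (intro conjI allI impI)
  fix x :: "nat => real" and y z :: real
  have "\<bar>f (x(i := y)) - f (x(i := z))\<bar> <= 2 * B1" using B1(2)[of "x(i := y)"] B1(2)[of "x(i := z)"] by linarith
  moreover have "B2 * \<bar>y - z\<bar> <= (2 * B1 + B2) * \<bar>y - z\<bar>" using B1(1) by (intro mult_right_mono) auto
  ultimately show "\<bar>f (x(i := y)) - f (x(i := z))\<bar> <= (2 * B1 + B2) * min 1 \<bar>y - z\<bar>"
   using lip[where x = x and y = y and z = z] B2(1) unfolding min_def by (simp split: if_splits) 
  assume far: "max 0 R < \<bar>y\<bar> \<and> max 0 R < \<bar>z\<bar>"
  show "f (x(i := y)) = f (x(i := z))"
  proof (cases "i < n")
   case True
   then have "f (x(i := y)) = 0" "f (x(i := z)) = 0" using R[of "x(i := y)" i] R[of "x(i := z)" i] far by (fastforce)+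
   then show ?thesis by simp
  next
   case False
   then show ?thesis using f by (intro dependsD[of n f]) (auto simp: C0_infinity_iff)
  qed
 qed (use B1 B2 in auto)
 then show ?thesis by blast
qed

lemma FC0_tame: assumes f: "f \<in> FC0" shows "EX B R. tame i B R f"
 using f
proof (induction f rule: FC0_induct)
 case zero
 show ?case by (intro exI[of _ 0]) (auto simp: tame_def)
next
 case (add f g n)
 obtain B R where f: "tame i B R f" using add by blast
 obtain B' R' where g: "tame i B' R' g" using C0_tame[OF \<open>g \<in> C0_infinity n\<close>] by blast
 have "tame i (B + B') (max R R') (%x. f x + g x)"
  unfolding tame_def
 proof (intro conjI allI impI)
  fix x :: "nat => real" and y z :: real
  have "\<bar>f (x(i := y)) - f (x(i := z))\<bar> <= B * min 1 \<bar>y - z\<bar>" "\<bar>g (x(i := y)) - g (x(i := z))\<bar> <= B' * min 1 \<bar>y - z\<bar>"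
   using f g by (auto simp: tame_def)
  then show "\<bar>f (x(i := y)) + g (x(i := y)) - (f (x(i := z)) + g (x(i := z)))\<bar> <= (B + B') * min 1 \<bar>y - z\<bar>"
   unfolding distrib_right by linarith
  show "f (x(i := y)) + g (x(i := y)) = f (x(i := z)) + g (x(i := z))" if "max R R' < \<bar>y\<bar> \<and> max R R' < \<bar>z\<bar>"
   using f g that unfolding tame_def by (metis max_less_iff_conj)
 qed (use f g in \<open>auto simp: tame_def\<close>)
 then show ?case by blast
qed

lemma FC0_bounded: assumes f: "f \<in> FC0" shows "EX B. ALL x. \<bar>f x\<bar> <= B"
 using f
proof (induction f rule: FC0_induct)
 case (add f g n)
 obtain B where B: "!!x. \<bar>f x\<bar> <= B" using add by blast
 obtain B' where B': "!!x. \<bar>g x\<bar> <= B'" using C0_bounded[OF \<open>g \<in> C0_infinity n\<close>] by blast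
 have "\<bar>f x + g x\<bar> <= B + B'" for x using B[of x] B'[of x] by linarith
 then show ?case by blast
qed auto

lemma FC0_continuous: "f \<in> FC0 ==> continuous_on UNIV f"
 by (metis FC0_props cyl_continuous)

lemma FC0_borel: "f \<in> FC0 ==> f \<in> borel_measurable borel"
 by (rule borel_measurable_continuous_onI[OF FC0_continuous])

lemma FC0_product:
 assumes h: "!!i k. i < n ==> Ck k (h i)" and R: "!!i t. i < n ==> h i t ~= 0 ==> \<bar>t\<bar> <= R" and n: "1 <= n"
 shows "(%x. \<Prod>i<n. h i (x i)) \<in> FC0"
proof (rule FC0_single[OF C0I n])
 show "depends n (%x. \<Prod>i<n. h i (x i))" by (auto simp: depends_def intro: prod.cong)
 show "cyl k (%x. \<Prod>i<n. h i (x i))" for k by (intro cyl_prod cyl_compose[OF h cyl_coord]) auto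
 show "bdd_support n (%x. \<Prod>i<n. h i (x i))" unfolding bdd_support_def using R by (intro exI[of _ R]) auto
qed

section \<open>Conditional distributions\<close>

locale cond_density_setting = prob_L2 \<mu> for \<mu> :: "(nat => real) measure" +
 fixes \<kappa> :: "nat => (nat => real) => real measure" and \<rho> :: "nat => (nat => real) => real => real" and \<alpha> :: real
 assumes alpha: "1 < \<alpha>" "\<alpha> < 2"
  and coord: "!!i. (%x. x i) \<in> borel_measurable \<mu>"
  and cond: "!!i. cond_distribution \<mu> i (\<kappa> i)"
  and dens: "!!i. cond_density \<mu> i (\<kappa> i) (\<rho> i)"
  and bounded: "!!i K. compact K ==> EX L. density_bound \<mu> (\<rho> i) K L"
begin

lemma id_measurable [measurable]: "(%x. x) \<in> borel_measurable \<mu>"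
 by (rule measurable_coordinatewise_then_product[OF coord])

lemma borel_comp: "f \<in> borel_measurable borel ==> f \<in> borel_measurable \<mu>"
 for f :: "(nat => real) => 'b::topological_space"
 by (rule measurable_compose[OF id_measurable])

lemma compl_rectangles_subset:
 "{{x \<in> space \<mu>. \<forall>j\<in>J. x j \<in> B j} | J B. finite J \<and> i \<notin> J \<and> (\<forall>j\<in>J. B j \<in> sets borel)} \<subseteq> Pow (space \<mu>)"
 by auto

lemma compl_space: "space (compl_field (space \<mu>) i) = space \<mu>"
 unfolding compl_field_def by (rule space_measure_of[OF compl_rectangles_subset])

lemma rectangle_in_sets:
 assumes "finite J" "!!j. j \<in> J ==> B j \<in> sets borel"
 shows "{x \<in> space \<mu>. \<forall>j\<in>J. x j \<in> B j} \<in> sets \<mu>"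
proof -
 have "{x \<in> space \<mu>. x j \<in> B j} \<in> sets \<mu>" if "j \<in> J" for j
  using measurable_sets[OF coord assms(2)[OF that]] by (simp add: vimage_def Int_def conj_commute)
 then show ?thesis by (intro sets.sets_Collect_finite_All assms(1))
qed

lemma id_compl: "(%x. x) \<in> measurable \<mu> (compl_field (space \<mu>) i)"
 unfolding compl_field_def
proof (rule measurable_measure_of[OF compl_rectangles_subset])
 fix y assume "y \<in> {{x \<in> space \<mu>. \<forall>j\<in>J. x j \<in> B j} | J B. finite J \<and> i \<notin> J \<and> (\<forall>j\<in>J. B j \<in> sets borel)}"
 then obtain J B where y: "y = {x \<in> space \<mu>. \<forall>j\<in>J. x j \<in> B j}" "finite J" "\<forall>j\<in>J. B j \<in> sets borel" by blast
 have "y \<in> sets \<mu>" unfolding y(1) by (rule rectangle_in_sets[OF y(2)]) (use y(3) in blast)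
 moreover have "(%x. x) -` y \<inter> space \<mu> = y" unfolding y(1) by auto
 ultimately show "(%x. x) -` y \<inter> space \<mu> \<in> sets \<mu>" by simp
qed (rule funcsetI)

lemma compl_sets:
 assumes B: "B \<in> sets (compl_field (space \<mu>) i)" shows "B \<in> sets \<mu>"
proof -
 have "B \<subseteq> space \<mu>" using sets.sets_into_space[OF B] by (simp only: compl_space)
 then have "(%x. x) -` B \<inter> space \<mu> = B" by auto
 then show ?thesis using measurable_sets[OF id_compl B] by (simp only:)
qed

lemma kernel_compl: "\<kappa> i \<in> compl_field (space \<mu>) i \<rightarrow>\<^sub>M prob_algebra borel"
 using cond[of i] unfolding cond_distribution_def by (rule conjunct1)

lemma kernel_prob [measurable]: "\<kappa> i \<in> \<mu> \<rightarrow>\<^sub>M prob_algebra borel"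
 by (rule measurable_compose[OF id_compl kernel_compl])

lemma kernel [measurable]: "\<kappa> i \<in> \<mu> \<rightarrow>\<^sub>M subprob_algebra borel"
 by (rule measurable_prob_algebraD[OF kernel_prob])

lemma kernel_space:
 assumes "x \<in> space \<mu>" shows "prob_space (\<kappa> i x)" "sets (\<kappa> i x) = sets borel" "space (\<kappa> i x) = UNIV"
proof -
 have "\<kappa> i x \<in> space (prob_algebra borel)" by (rule measurable_space[OF kernel_prob assms])
 then show "prob_space (\<kappa> i x)" and s: "sets (\<kappa> i x) = sets borel" by (auto simp: space_prob_algebra)
 show "space (\<kappa> i x) = UNIV" using sets_eq_imp_space_eq[OF s] by simp
qed

lemma kernel_measurable_cong: "x \<in> space \<mu> ==> measurable (\<kappa> i x) N = measurable borel N"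
 by (rule measurable_cong_sets[OF kernel_space(2) refl])

text \<open>The defining identity of the conditional distribution says that two finite measures on
  \<open>compl_field\<close> agree; integrating \<open>g\<close> against both extends it from sets
  to functions.\<close>

lemma kernel_average:
 assumes C: "C \<in> sets borel" and g: "g \<in> borel_measurable (compl_field (space \<mu>) i)"
 shows "(\<integral>\<^sup>+x. indicator C (x i) * g x \<partial>\<mu>) = (\<integral>\<^sup>+x. emeasure (\<kappa> i x) C * g x \<partial>\<mu>)"
proof -
 let ?N = "compl_field (space \<mu>) i"
 have Ci: "(%x. indicator C (x i) :: ennreal) \<in> borel_measurable \<mu>"
  by (rule measurable_compose[OF coord[of i] borel_measurable_indicator[OF C]])
 have Ck: "(%x. emeasure (\<kappa> i x) C) \<in> borel_measurable \<mu>"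
  by (rule measurable_emeasure_kernel[OF kernel C])
 let ?M1 = "distr (density \<mu> (%x. indicator C (x i))) ?N (%x. x)"
 let ?M2 = "distr (density \<mu> (%x. emeasure (\<kappa> i x) C)) ?N (%x. x)"
 have idd: "(%x. x) \<in> measurable (density \<mu> w) ?N" for w using id_compl by simp
 have gm: "g \<in> borel_measurable \<mu>" using measurable_compose[OF id_compl g] by simp
 have "?M1 = ?M2"
 proof (rule measure_eqI)
  fix B assume "B \<in> sets ?M1"
  then have B: "B \<in> sets ?N" by simp
  then have B': "B \<in> sets \<mu>" by (rule compl_sets)
  have v: "(%x. x) -` B \<inter> space \<mu> = B" using sets.sets_into_space[OF B'] by auto
  have Cs: "{x \<in> space \<mu>. x i \<in> C} \<in> sets \<mu>"
   using measurable_sets[OF coord[of i] C] by (simp add: vimage_def Int_def conj_commute)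
  have "emeasure ?M1 B = (\<integral>\<^sup>+x. indicator C (x i) * indicator B x \<partial>\<mu>)"
   using B B' v by (simp add: emeasure_distr[OF idd B] emeasure_density[OF Ci])
  also have "\<dots> = (\<integral>\<^sup>+x. indicator ({x \<in> space \<mu>. x i \<in> C} \<inter> B) x \<partial>\<mu>)"
   by (intro nn_integral_cong) (auto simp: indicator_def)
  also have "\<dots> = emeasure \<mu> ({x \<in> space \<mu>. x i \<in> C} \<inter> B)" using Cs B' by (intro nn_integral_indicator) auto
  also have "\<dots> = ennreal (\<integral>x. indicator B x * measure (\<kappa> i x) C \<partial>\<mu>)"
   using cond[of i] C B unfolding cond_distribution_def by (simp add: emeasure_eq_measure)
  also have "\<dots> = (\<integral>\<^sup>+x. ennreal (indicator B x * measure (\<kappa> i x) C) \<partial>\<mu>)"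
  proof (rule nn_integral_eq_integral[symmetric])
   have m: "(%x. measure (\<kappa> i x) C) \<in> borel_measurable \<mu>" using Ck unfolding measure_def by measurable
   show "integrable \<mu> (%x. indicator B x * measure (\<kappa> i x) C)"
   proof (rule integrable_const_bound[of _ 1])
    show "AE x in \<mu>. norm (indicator B x * measure (\<kappa> i x) C) <= 1"
     using prob_space.prob_le_1[OF kernel_space(1)] by (intro AE_I2) (auto simp: indicator_def)
   qed (use m B' in measurable)
  qed auto
  also have "\<dots> = (\<integral>\<^sup>+x. emeasure (\<kappa> i x) C * indicator B x \<partial>\<mu>)"
  proof (intro nn_integral_cong)
   fix x assume "x \<in> space \<mu>"
   then interpret k: prob_space "\<kappa> i x" by (rule kernel_space)
   show "ennreal (indicator B x * measure (\<kappa> i x) C) = emeasure (\<kappa> i x) C * indicator B x"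
    by (auto simp: indicator_def k.emeasure_eq_measure)
  qed
  also have "\<dots> = emeasure ?M2 B"
   using B B' v by (simp add: emeasure_distr[OF idd B] emeasure_density[OF Ck])
  finally show "emeasure ?M1 B = emeasure ?M2 B" .
 qed simp
 then have "(\<integral>\<^sup>+x. g x \<partial>?M1) = (\<integral>\<^sup>+x. g x \<partial>?M2)" by simp
 then show ?thesis
  by (simp add: nn_integral_distr[OF idd] g nn_integral_density[OF Ci gm] nn_integral_density[OF Ck gm])
qed

text \<open>The law of \<open>h x y\<close> when \<open>x\<close> has law \<open>\<mu>\<close> and
  \<open>y\<close> is drawn from the kernel at \<open>x\<close>. It lives on sequences with the
  product field, where measures can be compared on finite-dimensional rectangles.\<close>

definition joint :: "nat => ((nat => real) => real => nat => real) => (nat => real) measure" where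
 "joint i h = \<mu> \<bind> (%x. distr (\<kappa> i x) (Pi\<^sub>M UNIV (%_. borel)) (h x))"

lemma nn_integral_joint:
 assumes h: "(%(x, y). h x y) \<in> \<mu> \<Otimes>\<^sub>M borel \<rightarrow>\<^sub>M Pi\<^sub>M UNIV (%_. borel)" and g: "g \<in> borel_measurable (Pi\<^sub>M UNIV (%_. borel))"
 shows "(\<integral>\<^sup>+z. g z \<partial>joint i h) = (\<integral>\<^sup>+x. \<integral>\<^sup>+y. g (h x y) \<partial>\<kappa> i x \<partial>\<mu>)"
proof -
 have "(%x. distr (\<kappa> i x) (Pi\<^sub>M UNIV (%_. borel)) (h x)) \<in> \<mu> \<rightarrow>\<^sub>M subprob_algebra (Pi\<^sub>M UNIV (%_. borel))"
  by (rule measurable_distr2[OF h kernel])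
 then have "(\<integral>\<^sup>+z. g z \<partial>joint i h) = (\<integral>\<^sup>+x. \<integral>\<^sup>+z. g z \<partial>distr (\<kappa> i x) (Pi\<^sub>M UNIV (%_. borel)) (h x) \<partial>\<mu>)"
  unfolding joint_def by (rule nn_integral_bind[OF g])
 also have "\<dots> = (\<integral>\<^sup>+x. \<integral>\<^sup>+y. g (h x y) \<partial>\<kappa> i x \<partial>\<mu>)"
 proof (rule nn_integral_cong)
  fix x assume x: "x \<in> space \<mu>"
  have "h x \<in> \<kappa> i x \<rightarrow>\<^sub>M Pi\<^sub>M UNIV (%_. borel)"
   unfolding kernel_measurable_cong[OF x] using measurable_Pair2[OF h x] by simp
  then show "(\<integral>\<^sup>+z. g z \<partial>distr (\<kappa> i x) (Pi\<^sub>M UNIV (%_. borel)) (h x)) = (\<integral>\<^sup>+y. g (h x y) \<partial>\<kappa> i x)"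
   by (rule nn_integral_distr) (simp add: g)
 qed
 finally show ?thesis .
qed

lemma sets_joint: "sets (joint i h) = sets (Pi\<^sub>M UNIV (%_. borel))"
proof -
 have "sets (distr (\<kappa> i x) (Pi\<^sub>M UNIV (%_. borel :: real measure)) (h x)) = sets (Pi\<^sub>M UNIV (%_. borel))" for x
  by (rule sets_distr)
 then show ?thesis unfolding joint_def by (rule sets_bind) (rule not_empty)
qed

text \<open>Given the other coordinates, the \<open>i\<close>-th coordinate and an independent copy of it are exchangeable.
 The pair \<open>(x, y)\<close> is coded as the sequence \<open>y, x 0, x 1, \<dots>\<close>.\<close>

lemma joint_exchange: "joint i (%x y. case_nat (x i) (x(i := y))) = joint i (%x y. case_nat y x)"
proof -
 let ?P = "Pi\<^sub>M UNIV (%_. borel) :: (nat => real) measure"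
 have m0: "(%p. fst p j) \<in> borel_measurable (\<mu> \<Otimes>\<^sub>M borel)" for j
  by (rule measurable_compose[OF measurable_fst coord])
 have m1: "(%(x, y). case_nat y x) \<in> \<mu> \<Otimes>\<^sub>M borel \<rightarrow>\<^sub>M ?P"
 proof (rule measurable_PiM_single')
  fix j show "(%p. (case p of (x, y) => case_nat y x) j) \<in> borel_measurable (\<mu> \<Otimes>\<^sub>M borel)"
   using m0 by (cases j) (auto simp: split_beta)
 qed auto
 have m2: "(%(x, y). case_nat (x i) (x(i := y))) \<in> \<mu> \<Otimes>\<^sub>M borel \<rightarrow>\<^sub>M ?P"
 proof (rule measurable_PiM_single')
  fix j show "(%p. (case p of (x, y) => case_nat (x i) (x(i := y))) j) \<in> borel_measurable (\<mu> \<Otimes>\<^sub>M borel)"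
   using m0 by (cases j; cases "j = Suc i") (auto simp: split_beta)
 qed auto
 show ?thesis
 proof (rule measure_eqI_PiM_infinite)
  show "sets (joint i (%x y. case_nat (x i) (x(i := y)))) = sets ?P" by (rule sets_joint)
  show "sets (joint i (%x y. case_nat y x)) = sets ?P" by (rule sets_joint)
  show "finite_measure (joint i (%x y. case_nat (x i) (x(i := y))))"
  proof
   have "emeasure (joint i (%x y. case_nat (x i) (x(i := y)))) (space (joint i (%x y. case_nat (x i) (x(i := y)))))
    = (\<integral>\<^sup>+z. 1 \<partial>joint i (%x y. case_nat (x i) (x(i := y))))" by simp
   also have "\<dots> = (\<integral>\<^sup>+x. \<integral>\<^sup>+y. 1 \<partial>\<kappa> i x \<partial>\<mu>)" by (rule nn_integral_joint[OF m2]) simp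
   also have "\<dots> = (\<integral>\<^sup>+x. 1 \<partial>\<mu>)"
    using prob_space.emeasure_space_1[OF kernel_space(1)] by (intro nn_integral_cong) simp
   also have "\<dots> = 1" by (simp add: emeasure_space_1)
   finally show "emeasure (joint i (%x y. case_nat (x i) (x(i := y)))) (space (joint i (%x y. case_nat (x i) (x(i := y))))) ~= \<infinity>"
    by simp
  qed
  fix A :: "nat => real set" and J assume J: "finite J" "J \<subseteq> UNIV" and A: "!!j. j \<in> J ==> A j \<in> sets borel"
  let ?X = "prod_emb UNIV (%_. borel) J (Pi\<^sub>E J A)"
  define A' where "A' j = (if j \<in> J then A j else UNIV)" for j
  have A': "A' j \<in> sets borel" for j using A by (simp add: A'_def)
  have X: "z \<in> ?X \<longleftrightarrow> (\<forall>j\<in>J. z j \<in> A j)" for z by (auto simp: prod_emb_iff PiE_iff)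
  have Xs: "?X \<in> sets ?P" by (rule sets_PiM_I) (use J A in auto)
  \<comment> \<open>The rectangle splits into a condition on index 0, one on index
    \<open>Suc i\<close>, and the set \<open>B\<close> given by the remaining coordinates of
    \<open>x\<close>, which does not feel the change of coordinate \<open>i\<close>.\<close>
  define J' where "J' = {j. Suc j \<in> J \<and> j ~= i}"
  have "finite (Suc -` J)" using J(1) by (intro finite_vimageI) auto
  then have J': "finite J'" by (rule rev_finite_subset) (auto simp: J'_def)
  define B where "B = {x \<in> space \<mu>. \<forall>j\<in>J'. x j \<in> A (Suc j)}"
  have B: "B \<in> sets (compl_field (space \<mu>) i)"
   unfolding compl_field_def B_def
   by (rule in_measure_of[OF compl_rectangles_subset])
    (use J' A in \<open>auto simp: J'_def intro!: exI[of _ J'] exI[of _ "%j. A (Suc j)"]\<close>)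
  have "(\<forall>j\<in>J. case_nat u w j \<in> A j) \<longleftrightarrow> u \<in> A' 0 \<and> w i \<in> A' (Suc i) \<and> (\<forall>j\<in>J'. w j \<in> A (Suc j))" for u and w :: "nat => real"
  proof
   assume a: "\<forall>j\<in>J. case_nat u w j \<in> A j"
   then show "u \<in> A' 0 \<and> w i \<in> A' (Suc i) \<and> (\<forall>j\<in>J'. w j \<in> A (Suc j))"
    using a[rule_format, of 0] a[rule_format, of "Suc _"] by (auto simp: A'_def J'_def)
  next
   assume a: "u \<in> A' 0 \<and> w i \<in> A' (Suc i) \<and> (\<forall>j\<in>J'. w j \<in> A (Suc j))"
   show "\<forall>j\<in>J. case_nat u w j \<in> A j"
   proof
    fix j assume "j \<in> J"
    then show "case_nat u w j \<in> A j"
     using a by (cases j; cases "j = Suc i") (auto simp: A'_def J'_def split: if_splits)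
   qed
  qed
  then have X': "indicator ?X (case_nat u w) = (indicator (A' 0) u * indicator (A' (Suc i)) (w i) * indicator {w. \<forall>j\<in>J'. w j \<in> A (Suc j)} w :: ennreal)" for u w
   by (auto simp: indicator_def X)
  have iB: "indicator {w. \<forall>j\<in>J'. w j \<in> A (Suc j)} x = (indicator B x :: ennreal)"
   "indicator {w. \<forall>j\<in>J'. w j \<in> A (Suc j)} (x(i := y)) = (indicator B x :: ennreal)" if "x \<in> space \<mu>" for x y
   using that by (auto simp: indicator_def B_def J'_def)
  have k: "(%x. emeasure (\<kappa> i x) C * indicator B x) \<in> borel_measurable (compl_field (space \<mu>) i)" if "C \<in> sets borel" for C
   by (intro borel_measurable_times_ennreal borel_measurable_indicator B measurable_emeasure_kernel[OF measurable_prob_algebraD[OF kernel_compl] that])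
  have int: "(\<integral>\<^sup>+y. indicator C y * c \<partial>\<kappa> i x) = emeasure (\<kappa> i x) C * c" if "x \<in> space \<mu>" "C \<in> sets borel" for x C c
   using that by (subst nn_integral_multc) (auto simp: kernel_measurable_cong kernel_space)
  have "emeasure (joint i (%x y. case_nat (x i) (x(i := y)))) ?X = (\<integral>\<^sup>+z. indicator ?X z \<partial>joint i (%x y. case_nat (x i) (x(i := y))))"
   using Xs sets_joint by simp
  also have "\<dots> = (\<integral>\<^sup>+x. \<integral>\<^sup>+y. indicator ?X (case_nat (x i) (x(i := y))) \<partial>\<kappa> i x \<partial>\<mu>)"
   by (rule nn_integral_joint[OF m2 borel_measurable_indicator[OF Xs]])
  also have "\<dots> = (\<integral>\<^sup>+x. indicator (A' 0) (x i) * (emeasure (\<kappa> i x) (A' (Suc i)) * indicator B x) \<partial>\<mu>)"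
  proof (intro nn_integral_cong)
   fix x assume x: "x \<in> space \<mu>"
   have "(\<integral>\<^sup>+y. indicator ?X (case_nat (x i) (x(i := y))) \<partial>\<kappa> i x) = (\<integral>\<^sup>+y. indicator (A' (Suc i)) y * (indicator (A' 0) (x i) * indicator B x) \<partial>\<kappa> i x)"
    by (intro nn_integral_cong) (simp add: X' iB[OF x] mult_ac del: fun_upd_apply, simp add: mult_ac)
   also have "\<dots> = emeasure (\<kappa> i x) (A' (Suc i)) * (indicator (A' 0) (x i) * indicator B x)" by (rule int[OF x A'])
   finally show "(\<integral>\<^sup>+y. indicator ?X (case_nat (x i) (x(i := y))) \<partial>\<kappa> i x) = indicator (A' 0) (x i) * (emeasure (\<kappa> i x) (A' (Suc i)) * indicator B x)"
    by (simp add: mult_ac)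
  qed
  \<comment> \<open>Conditioning replaces the indicator of \<open>x i\<close> by a kernel mass. The
    result is symmetric in the two factors, and undoing the step on the other factor swaps their
    roles.\<close>
  also have "\<dots> = (\<integral>\<^sup>+x. emeasure (\<kappa> i x) (A' 0) * (emeasure (\<kappa> i x) (A' (Suc i)) * indicator B x) \<partial>\<mu>)"
   by (rule kernel_average[OF A' k[OF A']])
  also have "\<dots> = (\<integral>\<^sup>+x. emeasure (\<kappa> i x) (A' (Suc i)) * (emeasure (\<kappa> i x) (A' 0) * indicator B x) \<partial>\<mu>)"
   by (simp add: mult_ac)
  also have "\<dots> = (\<integral>\<^sup>+x. indicator (A' (Suc i)) (x i) * (emeasure (\<kappa> i x) (A' 0) * indicator B x) \<partial>\<mu>)"
   by (rule kernel_average[OF A' k[OF A'], symmetric])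
  also have "\<dots> = (\<integral>\<^sup>+x. \<integral>\<^sup>+y. indicator ?X (case_nat y x) \<partial>\<kappa> i x \<partial>\<mu>)"
  proof (intro nn_integral_cong)
   fix x assume x: "x \<in> space \<mu>"
   have "(\<integral>\<^sup>+y. indicator ?X (case_nat y x) \<partial>\<kappa> i x) = (\<integral>\<^sup>+y. indicator (A' 0) y * (indicator (A' (Suc i)) (x i) * indicator B x) \<partial>\<kappa> i x)"
    by (intro nn_integral_cong) (simp add: X' iB[OF x] mult_ac)
   also have "\<dots> = emeasure (\<kappa> i x) (A' 0) * (indicator (A' (Suc i)) (x i) * indicator B x)" by (rule int[OF x A'])
   finally show "indicator (A' (Suc i)) (x i) * (emeasure (\<kappa> i x) (A' 0) * indicator B x) = (\<integral>\<^sup>+y. indicator ?X (case_nat y x) \<partial>\<kappa> i x)"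
    by (simp add: mult_ac)
  qed
  also have "\<dots> = (\<integral>\<^sup>+z. indicator ?X z \<partial>joint i (%x y. case_nat y x))"
   by (rule nn_integral_joint[OF m1 borel_measurable_indicator[OF Xs], symmetric])
  also have "\<dots> = emeasure (joint i (%x y. case_nat y x)) ?X"
   using Xs sets_joint by simp
  finally show "emeasure (joint i (%x y. case_nat (x i) (x(i := y)))) ?X = emeasure (joint i (%x y. case_nat y x)) ?X" .
 qed
qed

lemma exchange:
 assumes g: "(%(x, y). g x y) \<in> borel_measurable (borel \<Otimes>\<^sub>M borel)"
 shows "(\<integral>\<^sup>+x. \<integral>\<^sup>+y. g (x(i := y)) (x i) \<partial>\<kappa> i x \<partial>\<mu>) = (\<integral>\<^sup>+x. \<integral>\<^sup>+y. (g x y :: ennreal) \<partial>\<kappa> i x \<partial>\<mu>)"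
proof -
 let ?P = "Pi\<^sub>M UNIV (%_. borel) :: (nat => real) measure"
 have m0: "(%p. fst p j) \<in> borel_measurable (\<mu> \<Otimes>\<^sub>M borel)" for j
  by (rule measurable_compose[OF measurable_fst coord])
 have m1: "(%(x, y). case_nat y x) \<in> \<mu> \<Otimes>\<^sub>M borel \<rightarrow>\<^sub>M ?P"
 proof (rule measurable_PiM_single')
  fix j show "(%p. (case p of (x, y) => case_nat y x) j) \<in> borel_measurable (\<mu> \<Otimes>\<^sub>M borel)"
   using m0 by (cases j) (auto simp: split_beta)
 qed auto
 have m2: "(%(x, y). case_nat (x i) (x(i := y))) \<in> \<mu> \<Otimes>\<^sub>M borel \<rightarrow>\<^sub>M ?P"
 proof (rule measurable_PiM_single')
  fix j show "(%p. (case p of (x, y) => case_nat (x i) (x(i := y))) j) \<in> borel_measurable (\<mu> \<Otimes>\<^sub>M borel)"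
   using m0 by (cases j; cases "j = Suc i") (auto simp: split_beta)
 qed auto
 have c: "(%z. z j) \<in> borel_measurable ?P" for j by measurable
 have "(%z j. z (Suc j)) \<in> borel_measurable ?P" by (rule measurable_coordinatewise_then_product) (rule c)
 then have "(%z. (%j. z (Suc j), z 0)) \<in> ?P \<rightarrow>\<^sub>M borel \<Otimes>\<^sub>M borel" using c by measurable
 from measurable_compose[OF this g]
 have g': "(%z. g (%j. z (Suc j)) (z 0)) \<in> borel_measurable ?P" by simp
 show ?thesis
  using nn_integral_joint[OF m2 g', of i] nn_integral_joint[OF m1 g', of i] joint_exchange[of i] by (simp del: fun_upd_apply)
qed

end

section \<open>The jump forms\<close>

lemma nn_integral_powr_from_0: "-1 < a ==> (\<integral>\<^sup>+s. ennreal (s powr a) * indicator {0..1} s \<partial>lborel) < \<infinity>"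
 using nn_integral_has_integral_lebesgue'[OF _ has_integral_powr_from_0[of a 1]] by simp

lemma nn_integral_powr_to_inf: "a < -1 ==> (\<integral>\<^sup>+s. ennreal (s powr a) * indicator {1..} s \<partial>lborel) < \<infinity>"
 using nn_integral_has_integral_lebesgue'[OF _ has_integral_powr_to_inf[of a 1]] by simp

text \<open>The total rate of capped squared increments of a function on the line; \<open>c\<close>
  is the square of its Lipschitz constant.\<close>

definition jump_mass :: "real => real => ennreal" where
 "jump_mass \<alpha> c = (\<integral>\<^sup>+s. ennreal (min 1 (c * s\<^sup>2) / \<bar>s\<bar> powr (\<alpha> + 1)) \<partial>lborel)"

text \<open>Near 0 the integrand is at most \<open>c s^(1-\<alpha>)\<close>, integrable since
  \<open>\<alpha> < 2\<close>, and far out it is at most \<open>s^(-1-\<alpha>)\<close>. The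
  negative half-line follows by reflection.\<close>

lemma jump_mass_finite:
 assumes a: "1 < \<alpha>" "\<alpha> < 2" and c: "0 <= c" shows "jump_mass \<alpha> c < \<infinity>"
proof -
 define h where "h s = ennreal c * (ennreal (s powr (1 - \<alpha>)) * indicator {0..1} s) + ennreal (s powr (- 1 - \<alpha>)) * indicator {1..} s" for s :: real
 have hm: "h \<in> borel_measurable borel" unfolding h_def by measurable
 have "(\<integral>\<^sup>+s. h s \<partial>lborel) = ennreal c * (\<integral>\<^sup>+s. ennreal (s powr (1 - \<alpha>)) * indicator {0..1} s \<partial>lborel)
   + (\<integral>\<^sup>+s. ennreal (s powr (- 1 - \<alpha>)) * indicator {1..} s \<partial>lborel)"
  unfolding h_def by (subst nn_integral_add) (auto simp: nn_integral_cmult)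
 also have "\<dots> < \<infinity>"
 proof -
  have 1: "(\<integral>\<^sup>+s. ennreal (s powr (1 - \<alpha>)) * indicator {0..1} s \<partial>lborel) < \<infinity>"
   by (rule nn_integral_powr_from_0) (use a in linarith)
  have 2: "(\<integral>\<^sup>+s. ennreal (s powr (- 1 - \<alpha>)) * indicator {1..} s \<partial>lborel) < \<infinity>"
   by (rule nn_integral_powr_to_inf) (use a in linarith)
  have "ennreal c * (\<integral>\<^sup>+s. ennreal (s powr (1 - \<alpha>)) * indicator {0..1} s \<partial>lborel) < \<infinity>"
   unfolding infinity_ennreal_def using 1 by (intro ennreal_mult_less_top[THEN iffD2]) simp
  then show ?thesis using 2 unfolding infinity_ennreal_def by (intro ennreal_add_less_top[THEN iffD2] conjI)
 qed
 finally have hf: "(\<integral>\<^sup>+s. h s \<partial>lborel) < \<infinity>" .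
 have hr: "(\<integral>\<^sup>+s. h (- s) \<partial>lborel) = (\<integral>\<^sup>+s. h s \<partial>lborel)"
  using nn_integral_real_affine[OF hm, of "-1" 0] by simp
 have pos: "ennreal (min 1 (c * s\<^sup>2) / \<bar>s\<bar> powr (\<alpha> + 1)) <= h \<bar>s\<bar>" for s
 proof (cases "s = 0")
  case False
  then have s: "0 < \<bar>s\<bar>" by simp
  show ?thesis
  proof (cases "\<bar>s\<bar> <= 1")
   case True
   have "min 1 (c * s\<^sup>2) / \<bar>s\<bar> powr (\<alpha> + 1) <= c * s\<^sup>2 / \<bar>s\<bar> powr (\<alpha> + 1)" by (intro divide_right_mono) auto
   also have "\<dots> = c * \<bar>s\<bar> powr (1 - \<alpha>)"
   proof -
    have "s\<^sup>2 = \<bar>s\<bar> powr 2" using s by (simp add: powr_numeral)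
    moreover have "\<bar>s\<bar> powr 2 / \<bar>s\<bar> powr (\<alpha> + 1) = \<bar>s\<bar> powr (1 - \<alpha>)" by (subst powr_diff[symmetric]) (simp add: algebra_simps)
    ultimately show ?thesis by (simp only: times_divide_eq_right[symmetric])
   qed
   finally have "ennreal (min 1 (c * s\<^sup>2) / \<bar>s\<bar> powr (\<alpha> + 1)) <= ennreal c * ennreal (\<bar>s\<bar> powr (1 - \<alpha>))"
    using c by (simp add: ennreal_mult[symmetric] ennreal_leI)
   then show ?thesis unfolding h_def using True by (intro order_trans[OF _ add_increasing2]) simp_all
  next
   case False
   have "min 1 (c * s\<^sup>2) / \<bar>s\<bar> powr (\<alpha> + 1) <= 1 / \<bar>s\<bar> powr (\<alpha> + 1)" by (intro divide_right_mono) auto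
   also have "\<dots> = \<bar>s\<bar> powr (- 1 - \<alpha>)" by (simp add: powr_minus_divide[symmetric] algebra_simps)
   finally show ?thesis using False by (auto simp: h_def intro: ennreal_leI)
  qed
 qed (simp)
 have "jump_mass \<alpha> c <= (\<integral>\<^sup>+s. h s + h (- s) \<partial>lborel)"
  unfolding jump_mass_def
 proof (rule nn_integral_mono)
  fix s :: real
  show "ennreal (min 1 (c * s\<^sup>2) / \<bar>s\<bar> powr (\<alpha> + 1)) <= h s + h (- s)"
  proof (cases "0 <= s")
   case True
   then show ?thesis using pos[of s] by (intro order_trans[OF _ add_increasing2]) simp_all
  next
   case False
   then show ?thesis using pos[of s] by (intro order_trans[OF _ add_increasing]) simp_all
  qed
 qed
 also have "\<dots> = (\<integral>\<^sup>+s. h s \<partial>lborel) + (\<integral>\<^sup>+s. h (- s) \<partial>lborel)"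
  using hm by (intro nn_integral_add) auto
 also have "\<dots> < \<infinity>" using hf unfolding hr by simp
 finally show ?thesis .
qed

text \<open>Substituting \<open>y = t + r s\<close> yields one factor \<open>r\<close> from the
  measure and \<open>r^-(\<alpha>+1)\<close> from the kernel.\<close>

lemma jump_mass_scaled:
 assumes r: "0 < r"
 shows "(\<integral>\<^sup>+y. ennreal (min 1 (c * ((y - t) / r)\<^sup>2) / \<bar>y - t\<bar> powr (\<alpha> + 1)) \<partial>lborel) = ennreal (r powr (- \<alpha>)) * jump_mass \<alpha> c"
proof -
 let ?f = "%y. ennreal (min 1 (c * ((y - t) / r)\<^sup>2) / \<bar>y - t\<bar> powr (\<alpha> + 1))"
 have "(\<integral>\<^sup>+y. ?f y \<partial>lborel) = \<bar>r\<bar> * (\<integral>\<^sup>+s. ?f (t + r * s) \<partial>lborel)"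
  by (rule nn_integral_real_affine) (use r in auto)
 also have "(\<integral>\<^sup>+s. ?f (t + r * s) \<partial>lborel) = (\<integral>\<^sup>+s. ennreal (r powr (- (\<alpha> + 1))) * ennreal (min 1 (c * s\<^sup>2) / \<bar>s\<bar> powr (\<alpha> + 1)) \<partial>lborel)"
 proof (intro nn_integral_cong)
  fix s :: real
  have "ennreal (r powr (- (\<alpha> + 1))) * ennreal (min 1 (c * s\<^sup>2) / \<bar>s\<bar> powr (\<alpha> + 1))
    = ennreal (r powr (- (\<alpha> + 1)) * (min 1 (c * s\<^sup>2) / \<bar>s\<bar> powr (\<alpha> + 1)))"
   by (rule ennreal_mult'[symmetric]) simp
  also have "r powr (- (\<alpha> + 1)) * (min 1 (c * s\<^sup>2) / \<bar>s\<bar> powr (\<alpha> + 1)) = min 1 (c * s\<^sup>2) / \<bar>r * s\<bar> powr (\<alpha> + 1)"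
   unfolding powr_minus_divide using r by (simp only: abs_mult powr_mult abs_of_pos times_divide_times_eq mult_1)
  finally show "?f (t + r * s) = ennreal (r powr (- (\<alpha> + 1))) * ennreal (min 1 (c * s\<^sup>2) / \<bar>s\<bar> powr (\<alpha> + 1))"
   using r by simp
 qed
 also have "\<dots> = ennreal (r powr (- (\<alpha> + 1))) * jump_mass \<alpha> c"
  unfolding jump_mass_def by (rule nn_integral_cmult) measurable
 also have "ennreal \<bar>r\<bar> * (ennreal (r powr (- (\<alpha> + 1))) * jump_mass \<alpha> c) = ennreal (r * r powr (- (\<alpha> + 1))) * jump_mass \<alpha> c"
  using r by (simp add: mult.assoc[symmetric] ennreal_mult)
 also have "r * r powr (- (\<alpha> + 1)) = r powr (- \<alpha>)"
  using r powr_add[of r 1 "- (\<alpha> + 1)"] by simp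
 finally show ?thesis .
qed

context cond_density_setting
begin

text \<open>The integrand of the form without its indicator: for \<open>y = x i\<close> both
  increments vanish, so the diagonal contributes 0 anyway.\<close>

definition ph :: "nat => ((nat => real) => real) => ((nat => real) => real) => (nat => real) => real => real" where
 "ph i u v x y = (u (x(i := y)) - u x) * (v (x(i := y)) - v x) / \<bar>y - x i\<bar> powr (\<alpha> + 1)"

lemma pre_form_i_ph: "pre_form_i \<alpha> \<mu> \<kappa> i u v = (\<integral>x. (\<integral>y. ph i u v x y \<partial>\<kappa> i x) \<partial>\<mu>)"
proof -
 have "indicator {y. y ~= x i} y * Phi \<alpha> i u v y (x i) x = ph i u v x y" for x y
  by (cases "y = x i") (simp_all add: Phi_def ph_def fun_upd_triv)
 then show ?thesis unfolding pre_form_i_def by simp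
qed

lemma ph_sym: "ph i u v = ph i v u" by (intro ext) (simp add: ph_def mult.commute)

lemma ph_lin: "ph i (%x. a * u x + b * v x) w x y = a * ph i u w x y + b * ph i v w x y"
 by (simp add: ph_def add_divide_distrib[symmetric] algebra_simps)

lemma ph_nonneg: "0 <= ph i u u x y" by (simp add: ph_def)

lemma ph_bound: "\<bar>ph i u v x y\<bar> <= ph i u u x y + ph i v v x y"
proof -
 let ?a = "u (x(i := y)) - u x" and ?b = "v (x(i := y)) - v x"
 have "0 <= (\<bar>?a\<bar> - \<bar>?b\<bar>)\<^sup>2" by simp
 then have "2 * (\<bar>?a\<bar> * \<bar>?b\<bar>) <= ?a * ?a + ?b * ?b" unfolding power2_diff by (simp add: power2_eq_square)
 moreover have "0 <= ?a * ?a + ?b * ?b" by simp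
 ultimately have "\<bar>?a * ?b\<bar> <= ?a * ?a + ?b * ?b" unfolding abs_mult by linarith
 then show ?thesis unfolding ph_def abs_divide add_divide_distrib[symmetric]
  by (simp add: divide_right_mono)
qed

lemma upd_measurable [measurable]: "(%(x, y). x(i := y)) \<in> borel_measurable (\<mu> \<Otimes>\<^sub>M borel)"
proof (rule measurable_coordinatewise_then_product)
 fix j
 have m0: "(%p. fst p j) \<in> borel_measurable (\<mu> \<Otimes>\<^sub>M borel)"
  by (rule measurable_compose[OF measurable_fst coord])
 show "(%p. (case p of (x, y) => x(i := y)) j) \<in> borel_measurable (\<mu> \<Otimes>\<^sub>M borel)"
  using m0 by (cases "j = i") (auto simp: split_beta)
qed

lemma upd_measurable_borel: "(%(x :: nat => real, y). x(i := y)) \<in> borel_measurable (borel \<Otimes>\<^sub>M borel)"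
proof (rule measurable_coordinatewise_then_product)
 fix j
 have m0: "(%p::(nat => real) \<times> real. fst p j) \<in> borel_measurable (borel \<Otimes>\<^sub>M borel)"
  by (rule measurable_compose[OF measurable_fst]) measurable
 show "(%p::(nat => real) \<times> real. (case p of (x, y) => x(i := y)) j) \<in> borel_measurable (borel \<Otimes>\<^sub>M borel)"
  using m0 by (cases "j = i") (auto simp: split_beta)
qed

lemma ph_measurable_borel:
 assumes u: "u \<in> borel_measurable borel" and v: "v \<in> borel_measurable borel"
 shows "(%(x, y). ph i u v x y) \<in> borel_measurable (borel \<Otimes>\<^sub>M borel)"
proof -
 have m0: "(%p::(nat => real) \<times> real. fst p i) \<in> borel_measurable (borel \<Otimes>\<^sub>M borel)"
  by (rule measurable_compose[OF measurable_fst]) measurable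
 have 1: "(%p. w ((fst p)(i := snd p))) \<in> borel_measurable (borel \<Otimes>\<^sub>M borel)" "(%p::(nat => real) \<times> real. w (fst p)) \<in> borel_measurable (borel \<Otimes>\<^sub>M borel)"
  if "w \<in> borel_measurable borel" for w :: "(nat => real) => real"
  using measurable_compose[OF upd_measurable_borel that, of i] measurable_compose[OF measurable_fst that] by (simp_all add: split_beta)
 show ?thesis unfolding ph_def split_beta using 1[OF u] 1[OF v] m0 by measurable
qed

lemma pair_id_measurable: "(%(x, y). (x, y)) \<in> \<mu> \<Otimes>\<^sub>M borel \<rightarrow>\<^sub>M borel \<Otimes>\<^sub>M (borel :: real measure)"
 unfolding split_beta by (rule measurable_Pair[OF measurable_compose[OF measurable_fst id_measurable] measurable_snd])

lemma borel_pair_comp: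
 assumes "(%(x, y). f x y) \<in> borel_measurable (borel \<Otimes>\<^sub>M borel)"
 shows "(%(x, y). f x y) \<in> borel_measurable (\<mu> \<Otimes>\<^sub>M (borel :: real measure))"
 using measurable_compose[OF pair_id_measurable assms] by (simp add: split_beta)

lemma ph_measurable:
 "u \<in> borel_measurable borel ==> v \<in> borel_measurable borel ==> (%(x, y). ph i u v x y) \<in> borel_measurable (\<mu> \<Otimes>\<^sub>M borel)"
 by (intro borel_pair_comp ph_measurable_borel)

lemma ph_measurable_kernel:
 assumes "u \<in> borel_measurable borel" "v \<in> borel_measurable borel" "x \<in> space \<mu>"
 shows "ph i u v x \<in> borel_measurable (\<kappa> i x)"
 unfolding kernel_measurable_cong[OF assms(3)]
 using measurable_Pair2[OF ph_measurable[OF assms(1,2), of i] assms(3)] by simp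

abbreviation carre :: "nat => ((nat => real) => real) => (nat => real) => ennreal" where
 "carre i u x \<equiv> \<integral>\<^sup>+y. ennreal (ph i u u x y) \<partial>\<kappa> i x"

text \<open>Energies with values in \<open>ennreal\<close> are available for every function, so
  monotonicity and Fatou's lemma need no integrability. On \<open>FC0\<close> they agree with the
  real-valued form.\<close>

definition En :: "nat => ((nat => real) => real) => ennreal" where
 "En i u = (\<integral>\<^sup>+x. carre i u x \<partial>\<mu>)"

text \<open>The exceptional null set precedes the choice of \<open>h\<close>, because in the
  applications \<open>h\<close> depends on \<open>x\<close> through the coordinate
  \<open>x i\<close>.\<close>

lemma density_domination:
 assumes b: "density_bound \<mu> (\<rho> i) K L" and K: "K \<in> sets borel"
 shows "AE x in \<mu>. \<forall>h\<in>borel_measurable borel. (\<integral>\<^sup>+y. h y * indicator K y \<partial>\<kappa> i x) <= ennreal L * (\<integral>\<^sup>+y. h y \<partial>lborel)"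
proof -
 have "AE x in \<mu>. \<kappa> i x = density lborel (%y. ennreal (\<rho> i x y))" using dens[of i] by (simp add: cond_density_def)
 moreover have "AE x in \<mu>. esssup (restrict_space lborel K) (%y. ereal (\<rho> i x y)) <= ereal L"
  using b by (simp add: density_bound_def)
 ultimately show ?thesis
 proof (rule AE_mp[OF AE_conjI], intro AE_I2 impI)
  fix x assume xs: "x \<in> space \<mu>" and x: "\<kappa> i x = density lborel (%y. ennreal (\<rho> i x y)) \<and> esssup (restrict_space lborel K) (%y. ereal (\<rho> i x y)) <= ereal L"
  have rm: "\<rho> i x \<in> borel_measurable borel" using dens[of i] xs by (simp add: cond_density_def)
  have "AE y in restrict_space lborel K. ereal (\<rho> i x y) <= ereal L"
   using esssup_AE[of "%y. ereal (\<rho> i x y)" "restrict_space lborel K"]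
   by eventually_elim (rule order_trans[OF _ conjunct2[OF x]])
  then have "AE y in restrict_space lborel K. \<rho> i x y <= L" by simp
  then have ae: "AE y in lborel. y \<in> K --> \<rho> i x y <= L"
   using K by (subst (asm) AE_restrict_space_iff) auto
  show "\<forall>h\<in>borel_measurable borel. (\<integral>\<^sup>+y. h y * indicator K y \<partial>\<kappa> i x) <= ennreal L * (\<integral>\<^sup>+y. h y \<partial>lborel)"
  proof
   fix h :: "real => ennreal" assume h: "h \<in> borel_measurable borel"
   have "(\<integral>\<^sup>+y. h y * indicator K y \<partial>\<kappa> i x) = (\<integral>\<^sup>+y. ennreal (\<rho> i x y) * (h y * indicator K y) \<partial>lborel)"
    using x h K rm by (simp add: nn_integral_density)
   also have "\<dots> <= (\<integral>\<^sup>+y. ennreal L * h y \<partial>lborel)"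
   proof (rule nn_integral_mono_AE, use ae in eventually_elim)
    fix y assume "y \<in> K --> \<rho> i x y <= L"
    then show "ennreal (\<rho> i x y) * (h y * indicator K y) <= ennreal L * h y"
     by (auto simp: indicator_def intro!: mult_right_mono ennreal_leI)
   qed
   also have "\<dots> = ennreal L * (\<integral>\<^sup>+y. h y \<partial>lborel)" using h by (intro nn_integral_cmult) auto
   finally show "(\<integral>\<^sup>+y. h y * indicator K y \<partial>\<kappa> i x) <= ennreal L * (\<integral>\<^sup>+y. h y \<partial>lborel)" .
  qed
 qed
qed

lemma tame_finite:
 assumes u: "u \<in> borel_measurable borel" and t: "tame i B R u"
 obtains C where "0 <= C" "AE x in \<mu>. carre i u x <= ennreal C"
proof -
 have B: "0 <= B" and R: "0 <= R" using t by (auto simp: tame_def)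
 \<comment> \<open>The margin 1 separates the two cases for \<open>y\<close> outside of
   \<open>K\<close>: either \<open>x i\<close> is beyond \<open>R\<close> too, with no increment, or
   the jump is longer than 1 and the kernel is at most 1.\<close>
 define K where "K = {- (R + 1)..R + 1}"
 have K: "K \<in> sets borel" "compact K" by (auto simp: K_def)
 obtain L where L: "density_bound \<mu> (\<rho> i) K L" using bounded[OF K(2)] by blast
 define m where "m x y = ennreal (min 1 (1 * ((y - x) / 1)\<^sup>2) / \<bar>y - x\<bar> powr (\<alpha> + 1))" for x y
 have ph1: "ennreal (ph i u u x y) <= ennreal (B\<^sup>2) * m (x i) y * indicator K y + ennreal (B\<^sup>2)" for x y
 proof -
  let ?s = "\<bar>y - x i\<bar>"
  have d: "\<bar>u (x(i := y)) - u x\<bar> <= B * min 1 ?s" and z: "R < \<bar>y\<bar> ==> R < \<bar>x i\<bar> ==> u (x(i := y)) = u x"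
   using t unfolding tame_def by (metis fun_upd_triv)+
  have sq: "(u (x(i := y)) - u x)\<^sup>2 <= B\<^sup>2 * (min 1 ?s)\<^sup>2"
   using power_mono[OF d, of 2] by (simp add: power_mult_distrib)
  have ms: "(min 1 ?s)\<^sup>2 = min 1 ((y - x i)\<^sup>2)"
  proof (cases "?s <= 1")
   case True
   then have "(y - x i)\<^sup>2 <= 1" by (simp only: abs_square_le_1)
   then show ?thesis using True by (simp add: min_absorb2)
  next
   case False
   then have "1 <= (y - x i)\<^sup>2" by (meson abs_square_le_1 linear power_one abs_square_less_1 not_less)
   then show ?thesis using False by (simp add: min_absorb1)
  qed
  show ?thesis
  proof (cases "y \<in> K")
   case True
   have "ph i u u x y <= B\<^sup>2 * (min 1 ((y - x i)\<^sup>2) / ?s powr (\<alpha> + 1))"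
    using divide_right_mono[OF sq[unfolded ms], of "?s powr (\<alpha> + 1)"]
    by (simp add: ph_def power2_eq_square[of "u (x(i := y)) - u x"])
   then have "ennreal (ph i u u x y) <= ennreal (B\<^sup>2) * m (x i) y"
    unfolding m_def by (subst ennreal_mult[symmetric]) (auto intro: ennreal_leI)
   then show ?thesis using True by (simp add: add_increasing2)
  next
   case False
   have "ph i u u x y <= B\<^sup>2"
   proof (cases "R < \<bar>x i\<bar>")
    case True
    have "R < \<bar>y\<bar>" using False R unfolding K_def atLeastAtMost_iff by linarith
    then show ?thesis using z True by (simp add: ph_def)
   next
    case far: False
    then have s: "1 <= ?s" using False unfolding K_def atLeastAtMost_iff by linarith
    then have "min 1 ?s = 1" by (rule min_absorb1)
    then have "(u (x(i := y)) - u x)\<^sup>2 <= B\<^sup>2" using sq by simp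
    moreover have "1 <= ?s powr (\<alpha> + 1)" using s alpha by (intro ge_one_powr_ge_zero) auto
    ultimately show ?thesis unfolding ph_def power2_eq_square[symmetric]
     using frac_le[of "B\<^sup>2" "(u (x(i := y)) - u x)\<^sup>2" 1 "?s powr (\<alpha> + 1)"] by simp
   qed
   then show ?thesis using False by (auto intro: ennreal_leI)
  qed
 qed
 define G where "G = jump_mass \<alpha> 1"
 have G: "G < \<infinity>" unfolding G_def by (rule jump_mass_finite[OF alpha]) simp
 have mint: "(\<integral>\<^sup>+y. m t y \<partial>lborel) = G" for t
  unfolding m_def G_def using jump_mass_scaled[of 1 1 t \<alpha>] by simp
 have mm: "m t \<in> borel_measurable borel" for t unfolding m_def by measurable
 have fin: "ennreal (B\<^sup>2) * (ennreal L * G) + ennreal (B\<^sup>2) < \<infinity>"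
  using G by (simp add: ennreal_mult_less_top ennreal_add_less_top)
 have "AE x in \<mu>. carre i u x <= ennreal (B\<^sup>2) * (ennreal L * G) + ennreal (B\<^sup>2)"
  using density_domination[OF L K(1)]
 proof (rule AE_mp, intro AE_I2 impI)
  fix x assume x: "x \<in> space \<mu>" and d: "\<forall>h\<in>borel_measurable borel. (\<integral>\<^sup>+y. h y * indicator K y \<partial>\<kappa> i x) <= ennreal L * (\<integral>\<^sup>+y. h y \<partial>lborel)"
  interpret k: prob_space "\<kappa> i x" by (rule kernel_space[OF x])
  have mk: "(%y. m (x i) y * indicator K y) \<in> borel_measurable (\<kappa> i x)"
   unfolding kernel_measurable_cong[OF x] using mm K by measurable
  have "carre i u x <= (\<integral>\<^sup>+y. ennreal (B\<^sup>2) * (m (x i) y * indicator K y) + ennreal (B\<^sup>2) \<partial>\<kappa> i x)"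
   by (intro nn_integral_mono) (use ph1 in \<open>simp add: mult.assoc\<close>)
  also have "\<dots> = ennreal (B\<^sup>2) * (\<integral>\<^sup>+y. m (x i) y * indicator K y \<partial>\<kappa> i x) + ennreal (B\<^sup>2)"
   using mk by (subst nn_integral_add) (auto simp: nn_integral_cmult k.emeasure_space_1)
  also have "\<dots> <= ennreal (B\<^sup>2) * (ennreal L * (\<integral>\<^sup>+y. m (x i) y \<partial>lborel)) + ennreal (B\<^sup>2)"
   using d mm by (intro add_right_mono mult_left_mono) auto
  finally show "carre i u x <= ennreal (B\<^sup>2) * (ennreal L * G) + ennreal (B\<^sup>2)"
   unfolding mint .
 qed
 moreover obtain C where "0 <= C" "ennreal (B\<^sup>2) * (ennreal L * G) + ennreal (B\<^sup>2) = ennreal C"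
  using fin by (cases "ennreal (B\<^sup>2) * (ennreal L * G) + ennreal (B\<^sup>2)") auto
 ultimately show thesis using that by simp
qed

definition finite_energy :: "nat => ((nat => real) => real) => bool" where
 "finite_energy i u \<longleftrightarrow> u \<in> borel_measurable borel \<and>
   (EX C. 0 <= C \<and> (AE x in \<mu>. carre i u x <= ennreal C))"

lemma FC0_finite_energy: "u \<in> FC0 ==> finite_energy i u"
proof -
 assume u: "u \<in> FC0"
 obtain B R where "tame i B R u" using FC0_tame[OF u] by blast
 then show ?thesis unfolding finite_energy_def using tame_finite[OF FC0_borel[OF u]] FC0_borel[OF u] by blast
qed

lemma ph_integrable:
 assumes u: "finite_energy i u" and v: "finite_energy i v"
 shows "AE x in \<mu>. integrable (\<kappa> i x) (ph i u v x)"
proof -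
 obtain C1 C2 where "AE x in \<mu>. carre i u x <= ennreal C1"
  "AE x in \<mu>. carre i v x <= ennreal C2"
  and m: "u \<in> borel_measurable borel" "v \<in> borel_measurable borel"
  using u v unfolding finite_energy_def by blast
 then have "AE x in \<mu>. carre i u x <= ennreal C1 \<and> carre i v x <= ennreal C2"
  by auto
 then show ?thesis
 proof (rule AE_mp, intro AE_I2 impI)
  fix x assume x: "x \<in> space \<mu>"
   and b: "carre i u x <= ennreal C1 \<and> carre i v x <= ennreal C2"
  have "integrable (\<kappa> i x) (%y. ph i u u x y + ph i v v x y)"
   using b m x ph_nonneg
   by (intro Bochner_Integration.integrable_add integrableI_nonneg ph_measurable_kernel)
    (auto intro: le_less_trans)
  then show "integrable (\<kappa> i x) (ph i u v x)"
   by (rule Bochner_Integration.integrable_bound)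
    (use m x ph_bound ph_nonneg in \<open>auto intro: ph_measurable_kernel order_trans[OF ph_bound abs_ge_self]\<close>)
 qed
qed

text \<open>The Bochner integral is 0 by convention where integrability fails. It is therefore
  assembled from the integrals of positive and negative part, with a case distinction on finiteness
  of the integral of the norm.\<close>

lemma inner_integral_measurable:
 assumes u: "u \<in> borel_measurable borel" and v: "v \<in> borel_measurable borel"
 shows "(%x. \<integral>y. ph i u v x y \<partial>\<kappa> i x) \<in> borel_measurable \<mu>"
proof -
 let ?p = "%x. \<integral>\<^sup>+y. ennreal (ph i u v x y) \<partial>\<kappa> i x" and ?n = "%x. \<integral>\<^sup>+y. ennreal (- ph i u v x y) \<partial>\<kappa> i x"
  and ?a = "%x. \<integral>\<^sup>+y. ennreal (norm (ph i u v x y)) \<partial>\<kappa> i x"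
 note ph = ph_measurable[OF u v, of i]
 have "(%(x, y). ennreal (ph i u v x y)) \<in> borel_measurable (\<mu> \<Otimes>\<^sub>M borel)" using ph by (simp add: split_beta)
 then have p: "?p \<in> borel_measurable \<mu>" by (rule nn_integral_measurable_subprob_algebra2[OF _ kernel])
 have "(%(x, y). ennreal (- ph i u v x y)) \<in> borel_measurable (\<mu> \<Otimes>\<^sub>M borel)" using ph by (simp add: split_beta)
 then have n: "?n \<in> borel_measurable \<mu>" by (rule nn_integral_measurable_subprob_algebra2[OF _ kernel])
 have "(%(x, y). ennreal (norm (ph i u v x y))) \<in> borel_measurable (\<mu> \<Otimes>\<^sub>M borel)" using ph by (simp add: split_beta)
 then have a: "?a \<in> borel_measurable \<mu>" by (rule nn_integral_measurable_subprob_algebra2[OF _ kernel])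
 have "(%x. if ?a x < \<infinity> then enn2real (?p x) - enn2real (?n x) else 0) \<in> borel_measurable \<mu>"
  using p n a by measurable
 moreover have "(if ?a x < \<infinity> then enn2real (?p x) - enn2real (?n x) else 0) = (\<integral>y. ph i u v x y \<partial>\<kappa> i x)"
  if x: "x \<in> space \<mu>" for x
 proof -
  have "integrable (\<kappa> i x) (ph i u v x) \<longleftrightarrow> ?a x < \<infinity>"
   using ph_measurable_kernel[OF u v x] by (simp add: integrable_iff_bounded)
  then show ?thesis by (auto simp: real_lebesgue_integral_def not_integrable_integral_eq)
 qed
 ultimately show ?thesis by (simp cong: measurable_cong)
qed

lemma inner_integral_integrable:
 assumes u: "finite_energy i u" and v: "finite_energy i v"
 shows "integrable \<mu> (%x. \<integral>y. ph i u v x y \<partial>\<kappa> i x)"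
proof -
 have m: "u \<in> borel_measurable borel" "v \<in> borel_measurable borel" using u v by (auto simp: finite_energy_def)
 obtain C1 C2 where C: "0 <= C1" "AE x in \<mu>. carre i u x <= ennreal C1"
  "0 <= C2" "AE x in \<mu>. carre i v x <= ennreal C2"
  using u v unfolding finite_energy_def by blast
 have "AE x in \<mu>. norm (\<integral>y. ph i u v x y \<partial>\<kappa> i x) <= C1 + C2"
  using ph_integrable[OF u v] ph_integrable[OF u u] ph_integrable[OF v v] C(2,4)
 proof eventually_elim
  case (elim x)
  have "norm (\<integral>y. ph i u v x y \<partial>\<kappa> i x) <= (\<integral>y. norm (ph i u v x y) \<partial>\<kappa> i x)" by (rule integral_norm_bound)
  also have "\<dots> <= (\<integral>y. ph i u u x y + ph i v v x y \<partial>\<kappa> i x)"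
   using elim ph_bound by (intro integral_mono integrable_norm Bochner_Integration.integrable_add) auto
  also have "\<dots> = (\<integral>y. ph i u u x y \<partial>\<kappa> i x) + (\<integral>y. ph i v v x y \<partial>\<kappa> i x)" using elim by simp
  also have "\<dots> <= C1 + C2"
   using elim C by (intro add_mono) (simp_all add: nn_integral_eq_integral ph_nonneg)
  finally show ?case .
 qed
 then show ?thesis by (intro integrable_const_bound inner_integral_measurable m)
qed

lemma pre_form_i_lin:
 assumes u: "finite_energy i u" and v: "finite_energy i v" and w: "finite_energy i w"
 shows "pre_form_i \<alpha> \<mu> \<kappa> i (%x. a * u x + b * v x) w = a * pre_form_i \<alpha> \<mu> \<kappa> i u w + b * pre_form_i \<alpha> \<mu> \<kappa> i v w"
proof -
 have m: "u \<in> borel_measurable borel" "v \<in> borel_measurable borel" "w \<in> borel_measurable borel"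
  using u v w by (auto simp: finite_energy_def)
 have "pre_form_i \<alpha> \<mu> \<kappa> i (%x. a * u x + b * v x) w
   = (\<integral>x. a * (\<integral>y. ph i u w x y \<partial>\<kappa> i x) + b * (\<integral>y. ph i v w x y \<partial>\<kappa> i x) \<partial>\<mu>)"
  unfolding pre_form_i_ph
 proof (rule integral_cong_AE)
  show "AE x in \<mu>. (\<integral>y. ph i (%x. a * u x + b * v x) w x y \<partial>\<kappa> i x) = a * (\<integral>y. ph i u w x y \<partial>\<kappa> i x) + b * (\<integral>y. ph i v w x y \<partial>\<kappa> i x)"
   using ph_integrable[OF u w] ph_integrable[OF v w] by eventually_elim (simp add: ph_lin)
 qed (use m in \<open>auto intro!: inner_integral_measurable borel_measurable_add borel_measurable_times\<close>)
 also have "\<dots> = a * pre_form_i \<alpha> \<mu> \<kappa> i u w + b * pre_form_i \<alpha> \<mu> \<kappa> i v w"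
  unfolding pre_form_i_ph using inner_integral_integrable[OF u w] inner_integral_integrable[OF v w] by simp
 finally show ?thesis .
qed

lemma pre_form_i_sym: "pre_form_i \<alpha> \<mu> \<kappa> i u v = pre_form_i \<alpha> \<mu> \<kappa> i v u"
 unfolding pre_form_i_ph ph_sym[of i u v] ..

lemma pre_form_i_nonneg: "0 <= pre_form_i \<alpha> \<mu> \<kappa> i u u"
 unfolding pre_form_i_ph by (intro integral_nonneg_AE AE_I2) (auto intro!: integral_nonneg_AE AE_I2 ph_nonneg)

lemma En_eq: assumes u: "finite_energy i u" shows "En i u = ennreal (pre_form_i \<alpha> \<mu> \<kappa> i u u)"
proof -
 have "En i u = (\<integral>\<^sup>+x. ennreal (\<integral>y. ph i u u x y \<partial>\<kappa> i x) \<partial>\<mu>)"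
  unfolding En_def
 proof (rule nn_integral_cong_AE, use ph_integrable[OF u u] in eventually_elim)
  fix x assume "integrable (\<kappa> i x) (ph i u u x)"
  then show "carre i u x = ennreal (\<integral>y. ph i u u x y \<partial>\<kappa> i x)"
   by (intro nn_integral_eq_integral) (auto simp: ph_nonneg)
 qed
 also have "\<dots> = ennreal (pre_form_i \<alpha> \<mu> \<kappa> i u u)"
  unfolding pre_form_i_ph using inner_integral_integrable[OF u u]
  by (intro nn_integral_eq_integral) (auto intro!: integral_nonneg_AE AE_I2 ph_nonneg)
 finally show ?thesis .
qed

lemma ph_depends: assumes "depends n u" "n <= i" shows "ph i u v = (%x y. 0)"
proof (intro ext)
 fix x y
 have "u (x(i := y)) = u x" by (rule dependsD[OF assms(1)]) (use assms(2) in auto)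
 then show "ph i u v x y = 0" by (simp add: ph_def)
qed

lemma pre_form_i_depends: "depends n u ==> n <= i ==> pre_form_i \<alpha> \<mu> \<kappa> i u v = 0"
 unfolding pre_form_i_ph by (simp add: ph_depends)

abbreviation "E0 \<equiv> pre_form \<alpha> \<mu> \<kappa>"

lemma pre_form_sum:
 assumes "depends n u" shows "E0 u v = (\<Sum>i<n. pre_form_i \<alpha> \<mu> \<kappa> i u v)"
 unfolding pre_form_def by (rule suminf_finite) (auto simp: pre_form_i_depends[OF assms])

lemma pre_form_semi_ip: "semi_ip FC0 E0"
proof
 fix u v w :: "(nat => real) => real" and a b :: real
 assume u: "u \<in> FC0" and v: "v \<in> FC0"
 show "(%x. a * u x + b * v x) \<in> FC0" by (rule FC0_lincomb[OF u v])
 show "E0 u v = E0 v u" unfolding pre_form_def pre_form_i_sym[of _ u v] ..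
 assume w: "w \<in> FC0"
 obtain n1 where n1: "depends n1 u" using FC0_props[OF u] by blast
 obtain n2 where n2: "depends n2 v" using FC0_props[OF v] by blast
 obtain n3 where n3: "depends n3 (%x. a * u x + b * v x)" using FC0_props[OF FC0_lincomb[OF u v]] by blast
 define n where "n = max n1 (max n2 n3)"
 have d: "depends n u" "depends n v" "depends n (%x. a * u x + b * v x)"
  using n1 n2 n3 by (auto intro: depends_mono simp: n_def)
 show "E0 (%x. a * u x + b * v x) w = a * E0 u w + b * E0 v w"
  unfolding d(1,2,3)[THEN pre_form_sum]
  by (simp add: pre_form_i_lin FC0_finite_energy u v w sum.distrib sum_distrib_left)
next
 fix u assume "u \<in> FC0"
 then obtain n where n: "depends n u" using FC0_props by blast
 show "0 <= E0 u u" unfolding pre_form_sum[OF n] by (intro sum_nonneg pre_form_i_nonneg)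
qed

section \<open>The total energy and closability\<close>

definition Etot :: "((nat => real) => real) => ennreal" where
 "Etot u = (\<integral>\<^sup>+i. En i u \<partial>count_space UNIV)"

lemma Etot_eq: assumes u: "u \<in> FC0" shows "Etot u = ennreal (E0 u u)"
proof -
 obtain n where n: "depends n u" using FC0_props[OF u] by blast
 have "Etot u = (\<Sum>i. ennreal (pre_form_i \<alpha> \<mu> \<kappa> i u u))"
  unfolding Etot_def nn_integral_count_space_nat by (simp add: En_eq FC0_finite_energy u)
 also have "\<dots> = (\<Sum>i<n. ennreal (pre_form_i \<alpha> \<mu> \<kappa> i u u))"
  by (rule suminf_finite) (auto simp: pre_form_i_depends[OF n])
 also have "\<dots> = ennreal (E0 u u)"
  unfolding pre_form_sum[OF n] by (rule sum_ennreal) (rule pre_form_i_nonneg)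
 finally show ?thesis .
qed

text \<open>By \<open>exchange\<close>, replacing coordinate \<open>i\<close> by its conditionally
  independent copy preserves the law, so null sets are avoided after the jump as well.\<close>

lemma AE_kernel_upd:
 assumes A: "A \<in> sets borel" "AE x in \<mu>. x \<in> A"
 shows "AE x in \<mu>. AE y in \<kappa> i x. x(i := y) \<in> A"
proof -
 have g: "(%(x, y). indicator (- A) x :: ennreal) \<in> borel_measurable (borel \<Otimes>\<^sub>M (borel :: real measure))"
  unfolding split_beta by (rule measurable_compose[OF measurable_fst borel_measurable_indicator]) (use A(1) in auto)
 have "(\<integral>\<^sup>+x. \<integral>\<^sup>+y. indicator (- A) (x(i := y)) \<partial>\<kappa> i x \<partial>\<mu>) = (\<integral>\<^sup>+x. \<integral>\<^sup>+y. indicator (- A) x \<partial>\<kappa> i x \<partial>\<mu>)"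
  by (rule exchange[OF g])
 also have "\<dots> = (\<integral>\<^sup>+x. indicator (- A) x \<partial>\<mu>)"
  by (intro nn_integral_cong) (simp add: prob_space.emeasure_space_1[OF kernel_space(1)])
 also have "\<dots> = (\<integral>\<^sup>+x. 0 \<partial>\<mu>)"
  using A(2) by (intro nn_integral_cong_AE) (auto elim!: eventually_mono)
 finally have z: "(\<integral>\<^sup>+x. \<integral>\<^sup>+y. indicator (- A) (x(i := y)) \<partial>\<kappa> i x \<partial>\<mu>) = 0" by simp
 have "(%(x, y). indicator (- A) (x(i := y)) :: ennreal) \<in> borel_measurable (\<mu> \<Otimes>\<^sub>M borel)"
  using measurable_compose[OF upd_measurable borel_measurable_indicator[of "- A"], of i] A(1) by (simp add: split_beta)
 note m = this
 have "(%x. \<integral>\<^sup>+y. indicator (- A) (x(i := y)) \<partial>\<kappa> i x) \<in> borel_measurable \<mu>"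
  by (rule nn_integral_measurable_subprob_algebra2[OF m kernel])
 then have ae: "AE x in \<mu>. (\<integral>\<^sup>+y. indicator (- A) (x(i := y)) \<partial>\<kappa> i x) = 0"
  using z by (subst (asm) nn_integral_0_iff_AE) auto
 show ?thesis
 proof (rule AE_mp[OF ae], rule AE_I2, rule impI)
  fix x assume x: "x \<in> space \<mu>" and z: "(\<integral>\<^sup>+y. indicator (- A) (x(i := y)) \<partial>\<kappa> i x) = 0"
  have "(%y. indicator (- A) (x(i := y)) :: ennreal) \<in> borel_measurable (\<kappa> i x)"
   unfolding kernel_measurable_cong[OF x] using measurable_Pair2[OF m x] by simp
  then have "AE y in \<kappa> i x. indicator (- A) (x(i := y)) = (0 :: ennreal)"
   using z by (subst (asm) nn_integral_0_iff_AE) auto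
  then show "AE y in \<kappa> i x. x(i := y) \<in> A" by eventually_elim (simp add: indicator_def split: if_splits)
 qed
qed

text \<open>A constant limit drops out of increments, so those of \<open>u - f m\<close> tend to
  those of \<open>u\<close> wherever \<open>f m\<close> converges both at \<open>x\<close> and at
  \<open>x(i := y)\<close>. Fatou's lemma is applied to the kernel, to \<open>\<mu>\<close>, and to
  the sum over coordinates, written as an integral over the counting measure.\<close>

lemma Etot_Fatou:
 assumes u: "u \<in> borel_measurable borel" and f: "!!m. f m \<in> borel_measurable borel"
  and l: "AE x in \<mu>. (%m. f m x) \<longlonglongrightarrow> c" and e: "!!m. Etot (%x. u x - f m x) <= e"
 shows "Etot u <= e"
proof -
 let ?w = "%m x. u x - f m x"
 define A where "A = {x. (%m. f m x) \<longlonglongrightarrow> c}"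
 have wm: "?w m \<in> borel_measurable borel" for m using u f by (intro borel_measurable_diff)
 have "Measurable.pred borel (%x. (%m. f m x) \<longlonglongrightarrow> c)"
  by (rule measurable_limit2[OF f borel_measurable_const])
 then have A: "A \<in> sets borel" by (simp add: A_def pred_def)
 have Ax: "AE x in \<mu>. x \<in> A" using l by (simp add: A_def)
 have pm: "(%x. carre i (?w m) x) \<in> borel_measurable \<mu>" for i m
 proof -
  have "(%(x, y). ennreal (ph i (?w m) (?w m) x y)) \<in> borel_measurable (\<mu> \<Otimes>\<^sub>M borel)"
   using ph_measurable[OF wm wm, of i m m] by (simp add: split_beta)
  then show ?thesis by (rule nn_integral_measurable_subprob_algebra2[OF _ kernel])
 qed
 have En_le: "En i u <= liminf (%m. En i (?w m))" for i
 proof -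
  have "En i u <= (\<integral>\<^sup>+x. liminf (%m. carre i (?w m) x) \<partial>\<mu>)"
   unfolding En_def
  proof (rule nn_integral_mono_AE)
   have "AE x in \<mu>. x \<in> A \<and> (AE y in \<kappa> i x. x(i := y) \<in> A)" using Ax AE_kernel_upd[OF A Ax] by (rule AE_conjI)
   then show "AE x in \<mu>. carre i u x <= liminf (%m. carre i (?w m) x)"
   proof (rule AE_mp, intro AE_I2 impI)
    fix x assume x: "x \<in> space \<mu>" and a: "x \<in> A \<and> (AE y in \<kappa> i x. x(i := y) \<in> A)"
    have "carre i u x = (\<integral>\<^sup>+y. liminf (%m. ennreal (ph i (?w m) (?w m) x y)) \<partial>\<kappa> i x)"
    proof (rule nn_integral_cong_AE, use conjunct2[OF a] in eventually_elim)
     fix y assume y: "x(i := y) \<in> A"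
     have "(%m. ((u (x(i := y)) - f m (x(i := y))) - (u x - f m x))) \<longlonglongrightarrow> (u (x(i := y)) - c) - (u x - c)"
      using a y by (intro tendsto_intros) (auto simp: A_def)
     then have "(%m. ph i (?w m) (?w m) x y) \<longlonglongrightarrow> ((u (x(i := y)) - c) - (u x - c)) * ((u (x(i := y)) - c) - (u x - c)) / \<bar>y - x i\<bar> powr (\<alpha> + 1)"
      unfolding ph_def divide_inverse by (intro tendsto_mult_right tendsto_mult)
     then have "(%m. ph i (?w m) (?w m) x y) \<longlonglongrightarrow> ph i u u x y" by (simp add: ph_def)
     then have "(%m. ennreal (ph i (?w m) (?w m) x y)) \<longlonglongrightarrow> ennreal (ph i u u x y)" by (rule tendsto_ennrealI)
     then show "ennreal (ph i u u x y) = liminf (%m. ennreal (ph i (?w m) (?w m) x y))"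
      by (rule lim_imp_Liminf[OF trivial_limit_sequentially, symmetric])
    qed
    also have "\<dots> <= liminf (%m. carre i (?w m) x)"
     using ph_measurable_kernel[OF wm wm x] by (intro nn_integral_liminf) simp
    finally show "carre i u x <= liminf (%m. carre i (?w m) x)" .
   qed
  qed
  also have "\<dots> <= liminf (%m. En i (?w m))" unfolding En_def by (rule nn_integral_liminf[OF pm])
  finally show ?thesis .
 qed
 have "Etot u <= (\<integral>\<^sup>+i. liminf (%m. En i (?w m)) \<partial>count_space UNIV)"
  unfolding Etot_def by (rule nn_integral_mono) (rule En_le)
 also have "\<dots> <= liminf (%m. Etot (?w m))" unfolding Etot_def by (rule nn_integral_liminf) simp
 also have "\<dots> <= liminf (%m. e)" using e by (intro Liminf_mono always_eventually) auto
 finally show ?thesis by (simp add: Liminf_const)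
qed

lemma FC0_L2: "f \<in> FC0 ==> f \<in> L2_fun \<mu>"
 using FC0_bounded[of f] bounded_L2[OF borel_comp[OF FC0_borel]] by blast

text \<open>The limit is an arbitrary constant because the lemma serves twice: \<open>c = 0\<close>
  is closability, and \<open>c = 1\<close> shows that the function 1 has energy 0 once it belongs to
  the domain.\<close>

lemma closable_to_const:
 assumes f: "!!n. f n \<in> FC0" and c: "Cauchy_wrt E0 f" and l: "(%n. L2_dist \<mu> (f n) (%x. c)) \<longlonglongrightarrow> 0"
 shows "(%n. E0 (f n) (f n)) \<longlonglongrightarrow> 0"
proof (rule LIMSEQ_I)
 interpret E0: semi_ip FC0 E0 by (rule pre_form_semi_ip)
 fix e :: real assume e: "0 < e"
 obtain r :: "nat => nat" where r: "strict_mono r" "AE x in \<mu>. (%n. f (r n) x) \<longlonglongrightarrow> c"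
  by (rule L2_AE_subseq[OF FC0_L2[OF f] const_L2 l])
 obtain N where N: "!!m n. m >= N ==> n >= N ==> form_dist E0 (f m) (f n) < sqrt (e / 2)"
  using c e unfolding Cauchy_wrt_def by (metis half_gt_zero real_sqrt_gt_zero)
 have "E0 (f n) (f n) <= e / 2" if n: "n >= N" for n
 proof -
  have "Etot (f n) <= ennreal (e / 2)"
  proof (rule Etot_Fatou[where f = "%m. f (r (m + N))" and c = c])
   show "AE x in \<mu>. (%m. f (r (m + N)) x) \<longlonglongrightarrow> c"
    using r(2) by eventually_elim (rule LIMSEQ_ignore_initial_segment)
   fix m
   have d: "(%x. f n x - f (r (m + N)) x) \<in> FC0" by (rule E0.mem_diff[OF f f])
   have "N <= r (m + N)" using seq_suble[OF r(1), of "m + N"] by linarith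
   from N[OF n this] have "E0 (%x. f n x - f (r (m + N)) x) (%x. f n x - f (r (m + N)) x) < e / 2"
    by (simp add: form_dist_def)
   then show "Etot (%x. f n x - f (r (m + N)) x) <= ennreal (e / 2)"
    unfolding Etot_eq[OF d] by (intro ennreal_leI) simp
  qed (rule FC0_borel[OF f])+
  then show ?thesis unfolding Etot_eq[OF f] using e by simp
 qed
 then show "EX no. \<forall>n\<ge>no. norm (E0 (f n) (f n) - 0) < e"
  using E0.nonneg[OF f] e by (intro exI[of _ N]) fastforce
qed

sublocale closable_form \<mu> FC0 E0
proof (intro closable_form.intro closable_form_axioms.intro)
 show "prob_L2 \<mu>" by unfold_locales
 show "FC0 \<subseteq> L2_fun \<mu>" using FC0_L2 by blast
 show "FC0 ~= {}" using FC0_zero by blast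
 show "semi_ip FC0 E0" by (rule pre_form_semi_ip)
qed (rule closable_to_const)

end

section \<open>Cutoff functions of bounded energy\<close>

context cond_density_setting
begin

lemma energy_one: assumes "(%x. 1) \<in> D" shows "E (%x. 1) (%x. 1) = 0"
proof -
 obtain f where f: "appr f (%x. 1)" using assms D_iff by blast
 have "(%n. E0 (f n) (f n)) \<longlonglongrightarrow> 0" by (rule closable_to_const[OF apprD(1)[OF f] apprD(2)[OF f] apprD(3)[OF f]])
 with E_lim[OF f const_L2 f const_L2] show ?thesis by (rule LIMSEQ_unique)
qed

lemma Etot_mono:
 assumes "!!i x y. (v (x(i := y)) - v x)\<^sup>2 <= (u (x(i := y)) - u x)\<^sup>2" shows "Etot v <= Etot u"
 unfolding Etot_def En_def
proof (rule nn_integral_mono, rule nn_integral_mono, rule nn_integral_mono)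
 fix i x y
 have "(v (x(i := y)) - v x)\<^sup>2 / \<bar>y - x i\<bar> powr (\<alpha> + 1) <= (u (x(i := y)) - u x)\<^sup>2 / \<bar>y - x i\<bar> powr (\<alpha> + 1)"
  by (rule divide_right_mono[OF assms]) simp
 then show "ennreal (ph i v v x y) <= ennreal (ph i u u x y)"
  unfolding ph_def power2_eq_square by (rule ennreal_leI)
qed

lemma E0_le_if_Etot_le:
 assumes u: "u \<in> FC0" and c: "0 <= c" "Etot u <= ennreal c" shows "E0 u u <= c"
 using c unfolding Etot_eq[OF u] by simp

lemma FC0_clamp_energy:
 assumes f: "f \<in> FC0"
 shows "(%x. soft_clamp n (f x)) \<in> FC0" "E0 (%x. soft_clamp n (f x)) (%x. soft_clamp n (f x)) <= E0 f f"
proof -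
 show s: "(%x. soft_clamp n (f x)) \<in> FC0" by (rule FC0_compose[OF f Ck_soft_clamp soft_clamp_0])
 have "Etot (%x. soft_clamp n (f x)) <= Etot f"
  by (rule Etot_mono, rule abs_le_square_iff[THEN iffD1], rule soft_clamp_contraction)
 then show "E0 (%x. soft_clamp n (f x)) (%x. soft_clamp n (f x)) <= E0 f f"
  by (intro E0_le_if_Etot_le[OF s E0.nonneg[OF f]]) (simp add: Etot_eq[OF f])
qed

lemma D_clamp:
 assumes u: "u \<in> D"
 shows "(%x. min 1 (max 0 (u x))) \<in> D" "E (%x. min 1 (max 0 (u x))) (%x. min 1 (max 0 (u x))) <= E u u"
 by (rule closure_clamp[OF FC0_clamp_energy soft_clamp_tendsto soft_clamp_bound u]; assumption)+


lemma ph_borel_ennreal: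
 assumes "u \<in> borel_measurable borel"
 shows "(%(x, y). ennreal (ph i u u x y)) \<in> borel_measurable (\<mu> \<Otimes>\<^sub>M borel)"
 using ph_measurable[OF assms assms, of i] by (simp add: split_beta)

text \<open>A jump contributes only if it
 starts or ends outside of \<open>[-r, r]\<close>, and the two cases are exchanged by the symmetry of the jump
 measure. Jumps ending in \<open>[-6r, 6r]\<close> are controlled by the density bound, all other ones have length
 at least \<open>3r\<close>.\<close>

lemma plateau_energy:
 assumes r: "0 < r" and b: "density_bound \<mu> (\<rho> i) {- (6 * r)..6 * r} L"
  and c: "1 <= c" "!!s t. \<bar>plateau s - plateau t\<bar> <= c * \<bar>s - t\<bar>"
 shows "En i (%x. plateau (x i / r))
  <= 2 * ((ennreal (r powr (- (\<alpha> + 1))) + ennreal L * (ennreal (r powr (- \<alpha>)) * jump_mass \<alpha> (c\<^sup>2)))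
    * emeasure \<mu> {x \<in> space \<mu>. r < \<bar>x i\<bar>})"
proof -
 define q where "q s t = ennreal ((plateau (t / r) - plateau (s / r))\<^sup>2 / \<bar>t - s\<bar> powr (\<alpha> + 1))" for s t
 define far where "far = {t::real. r < \<bar>t\<bar>}"
 have far: "far \<in> sets borel" unfolding far_def by measurable
 have pm [measurable]: "plateau \<in> borel_measurable borel"
  using Ck_plateau[of 0] by (auto intro: borel_measurable_continuous_onI)
 have qm: "(%(s, t). q s t) \<in> borel_measurable (borel \<Otimes>\<^sub>M borel)" unfolding q_def split_beta by measurable
 have qm1: "q s \<in> borel_measurable borel" for s unfolding q_def by measurable
 have sym: "q s t = q t s" for s t unfolding q_def by (simp add: power2_commute abs_minus_commute)
 have split: "q s t <= q s t * indicator far s + q s t * indicator far t" for s t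
 proof (cases "s \<in> far \<or> t \<in> far")
  case True then show ?thesis by (auto simp: indicator_def)
 next
  case False
  then have "\<bar>s / r\<bar> <= 1" "\<bar>t / r\<bar> <= 1" using r by (auto simp: far_def abs_if field_simps split: if_splits)
  then show ?thesis by (simp add: q_def plateau_bounds(3))
 qed
 have ev: "ennreal (ph i (%x. plateau (x i / r)) (%x. plateau (x i / r)) x y) = q (x i) y" for x y
  by (simp add: ph_def q_def power2_eq_square)
 define K where "K = {- (6 * r)..6 * r}"
 have K: "K \<in> sets borel" by (simp add: K_def)
 define m where "m s t = ennreal (min 1 (c\<^sup>2 * ((t - s) / r)\<^sup>2) / \<bar>t - s\<bar> powr (\<alpha> + 1))" for s t
 have mm: "m s \<in> borel_measurable borel" for s unfolding m_def by measurable
 define B where "B = ennreal (r powr (- (\<alpha> + 1))) + ennreal L * (ennreal (r powr (- \<alpha>)) * jump_mass \<alpha> (c\<^sup>2))"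
 have qb: "q s t <= m s t * indicator K t + ennreal (r powr (- (\<alpha> + 1)))" for s t
 proof (cases "t \<in> K")
  case True
  have "\<bar>plateau (t / r) - plateau (s / r)\<bar> <= 1" using plateau_bounds(1,2)[of "t / r"] plateau_bounds(1,2)[of "s / r"] by linarith
  then have "(plateau (t / r) - plateau (s / r))\<^sup>2 <= 1" by (simp only: abs_square_le_1)
  moreover have "(plateau (t / r) - plateau (s / r))\<^sup>2 <= c\<^sup>2 * ((t - s) / r)\<^sup>2"
   using power_mono[OF c(2)[of "t / r" "s / r"] abs_ge_zero, of 2] by (simp add: power_mult_distrib diff_divide_distrib)
  ultimately have "(plateau (t / r) - plateau (s / r))\<^sup>2 <= min 1 (c\<^sup>2 * ((t - s) / r)\<^sup>2)" by (rule min.boundedI)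
  then have "q s t <= m s t" unfolding q_def m_def by (intro ennreal_leI divide_right_mono) simp_all
  then show ?thesis using True by (simp add: add_increasing2)
 next
  case False
  have "q s t <= ennreal (r powr (- (\<alpha> + 1)))"
  \<comment> \<open>The jump ends outside of \<open>[-6r, 6r]\<close>. It either starts where the
    plateau vanishes as well, or is longer than \<open>3r\<close>; the estimate uses length
    \<open>r\<close>.\<close>
  proof (cases "3 * r <= \<bar>s\<bar>")
   case True
   have "3 <= \<bar>s / r\<bar>" "3 <= \<bar>t / r\<bar>"
    using True False r unfolding K_def atLeastAtMost_iff by (auto simp: le_divide_eq)
   then show ?thesis by (simp add: q_def plateau_bounds(4))
  next
   case near: False
   have d: "r <= \<bar>t - s\<bar>" using near False r unfolding K_def atLeastAtMost_iff by linarith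
   have "\<bar>plateau (t / r) - plateau (s / r)\<bar> <= 1" using plateau_bounds(1,2)[of "t / r"] plateau_bounds(1,2)[of "s / r"] by linarith
   then have "(plateau (t / r) - plateau (s / r))\<^sup>2 <= 1" by (simp only: abs_square_le_1)
   moreover have "r powr (\<alpha> + 1) <= \<bar>t - s\<bar> powr (\<alpha> + 1)" using d r alpha by (intro powr_mono2) auto
   ultimately have "(plateau (t / r) - plateau (s / r))\<^sup>2 / \<bar>t - s\<bar> powr (\<alpha> + 1) <= 1 / r powr (\<alpha> + 1)"
    using r by (intro frac_le) auto
   then show ?thesis unfolding q_def powr_minus_divide by (rule ennreal_leI)
  qed
  then show ?thesis using False by simp
 qed
 have inner: "AE x in \<mu>. (\<integral>\<^sup>+y. q (x i) y \<partial>\<kappa> i x) <= B"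
  using density_domination[OF b[folded K_def] K]
 proof (rule AE_mp, intro AE_I2 impI)
  fix x assume x: "x \<in> space \<mu>" and d: "\<forall>h\<in>borel_measurable borel. (\<integral>\<^sup>+y. h y * indicator K y \<partial>\<kappa> i x) <= ennreal L * (\<integral>\<^sup>+y. h y \<partial>lborel)"
  interpret k: prob_space "\<kappa> i x" by (rule kernel_space[OF x])
  have mk: "(%y. m (x i) y * indicator K y) \<in> borel_measurable (\<kappa> i x)"
   unfolding kernel_measurable_cong[OF x] using mm K by measurable
  have "(\<integral>\<^sup>+y. q (x i) y \<partial>\<kappa> i x) <= (\<integral>\<^sup>+y. m (x i) y * indicator K y + ennreal (r powr (- (\<alpha> + 1))) \<partial>\<kappa> i x)"
   by (rule nn_integral_mono) (rule qb)
  also have "\<dots> = (\<integral>\<^sup>+y. m (x i) y * indicator K y \<partial>\<kappa> i x) + ennreal (r powr (- (\<alpha> + 1)))"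
   using mk by (subst nn_integral_add) (auto simp: k.emeasure_space_1)
  also have "\<dots> <= ennreal L * (\<integral>\<^sup>+y. m (x i) y \<partial>lborel) + ennreal (r powr (- (\<alpha> + 1)))"
   using d mm by (intro add_right_mono) auto
  also have "(\<integral>\<^sup>+y. m (x i) y \<partial>lborel) = ennreal (r powr (- \<alpha>)) * jump_mass \<alpha> (c\<^sup>2)"
   unfolding m_def by (rule jump_mass_scaled[OF r])
  finally show "(\<integral>\<^sup>+y. q (x i) y \<partial>\<kappa> i x) <= B" unfolding B_def by (simp add: add.commute)
 qed
 have coordm: "(%p::(nat => real) \<times> real. fst p i) \<in> borel_measurable (borel \<Otimes>\<^sub>M borel)"
  by (rule measurable_compose[OF measurable_fst]) measurable
 have qim: "(%(x, y). q (x i) y * indicator far (x i)) \<in> borel_measurable (borel \<Otimes>\<^sub>M borel)"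
  "(%(x, y). q (x i) y * indicator far y) \<in> borel_measurable (borel \<Otimes>\<^sub>M borel)"
 proof -
  have 1: "(%p::(nat => real) \<times> real. q (fst p i) (snd p)) \<in> borel_measurable (borel \<Otimes>\<^sub>M borel)"
   using measurable_compose[OF measurable_Pair[OF coordm measurable_snd] qm] by simp
  have 2: "(%p::(nat => real) \<times> real. indicator far (fst p i) :: ennreal) \<in> borel_measurable (borel \<Otimes>\<^sub>M borel)"
   by (rule measurable_compose[OF coordm]) (use far in measurable)
  have 3: "(%p::(nat => real) \<times> real. indicator far (snd p) :: ennreal) \<in> borel_measurable (borel \<Otimes>\<^sub>M borel)"
   by (rule measurable_compose[OF measurable_snd]) (use far in measurable)
  show "(%(x, y). q (x i) y * indicator far (x i)) \<in> borel_measurable (borel \<Otimes>\<^sub>M borel)"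
   unfolding split_beta by (rule borel_measurable_times_ennreal[OF 1 2])
  show "(%(x, y). q (x i) y * indicator far y) \<in> borel_measurable (borel \<Otimes>\<^sub>M borel)"
   unfolding split_beta by (rule borel_measurable_times_ennreal[OF 1 3])
 qed
 have flip: "(\<integral>\<^sup>+x. \<integral>\<^sup>+y. q (x i) y * indicator far y \<partial>\<kappa> i x \<partial>\<mu>) = (\<integral>\<^sup>+x. \<integral>\<^sup>+y. q (x i) y * indicator far (x i) \<partial>\<kappa> i x \<partial>\<mu>)"
  using exchange[OF qim(1), of i] by (simp add: sym)
 have km: "(%y. q (x i) y * indicator far (x i)) \<in> borel_measurable (\<kappa> i x)" "(%y. q (x i) y * indicator far y) \<in> borel_measurable (\<kappa> i x)"
  if "x \<in> space \<mu>" for x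
  unfolding kernel_measurable_cong[OF that] using qm1 far by measurable
 have im: "(%x. \<integral>\<^sup>+y. q (x i) y * indicator far (x i) \<partial>\<kappa> i x) \<in> borel_measurable \<mu>"
  "(%x. \<integral>\<^sup>+y. q (x i) y * indicator far y \<partial>\<kappa> i x) \<in> borel_measurable \<mu>"
  using borel_pair_comp[OF qim(1)] borel_pair_comp[OF qim(2)]
  by (auto intro: nn_integral_measurable_subprob_algebra2[OF _ kernel])
 have "En i (%x. plateau (x i / r)) = (\<integral>\<^sup>+x. \<integral>\<^sup>+y. q (x i) y \<partial>\<kappa> i x \<partial>\<mu>)" unfolding En_def ev ..
 also have "\<dots> <= (\<integral>\<^sup>+x. \<integral>\<^sup>+y. q (x i) y * indicator far (x i) + q (x i) y * indicator far y \<partial>\<kappa> i x \<partial>\<mu>)"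
  by (rule nn_integral_mono, rule nn_integral_mono, rule split)
 also have "\<dots> = (\<integral>\<^sup>+x. (\<integral>\<^sup>+y. q (x i) y * indicator far (x i) \<partial>\<kappa> i x) + (\<integral>\<^sup>+y. q (x i) y * indicator far y \<partial>\<kappa> i x) \<partial>\<mu>)"
  by (rule nn_integral_cong) (rule nn_integral_add[OF km])
 also have "\<dots> = 2 * (\<integral>\<^sup>+x. \<integral>\<^sup>+y. q (x i) y * indicator far (x i) \<partial>\<kappa> i x \<partial>\<mu>)"
  unfolding nn_integral_add[OF im] flip by (simp add: mult_2)
 also have "(\<integral>\<^sup>+x. \<integral>\<^sup>+y. q (x i) y * indicator far (x i) \<partial>\<kappa> i x \<partial>\<mu>) <= (\<integral>\<^sup>+x. B * indicator {x \<in> space \<mu>. r < \<bar>x i\<bar>} x \<partial>\<mu>)"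
 proof (rule nn_integral_mono_AE, use inner in \<open>rule AE_mp\<close>, intro AE_I2 impI)
  fix x assume "x \<in> space \<mu>" "(\<integral>\<^sup>+y. q (x i) y \<partial>\<kappa> i x) <= B"
  then show "(\<integral>\<^sup>+y. q (x i) y * indicator far (x i) \<partial>\<kappa> i x) <= B * indicator {x \<in> space \<mu>. r < \<bar>x i\<bar>} x"
   by (cases "r < \<bar>x i\<bar>") (auto simp: far_def)
 qed
 also have "\<dots> = B * emeasure \<mu> {x \<in> space \<mu>. r < \<bar>x i\<bar>}"
 proof -
  have "{x \<in> space \<mu>. r < \<bar>x i\<bar>} \<in> sets \<mu>" using coord[of i] by measurable
  then show ?thesis by (rule nn_integral_cmult_indicator)
 qed
 finally show ?thesis unfolding B_def by (simp add: mult_left_mono)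
qed

definition cutoff :: "nat => (nat => real) => (nat => real) => real" where
 "cutoff n r x = (\<Prod>i<n. plateau (x i / r i))"

lemma cutoff_bounds: "0 <= cutoff n r x" "cutoff n r x <= 1"
 unfolding cutoff_def by (auto intro: prod_nonneg prod_le_1 simp: plateau_bounds)

lemma cutoff_eq_1: "(!!i. i < n ==> 0 < r i \<and> \<bar>x i\<bar> <= r i) ==> cutoff n r x = 1"
 unfolding cutoff_def
proof (intro prod.neutral ballI plateau_bounds(3))
 fix i assume "!!i. i < n ==> 0 < r i \<and> \<bar>x i\<bar> <= r i" "i \<in> {..<n}"
 then have "0 < r i" "\<bar>x i\<bar> <= r i" by auto
 then show "\<bar>x i / r i\<bar> <= 1" by (simp add: divide_le_eq)
qed

lemma cutoff_support: "cutoff n r x ~= 0 ==> i < n ==> 0 < r i ==> \<bar>x i\<bar> <= 3 * r i"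
proof (rule ccontr)
 assume c: "cutoff n r x ~= 0" "i < n" "0 < r i" and n: "\<not> \<bar>x i\<bar> <= 3 * r i"
 then have "3 <= \<bar>x i / r i\<bar>" by (simp add: le_divide_eq)
 then have "plateau (x i / r i) = 0" by (rule plateau_bounds(4))
 then have "cutoff n r x = 0" unfolding cutoff_def using c(2) by (intro prod_zero) auto
 then show False using c(1) by contradiction
qed

lemma cutoff_FC0:
 assumes n: "1 <= n" and r: "!!i. i < n ==> 0 < r i" shows "cutoff n r \<in> FC0"
 unfolding cutoff_def[abs_def]
proof (rule FC0_product[OF _ _ n])
 fix i k assume i: "i < n"
 have "Ck k (%t. plateau ((1 / r i) * t + 0))" by (rule Ck_compose[OF Ck_plateau Ck_affine])
 then show "Ck k (%t. plateau (t / r i))" by simp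
next
 fix i t assume i: "i < n" and t: "plateau (t / r i) ~= 0"
 have "\<bar>t / r i\<bar> < 3" using t plateau_bounds(4) by (meson not_less)
 then have "\<bar>t\<bar> < 3 * r i" using r[OF i] by (simp add: divide_less_eq)
 also have "3 * r i <= (\<Sum>j<n. 3 * r j)" using i r by (intro member_le_sum) (auto intro: less_imp_le)
 finally show "\<bar>t\<bar> <= (\<Sum>j<n. 3 * r j)" by simp
qed

lemma cutoff_depends: "depends n (cutoff n r)"
 unfolding depends_def cutoff_def by auto

text \<open>A jump in coordinate \<open>i\<close> changes only the \<open>i\<close>-th factor, and
  the product of the others is a number in \<open>[0, 1]\<close>.\<close>

lemma Etot_cutoff_le: "Etot (cutoff n r) <= (\<Sum>i<n. En i (%x. plateau (x i / r i)))"
proof -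
 have z: "En i (cutoff n r) = 0" if "i >= n" for i
  unfolding En_def ph_depends[OF cutoff_depends that] by simp
 have le: "En i (cutoff n r) <= En i (%x. plateau (x i / r i))" if i: "i < n" for i
  unfolding En_def
 proof (rule nn_integral_mono, rule nn_integral_mono, rule ennreal_leI)
  fix x y
  define P where "P = (\<Prod>j\<in>{..<n} - {i}. plateau (x j / r j))"
  have P: "0 <= P" "P <= 1" unfolding P_def by (auto intro: prod_nonneg prod_le_1 simp: plateau_bounds)
  have c: "cutoff n r z = plateau (z i / r i) * P" if z: "!!j. j ~= i ==> z j = x j" for z
   unfolding cutoff_def P_def using i z by (subst prod.remove[of _ i]) (auto intro!: prod.cong)
  define d where "d = plateau (y / r i) - plateau (x i / r i)"
  have "cutoff n r (x(i := y)) - cutoff n r x = d * P"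
   using c[of "x(i := y)"] c[of x] by (simp add: d_def left_diff_distrib)
  moreover have "(d * P) * (d * P) <= d * d"
   using P mult_left_mono[OF mult_le_one[of P P], of "d * d"] by (simp add: mult_ac)
  ultimately show "ph i (cutoff n r) (cutoff n r) x y <= ph i (%x. plateau (x i / r i)) (%x. plateau (x i / r i)) x y"
   unfolding ph_def by (auto simp: d_def intro!: divide_right_mono)
 qed
 have "Etot (cutoff n r) = (\<Sum>i<n. En i (cutoff n r))"
  unfolding Etot_def nn_integral_count_space_nat by (rule suminf_finite) (use z in auto)
 also have "\<dots> <= (\<Sum>i<n. En i (%x. plateau (x i / r i)))" by (rule sum_mono) (use le in auto)
 finally show ?thesis .
qed

text \<open>The bound of \<open>plateau_energy\<close> up to a constant: the first term is for long
  jumps, the second for jumps into the region where the density is bounded.\<close>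

definition tail_cost :: "(nat => real) => (nat => real) => nat => ennreal" where
 "tail_cost r L i = (ennreal (r i powr (- (\<alpha> + 1))) + ennreal (L i * r i powr (- \<alpha>))) * emeasure \<mu> {x \<in> space \<mu>. r i < \<bar>x i\<bar>}"

text \<open>One constant \<open>2 * (1 + G)\<close>, with \<open>G\<close> the jump mass for the
  Lipschitz constant of the plateau, serves all radii, bounds and numbers of coordinates. This
  uniformity lets the radii be scaled later.\<close>

lemma cutoff_energy:
 obtains C :: real where "0 <= C"
  "!!n r L. (!!i. i < n ==> 0 < r i \<and> density_bound \<mu> (\<rho> i) {- (6 * r i)..6 * r i} (L i)) ==>
    Etot (cutoff n r) <= ennreal C * (\<Sum>i<n. tail_cost r L i)"
proof -
 obtain c where c: "1 <= c" "!!s t. \<bar>plateau s - plateau t\<bar> <= c * \<bar>s - t\<bar>" by (rule plateau_Lipschitz) blast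
 define G where "G = jump_mass \<alpha> (c\<^sup>2)"
 have G: "G < \<infinity>" unfolding G_def by (rule jump_mass_finite[OF alpha]) simp
 then have fin: "2 * (1 + G) < \<infinity>" by (simp add: ennreal_mult_less_top)
 then obtain C where C: "0 <= C" "2 * (1 + G) = ennreal C" by (cases "2 * (1 + G)") auto
 have "Etot (cutoff n r) <= ennreal C * (\<Sum>i<n. tail_cost r L i)"
  if h: "!!i. i < n ==> 0 < r i \<and> density_bound \<mu> (\<rho> i) {- (6 * r i)..6 * r i} (L i)" for n r L
 proof -
  have "En i (%x. plateau (x i / r i)) <= ennreal C * tail_cost r L i" if i: "i < n" for i
  proof -
   define a where "a = ennreal (r i powr (- (\<alpha> + 1)))"
   define b where "b = ennreal (L i * r i powr (- \<alpha>))"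
   define p where "p = emeasure \<mu> {x \<in> space \<mu>. r i < \<bar>x i\<bar>}"
   have b: "ennreal (L i) * (ennreal (r i powr (- \<alpha>)) * G) = b * G"
    unfolding b_def by (simp add: ennreal_mult'' mult.assoc)
   have "En i (%x. plateau (x i / r i)) <= 2 * ((a + b * G) * p)"
    using plateau_energy[OF conjunct1[OF h[OF i]] conjunct2[OF h[OF i]] c]
    unfolding a_def[symmetric] p_def[symmetric] G_def[symmetric] b .
   also have "a + b * G <= (1 + G) * (a + b)"
    by (simp add: distrib_left distrib_right add_increasing add_mono add_increasing2 mult.commute)
   finally have "En i (%x. plateau (x i / r i)) <= 2 * (((1 + G) * (a + b)) * p)" by (simp add: mult_left_mono mult_right_mono)
   also have "\<dots> = ennreal C * tail_cost r L i"
    unfolding tail_cost_def a_def[symmetric] b_def[symmetric] p_def[symmetric] C(2)[symmetric] by (simp only: mult.assoc)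
   finally show ?thesis .
  qed
  then have "(\<Sum>i<n. En i (%x. plateau (x i / r i))) <= (\<Sum>i<n. ennreal C * tail_cost r L i)" by (intro sum_mono) auto
  then show ?thesis using Etot_cutoff_le[of n r] unfolding sum_distrib_left by (rule order_trans[rotated])
 qed
 then show thesis by (rule that[OF C(1)])
qed

lemma bounded_limit:
 assumes f: "!!m. f m \<in> D" "!!m. E (f m) (f m) <= c" "!!m x. \<bar>f m x\<bar> <= 1"
  and u: "u \<in> borel_measurable \<mu>" and l: "AE x in \<mu>. (%m. f m x) \<longlonglongrightarrow> u x"
 shows "u \<in> D" "E u u <= c" "EX w. (ALL n. w n \<in> cvx hull range f) \<and> (%n. form_dist (form1 \<mu> E) (w n) u) \<longlonglongrightarrow> 0"
  "(%m. L2_dist \<mu> (f m) u) \<longlonglongrightarrow> 0"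
proof -
 have b: "AE x in \<mu>. \<bar>f m x\<bar> <= \<bar>1::real\<bar>" for m using f(3) by simp
 note fm = L2_measurable[OF DL[OF f(1)]]
 show l2: "(%m. L2_dist \<mu> (f m) u) \<longlonglongrightarrow> 0" by (rule L2_bounded_convergence(2)[OF fm u l b const_L2])
 have uL: "u \<in> L2_fun \<mu>" by (rule L2_bounded_convergence(1)[OF fm u l b const_L2])
 show "u \<in> D" by (rule bounded_energy_limit(1)[OF f(1) f(2) uL l2])
 show "E u u <= c" by (rule bounded_energy_limit(2)[OF f(1) f(2) uL l2])
 show "EX w. (ALL n. w n \<in> cvx hull range f) \<and> (%n. form_dist (form1 \<mu> E) (w n) u) \<longlonglongrightarrow> 0"
  by (rule bounded_energy_limit(3)[OF f(1) f(2) uL l2])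
qed

lemma hull_property:
 assumes "w \<in> cvx hull S" "S \<subseteq> {u. P u}" "cvx {u. P u}" shows "P w"
 using hull_minimal[of S "{u. P u}" cvx] assms(2,3) assms(1) by blast

definition exhausted :: "(nat => (nat => real) set) => bool" where
 "exhausted K \<longleftrightarrow> (%x. 1) \<in> D \<and> (EX v. (ALL k. v k \<in> D) \<and> (ALL k x. 0 <= v k x \<and> v k x <= 1) \<and>
   (ALL k x. v k x ~= 0 --> x \<in> K k) \<and> (%k. form_dist (form1 \<mu> E) (v k) (%x. 1)) \<longlonglongrightarrow> 0)"

end

section \<open>Exhaustion by boxes\<close>

context cond_density_setting
begin

abbreviation tail :: "real => nat => real" where
 "tail t i \<equiv> measure \<mu> {x \<in> space \<mu>. t < \<bar>x i\<bar>}"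

text \<open>Enlarging the radii by \<open>M >= 1\<close> lowers the long jump costs, and for large
  \<open>M\<close> the limit hypothesis bounds all density costs together by \<open>l + 1\<close>.
  Only the long jump costs remain visible in the result.\<close>

lemma scaled_cutoff_energy:
 assumes R: "!!i. 0 < R i"
  and b: "!!M i. 1 <= M ==> density_bound \<mu> (\<rho> i) {- (6 * (real M * R i))..6 * (real M * R i)} (L M i)"
  and l: "l < \<infinity>" "(%M. ennreal (real M powr - \<alpha>) *
    (\<Sum>i. ennreal (L M i * R i powr - \<alpha> * tail (real M * R i) i))) \<longlonglongrightarrow> l"
 shows "EX C N. 0 <= C \<and> (1::nat) <= N \<and> (\<forall>M\<ge>N. ALL n. Etot (cutoff n (%i. real M * R i)) \<le>
    ennreal C * (1 + (\<Sum>i<n. ennreal (R i powr (- (\<alpha> + 1)) * tail (real M * R i) i))))"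
proof -
 define m where "m M i = tail (real M * R i) i" for M i
 obtain C where C: "0 <= C" "!!n r L. (!!i. i < n ==> 0 < r i \<and> density_bound \<mu> (\<rho> i) {- (6 * r i)..6 * r i} (L i)) ==>
    Etot (cutoff n r) <= ennreal C * (\<Sum>i<n. tail_cost r L i)"
  by (rule cutoff_energy) blast
 \<comment> \<open>The added 1 makes the limit strictly smaller than the bound, so the terms are
   eventually below it.\<close>
 obtain k where k: "0 <= k" "l + 1 = ennreal k" using l(1) by (cases "l + 1") auto
 have "l < l + 1" using l(1) by (metis ennreal_add_left_cancel_less add.right_neutral infinity_ennreal_def less_irrefl zero_less_one)
 from order_tendstoD(2)[OF l(2) this] obtain N where N: "!!M. N <= M ==> ennreal (real M powr - \<alpha>) *
    (\<Sum>i. ennreal (L M i * R i powr - \<alpha> * m M i)) < l + 1"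
  unfolding eventually_sequentially m_def by blast
 have "Etot (cutoff n (%i. real M * R i)) <= ennreal (C * (k + 1)) * (1 + (\<Sum>i<n. ennreal (R i powr (- (\<alpha> + 1)) * m M i)))"
  if M: "max 1 N <= M" for M n
 proof -
  have M1: "1 <= real M" using M by simp
  have tc: "tail_cost (%i. real M * R i) (L M) i <= ennreal (R i powr (- (\<alpha> + 1)) * m M i) + ennreal (real M powr - \<alpha>) * ennreal (L M i * R i powr - \<alpha> * m M i)" for i
  proof -
   have em: "emeasure \<mu> {x \<in> space \<mu>. real M * R i < \<bar>x i\<bar>} = ennreal (m M i)" by (simp add: m_def emeasure_eq_measure)
   have m0: "0 <= m M i" by (simp add: m_def)
   have "(real M * R i) powr (- (\<alpha> + 1)) <= R i powr (- (\<alpha> + 1))"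
    using M1 R[of i] alpha by (intro powr_mono2') auto
   then have 1: "ennreal ((real M * R i) powr (- (\<alpha> + 1))) * ennreal (m M i) <= ennreal (R i powr (- (\<alpha> + 1)) * m M i)"
    using m0 by (simp add: ennreal_mult[symmetric] ennreal_leI mult_right_mono)
   have "ennreal (L M i * (real M * R i) powr - \<alpha>) * ennreal (m M i) = ennreal (L M i * (real M powr - \<alpha> * R i powr - \<alpha>) * m M i)"
    using m0 by (simp add: ennreal_mult''[symmetric] powr_mult)
   also have "\<dots> = ennreal (real M powr - \<alpha> * (L M i * R i powr - \<alpha> * m M i))" by (simp add: mult_ac)
   also have "\<dots> = ennreal (real M powr - \<alpha>) * ennreal (L M i * R i powr - \<alpha> * m M i)" by (rule ennreal_mult') simp
   finally have 2: "ennreal (L M i * (real M * R i) powr - \<alpha>) * ennreal (m M i) = ennreal (real M powr - \<alpha>) * ennreal (L M i * R i powr - \<alpha> * m M i)" .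
   show ?thesis unfolding tail_cost_def em distrib_right 2 by (rule add_right_mono[OF 1])
  qed
  define S where "S = (\<Sum>i<n. ennreal (R i powr (- (\<alpha> + 1)) * m M i))"
  have "(\<Sum>i<n. tail_cost (%i. real M * R i) (L M) i) <= S + ennreal (real M powr - \<alpha>) * (\<Sum>i<n. ennreal (L M i * R i powr - \<alpha> * m M i))"
   unfolding S_def sum_distrib_left sum.distrib[symmetric] by (rule sum_mono) (rule tc)
  also have "\<dots> <= S + ennreal (real M powr - \<alpha>) * (\<Sum>i. ennreal (L M i * R i powr - \<alpha> * m M i))"
   by (intro add_left_mono mult_left_mono sum_le_suminf) auto
  also have "\<dots> <= S + ennreal k" using N[of M] M unfolding k(2) by (intro add_left_mono) auto
  also have "\<dots> <= ennreal (k + 1) * (1 + S)"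
  proof -
   have "ennreal (k + 1) * (1 + S) = (ennreal k + 1) * (1 + S)" using k(1) by simp
   also have "\<dots> = (S + ennreal k) + (1 + ennreal k * S)" by (simp only: distrib_left distrib_right mult_1 mult_1_right ac_simps)
   finally show ?thesis by simp
  qed
  finally have s: "(\<Sum>i<n. tail_cost (%i. real M * R i) (L M) i) <= ennreal (k + 1) * (1 + S)" .
  have "Etot (cutoff n (%i. real M * R i)) <= ennreal C * (\<Sum>i<n. tail_cost (%i. real M * R i) (L M) i)"
   by (rule C(2)) (use R M b in auto)
  also have "\<dots> <= ennreal C * (ennreal (k + 1) * (1 + S))" by (rule mult_left_mono[OF s]) simp
  also have "\<dots> = ennreal (C * (k + 1)) * (1 + S)" using C(1) k(1) by (simp only: ennreal_mult mult.assoc)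
  finally show ?thesis unfolding S_def .
 qed
 then show ?thesis using C(1) k(1) unfolding m_def by (intro exI[of _ "C * (k + 1)"] exI[of _ "max 1 N"]) simp
qed

lemma cutoff_energy_real:
 assumes "1 <= n" "!!i. i < n ==> 0 < r i" "Etot (cutoff n r) <= ennreal c" "0 <= c"
 shows "cutoff n r \<in> D" "E (cutoff n r) (cutoff n r) <= c"
proof -
 have f: "cutoff n r \<in> FC0" by (rule cutoff_FC0[OF assms(1,2)])
 show "cutoff n r \<in> D" by (rule C_D[OF f])
 show "E (cutoff n r) (cutoff n r) <= c" unfolding E_eq_E0[OF f f] by (rule E0_le_if_Etot_le[OF f assms(4,3)])
qed

text \<open>Two limits: for fixed scale the cutoffs of more and more coordinates decrease to a
  function supported in a box of three times the radii, and then the scale grows. Summability keeps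
  the energy bounded in the first limit, and the measure hypothesis makes the second one equal to 1
  almost everywhere.\<close>

proposition exhausted_boxes:
 assumes R: "!!i. 0 < R i"
  and one: "measure \<mu> (\<Union>M\<in>{1::nat..}. {x \<in> space \<mu>. ALL i. \<bar>x i\<bar> <= real M * R i}) = 1"
  and s: "summable (%i. R i powr (- (\<alpha> + 1)) * tail (M0 * R i) i)"
  and b: "!!M i. 1 <= M ==> density_bound \<mu> (\<rho> i) {- (6 * (real M * R i))..6 * (real M * R i)} (L M i)"
  and l: "l < \<infinity>" "(%M. ennreal (real M powr - \<alpha>) *
    (\<Sum>i. ennreal (L M i * R i powr - \<alpha> * tail (real M * R i) i))) \<longlonglongrightarrow> l"
 shows "EX m. exhausted (%k. {x. ALL i. \<bar>x i\<bar> <= m k * R i})"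
proof -
 obtain C N where C: "0 <= C" and N: "1 <= N" and en: "!!M n. N <= M ==> Etot (cutoff n (%i. real M * R i)) \<le>
    ennreal C * (1 + (\<Sum>i<n. ennreal (R i powr (- (\<alpha> + 1)) * tail (real M * R i) i)))"
  using scaled_cutoff_energy[OF R b l] by blast
 define a where "a i = R i powr (- (\<alpha> + 1)) * tail (M0 * R i) i" for i
 have a: "summable a" "0 <= a i" for i using s unfolding a_def by simp_all
 \<comment> \<open>From \<open>M0\<close> on, the tails at scale \<open>M\<close> are bounded by
   those of the summability hypothesis.\<close>
 define N' where "N' = max N (nat \<lceil>M0\<rceil>)"
 define c where "c = C * (1 + suminf a)"
 have c: "0 <= c" unfolding c_def using C a by (simp add: suminf_nonneg)
 have en': "Etot (cutoff n (%i. real M * R i)) <= ennreal c" if M: "N' <= M" for M n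
 proof -
  have MM: "M0 <= real M" using M unfolding N'_def by linarith
  have "(\<Sum>i<n. ennreal (R i powr (- (\<alpha> + 1)) * tail (real M * R i) i)) <= (\<Sum>i<n. ennreal (a i))"
  proof (intro sum_mono ennreal_leI)
   fix i
   have "{x \<in> space \<mu>. M0 * R i < \<bar>x i\<bar>} \<in> sets \<mu>" using coord[of i] by measurable
   moreover have "{x \<in> space \<mu>. real M * R i < \<bar>x i\<bar>} \<subseteq> {x \<in> space \<mu>. M0 * R i < \<bar>x i\<bar>}"
    using mult_right_mono[OF MM less_imp_le[OF R[of i]]] by auto
   ultimately show "R i powr (- (\<alpha> + 1)) * tail (real M * R i) i <= a i"
    unfolding a_def by (intro mult_left_mono finite_measure_mono) auto
  qed
  also have "\<dots> = ennreal (\<Sum>i<n. a i)" by (rule sum_ennreal[OF a(2)])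
  also have "\<dots> <= ennreal (suminf a)" using a by (intro ennreal_leI sum_le_suminf) auto
  finally have "1 + (\<Sum>i<n. ennreal (R i powr (- (\<alpha> + 1)) * tail (real M * R i) i)) <= ennreal (1 + suminf a)"
   using a by (simp add: suminf_nonneg)
  then have "ennreal C * (1 + (\<Sum>i<n. ennreal (R i powr (- (\<alpha> + 1)) * tail (real M * R i) i))) <= ennreal C * ennreal (1 + suminf a)"
   by (intro mult_left_mono) auto
  also have "\<dots> = ennreal c" unfolding c_def using C by (simp only: ennreal_mult')
  finally show ?thesis using en[of M n] M unfolding N'_def by (auto intro: order_trans)
 qed
 define u where "u M x = lim (%n. cutoff (Suc n) (%i. real M * R i) x)" for M x
 have ul: "(%n. cutoff (Suc n) (%i. real M * R i) x) \<longlonglongrightarrow> u M x" for M x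
 proof -
  have "decseq (%n. cutoff (Suc n) (%i. real M * R i) x)"
  proof (rule decseq_SucI)
   fix n
   have "cutoff (Suc (Suc n)) (%i. real M * R i) x = cutoff (Suc n) (%i. real M * R i) x * plateau (x (Suc n) / (real M * R (Suc n)))"
    by (simp add: cutoff_def)
   also have "\<dots> <= cutoff (Suc n) (%i. real M * R i) x" using cutoff_bounds(1) plateau_bounds(2) by (rule mult_right_le_one_le[OF _ plateau_bounds(1)])
   finally show "cutoff (Suc (Suc n)) (%i. real M * R i) x <= cutoff (Suc n) (%i. real M * R i) x" .
  qed
  then obtain y where "(%n. cutoff (Suc n) (%i. real M * R i) x) \<longlonglongrightarrow> y"
   by (rule decseq_convergent[where B = 0]) (use cutoff_bounds(1) in auto)
  then show ?thesis unfolding u_def by (simp add: limI)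
 qed
 have ub: "0 <= u M x" "u M x <= 1" for M x
  using LIMSEQ_le_const[OF ul] LIMSEQ_le_const2[OF ul] cutoff_bounds by blast+
 have Rp: "0 < real M * R i" if "N' <= M" for M i using that N R[of i] unfolding N'_def by simp
 have uD: "u M \<in> D" "E (u M) (u M) <= c" if M: "N' <= M" for M
 proof -
  let ?f = "%n. cutoff (Suc n) (%i. real M * R i)"
  have f: "?f n \<in> D" "E (?f n) (?f n) <= c" for n
   using cutoff_energy_real[OF _ Rp[OF M] en'[OF M] c, of "Suc n"] by simp_all
  have fb: "\<bar>?f n x\<bar> <= 1" for n x using cutoff_bounds[of "Suc n" "%i. real M * R i" x] by simp
  have um: "u M \<in> borel_measurable \<mu>"
   by (rule borel_measurable_LIMSEQ_real[OF ul L2_measurable[OF DL[OF f(1)]]])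
  have ae: "AE x in \<mu>. (%n. ?f n x) \<longlonglongrightarrow> u M x" using ul by simp
  show "u M \<in> D" by (rule bounded_limit(1)[OF f fb um ae])
  show "E (u M) (u M) <= c" by (rule bounded_limit(2)[OF f fb um ae])
 qed
 have us: "\<bar>x i\<bar> <= 3 * (real M * R i)" if nz: "u M x ~= 0" and M: "N' <= M" for M x i
 proof (rule ccontr)
  assume "\<not> ?thesis"
  then have z: "cutoff (Suc n) (%i. real M * R i) x = 0" if "n >= i" for n
   using cutoff_support[of "Suc n" "%i. real M * R i" x i] Rp[OF M, of i] that by auto
  have "(%n. cutoff (Suc n) (%i. real M * R i) x) \<longlonglongrightarrow> 0"
   by (rule tendsto_eventually) (use z in \<open>auto simp: eventually_sequentially\<close>)
  from LIMSEQ_unique[OF this ul] show False using nz by simp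
 qed
 let ?f = "%m. u (N' + m)"
 have f: "?f m \<in> D" "E (?f m) (?f m) <= c" for m using uD[of "N' + m"] by simp_all
 have fb: "\<bar>?f m x\<bar> <= 1" for m x using ub[of "N' + m" x] by simp
 have ae: "AE x in \<mu>. (%m. ?f m x) \<longlonglongrightarrow> 1"
  using AE_prob_1[OF one]
 proof (rule AE_mp, intro AE_I2 impI)
  fix x assume "x \<in> (\<Union>M\<in>{1::nat..}. {x \<in> space \<mu>. ALL i. \<bar>x i\<bar> <= real M * R i})"
  then obtain M where M: "!!i. \<bar>x i\<bar> <= real M * R i" by blast
  have "u (N' + m) x = 1" if m: "M <= m" for m
  proof -
   have "cutoff (Suc n) (%i. real (N' + m) * R i) x = 1" for n
   proof (rule cutoff_eq_1, intro conjI)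
    fix i
    show "0 < real (N' + m) * R i" by (rule Rp) simp
    have "real M * R i <= real (N' + m) * R i" using m less_imp_le[OF R[of i]] by (intro mult_right_mono) auto
    then show "\<bar>x i\<bar> <= real (N' + m) * R i" using M[of i] by linarith
   qed
   then show ?thesis using LIMSEQ_unique[OF ul[of "N' + m" x], of 1] by simp
  qed
  then show "(%m. ?f m x) \<longlonglongrightarrow> 1" by (intro tendsto_eventually) (auto simp: eventually_sequentially)
 qed
 have oneD: "(%x. 1) \<in> D" by (rule bounded_limit(1)[OF f fb borel_measurable_const ae])
 obtain w where w: "!!k. w k \<in> cvx hull range ?f" "(%k. form_dist (form1 \<mu> E) (w k) (%x. 1)) \<longlonglongrightarrow> 0"
  using bounded_limit(3)[OF f fb borel_measurable_const ae] by blast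
 \<comment> \<open>The box may depend on the function, so \<open>P\<close> is stable under convex
   combinations: the support of a combination lies in the larger of two boxes.\<close>
 define P where "P v \<longleftrightarrow> v \<in> D \<and> (ALL x. 0 <= v x \<and> v x <= 1) \<and> (EX m. ALL x. v x ~= 0 --> (ALL i. \<bar>x i\<bar> <= m * R i))" for v
 have Pw: "P (w k)" for k
 proof (rule hull_property[OF w(1)])
  show "range ?f \<subseteq> {v. P v}"
  proof (clarify)
   fix m
   have "ALL x. u (N' + m) x ~= 0 --> (ALL i. \<bar>x i\<bar> <= (3 * real (N' + m)) * R i)"
    using us[of "N' + m"] unfolding mult.assoc by simp
   then show "P (u (N' + m))" unfolding P_def using f(1)[of m] ub by blast
  qed
  show "cvx {v. P v}"
  proof (rule cvxI, clarify)
   fix v v' and p q :: real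
   assume P: "P v" "P v'" and p: "0 <= p" "0 <= q" "p + q = 1"
   obtain m where m: "!!x i. v x ~= 0 ==> \<bar>x i\<bar> <= m * R i" using P(1) unfolding P_def by blast
   obtain m' where m': "!!x i. v' x ~= 0 ==> \<bar>x i\<bar> <= m' * R i" using P(2) unfolding P_def by blast
   have "(%x. p * v x + q * v' x) \<in> D" using P unfolding P_def by (intro E.lincomb) auto
   moreover have "0 <= p * v x + q * v' x \<and> p * v x + q * v' x <= 1" for x
    using P p convex_bound_le[of "v x" 1 "v' x" p q] unfolding P_def by simp
   moreover have "ALL x. p * v x + q * v' x ~= 0 --> (ALL i. \<bar>x i\<bar> <= max m m' * R i)"
   proof (intro allI impI)
    fix x i assume "p * v x + q * v' x ~= 0"
    then have "v x ~= 0 \<or> v' x ~= 0" by auto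
    then have "\<bar>x i\<bar> <= m * R i \<or> \<bar>x i\<bar> <= m' * R i" using m m' by blast
    moreover have "m * R i <= max m m' * R i" "m' * R i <= max m m' * R i" using less_imp_le[OF R[of i]] by (auto intro: mult_right_mono)
    ultimately show "\<bar>x i\<bar> <= max m m' * R i" by linarith
   qed
   ultimately show "P (%x. p * v x + q * v' x)" unfolding P_def by blast
  qed
 qed
 then have "ALL k. EX m. ALL x. w k x ~= 0 --> (ALL i. \<bar>x i\<bar> <= m * R i)" unfolding P_def by blast
 then obtain m where m: "!!k x i. w k x ~= 0 ==> \<bar>x i\<bar> <= m k * R i" by metis
 have "exhausted (%k. {x. ALL i. \<bar>x i\<bar> <= m k * R i})"
  unfolding exhausted_def
 proof (intro conjI exI[of _ w])
  show "ALL k. w k \<in> D" "ALL k x. 0 <= w k x \<and> w k x <= 1" using Pw unfolding P_def by blast+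
  show "ALL k x. w k x ~= 0 --> x \<in> {x. ALL i. \<bar>x i\<bar> <= m k * R i}" using m by blast
 qed (rule oneD, rule w(2))
 then show ?thesis by blast
qed

text \<open>The increment of the product is \<open>b x * (a x' - a x) + a x' * (b x' - b x)\<close>;
  its square is at most twice the sum of the squares, and the outer factors are at most 1 in
  absolute value.\<close>

lemma Etot_mult:
 assumes a: "a \<in> borel_measurable borel" "!!x. \<bar>a x\<bar> <= 1" and b: "b \<in> borel_measurable borel" "!!x. \<bar>b x\<bar> <= 1"
 shows "Etot (%x. a x * b x) <= 2 * Etot a + 2 * Etot b"
proof -
 let ?ab = "%x. a x * b x"
 have le: "ennreal (ph i ?ab ?ab x y) <= 2 * ennreal (ph i a a x y) + 2 * ennreal (ph i b b x y)" for i x y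
 proof -
  define x' where "x' = x(i := y)"
  define s where "s = \<bar>y - x i\<bar> powr (\<alpha> + 1)"
  define p q where "p = b x * (a x' - a x)" and "q = a x' * (b x' - b x)"
  have sq: "(c * d)\<^sup>2 <= d\<^sup>2" if "\<bar>c\<bar> <= 1" for c d :: real
   using that mult_left_le_one_le[of "d\<^sup>2" "c\<^sup>2"] by (simp add: power_mult_distrib abs_square_le_1)
  have "(p + q)\<^sup>2 + (p - q)\<^sup>2 = 2 * p\<^sup>2 + 2 * q\<^sup>2" by (simp add: power2_eq_square algebra_simps)
  then have "(p + q)\<^sup>2 <= 2 * p\<^sup>2 + 2 * q\<^sup>2" using zero_le_power2[of "p - q"] by linarith
  also have "\<dots> <= 2 * (a x' - a x)\<^sup>2 + 2 * (b x' - b x)\<^sup>2"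
   unfolding p_def q_def using sq[OF b(2)] sq[OF a(2)] by (intro add_mono mult_left_mono) auto
  finally have "(p + q)\<^sup>2 <= 2 * (a x' - a x)\<^sup>2 + 2 * (b x' - b x)\<^sup>2" .
  moreover have "p + q = ?ab x' - ?ab x" by (simp add: p_def q_def algebra_simps)
  ultimately have "(?ab x' - ?ab x)\<^sup>2 <= 2 * (a x' - a x)\<^sup>2 + 2 * (b x' - b x)\<^sup>2" by simp
  then have "(?ab x' - ?ab x)\<^sup>2 / s <= (2 * (a x' - a x)\<^sup>2 + 2 * (b x' - b x)\<^sup>2) / s"
   by (rule divide_right_mono) (simp add: s_def)
  then have "ph i ?ab ?ab x y <= 2 * ph i a a x y + 2 * ph i b b x y"
   unfolding ph_def x'_def[symmetric] s_def[symmetric] by (simp add: power2_eq_square add_divide_distrib)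
  then have "ennreal (ph i ?ab ?ab x y) <= ennreal (2 * ph i a a x y + 2 * ph i b b x y)" by (rule ennreal_leI)
  also have "\<dots> = 2 * ennreal (ph i a a x y) + 2 * ennreal (ph i b b x y)"
   using ph_nonneg[of i a x y] ph_nonneg[of i b x y] by (simp add: ennreal_plus ennreal_mult)
  finally show ?thesis .
 qed
 have im: "(%x. carre i u x) \<in> borel_measurable \<mu>" if "u \<in> borel_measurable borel" for i u
  by (rule nn_integral_measurable_subprob_algebra2[OF ph_borel_ennreal[OF that] kernel])
 have "En i ?ab <= 2 * En i a + 2 * En i b" for i
 proof -
  have "En i ?ab <= (\<integral>\<^sup>+x. \<integral>\<^sup>+y. 2 * ennreal (ph i a a x y) + 2 * ennreal (ph i b b x y) \<partial>\<kappa> i x \<partial>\<mu>)"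
   unfolding En_def by (rule nn_integral_mono, rule nn_integral_mono, rule le)
  also have "\<dots> = (\<integral>\<^sup>+x. 2 * carre i a x + 2 * carre i b x \<partial>\<mu>)"
  proof (rule nn_integral_cong)
   fix x assume x: "x \<in> space \<mu>"
   have "(%y. ennreal (ph i a a x y)) \<in> borel_measurable (\<kappa> i x)" "(%y. ennreal (ph i b b x y)) \<in> borel_measurable (\<kappa> i x)"
    using ph_measurable_kernel[OF a(1) a(1) x] ph_measurable_kernel[OF b(1) b(1) x] by simp_all
   then show "(\<integral>\<^sup>+y. 2 * ennreal (ph i a a x y) + 2 * ennreal (ph i b b x y) \<partial>\<kappa> i x)
    = 2 * carre i a x + 2 * carre i b x"
    by (subst nn_integral_add) (auto simp: nn_integral_cmult)
  qed
  also have "\<dots> = 2 * En i a + 2 * En i b"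
   unfolding En_def using im[OF a(1), of i] im[OF b(1), of i] by (subst nn_integral_add) (auto simp: nn_integral_cmult)
  finally show ?thesis .
 qed
 then have "Etot ?ab <= (\<integral>\<^sup>+i. 2 * En i a + 2 * En i b \<partial>count_space UNIV)"
  unfolding Etot_def by (rule nn_integral_mono)
 also have "\<dots> = 2 * Etot a + 2 * Etot b"
  unfolding Etot_def by (subst nn_integral_add) (auto simp: nn_integral_cmult)
 finally show ?thesis .
qed

text \<open>\<open>a b - 1 = a (b - 1) + (a - 1)\<close>, where the first factor is at most 1 in
  absolute value.\<close>

lemma L2_dist_mult_one:
 assumes a: "a \<in> L2_fun \<mu>" "!!x. \<bar>a x\<bar> <= 1" and b: "b \<in> L2_fun \<mu>" "!!x. \<bar>b x\<bar> <= 1"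
 shows "L2_dist \<mu> (%x. a x * b x) (%x. 1) <= L2_dist \<mu> a (%x. 1) + L2_dist \<mu> b (%x. 1)"
proof -
 have abm: "(%x. a x * b x) \<in> borel_measurable \<mu>" using L2_measurable[OF a(1)] L2_measurable[OF b(1)] by measurable
 have ab: "(%x. a x * b x) \<in> L2_fun \<mu>"
  by (rule bounded_L2[OF abm, of 1]) (use mult_mono[OF a(2) b(2)] in \<open>simp add: abs_mult\<close>)
 have "L2_inner \<mu> (%x. a x * b x - a x) (%x. a x * b x - a x) <= L2_inner \<mu> (%x. b x - 1) (%x. b x - 1)"
  unfolding L2_inner_def
 proof (rule integral_mono)
  fix x
  have "(a x)\<^sup>2 * (b x - 1)\<^sup>2 <= (b x - 1)\<^sup>2" using a(2)[of x] by (intro mult_left_le_one_le) (simp_all add: abs_square_le_1)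
  then show "(a x * b x - a x) * (a x * b x - a x) <= (b x - 1) * (b x - 1)"
   by (simp add: power2_eq_square algebra_simps)
 qed (intro L2_integrable_mult L2.mem_diff ab a b const_L2)+
 then have "L2_dist \<mu> (%x. a x * b x) a <= L2_dist \<mu> b (%x. 1)" unfolding L2_dist_def by (rule real_sqrt_le_mono)
 moreover have "L2_dist \<mu> (%x. a x * b x) (%x. 1) <= L2_dist \<mu> (%x. a x * b x) a + L2_dist \<mu> a (%x. 1)"
  by (rule L2.dist_triangle[OF ab a(1) const_L2])
 ultimately show ?thesis by simp
qed

text \<open>Without a condition on the size of the tails, the cutoffs \<open>w\<^sub>n\<close> of the first \<open>n\<close> coordinates can
 still be chosen with energy at most \<open>4\<^sup>-\<^sup>n\<close>; the infinite products \<open>w\<^sub>k w\<^sub>k\<^sub>+\<^sub>1 \<dots>\<close> then have small energy and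
 are supported in boxes.\<close>

proposition exhausted_products:
 assumes R: "!!i. 0 < R i"
  and b: "!!M i. 1 <= M ==> density_bound \<mu> (\<rho> i) {- (6 * (real M * R i))..6 * (real M * R i)} (L M i)"
  and l: "l < \<infinity>" "(%M. ennreal (real M powr - \<alpha>) *
    (\<Sum>i. ennreal (L M i * R i powr - \<alpha> * tail (real M * R i) i))) \<longlonglongrightarrow> l"
 shows "EX m. exhausted (%k. {x. ALL i. \<bar>x i\<bar> <= m k i})"
proof -
 obtain C N where C: "0 <= C" and N: "1 <= N" and en: "!!M n. N <= M ==> Etot (cutoff n (%i. real M * R i)) \<le>
    ennreal C * (1 + (\<Sum>i<n. ennreal (R i powr (- (\<alpha> + 1)) * tail (real M * R i) i)))"
  using scaled_cutoff_energy[OF R b l] by blast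
 \<comment> \<open>The tail probabilities are simply bounded by 1. The bound grows with
   \<open>n\<close>, which is harmless while the number of coordinates is fixed.\<close>
 define c where "c n = C * (1 + (\<Sum>i<n. R i powr (- (\<alpha> + 1))))" for n
 have c: "0 <= c n" for n unfolding c_def using C by (simp add: sum_nonneg)
 have en': "Etot (cutoff n (%i. real M * R i)) <= ennreal (c n)" if M: "N <= M" for M n
 proof -
  have "(\<Sum>i<n. ennreal (R i powr (- (\<alpha> + 1)) * tail (real M * R i) i)) <= (\<Sum>i<n. ennreal (R i powr (- (\<alpha> + 1))))"
   by (intro sum_mono ennreal_leI) (simp add: mult_left_le)
  also have "\<dots> = ennreal (\<Sum>i<n. R i powr (- (\<alpha> + 1)))" by (rule sum_ennreal) simp
  finally have "1 + (\<Sum>i<n. ennreal (R i powr (- (\<alpha> + 1)) * tail (real M * R i) i)) <= ennreal (1 + (\<Sum>i<n. R i powr (- (\<alpha> + 1))))"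
   by (simp add: sum_nonneg)
  then have "ennreal C * (1 + (\<Sum>i<n. ennreal (R i powr (- (\<alpha> + 1)) * tail (real M * R i) i))) <= ennreal C * ennreal (1 + (\<Sum>i<n. R i powr (- (\<alpha> + 1))))"
   by (intro mult_left_mono) auto
  also have "\<dots> = ennreal (c n)" unfolding c_def using C by (simp only: ennreal_mult')
  finally show ?thesis using en[OF M, of n] by (rule order_trans[rotated])
 qed
 have Rp: "0 < real (N + m) * R i" for m i using N R[of i] by simp
 define f where "f n m = cutoff n (%i. real (N + m) * R i)" for n m
 have fF: "f n m \<in> FC0" if "1 <= n" for n m unfolding f_def by (rule cutoff_FC0[OF that Rp])
 have fD: "f n m \<in> D" "E (f n m) (f n m) <= c n" if "1 <= n" for n m
  unfolding f_def by (rule cutoff_energy_real[OF that Rp en' c], simp)+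
 have fb: "\<bar>f n m x\<bar> <= 1" for n m x unfolding f_def using cutoff_bounds[of n "%i. real (N + m) * R i" x] by simp
 have lim: "(%m. f n m x) \<longlonglongrightarrow> 1" for n x
 proof (rule tendsto_eventually)
  define B where "B = (\<Sum>i<n. \<bar>x i\<bar> / R i)"
  have "f n m x = 1" if m: "nat \<lceil>B\<rceil> <= m" for m
   unfolding f_def
  proof (rule cutoff_eq_1, intro conjI)
   fix i assume i: "i < n"
   show "0 < real (N + m) * R i" by (rule Rp)
   have "\<bar>x i\<bar> / R i <= B" unfolding B_def using i less_imp_le[OF R] by (intro member_le_sum) auto
   also have "B <= real (N + m)" using m by linarith
   finally show "\<bar>x i\<bar> <= real (N + m) * R i" using R[of i] by (simp add: divide_le_eq)
  qed
  then show "\<forall>\<^sub>F m in sequentially. f n m x = 1" unfolding eventually_sequentially by blast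
 qed
 have ae: "AE x in \<mu>. (%m. f n m x) \<longlonglongrightarrow> 1" for n using lim by simp
 note bl = bounded_limit[OF fD fb borel_measurable_const ae]
 have oneD: "(%x. 1) \<in> D" using bl(1)[of 1] by simp
 have E1: "E.nrm (%x. 1) = 0" unfolding E.nrm_def energy_one[OF oneD] by simp
 \<comment> \<open>The functions are kept in \<open>FC0\<close>, and not merely in the domain, since
   they are going to be multiplied with each other.\<close>
 define P where "P n v \<longleftrightarrow> v \<in> FC0 \<and> (ALL x. 0 <= v x \<and> v x <= 1) \<and> (EX m. ALL x. v x ~= 0 --> (\<forall>i<n. \<bar>x i\<bar> <= m))" for n and v :: "(nat => real) => real"
 have "EX w. P (Suc n) w \<and> form_dist (form1 \<mu> E) w (%x. 1) < (1 / 2) ^ n" for n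
 proof -
  obtain w where w: "!!k. w k \<in> cvx hull range (f (Suc n))" "(%k. form_dist (form1 \<mu> E) (w k) (%x. 1)) \<longlonglongrightarrow> 0"
   using bl(3)[of "Suc n"] by auto
  have Pw: "P (Suc n) (w k)" for k
  proof (rule hull_property[OF w(1)])
   show "range (f (Suc n)) \<subseteq> {v. P (Suc n) v}"
   proof (clarify)
    fix m
    have "\<bar>x i\<bar> <= (\<Sum>i<Suc n. 3 * (real (N + m) * R i))" if "f (Suc n) m x ~= 0" "i < Suc n" for x i
    proof -
     have "\<bar>x i\<bar> <= 3 * (real (N + m) * R i)" using cutoff_support[of "Suc n" "%i. real (N + m) * R i" x i] that Rp unfolding f_def by blast
     also have "\<dots> <= (\<Sum>i<Suc n. 3 * (real (N + m) * R i))" using that(2) less_imp_le[OF Rp] by (intro member_le_sum) auto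
     finally show ?thesis .
    qed
    then show "P (Suc n) (f (Suc n) m)" unfolding P_def using fF[of "Suc n" m] cutoff_bounds unfolding f_def by auto
   qed
   show "cvx {v. P (Suc n) v}"
   proof (rule cvxI, clarify)
    fix v v' and p q :: real
    assume P: "P (Suc n) v" "P (Suc n) v'" and p: "0 <= p" "0 <= q" "p + q = 1"
    obtain m where m: "!!x i. v x ~= 0 ==> i < Suc n ==> \<bar>x i\<bar> <= m" using P(1) unfolding P_def by blast
    obtain m' where m': "!!x i. v' x ~= 0 ==> i < Suc n ==> \<bar>x i\<bar> <= m'" using P(2) unfolding P_def by blast
    have "(%x. p * v x + q * v' x) \<in> FC0" using P unfolding P_def by (intro FC0_lincomb) auto
    moreover have "0 <= p * v x + q * v' x \<and> p * v x + q * v' x <= 1" for x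
     using P p convex_bound_le[of "v x" 1 "v' x" p q] unfolding P_def by simp
    moreover have "ALL x. p * v x + q * v' x ~= 0 --> (\<forall>i<Suc n. \<bar>x i\<bar> <= max m m')"
    proof (intro allI impI)
     fix x i assume i: "i < Suc n" and "p * v x + q * v' x ~= 0"
     then have "v x ~= 0 \<or> v' x ~= 0" by auto
     then show "\<bar>x i\<bar> <= max m m'" using m[OF _ i, of x] m'[OF _ i, of x] by (auto simp: le_max_iff_disj)
    qed
    ultimately show "P (Suc n) (%x. p * v x + q * v' x)" unfolding P_def by blast
   qed
  qed
  obtain k where "form_dist (form1 \<mu> E) (w k) (%x. 1) < (1 / 2) ^ n"
   using order_tendstoD(2)[OF w(2), of "(1 / 2) ^ n"] by (auto simp: eventually_sequentially)
  then show ?thesis using Pw by blast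
 qed
 then obtain w where w: "!!n. P (Suc n) (w n)" "!!n. form_dist (form1 \<mu> E) (w n) (%x. 1) < (1 / 2) ^ n" by metis
 have wF: "w n \<in> FC0" and wb: "0 <= w n x" "w n x <= 1" for n x using w(1)[of n] unfolding P_def by blast+
 have "ALL n. EX m. ALL x. w n x ~= 0 --> (\<forall>i<Suc n. \<bar>x i\<bar> <= m)" using w(1) unfolding P_def by blast
 then obtain m where m: "!!n x i. w n x ~= 0 ==> i < Suc n ==> \<bar>x i\<bar> <= m n" by metis
 \<comment> \<open>As 1 has energy 0, the energy norm of \<open>w n\<close> is at most its distance
   from 1.\<close>
 have wE: "Etot (w n) <= ennreal ((1 / 4) ^ n)" for n
 proof -
  have D: "w n \<in> D" by (rule C_D[OF wF])
  have "E.nrm (w n) <= form_dist E (w n) (%x. 1)" using E.nrm_diff_le[OF D oneD] E1 by simp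
  also have "\<dots> <= (1 / 2) ^ n" using dist_le_E1(1)[OF D oneD] w(2)[of n] by linarith
  finally have "(E.nrm (w n))\<^sup>2 <= ((1 / 2) ^ n)\<^sup>2" using E.nrm_nonneg[OF D] by (intro power_mono) auto
  then have "E0 (w n) (w n) <= (1 / 4) ^ n"
   unfolding E.nrm_sq[OF D] E_eq_E0[OF wF wF] by (simp add: power2_eq_square power_mult_distrib[symmetric])
  then show ?thesis unfolding Etot_eq[OF wF] by (rule ennreal_leI)
 qed
 have wL: "L2_dist \<mu> (w n) (%x. 1) <= (1 / 2) ^ n" for n
  using dist_le_E1(2)[OF C_D[OF wF] oneD] w(2)[of n] by (meson less_imp_le order_trans)
 define p where "p k n x = (\<Prod>j<n. w (k + j) x)" for k n x
 have p0: "p k 0 = (%x. 1)" for k by (simp add: p_def fun_eq_iff)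
 have pS: "p k (Suc n) = (%x. w k x * p (Suc k) n x)" for k n
  unfolding p_def prod.lessThan_Suc_shift by (simp add: fun_eq_iff)
 have pS': "p k (Suc n) x = p k n x * w (k + n) x" for k n x by (simp add: p_def)
 have pb: "0 <= p k n x" "p k n x <= 1" for k n x
  unfolding p_def using wb by (auto intro: prod_nonneg prod_le_1)
 have pF: "p k (Suc n) \<in> FC0" for k n
 proof (induction n arbitrary: k)
  case 0 show ?case unfolding pS p0 using wF by simp
 next
  case (Suc n) show ?case unfolding pS[of k "Suc n"] by (rule FC0_mult[OF wF Suc.IH])
 qed
 have pm: "p k n \<in> borel_measurable borel" for k n
  by (cases n) (simp_all add: p0 FC0_borel[OF pF])
 have pL2: "p k n \<in> L2_fun \<mu>" for k n
 proof (rule bounded_L2[OF borel_comp[OF pm]])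
  show "AE x in \<mu>. \<bar>p k n x\<bar> <= 1" using pb[of k n] by simp
 qed
 \<comment> \<open>The product rule doubles energies, but those of the factors fall by 4 at each
   step: \<open>2 * 4^-k + 2 * (4 * 4^-(k+1)) = 4 * 4^-k\<close>, so the bound reproduces
   itself.\<close>
 have pE: "Etot (p k n) <= ennreal (4 * (1 / 4) ^ k)" for k n
 proof (induction n arbitrary: k)
  case 0
  have "Etot (p k 0) = 0" unfolding p0 Etot_def En_def ph_def by simp
  then show ?case by simp
 next
  case (Suc n)
  have "Etot (p k (Suc n)) <= 2 * Etot (w k) + 2 * Etot (p (Suc k) n)"
   unfolding pS using wb pb by (intro Etot_mult FC0_borel[OF wF] pm) simp_all
  also have "\<dots> <= 2 * ennreal ((1 / 4) ^ k) + 2 * ennreal (4 * (1 / 4) ^ Suc k)"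
   by (intro add_mono mult_left_mono wE Suc.IH) auto
  also have "\<dots> = ennreal (2 * (1 / 4) ^ k + 2 * (4 * (1 / 4) ^ Suc k))"
   by (subst ennreal_plus) (simp_all add: ennreal_mult)
  also have "2 * (1 / 4) ^ k + 2 * (4 * (1 / 4) ^ Suc k) = 4 * (1 / 4 :: real) ^ k" by simp
  finally show ?case .
 qed
 have pL: "L2_dist \<mu> (p k n) (%x. 1) <= 2 * (1 / 2) ^ k" for k n
 proof (induction n arbitrary: k)
  case 0
  show ?case unfolding p0 L2.dist_self[OF const_L2] by simp
 next
  case (Suc n)
  have "L2_dist \<mu> (p k (Suc n)) (%x. 1) <= L2_dist \<mu> (w k) (%x. 1) + L2_dist \<mu> (p (Suc k) n) (%x. 1)"
   unfolding pS using wb pb by (intro L2_dist_mult_one FC0_L2[OF wF] pL2) simp_all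
  also have "\<dots> <= (1 / 2) ^ k + 2 * (1 / 2) ^ Suc k" by (intro add_mono wL Suc.IH)
  finally show ?case by simp
 qed
 define v where "v k x = lim (%n. p k (Suc n) x)" for k x
 have vl: "(%n. p k (Suc n) x) \<longlonglongrightarrow> v k x" for k x
 proof -
  have "decseq (%n. p k (Suc n) x)"
  proof (rule decseq_SucI)
   fix n show "p k (Suc (Suc n)) x <= p k (Suc n) x"
    unfolding pS'[of k "Suc n"] by (rule mult_right_le_one_le[OF pb(1) wb])
  qed
  then obtain y where "(%n. p k (Suc n) x) \<longlonglongrightarrow> y"
   by (rule decseq_convergent[where B = 0]) (use pb(1) in auto)
  then show ?thesis unfolding v_def by (simp add: limI)
 qed
 have vb: "0 <= v k x" "v k x <= 1" for k x
  using LIMSEQ_le_const[OF vl] LIMSEQ_le_const2[OF vl] pb by blast+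
 have pD: "p k (Suc n) \<in> D" "E (p k (Suc n)) (p k (Suc n)) <= 4 * (1 / 4) ^ k" for k n
  using C_D[OF pF] E0_le_if_Etot_le[OF pF _ pE] unfolding E_eq_E0[OF pF pF] by simp_all
 have pb': "\<bar>p k (Suc n) x\<bar> <= 1" for k n x using pb[of k "Suc n" x] by simp
 have vm: "v k \<in> borel_measurable \<mu>" for k
  by (rule borel_measurable_LIMSEQ_real[OF vl borel_comp[OF pm]])
 have vae: "AE x in \<mu>. (%n. p k (Suc n) x) \<longlonglongrightarrow> v k x" for k using vl by simp
 note vlim = bounded_limit[OF pD pb' vm vae]
 \<comment> \<open>The factor with index \<open>k + i\<close> is a cutoff in the first
   \<open>k + i + 1\<close> coordinates, among which is coordinate \<open>i\<close>.\<close>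
 have vs: "\<bar>x i\<bar> <= m (k + i)" if nz: "v k x ~= 0" for k x i
 proof -
  have "w (k + i) x ~= 0"
  proof
   assume z: "w (k + i) x = 0"
   have "p k (Suc n) x = 0" if "i <= n" for n
    unfolding p_def using z that by (intro prod_zero) auto
   then have "(%n. p k (Suc n) x) \<longlonglongrightarrow> 0" by (intro tendsto_eventually) (auto simp: eventually_sequentially)
   from LIMSEQ_unique[OF this vl] show False using nz by simp
  qed
  then show ?thesis by (rule m) simp
 qed
 have vd: "form_dist (form1 \<mu> E) (v k) (%x. 1) <= 4 * (1 / 2) ^ k" for k
 proof -
  note vD = vlim(1)[of k]
  have z: "(%x. 0) \<in> D" by (rule E.mem_zero[OF oneD])
  have "E.nrm (v k) <= sqrt (4 * (1 / 4) ^ k)" unfolding E.nrm_def using vlim(2)[of k] by (rule real_sqrt_le_mono)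
  also have "sqrt (4 * (1 / 4) ^ k) = 2 * (1 / 2) ^ k"
   by (rule real_sqrt_unique) (simp_all add: power_mult_distrib power2_eq_square power_mult_distrib[symmetric])
  finally have n: "E.nrm (v k) <= 2 * (1 / 2) ^ k" .
  have "form_dist E (v k) (%x. 1) <= form_dist E (v k) (%x. 0) + form_dist E (%x. 1) (%x. 0)"
   using E.dist_triangle[OF vD z oneD] E.dist_commute[OF z oneD] by simp
  then have e: "form_dist E (v k) (%x. 1) <= 2 * (1 / 2) ^ k" using n E1 by (simp add: E.dist_nrm)
  have "L2_dist \<mu> (v k) (%x. 1) <= 2 * (1 / 2) ^ k"
  proof (rule L2.dist_le_Lim[OF pL2 const_L2 DL[OF vD] const_L2])
   show "(%n. L2_dist \<mu> (p k (Suc n)) (v k)) \<longlonglongrightarrow> 0" by (rule vlim(4))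
   show "(%n. L2_dist \<mu> (%x. 1) (%x. 1)) \<longlonglongrightarrow> 0" unfolding L2.dist_self[OF const_L2] by simp
   show "L2_dist \<mu> (p k (Suc n)) (%x. 1) <= 2 * (1 / 2) ^ k" for n by (rule pL)
  qed simp
  then show ?thesis using E1_le_sum[OF vD oneD] e by linarith
 qed
 have "exhausted (%k. {x. ALL i. \<bar>x i\<bar> <= m (k + i)})"
  unfolding exhausted_def
 proof (intro conjI exI[of _ v])
  show "ALL k. v k \<in> D" "ALL k x. 0 <= v k x \<and> v k x <= 1" using vlim(1) vb by blast+
  show "ALL k x. v k x ~= 0 --> x \<in> {x. ALL i. \<bar>x i\<bar> <= m (k + i)}" using vs by blast
  show "(%k. form_dist (form1 \<mu> E) (v k) (%x. 1)) \<longlonglongrightarrow> 0"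
  proof (rule Lim_null_comparison[OF always_eventually])
   show "ALL k. norm (form_dist (form1 \<mu> E) (v k) (%x. 1)) <= 4 * (1 / 2) ^ k"
    using vd E1.dist_nonneg[OF vlim(1) oneD] by simp
   show "(%k. 4 * (1 / 2 :: real) ^ k) \<longlonglongrightarrow> 0" by (intro tendsto_mult_right_zero LIMSEQ_realpow_zero) auto
  qed
 qed (rule oneD)
 then show ?thesis by (intro exI[of _ "%k i. m (k + i)"])
qed

end

section \<open>Strict quasi-regularity\<close>

context closed_form
begin

definition L2_closure :: "('a => real) set" where
 "L2_closure = {f \<in> L2_fun M. \<forall>e>0. \<exists>u\<in>D. L2_dist M f u < e}"

lemma L2_closureD: "f \<in> L2_closure ==> f \<in> L2_fun M" by (simp add: L2_closure_def)

lemma D_L2_closure: "u \<in> D ==> u \<in> L2_closure"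
 unfolding L2_closure_def using L2.dist_self[OF DL] by (auto simp: DL intro!: bexI[of _ u])

lemma L2_closure_limit:
 assumes f: "!!n. f n \<in> L2_closure" and u: "u \<in> L2_fun M" and l: "(%n. L2_dist M (f n) u) \<longlonglongrightarrow> 0"
 shows "u \<in> L2_closure"
 unfolding L2_closure_def
proof (intro CollectI conjI allI impI)
 fix e :: real assume "0 < e"
 then have e: "0 < e / 2" by simp
 from order_tendstoD(2)[OF l e] obtain n where n: "L2_dist M (f n) u < e / 2" by (auto simp: eventually_sequentially)
 obtain v where v: "v \<in> D" "L2_dist M (f n) v < e / 2" using f[of n] e unfolding L2_closure_def by blast
 have "L2_dist M u v <= L2_dist M u (f n) + L2_dist M (f n) v" by (rule L2.dist_triangle[OF u L2_closureD[OF f] DL[OF v(1)]])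
 then have "L2_dist M u v < e" using n v(2) L2.dist_commute[OF u L2_closureD[OF f], of n] by linarith
 then show "\<exists>v\<in>D. L2_dist M u v < e" using v(1) by blast
qed (rule u)

lemma L2_closure_bounded_limit:
 assumes f: "!!n. f n \<in> L2_closure" and u: "u \<in> borel_measurable M"
  and l: "AE x in M. (%n. f n x) \<longlonglongrightarrow> u x" and b: "!!n. AE x in M. \<bar>f n x\<bar> <= \<bar>g x\<bar>" and g: "g \<in> L2_fun M"
 shows "u \<in> L2_closure"
 using L2_bounded_convergence[OF L2_measurable[OF L2_closureD[OF f]] u l b g] by (intro L2_closure_limit[OF f])

lemma L2_closure_lincomb:
 assumes f: "f \<in> L2_closure" and g: "g \<in> L2_closure" shows "(%x. a * f x + b * g x) \<in> L2_closure"
proof -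
 have "\<exists>w\<in>D. L2_dist M h w < 1 / real (Suc n)" if "h \<in> L2_closure" for h n using that unfolding L2_closure_def by simp
 then obtain u v where u: "!!n. u n \<in> D" "!!n. L2_dist M f (u n) < 1 / real (Suc n)"
  and v: "!!n. v n \<in> D" "!!n. L2_dist M g (v n) < 1 / real (Suc n)"
  using f g by metis
 have lim: "(%n. L2_dist M (w n) h) \<longlonglongrightarrow> 0"
  if h: "h \<in> L2_closure" and w: "!!n. w n \<in> D" "!!n. L2_dist M h (w n) < 1 / real (Suc n)" for w h
 proof (rule Lim_null_comparison[OF always_eventually LIMSEQ_Suc[OF lim_1_over_n]])
  show "ALL n. norm (L2_dist M (w n) h) <= 1 / real (Suc n)"
   using w(2) L2.dist_commute[OF L2_closureD[OF h] DL[OF w(1)]] L2.dist_nonneg[OF DL[OF w(1)] L2_closureD[OF h]]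
   by (simp add: less_imp_le)
 qed
 show ?thesis
 proof (rule L2_closure_limit)
  show "(%x. a * u n x + b * v n x) \<in> L2_closure" for n by (intro D_L2_closure E.lincomb u v)
  show "(%x. a * f x + b * g x) \<in> L2_fun M" by (intro L2_lincomb L2_closureD f g)
  show "(%n. L2_dist M (%x. a * u n x + b * v n x) (%x. a * f x + b * g x)) \<longlonglongrightarrow> 0"
   by (rule L2.tendsto_lincomb[OF DL[OF u(1)] DL[OF v(1)] L2_closureD[OF f] L2_closureD[OF g] lim[OF f u] lim[OF g v]])
 qed
qed

lemma L2_closure_AE:
 assumes f: "f \<in> L2_closure" and g: "g \<in> borel_measurable M" "AE x in M. f x = g x" shows "g \<in> L2_closure"
proof (rule L2_closure_bounded_limit[OF f g(1)])
 show "AE x in M. (%n. f x) \<longlonglongrightarrow> g x" using g(2) by eventually_elim simp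
 show "AE x in M. \<bar>f x\<bar> <= \<bar>f x\<bar>" by simp
qed (rule L2_closureD[OF f])

lemma L2_closure_sum:
 assumes "finite I" "!!i. i \<in> I ==> f i \<in> L2_closure" shows "(%x. \<Sum>i\<in>I. f i x) \<in> L2_closure"
 using assms
proof (induction I rule: finite_induct)
 case empty
 obtain u where "u \<in> D" using D_ne by blast
 from D_L2_closure[OF E.mem_zero[OF this]] show ?case by simp
next
 case (insert i I)
 then show ?case using L2_closure_lincomb[of "f i" "%x. \<Sum>i\<in>I. f i x" 1 1] by simp
qed

lemma L2_closure_UNIV:
 assumes ind: "!!A. A \<in> sets M ==> (indicator A :: 'a => real) \<in> L2_closure" and f: "f \<in> L2_fun M"
 shows "f \<in> L2_closure"
proof -
 obtain F where F: "!!i. simple_function M (F i)" "!!x. x \<in> space M ==> (%i. F i x) \<longlonglongrightarrow> f x"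
  "!!i x. x \<in> space M ==> dist (F i x) 0 <= 2 * dist (f x) 0"
  using borel_measurable_implies_sequence_metric[OF L2_measurable[OF f], of 0] by blast
 have s: "F i \<in> L2_closure" for i
 proof (rule L2_closure_AE)
  show "(%x. \<Sum>y\<in>F i ` space M. y * indicator (F i -` {y} \<inter> space M) x + 0 * indicator (F i -` {y} \<inter> space M) x) \<in> L2_closure"
   using F(1)[of i] by (intro L2_closure_sum L2_closure_lincomb ind) (auto simp: simple_function_def)
  show "F i \<in> borel_measurable M" by (rule borel_measurable_simple_function[OF F(1)])
  show "AE x in M. (\<Sum>y\<in>F i ` space M. y * indicator (F i -` {y} \<inter> space M) x + 0 * indicator (F i -` {y} \<inter> space M) x) = F i x"
  proof (rule AE_I2)
   fix x assume x: "x \<in> space M"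
   have "(\<Sum>y\<in>F i ` space M. y * indicator (F i -` {y} \<inter> space M) x + 0 * indicator (F i -` {y} \<inter> space M) x)
     = (\<Sum>y\<in>F i ` space M. indicator (F i -` {y} \<inter> space M) x *\<^sub>R y)" by (intro sum.cong) (simp_all add: mult.commute)
   also have "\<dots> = F i x" by (rule simple_function_indicator_representation_banach[OF F(1) x, symmetric])
   finally show "(\<Sum>y\<in>F i ` space M. y * indicator (F i -` {y} \<inter> space M) x + 0 * indicator (F i -` {y} \<inter> space M) x) = F i x" .
  qed
 qed
 show ?thesis
 proof (rule L2_closure_bounded_limit[OF s L2_measurable[OF f], where g = "%x. 2 * f x"])
  show "AE x in M. (%n. F n x) \<longlonglongrightarrow> f x" using F(2) by simp
  show "AE x in M. \<bar>F n x\<bar> <= \<bar>2 * f x\<bar>" for n using F(3)[of _ n] by (simp add: abs_mult)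
  show "(%x. 2 * f x) \<in> L2_fun M" by (rule L2.mem_scale[OF f])
 qed
qed

end

text \<open>An intersection-stable generator of the product Borel field made of open half-lines,
  because \<open>flat0\<close> approximates exactly their indicators by smooth functions.\<close>

definition lower_boxes :: "(nat => real) set set" where
 "lower_boxes = {{x. ALL i. x i \<in> B i} | B. (ALL i. B i \<in> insert UNIV (range lessThan)) \<and> finite {i. B i ~= UNIV}}"

lemma lower_boxes_Int_stable: "Int_stable lower_boxes"
proof (rule Int_stableI)
 fix X Y assume "X \<in> lower_boxes" "Y \<in> lower_boxes"
 then obtain B C where B: "X = {x. ALL i. x i \<in> B i}" "!!i. B i \<in> insert UNIV (range lessThan)" "finite {i. B i ~= UNIV}"
  and C: "Y = {x. ALL i. x i \<in> C i}" "!!i. C i \<in> insert UNIV (range lessThan)" "finite {i. C i ~= UNIV}"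
  unfolding lower_boxes_def by blast
 have "U \<inter> V \<in> insert UNIV (range lessThan)" if "U \<in> insert UNIV (range lessThan)" "V \<in> insert UNIV (range lessThan)" for U V :: "real set"
  using that
 proof (elim insertE imageE)
  fix a b :: real assume "U = {..<a}" "V = {..<b}"
  then have "U \<inter> V = {..<min a b}" by auto
  then show ?thesis by blast
 qed auto
 then have 1: "!!i. B i \<inter> C i \<in> insert UNIV (range lessThan)" using B(2) C(2) by (simp only:)
 have 2: "finite {i. B i \<inter> C i ~= UNIV}" by (rule finite_subset[OF _ finite_UnI[OF B(3) C(3)]]) auto
 have 3: "X \<inter> Y = {x. ALL i. x i \<in> B i \<inter> C i}" using B(1) C(1) by auto
 show "X \<inter> Y \<in> lower_boxes"
  unfolding lower_boxes_def 3 by (rule CollectI, rule exI[of _ "%i. B i \<inter> C i"]) (use 1 2 in simp)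
qed

lemma lower_boxes_borel: "sets (borel :: (nat => real) measure) = sigma_sets UNIV lower_boxes"
proof (rule antisym)
 have id: "(%x. x) \<in> borel_measurable (sigma UNIV lower_boxes)"
 proof (rule measurable_coordinatewise_then_product)
  fix i :: nat
  show "(%x. x i) \<in> borel_measurable (sigma UNIV lower_boxes)"
   unfolding borel_measurable_iff_less
  proof
   fix a :: real
   define B where "B = (%j. if j = i then {..<a} else UNIV)"
   have "finite {j. B j ~= UNIV}" by (rule finite_subset[of _ "{i}"]) (auto simp: B_def)
   moreover have "!!j. B j \<in> insert UNIV (range lessThan)" by (simp add: B_def)
   moreover have "{w \<in> space (sigma UNIV lower_boxes). w i < a} = {x. ALL j. x j \<in> B j}" by (auto simp: B_def space_measure_of_conv)
   ultimately have "{w \<in> space (sigma UNIV lower_boxes). w i < a} \<in> lower_boxes"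
    unfolding lower_boxes_def by (intro CollectI exI[of _ B]) simp
   then show "{w \<in> space (sigma UNIV lower_boxes). w i < a} \<in> sets (sigma UNIV lower_boxes)" by simp
  qed
 qed
 have "A \<in> sets (sigma UNIV lower_boxes)" if "A \<in> sets borel" for A :: "(nat => real) set"
  using measurable_sets[OF id that] by (simp add: space_measure_of_conv)
 then show "sets borel \<subseteq> sigma_sets UNIV lower_boxes" by auto
 have "X \<in> sets borel" if X: "X \<in> lower_boxes" for X
 proof -
  obtain B where B: "X = {x. ALL i. x i \<in> B i}" "ALL i. B i \<in> insert UNIV (range lessThan)"
   using X unfolding lower_boxes_def by blast
  have Bb: "B i \<in> sets borel" for i using B(2)[rule_format, of i] by (elim insertE imageE) (simp_all only: sets.top space_borel[symmetric] lessThan_borel)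
  have c: "(%x :: nat => real. x i) \<in> borel_measurable borel" for i by measurable
  have "{x :: nat => real. x i \<in> B i} \<in> sets borel" for i
   using measurable_sets[OF c Bb, of i] by (simp add: vimage_def)
  then have "(\<Inter>i. {x :: nat => real. x i \<in> B i}) \<in> sets borel" by (intro sets.countable_INT) auto
  moreover have "(\<Inter>i. {x. x i \<in> B i}) = X" unfolding B(1) by auto
  ultimately show ?thesis by simp
 qed
 then show "sigma_sets UNIV lower_boxes \<subseteq> sets borel" using sets.sigma_sets_subset[of lower_boxes borel] by auto
qed

context cond_density_setting
begin

text \<open>Smoothed half-line indicators approximate the finitely many constraints, and a widening
  plateau in every variable provides the compact support.\<close>

lemma indicator_lower_box:
 assumes X: "X \<in> lower_boxes" shows "(indicator X :: _ => real) \<in> L2_closure"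
proof -
 obtain B where B: "X = {x. ALL i. x i \<in> B i}" "!!i. B i \<in> insert UNIV (range lessThan)" "finite {i. B i ~= UNIV}"
  using X unfolding lower_boxes_def by blast
 obtain n0 where n0: "!!i. B i ~= UNIV ==> i < n0" using B(3) by (auto simp: finite_nat_set_iff_bounded)
 \<comment> \<open>Cylinder functions need at least one variable, even when the box has no
   constraint.\<close>
 define n where "n = Suc n0"
 have n: "B i = UNIV" if "n <= i" for i using n0[of i] that unfolding n_def by linarith
 have "ALL i. EX a. B i ~= UNIV --> B i = {..<a}" using B(2) by blast
 then obtain a where a: "!!i. B i ~= UNIV ==> B i = {..<a i}" by metis
 define g where "g i m t = (if B i = UNIV then 1 else flat0 (real m * (a i - t)))" for i m t
 define h where "h i m t = g i m t * plateau ((1 / real (Suc m)) * t + 0)" for i m t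
 define f where "f m x = (\<Prod>i<n. h i m (x i))" for m and x :: "nat => real"
 have gC: "Ck k (g i m)" for k i m
 proof (cases "B i = UNIV")
  case True then show ?thesis unfolding g_def by (simp add: Ck_const)
 next
  case False
  have "Ck k (%t. flat0 ((- real m) * t + real m * a i))" by (rule Ck_compose[OF Ck_flat_exp Ck_affine])
  moreover have "g i m = (%t. flat0 ((- real m) * t + real m * a i))"
   using False by (simp add: g_def fun_eq_iff algebra_simps)
  ultimately show ?thesis by simp
 qed
 have hb: "0 <= h i m t" "h i m t <= 1" for i m t
  unfolding h_def g_def using flat0_bounds plateau_bounds by (auto intro: mult_le_one)
 have fF: "f m \<in> FC0" for m
  unfolding f_def
 proof (rule FC0_product)
  show "Ck k (h i m)" for i k unfolding h_def by (intro Ck_mult gC Ck_compose[OF Ck_plateau Ck_affine])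
  show "\<bar>t\<bar> <= 3 * real (Suc m)" if "h i m t ~= 0" for i t
  proof -
   have "\<not> 3 <= \<bar>(1 / real (Suc m)) * t + 0\<bar>" using that plateau_bounds(4) unfolding h_def by fastforce
   then show ?thesis by (simp add: abs_mult divide_less_eq not_le)
  qed
 qed (simp add: n_def)
 have fb: "\<bar>f m x\<bar> <= 1" for m x
  unfolding f_def using hb by (simp add: abs_prod abs_of_nonneg prod_le_1)
 have hl: "(%m. h i m t) \<longlonglongrightarrow> indicator (B i) t" for i t
 proof -
  have "(%m. g i m t) \<longlonglongrightarrow> indicator (B i) t"
  proof (cases "B i = UNIV")
   case True then show ?thesis by (simp add: g_def)
  next
   case False
   show ?thesis
   proof (cases "t < a i")
    case True
    then show ?thesis using flat0_tendsto_1[of "a i - t"] False a[OF False] by (simp add: g_def)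
   next
    case ge: False
    then have "real m * (a i - t) <= 0" for m by (simp add: mult_nonneg_nonpos)
    then show ?thesis using ge False a[OF False] by (simp add: g_def flat0_bounds(3))
   qed
  qed
  moreover have "(%m. plateau ((1 / real (Suc m)) * t + 0)) \<longlonglongrightarrow> 1"
  proof (rule tendsto_eventually, unfold eventually_sequentially, intro exI allI impI)
   fix m assume "nat \<lceil>\<bar>t\<bar>\<rceil> <= m"
   then have "\<bar>t\<bar> <= real (Suc m)" by linarith
   then show "plateau ((1 / real (Suc m)) * t + 0) = 1" by (intro plateau_bounds(3)) (simp add: abs_mult divide_le_eq)
  qed
  ultimately show ?thesis unfolding h_def using tendsto_mult by fastforce
 qed
 have fl: "(%m. f m x) \<longlonglongrightarrow> indicator X x" for x
 proof -
  have "(%m. f m x) \<longlonglongrightarrow> (\<Prod>i<n. indicator (B i) (x i))" unfolding f_def by (intro tendsto_prod hl)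
  moreover have "(\<Prod>i<n. indicator (B i) (x i)) = (indicator X x :: real)"
  proof (cases "x \<in> X")
   case True then show ?thesis unfolding B(1) by (simp add: indicator_def)
  next
   case False
   then obtain i where i: "x i \<notin> B i" unfolding B(1) by blast
   then have "i < n" using n by (metis UNIV_I not_less)
   then have "(\<Prod>i<n. indicator (B i) (x i)) = (0 :: real)" using i by (intro prod_zero bexI[of _ i]) auto
   then show ?thesis using False by simp
  qed
  ultimately show ?thesis by simp
 qed
 show ?thesis
 proof (rule L2_closure_bounded_limit[of f _ "%x. 1"])
  show "f m \<in> L2_closure" for m by (rule D_L2_closure[OF C_D[OF fF]])
  have "X \<in> sets borel" unfolding lower_boxes_borel using X by blast
  then have "indicator X \<in> borel_measurable borel" by (rule borel_measurable_indicator)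
  then show "(indicator X :: _ => real) \<in> borel_measurable \<mu>" by (rule borel_comp)
 qed (use fl fb const_L2 in auto)
qed

text \<open>Dynkin's theorem. Complements are where the constant 1 has to lie in the domain.\<close>

lemma indicator_borel:
 assumes one: "(%x. 1) \<in> D" and A: "A \<in> sets borel" shows "(indicator A :: _ => real) \<in> L2_closure"
proof -
 have m: "(indicator A :: _ => real) \<in> borel_measurable \<mu>" if "A \<in> sigma_sets UNIV lower_boxes" for A
  by (rule borel_comp[OF borel_measurable_indicator]) (simp add: that lower_boxes_borel)
 have "lower_boxes \<subseteq> Pow UNIV" by simp
 from lower_boxes_Int_stable this A[unfolded lower_boxes_borel] show ?thesis
 proof (induction A rule: sigma_sets_induct_disjoint)
  case (basic A) then show ?case by (rule indicator_lower_box)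
 next
  case empty
  then show ?case using D_L2_closure[OF E.mem_zero[OF one]] by simp
 next
  case (compl A)
  have "(%x. 1 * 1 + (- 1) * indicator A x) \<in> L2_closure"
   by (rule L2_closure_lincomb[OF D_L2_closure[OF one] compl.IH])
  moreover have "(%x. 1 * 1 + (- 1) * indicator A x) = (indicator (UNIV - A) :: _ => real)"
   by (auto simp: fun_eq_iff indicator_def)
  ultimately show ?case by simp
 next
  case (union A)
  show ?case
  proof (rule L2_closure_bounded_limit[of "%n x. \<Sum>i<n. indicator (A i) x" _ "%x. 1"])
   show "(%x. \<Sum>i<n. indicator (A i) x) \<in> L2_closure" for n using union.IH by (intro L2_closure_sum) auto
   show "(indicator (\<Union>i. A i) :: _ => real) \<in> borel_measurable \<mu>" using union.hyps(2) by (intro m sigma_sets.Union) auto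
   show "AE x in \<mu>. (%n. \<Sum>i<n. indicator (A i) x) \<longlonglongrightarrow> (indicator (\<Union>i. A i) x :: real)"
    using indicator_sums[of A] union.hyps(1) by (auto simp: sums_def disjoint_family_on_def)
   have "(\<Sum>i<n. indicator (A i) x) = (indicator (\<Union>i<n. A i) x :: real)" for n x
    using union.hyps(1) by (subst indicator_UN_disjoint) (auto simp: disjoint_family_on_def)
   then show "AE x in \<mu>. \<bar>\<Sum>i<n. indicator (A i) x\<bar> <= \<bar>1 :: real\<bar>" for n by (simp add: indicator_def)
  qed (rule const_L2)
 qed
qed

end

section \<open>The compact nest and strict quasi-regularity\<close>

locale topological_setting = cond_density_setting \<mu> \<kappa> \<rho> \<alpha>
 for \<mu> :: "(nat => real) measure" and \<kappa> \<rho> \<alpha> +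
 fixes T :: "(nat => real) topology" and K :: "nat => (nat => real) set"
 assumes Hausdorff: "Hausdorff_space T"
  and continuous_coord: "!!i. continuous_map T euclideanreal (%x. x i)"
  and sets_\<mu>: "sets \<mu> = sets (borel_field T)"
  and compact_K: "!!k. compactin T (K k)"
  and exhausted_K: "exhausted K"
begin

lemma opens_Pow: "{U. openin T U} \<subseteq> Pow (topspace T)" using openin_subset by blast

lemma space_\<mu>: "space \<mu> = topspace T"
 using sets_eq_imp_space_eq[OF sets_\<mu>] unfolding borel_field_def by (simp add: space_measure_of[OF opens_Pow])

lemma continuous_id: "continuous_map T euclidean (%x. x)"
 using continuous_coord by (simp add: euclidean_product_topology[symmetric] continuous_map_componentwise_UNIV)

lemma continuous_FC0: "f \<in> FC0 ==> continuous_map T euclideanreal f"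
 using continuous_map_compose[OF continuous_id, of euclideanreal f] FC0_continuous[of f] by (simp add: o_def)

lemma compactin_closed: assumes "compactin T C" shows "closed C"
 using image_compactin[OF assms continuous_id] by (simp add: compact_imp_closed)

text \<open>A relatively closed subset of a \<open>T\<close>-compact set is
  \<open>T\<close>-compact, so its image under the continuous inclusion into the product is compact
  and hence closed. Within compact sets the Borel field of \<open>T\<close> thus brings nothing new
  compared to the product, although globally it may be larger.\<close>

lemma Int_compact_borel:
 assumes C: "compactin T C" and A: "A \<in> sets \<mu>" shows "A \<inter> C \<in> sets borel"
proof -
 have CT: "C \<subseteq> topspace T" by (rule compactin_subset_topspace[OF C])
 have C': "C \<in> sets borel" using compactin_closed[OF C] by (rule borel_closed)
 have "A \<in> sigma_sets (topspace T) {U. openin T U}"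
  using A unfolding sets_\<mu> borel_field_def by (simp add: sets_measure_of[OF opens_Pow])
 then show ?thesis
 proof induction
  case (Basic U)
  have "compactin T (C \<inter> (topspace T - U))"
   using Basic by (intro compact_Int_closedin[OF C] openin_closedin_eq[THEN iffD1, THEN conjunct2]) auto
  then have "C \<inter> (topspace T - U) \<in> sets borel" using compactin_closed borel_closed by blast
  then have "C - C \<inter> (topspace T - U) \<in> sets borel" using C' by (rule sets.Diff[rotated])
  moreover have "C - C \<inter> (topspace T - U) = U \<inter> C" using CT by blast
  ultimately show ?case by simp
 next
  case Empty show ?case by simp
 next
  case (Compl A)
  have "C - A \<inter> C \<in> sets borel" using C' Compl.IH by (rule sets.Diff)
  moreover have "C - A \<inter> C = (topspace T - A) \<inter> C" using CT by blast
  ultimately show ?case by simp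
 next
  case (Union A)
  have "(\<Union>i. A i \<inter> C) \<in> sets borel" using Union.IH by blast
  then show ?case by (simp add: Int_UN_distrib2)
 qed
qed

lemma one_D: "(%x. 1) \<in> D" using exhausted_K by (simp add: exhausted_def)

lemma cutoffs:
 obtains v where "!!k. v k \<in> D" "!!k x. v k x ~= 0 ==> x \<in> K k" "(%k. form_dist (form1 \<mu> E) (v k) (%x. 1)) \<longlonglongrightarrow> 0"
 using exhausted_K unfolding exhausted_def by blast

lemma AE_exhausted: "AE x in \<mu>. EX k. x \<in> K k"
proof -
 obtain v where v: "!!k. v k \<in> D" "!!k x. v k x ~= 0 ==> x \<in> K k" "(%k. form_dist (form1 \<mu> E) (v k) (%x. 1)) \<longlonglongrightarrow> 0"
  by (rule cutoffs) blast
 obtain r :: "nat => nat" where r: "strict_mono r" "AE x in \<mu>. (%k. v (r k) x) \<longlonglongrightarrow> 1"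
  by (rule L2_AE_subseq[OF DL[OF v(1)] const_L2 tendsto_E1_imp(2)[OF v(1) one_D v(3)]])
 from r(2) show ?thesis
 proof eventually_elim
  fix x assume l: "(%k. v (r k) x) \<longlonglongrightarrow> 1"
  have "EX k. v (r k) x ~= 0"
  proof (rule ccontr)
   assume "\<not> ?thesis"
   then have "(%k. v (r k) x) = (%k. 0)" by auto
   with l show False using LIMSEQ_unique[OF tendsto_const[of "0::real"]] by fastforce
  qed
  then show "EX k. x \<in> K k" using v(2) by blast
 qed
qed

definition F :: "nat => (nat => real) set" where "F k = (\<Union>j\<le>k. K j)"

lemma F_compact: "compactin T (F k)"
 unfolding F_def by (rule compactin_Union) (use compact_K in auto)

lemma F_incseq: "incseq F" unfolding F_def by (intro incseq_SucI UN_mono) auto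

text \<open>The sets \<open>F k\<close> exhaust the space almost everywhere, so every event is a
  limit of its traces on them, which are Borel in the product.\<close>

lemma L2_closure_full: "f \<in> L2_fun \<mu> ==> f \<in> L2_closure"
proof (rule L2_closure_UNIV)
 fix A assume A: "A \<in> sets \<mu>"
 show "(indicator A :: _ => real) \<in> L2_closure"
 proof (rule L2_closure_bounded_limit[where f = "%k. indicator (A \<inter> F k)" and g = "%x. 1"])
  show "(indicator (A \<inter> F k) :: _ => real) \<in> L2_closure" for k
   by (rule indicator_borel[OF one_D Int_compact_borel[OF F_compact A]])
  show "(indicator A :: _ => real) \<in> borel_measurable \<mu>" using A by simp
  show "AE x in \<mu>. (%k. indicator (A \<inter> F k) x) \<longlonglongrightarrow> (indicator A x :: real)"
   using AE_exhausted
  proof eventually_elim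
   fix x assume "EX k. x \<in> K k"
   then obtain k where k: "x \<in> K k" by blast
   have "indicator (A \<inter> F j) x = (indicator A x :: real)" if "k <= j" for j
    using k that unfolding F_def indicator_def by auto
   then show "(%k. indicator (A \<inter> F k) x) \<longlonglongrightarrow> (indicator A x :: real)"
    by (intro tendsto_eventually) (auto simp: eventually_sequentially)
  qed
 qed (auto simp: indicator_def const_L2)
qed

sublocale Dirichlet: dirichlet_form \<mu> D E
proof (intro dirichlet_form.intro dirichlet_form_axioms.intro)
 show "closed_form \<mu> D E" by unfold_locales
 show "\<exists>u\<in>D. L2_dist \<mu> f u < e" if "f \<in> L2_fun \<mu>" "0 < e" for f and e :: real
  using L2_closure_full[OF that(1)] that(2) unfolding L2_closure_def by blast
 show "(%x. min 1 (max 0 (u x))) \<in> D" if "u \<in> D" for u using D_clamp(1)[OF that] .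
 show "E (%x. min 1 (max 0 (u x))) (%x. min 1 (max 0 (u x))) <= E u u" if "u \<in> D" for u using D_clamp(2)[OF that] .
qed

context
 fixes \<phi> :: "(nat => real) => real"
 assumes \<phi>: "\<phi> \<in> L2_fun \<mu>" "\<forall>x\<in>space \<mu>. 0 < \<phi> x"
begin

lemma strict_nest_F: "strict_nest T \<mu> \<phi> D E F"
proof -
 obtain v where v: "!!k. v k \<in> D" "!!k x. v k x ~= 0 ==> x \<in> K k" "(%k. form_dist (form1 \<mu> E) (v k) (%x. 1)) \<longlonglongrightarrow> 0"
  by (rule cutoffs) blast
 show ?thesis
 proof (rule Dirichlet.strict_nest_criterion[OF one_D energy_one[OF one_D] \<phi> F_incseq])
  show "closedin T (F k)" for k by (rule compactin_imp_closedin[OF Hausdorff F_compact])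
  show "(%x. 1 - v k x) \<in> D" for k by (rule E.mem_diff[OF one_D v(1)])
  show "AE x in \<mu>. x \<in> topspace T - F k --> 1 <= 1 - v k x" for k
  proof (intro AE_I2 impI)
   fix x assume "x \<in> topspace T - F k"
   then have "x \<notin> K k" by (auto simp: F_def)
   then have "v k x = 0" using v(2) by blast
   then show "1 <= 1 - v k x" by simp
  qed
  have "form_dist (form1 \<mu> E) (v k) (%x. 1) = E1.nrm (%x. 1 - v k x)" for k
   by (subst E1.dist_commute[OF v(1) one_D]) (rule E1.dist_nrm)
  then have "form1 \<mu> E (%x. 1 - v k x) (%x. 1 - v k x) = (form_dist (form1 \<mu> E) (v k) (%x. 1))\<^sup>2" for k
   by (simp only: E1.nrm_sq[OF E1.mem_diff[OF one_D v(1)]])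
  then show "(%k. form1 \<mu> E (%x. 1 - v k x) (%x. 1 - v k x)) \<longlonglongrightarrow> 0"
   using tendsto_power[OF v(3), of 2] by simp
 qed
qed

lemma continuous_quasi_continuous: "continuous_map T euclideanreal f ==> strictly_quasi_continuous T \<mu> \<phi> D E f"
 unfolding strictly_quasi_continuous_def using strict_nest_F continuous_map_from_subtopology by blast

text \<open>A cylinder function that equals the coordinate \<open>x i\<close> on a box of size
  \<open>R\<close>. The plateau acts on all variables up to \<open>i\<close>, since the support must
  be bounded in each of them.\<close>

definition sep :: "nat => nat => (nat => real) => real" where
 "sep i R x = (\<Prod>j<Suc i. plateau ((1 / real (Suc R)) * x j + 0) * (if j = i then x j else 1))"

lemma sep_FC0: "sep i R \<in> FC0"
 unfolding sep_def[abs_def]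
proof (rule FC0_product)
 fix j k
 have "Ck k (%t. if j = i then t else 1)" by (cases "j = i") (simp_all add: Ck_ident Ck_const)
 then show "Ck k (%t. plateau ((1 / real (Suc R)) * t + 0) * (if j = i then t else 1))"
  by (intro Ck_mult Ck_compose[OF Ck_plateau Ck_affine])
next
 fix j t assume "plateau ((1 / real (Suc R)) * t + 0) * (if j = i then t else 1) ~= 0"
 then have "\<not> 3 <= \<bar>(1 / real (Suc R)) * t + 0\<bar>" using plateau_bounds(4) by fastforce
 then show "\<bar>t\<bar> <= 3 * real (Suc R)" by (simp add: abs_mult divide_less_eq not_le)
qed simp

lemma sep_eq: "(!!j. j <= i ==> \<bar>x j\<bar> <= real R) ==> sep i R x = x i"
proof -
 assume R: "!!j. j <= i ==> \<bar>x j\<bar> <= real R"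
 have "plateau ((1 / real (Suc R)) * x j + 0) = 1" if "j <= i" for j
  using R[OF that] by (intro plateau_bounds(3)) (simp add: abs_mult divide_le_eq)
 then show "sep i R x = x i" unfolding sep_def by (simp add: prod.neutral)
qed

theorem strictly_quasi_regular_form: "strictly_quasi_regular_Dirichlet_form T \<mu> \<phi> D E"
 unfolding strictly_quasi_regular_Dirichlet_form_def strictly_quasi_regular_def
proof (intro conjI)
 show "symmetric_Dirichlet_form \<mu> D E" by (rule Dirichlet.symmetric_Dirichlet_form)
 show "EX F. strict_nest T \<mu> \<phi> D E F \<and> (ALL k. compactin T (F k))" using strict_nest_F F_compact by blast
 show "\<exists>A\<subseteq>D. (\<forall>u\<in>D. \<forall>e>0. \<exists>a\<in>A. L2_dist \<mu> u a + form_dist E u a < e) \<and>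
   (\<forall>a\<in>A. EX v. strictly_quasi_continuous T \<mu> \<phi> D E v \<and> (AE x in \<mu>. v x = a x))"
 proof (intro exI[of _ FC0] conjI ballI allI impI)
  show "FC0 \<subseteq> D" using C_D by blast
  show "\<exists>a\<in>FC0. L2_dist \<mu> u a + form_dist E u a < e" if "u \<in> D" "0 < e" for u and e :: real
   using C_dense_sum[OF that] by blast
  show "EX v. strictly_quasi_continuous T \<mu> \<phi> D E v \<and> (AE x in \<mu>. v x = a x)" if "a \<in> FC0" for a
   using continuous_quasi_continuous[OF continuous_FC0[OF that]] by (intro exI[of _ a]) simp
 qed
 \<comment> \<open>The constant 1 comes first: it separates every point from the adjoined one, at
   which all functions vanish.\<close>
 define u where "u n = (case n of 0 => (%x. 1) | Suc m => sep (fst (prod_decode m)) (snd (prod_decode m)))" for n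
 have uD: "u n \<in> D" for n unfolding u_def using one_D C_D[OF sep_FC0] by (simp split: nat.split)
 have uc: "continuous_map T euclideanreal (u n)" for n unfolding u_def using continuous_FC0[OF sep_FC0] by (simp split: nat.split)
 have us: "EX n. u n x ~= u n y" if ne: "x ~= y" for x y
 proof -
  obtain i where i: "x i ~= y i" using ne by blast
  define R where "R = nat \<lceil>\<Sum>j\<le>i. \<bar>x j\<bar> + \<bar>y j\<bar>\<rceil>"
  have R: "\<bar>x j\<bar> <= real R" "\<bar>y j\<bar> <= real R" if "j <= i" for j
  proof -
   have "\<bar>x j\<bar> + \<bar>y j\<bar> <= (\<Sum>j\<le>i. \<bar>x j\<bar> + \<bar>y j\<bar>)" using that by (intro member_le_sum) auto
   also have "\<dots> <= real R" unfolding R_def by linarith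
   finally show "\<bar>x j\<bar> <= real R" "\<bar>y j\<bar> <= real R" by linarith+
  qed
  have "u (Suc (prod_encode (i, R))) x ~= u (Suc (prod_encode (i, R))) y"
   using i by (simp add: u_def sep_eq R)
  then show ?thesis by blast
 qed
 show "EX u v N. (\<forall>n::nat. u n \<in> D \<and> strictly_quasi_continuous T \<mu> \<phi> D E (v n) \<and> (AE x in \<mu>. v n x = u n x)) \<and>
   strictly_exceptional T \<mu> \<phi> D E N \<and>
   (\<forall>z\<in>insert None (Some ` (topspace T - N)). \<forall>w\<in>insert None (Some ` (topspace T - N)).
     z ~= w --> (EX n. case_option 0 (v n) z ~= case_option 0 (v n) w))"
 \<comment> \<open>The separating functions are continuous and separate all points, so the
   exceptional set can be empty.\<close>
 proof (intro exI[of _ u] exI[of _ "{}"] conjI allI ballI impI)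
  show "u n \<in> D" "strictly_quasi_continuous T \<mu> \<phi> D E (u n)" for n by (rule uD, rule continuous_quasi_continuous[OF uc])
  show "AE x in \<mu>. u n x = u n x" for n by simp
  show "strictly_exceptional T \<mu> \<phi> D E {}" unfolding strictly_exceptional_def using strict_nest_F by blast
  have u0: "u 0 x = 1" for x by (simp add: u_def)
  fix z w :: "(nat => real) option" assume "z ~= w"
  then consider x where "z = None" "w = Some x" | x where "z = Some x" "w = None"
   | x y where "z = Some x" "w = Some y" "x ~= y" by (cases z; cases w) auto
  then show "EX n. case_option 0 (u n) z ~= case_option 0 (u n) w"
  proof cases
   case 1 then show ?thesis using u0 by (intro exI[of _ 0]) simp
  next
   case 2 then show ?thesis using u0 by (intro exI[of _ 0]) simp
  next
   case 3 then show ?thesis using us by simp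
  qed
 qed
qed

end

end

section \<open>The state spaces\<close>

lemma continuous_on_suminf:
 fixes f :: "nat => 'a::topological_space => real"
 assumes "!!n. continuous_on A (f n)" "!!n x. x \<in> A ==> \<bar>f n x\<bar> <= M n" "summable M"
 shows "continuous_on A (%x. \<Sum>n. f n x)"
proof (rule uniform_limit_theorem)
 show "uniform_limit A (%n x. \<Sum>i<n. f i x) (%x. \<Sum>i. f i x) sequentially"
  by (rule Weierstrass_m_test[OF _ assms(3)]) (use assms(2) in simp)
 show "\<forall>\<^sub>F n in sequentially. continuous_on A (%x. \<Sum>i<n. f i x)"
  using assms(1) by (intro always_eventually allI continuous_on_sum) auto
qed simp

lemma compact_box: "compact {x :: nat => real. ALL i. \<bar>x i\<bar> <= r i}"
proof -
 have "compactin (product_topology (%i. euclidean) UNIV) (PiE UNIV (%i. {- r i..r i}))"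
  unfolding compactin_PiE by simp
 moreover have "t \<in> {- s..s} \<longleftrightarrow> \<bar>t\<bar> <= s" for s t :: real by auto
 then have "PiE UNIV (%i. {- r i..r i}) = {x. ALL i. \<bar>x i\<bar> <= r i}"
  by (simp add: PiE_UNIV_domain Pi_def del: atLeastAtMost_iff)
 ultimately show ?thesis by (simp add: euclidean_product_topology)
qed

text \<open>The premise says that the identity from \<open>B\<close> with its original topology into
  the metric space is continuous; compactness is then carried over to the image.\<close>

lemma compactin_mtopology_if_continuous:
 fixes B :: "'a::topological_space set"
 assumes M: "Metric_space M d" and B: "compact B" "B \<subseteq> M"
  and c: "!!x e. x \<in> B ==> 0 < e ==> EX U. openin (top_of_set B) U \<and> x \<in> U \<and> (\<forall>y\<in>U. d x y < e)"
 shows "compactin (Metric_space.mtopology M d) B"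
proof -
 interpret Metric_space M d by (rule M)
 have "continuous_map (top_of_set B) mtopology (%x. x)"
  unfolding continuous_map_to_metric
 proof (intro ballI allI impI)
  fix x and e :: real assume x: "x \<in> topspace (top_of_set B)" and e: "0 < e"
  then obtain U where U: "openin (top_of_set B) U" "x \<in> U" "\<forall>y\<in>U. d x y < e" using c[of x e] by auto
  have "y \<in> mball x e" if "y \<in> U" for y
   using U(3) that openin_subset[OF U(1)] x B(2) by (auto simp: in_mball)
  then show "EX U. openin (top_of_set B) U \<and> x \<in> U \<and> (\<forall>y\<in>U. y \<in> mball x e)" using U by blast
 qed
 moreover have "compactin (top_of_set B) B" using B(1) by (simp add: compactin_subtopology)
 ultimately show ?thesis using image_compactin by fastforce
qed

lemma compactin_mtopology_if_continuous_on:
 fixes B :: "'a::topological_space set"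
 assumes M: "Metric_space M d" and B: "compact B" "B \<subseteq> M" and c: "!!x. x \<in> B ==> continuous_on B (d x)"
 shows "compactin (Metric_space.mtopology M d) B"
proof (rule compactin_mtopology_if_continuous[OF M B])
 interpret Metric_space M d by (rule M)
 fix x and e :: real assume x: "x \<in> B" and e: "0 < e"
 have "openin (top_of_set B) (B \<inter> d x -` {..<e})" by (rule continuous_openin_preimage_gen[OF c[OF x]]) simp
 moreover have "x \<in> B \<inter> d x -` {..<e}" using x e B(2) by auto
 ultimately show "EX U. openin (top_of_set B) U \<and> x \<in> U \<and> (\<forall>y\<in>U. d x y < e)" by blast
qed

lemma (in Metric_space) continuous_map_real:
 assumes "!!x e. x \<in> M ==> 0 < e ==> \<exists>r>0. \<forall>y\<in>M. d x y < r --> \<bar>f x - f y\<bar> < e"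
 shows "continuous_map mtopology euclideanreal f"
 unfolding continuous_map_from_metric
proof (intro conjI ballI allI impI)
 fix x U assume x: "x \<in> M" and U: "openin euclideanreal U \<and> f x \<in> U"
 then obtain e where e: "0 < e" "!!z. dist z (f x) < e ==> z \<in> U" by (auto simp: open_dist)
 obtain r where "r > 0" "\<forall>y\<in>M. d x y < r --> \<bar>f x - f y\<bar> < e" using assms[OF x e(1)] by blast
 then show "\<exists>r>0. ALL y. y \<in> M \<and> d x y < r --> f y \<in> U"
  using e(2) by (intro exI[of _ r]) (auto simp: dist_real_def abs_minus_commute)
qed simp

lemma RN_topology_props:
 shows "Hausdorff_space RN_topology" "continuous_map RN_topology euclideanreal (%x. x i)"
  "compactin RN_topology {x. ALL i. \<bar>x i\<bar> <= r i}"
proof -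
 interpret Metric_space UNIV RN_dist by (rule Metric_space_RN)
 define q where "q k x y = (1 / 2) ^ Suc k * (L2_set (%i. x i - y i) {..<Suc k} / (L2_set (%i. x i - y i) {..<Suc k} + 1))"
  for k and x y :: "nat => real"
 have d: "RN_dist x y = (\<Sum>k. q k x y)" for x y by (simp add: RN_dist_def q_def)
 have L0: "0 <= L2_set (%i. x i - y i) {..<Suc k}" for x y :: "nat => real" and k by simp
 have q0: "0 <= q k x y" for k x y unfolding q_def using L0[of x y k] by (intro mult_nonneg_nonneg divide_nonneg_nonneg) auto
 have q1: "q k x y <= (1 / 2) ^ Suc k" for k x y
 proof -
  have "a / (a + 1) <= 1" if "0 <= a" for a :: real using that by simp
  from this[OF L0] show ?thesis unfolding q_def by (rule mult_left_le) simp
 qed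
 have s2: "summable (%k. (1 / 2 :: real) ^ Suc k)" unfolding power_Suc by (intro summable_mult summable_geometric) simp
 have s: "summable (%k. q k x y)" for x y
  by (rule summable_comparison_test'[OF s2, of 0]) (use q0 q1 in \<open>simp add: abs_of_nonneg\<close>)
 show "Hausdorff_space RN_topology" unfolding RN_topology_def by (rule Hausdorff_space_mtopology)
 show "continuous_map RN_topology euclideanreal (%x. x i)"
  unfolding RN_topology_def
 proof (rule continuous_map_real)
  fix x and e :: real assume e: "0 < e"
  \<comment> \<open>The \<open>i\<close>-th summand, whose norm includes coordinate
    \<open>i\<close>, bounds the distance from below, and \<open>t / (t + 1) < e / (e + 1)\<close>
    amounts to \<open>t < e\<close>.\<close>
  have "\<bar>x i - y i\<bar> < e" if l: "RN_dist x y < (1 / 2) ^ Suc i * (e / (e + 1))" for y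
  proof -
   define t where "t = L2_set (%i. x i - y i) {..<Suc i}"
   have t0: "0 <= t" unfolding t_def by simp
   have "q i x y <= RN_dist x y" unfolding d using sum_le_suminf[OF s, of "{i}" x y] q0 by simp
   then have "(1 / 2) ^ Suc i * (t / (t + 1)) < (1 / 2) ^ Suc i * (e / (e + 1))" using l unfolding q_def t_def by linarith
   then have "t / (t + 1) < e / (e + 1)" by (rule mult_left_less_imp_less) simp
   then have "t < e" using t0 e by (simp add: field_simps)
   moreover have "\<bar>x i - y i\<bar> <= t" unfolding t_def using member_le_L2_set[of "{..<Suc i}" i "%i. \<bar>x i - y i\<bar>"] by (simp add: L2_set_def)
   ultimately show ?thesis by simp
  qed
  then show "\<exists>r>0. \<forall>y\<in>UNIV. RN_dist x y < r --> \<bar>x i - y i\<bar> < e"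
   using e by (intro exI[of _ "(1 / 2) ^ Suc i * (e / (e + 1))"]) simp
 qed
 show "compactin RN_topology {x. ALL i. \<bar>x i\<bar> <= r i}"
  unfolding RN_topology_def
 proof (rule compactin_mtopology_if_continuous_on[OF Metric_space_axioms compact_box])
  fix x :: "nat => real"
  have "continuous_on B (%y. \<Sum>k. q k x y)" for B
  proof (rule continuous_on_suminf[OF _ _ s2])
   have c: "continuous_on B (%y. y i)" for i :: nat and B :: "(nat => real) set"
    by (rule continuous_on_subset[OF continuous_on_product_coordinates]) simp
   have nz: "L2_set (%i. x i - y i) {..<Suc k} + 1 ~= 0" for k y using L0[of x y k] by linarith
   have "continuous_on B (%y. L2_set (%i. x i - y i) {..<Suc k})" for k
    unfolding L2_set_def by (intro continuous_intros c)
   then show "continuous_on B (%y. q k x y)" for k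
    unfolding q_def by (intro continuous_intros) (use nz in auto)
   show "\<bar>q k x y\<bar> <= (1 / 2) ^ Suc k" for k y using q0 q1 by (simp only: abs_of_nonneg)
  qed
  then show "continuous_on {x. ALL i. \<bar>x i\<bar> <= r i} (RN_dist x)" unfolding d[abs_def] .
 qed simp
qed

lemma lp_topology_props:
 assumes p: "1 <= p" and b: "ALL i. 0 < \<beta> i"
 shows "Hausdorff_space (lp_topology p \<beta>)" "continuous_map (lp_topology p \<beta>) euclideanreal (%x. x i)"
  "summable (%i. \<beta> i * \<bar>r i\<bar> powr p) ==> compactin (lp_topology p \<beta>) {x. ALL i. \<bar>x i\<bar> <= r i}"
proof -
 define d where "d x y = lp_norm p \<beta> (%i. x i - y i)" for x y
 interpret Metric_space "lp_space p \<beta>" d unfolding d_def by (rule Metric_space_lp[OF p b])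
 have T: "lp_topology p \<beta> = mtopology" unfolding lp_topology_def d_def ..
 show "Hausdorff_space (lp_topology p \<beta>)" unfolding T by (rule Hausdorff_space_mtopology)
 show "continuous_map (lp_topology p \<beta>) euclideanreal (%x. x i)"
  unfolding T
 proof (rule continuous_map_real)
  fix x and e :: real assume x: "x \<in> lp_space p \<beta>" and e: "0 < e"
  have "\<bar>x i - y i\<bar> < e" if y: "y \<in> lp_space p \<beta>" and l: "d x y < \<beta> i powr (1 / p) * e" for y
  proof -
   have s: "summable (%i. \<beta> i * \<bar>x i - y i\<bar> powr p)"
    using lp_sum_bound(1)[OF p b x, of "%i. - y i"] y by (simp add: lp_space_def)
   have "\<beta> i * \<bar>x i - y i\<bar> powr p <= (\<Sum>i. \<beta> i * \<bar>x i - y i\<bar> powr p)"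
    using sum_le_suminf[OF s, of "{i}"] b by (simp add: less_imp_le)
   moreover have "0 <= \<beta> i * \<bar>x i - y i\<bar> powr p" using b[rule_format, of i] by simp
   ultimately have "(\<beta> i * \<bar>x i - y i\<bar> powr p) powr (1 / p) <= d x y"
    unfolding d_def lp_norm_def using p by (intro powr_mono2) auto
   moreover have "(\<beta> i * \<bar>x i - y i\<bar> powr p) powr (1 / p) = \<beta> i powr (1 / p) * \<bar>x i - y i\<bar>"
    using p b by (simp add: powr_mult powr_powr)
   ultimately have "\<beta> i powr (1 / p) * \<bar>x i - y i\<bar> < \<beta> i powr (1 / p) * e" using l by linarith
   moreover have "0 < \<beta> i powr (1 / p)" using b by (simp add: less_imp_neq[symmetric])
   ultimately show ?thesis by (simp add: mult_less_cancel_left_pos)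
  qed
  moreover have "0 < \<beta> i powr (1 / p) * e" using b[rule_format, of i] e by simp
  ultimately show "\<exists>r>0. \<forall>y\<in>lp_space p \<beta>. d x y < r --> \<bar>x i - y i\<bar> < e" by blast
 qed
 assume s: "summable (%i. \<beta> i * \<bar>r i\<bar> powr p)"
 show "compactin (lp_topology p \<beta>) {x. ALL i. \<bar>x i\<bar> <= r i}"
  unfolding T
 proof (rule compactin_mtopology_if_continuous_on[OF Metric_space_axioms compact_box])
  let ?B = "{x. ALL i. \<bar>x i\<bar> <= r i}"
  have le: "\<beta> i * \<bar>t\<bar> powr p <= \<beta> i * \<bar>s\<bar> powr p" if "\<bar>t\<bar> <= \<bar>s\<bar>" for s t i
   using that b[rule_format, of i] p by (intro mult_left_mono powr_mono2) auto
  show "?B \<subseteq> lp_space p \<beta>"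
  proof
   fix x assume "x \<in> ?B"
   then have "\<bar>x i\<bar> <= \<bar>r i\<bar>" for i by (metis abs_ge_self mem_Collect_eq order_trans)
   then show "x \<in> lp_space p \<beta>" unfolding lp_space_def using le b
    by (intro CollectI summable_comparison_test'[OF s, of 0]) (simp add: abs_of_nonneg less_imp_le)
  qed
  fix x assume x: "x \<in> ?B"
  \<comment> \<open>Two points of the box differ by at most \<open>2 * r i\<close> in coordinate
    \<open>i\<close>; this series is the majorant for uniform convergence.\<close>
  have s2: "summable (%i. \<beta> i * \<bar>2 * r i\<bar> powr p)"
  proof -
   have "\<beta> i * \<bar>2 * r i\<bar> powr p = 2 powr p * (\<beta> i * \<bar>r i\<bar> powr p)" for i by (simp add: abs_mult powr_mult)
   then show ?thesis using summable_mult[OF s, of "2 powr p"] by (simp only:)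
  qed
  have "continuous_on ?B (%y. \<Sum>i. \<beta> i * \<bar>x i - y i\<bar> powr p)"
  proof (rule continuous_on_suminf[OF _ _ s2])
   have c: "continuous_on B (%y. y i)" for i :: nat and B :: "(nat => real) set"
    by (rule continuous_on_subset[OF continuous_on_product_coordinates]) simp
   show "continuous_on ?B (%y. \<beta> i * \<bar>x i - y i\<bar> powr p)" for i
    using p by (intro continuous_intros continuous_on_powr' c) auto
   fix i y assume y: "y \<in> ?B"
   have "\<bar>x i\<bar> <= r i" "\<bar>y i\<bar> <= r i" using x y by auto
   then have "\<bar>x i - y i\<bar> <= \<bar>2 * r i\<bar>" by linarith
   from le[OF this, of i] show "\<bar>\<beta> i * \<bar>x i - y i\<bar> powr p\<bar> <= \<beta> i * \<bar>2 * r i\<bar> powr p"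
    using b[rule_format, of i] by (simp add: abs_mult)
  qed
  moreover have "0 <= (\<Sum>i. \<beta> i * \<bar>x i - y i\<bar> powr p)" if "y \<in> ?B" for y
  proof (rule suminf_nonneg)
   have "\<bar>x i - y i\<bar> <= \<bar>2 * r i\<bar>" for i
   proof -
    have "\<bar>x i\<bar> <= r i" "\<bar>y i\<bar> <= r i" using x that by auto
    then show ?thesis by linarith
   qed
   then show "summable (%i. \<beta> i * \<bar>x i - y i\<bar> powr p)" using le b
    by (intro summable_comparison_test'[OF s2, of 0]) (simp add: abs_of_nonneg less_imp_le)
  qed (use b in \<open>simp add: less_imp_le\<close>)
  ultimately show "continuous_on ?B (d x)"
   unfolding d_def[abs_def] lp_norm_def using p by (intro continuous_on_powr' continuous_intros) auto
 qed
qed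

lemma linf_space_iff:
 assumes b: "ALL i. 0 < \<beta> i" shows "x \<in> linf_space \<beta> \<longleftrightarrow> (EX C. ALL i. \<beta> i * \<bar>x i\<bar> <= C)"
proof
 assume "x \<in> linf_space \<beta>"
 then obtain C where C: "0 <= C" "(SUP i. ennreal (\<beta> i * \<bar>x i\<bar>)) = ennreal C"
  unfolding linf_space_def by (cases "SUP i. ennreal (\<beta> i * \<bar>x i\<bar>)") auto
 have "\<beta> i * \<bar>x i\<bar> <= C" for i
  using SUP_upper[of i UNIV "%i. ennreal (\<beta> i * \<bar>x i\<bar>)"] C by simp
 then show "EX C. ALL i. \<beta> i * \<bar>x i\<bar> <= C" by blast
next
 assume "EX C. ALL i. \<beta> i * \<bar>x i\<bar> <= C"
 then obtain C where "!!i. \<beta> i * \<bar>x i\<bar> <= C" by blast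
 then have "(SUP i. ennreal (\<beta> i * \<bar>x i\<bar>)) <= ennreal C" by (intro SUP_least ennreal_leI)
 then show "x \<in> linf_space \<beta>" unfolding linf_space_def by (auto intro: le_less_trans)
qed

lemma linf_topology_props:
 assumes b: "ALL i. 0 < \<beta> i"
 shows "Hausdorff_space (linf_topology \<beta>)" "continuous_map (linf_topology \<beta>) euclideanreal (%x. x i)"
  "(%i. \<beta> i * \<bar>r i\<bar>) \<longlonglongrightarrow> 0 ==> compactin (linf_topology \<beta>) {x. ALL i. \<bar>x i\<bar> <= r i}"
proof -
 define d where "d x y = linf_norm \<beta> (%i. x i - y i)" for x y
 interpret Metric_space "linf_space \<beta>" d unfolding d_def by (rule Metric_space_linf[OF b])
 have T: "linf_topology \<beta> = mtopology" unfolding linf_topology_def d_def ..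
 show "Hausdorff_space (linf_topology \<beta>)" unfolding T by (rule Hausdorff_space_mtopology)
 have diff: "(%i. x i - y i) \<in> linf_space \<beta>" if x: "x \<in> linf_space \<beta>" and y: "y \<in> linf_space \<beta>" for x y
 proof -
  obtain C C' where C: "!!i. \<beta> i * \<bar>x i\<bar> <= C" "!!i. \<beta> i * \<bar>y i\<bar> <= C'" using x y unfolding linf_space_iff[OF b] by metis
  have "\<beta> i * \<bar>x i - y i\<bar> <= C + C'" for i
  proof -
   have "\<beta> i * \<bar>x i - y i\<bar> <= \<beta> i * (\<bar>x i\<bar> + \<bar>y i\<bar>)" using b[rule_format, of i] by (intro mult_left_mono) auto
   then show ?thesis using C[of i] by (simp add: distrib_left)
  qed
  then show ?thesis unfolding linf_space_iff[OF b] by blast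
 qed
 show "continuous_map (linf_topology \<beta>) euclideanreal (%x. x i)"
  unfolding T
 proof (rule continuous_map_real)
  fix x and e :: real assume x: "x \<in> linf_space \<beta>" and e: "0 < e"
  have "\<bar>x i - y i\<bar> < e" if y: "y \<in> linf_space \<beta>" and l: "d x y < \<beta> i * e" for y
  proof -
   have f: "(SUP i. ennreal (\<beta> i * \<bar>x i - y i\<bar>)) < \<infinity>" using diff[OF x y] by (simp add: linf_space_def)
   have "ennreal (\<beta> i * \<bar>x i - y i\<bar>) <= (SUP i. ennreal (\<beta> i * \<bar>x i - y i\<bar>))" by (rule SUP_upper) simp
   then have "enn2real (ennreal (\<beta> i * \<bar>x i - y i\<bar>)) <= d x y" unfolding d_def linf_norm_def using f by (intro enn2real_mono) auto
   moreover have "enn2real (ennreal (\<beta> i * \<bar>x i - y i\<bar>)) = \<beta> i * \<bar>x i - y i\<bar>"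
    using b[rule_format, of i] by (intro enn2real_ennreal) simp
   ultimately have "\<beta> i * \<bar>x i - y i\<bar> < \<beta> i * e" using l by linarith
   then show ?thesis using b by (simp only: mult_less_cancel_left_pos)
  qed
  moreover have "0 < \<beta> i * e" using b e by simp
  ultimately show "\<exists>r>0. \<forall>y\<in>linf_space \<beta>. d x y < r --> \<bar>x i - y i\<bar> < e" by blast
 qed
 assume s: "(%i. \<beta> i * \<bar>r i\<bar>) \<longlonglongrightarrow> 0"
 show "compactin (linf_topology \<beta>) {x. ALL i. \<bar>x i\<bar> <= r i}"
  unfolding T
 proof (rule compactin_mtopology_if_continuous[OF Metric_space_axioms compact_box])
  let ?B = "{x. ALL i. \<bar>x i\<bar> <= r i}"
  obtain C where C: "!!i. \<beta> i * \<bar>r i\<bar> <= C" using convergent_imp_Bseq[OF convergentI[OF s]] unfolding Bseq_def by (auto simp: abs_le_iff)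
  show "?B \<subseteq> linf_space \<beta>"
  proof
   fix x assume x: "x \<in> ?B"
   have "\<beta> i * \<bar>x i\<bar> <= C" for i
   proof -
    have "\<bar>x i\<bar> <= \<bar>r i\<bar>" using x by (metis abs_ge_self mem_Collect_eq order_trans)
    then have "\<beta> i * \<bar>x i\<bar> <= \<beta> i * \<bar>r i\<bar>" using b[rule_format, of i] by (intro mult_left_mono) auto
    then show ?thesis using C[of i] by linarith
   qed
   then show "x \<in> linf_space \<beta>" unfolding linf_space_iff[OF b] by blast
  qed
  fix x and e :: real assume x: "x \<in> ?B" and e: "0 < e"
  then have "0 < e / 4" by simp
  from order_tendstoD(2)[OF s this] obtain N where N: "!!i. N <= i ==> \<beta> i * \<bar>r i\<bar> < e / 4" by (auto simp: eventually_sequentially)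
  \<comment> \<open>The first \<open>N\<close> coordinates are controlled by the product topology.
    For the others membership in the box is enough: the weighted difference is at most twice the
    weighted radius, below \<open>2 * (e / 4)\<close>.\<close>
  define U where "U = ?B \<inter> {y. \<forall>i\<in>{..<N}. \<beta> i * \<bar>x i - y i\<bar> < e / 2}"
  have "open {y :: nat => real. \<forall>i\<in>{..<N}. \<beta> i * \<bar>x i - y i\<bar> < e / 2}"
   unfolding Collect_ball_eq
   by (intro open_INT ballI finite_lessThan open_Collect_less continuous_intros continuous_on_product_coordinates)
  then have o: "openin (top_of_set ?B) U" unfolding U_def by (rule openin_open_Int)
  have xU: "x \<in> U" using x e by (simp add: U_def)
  have "d x y < e" if y: "y \<in> U" for y
  proof -
   have "\<beta> i * \<bar>x i - y i\<bar> <= e / 2" for i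
   proof (cases "i < N")
    case True then show ?thesis using y by (auto simp: U_def intro: less_imp_le)
   next
    case False
    have "\<bar>x i\<bar> <= r i" "\<bar>y i\<bar> <= r i" using x y by (auto simp: U_def)
    then have "\<bar>x i - y i\<bar> <= 2 * \<bar>r i\<bar>" by linarith
    then have "\<beta> i * \<bar>x i - y i\<bar> <= \<beta> i * (2 * \<bar>r i\<bar>)" using b[rule_format, of i] by (intro mult_left_mono) auto
    then show ?thesis using N[of i] False by simp
   qed
   then have "(SUP i. ennreal (\<beta> i * \<bar>x i - y i\<bar>)) <= ennreal (e / 2)" by (intro SUP_least ennreal_leI)
   then have "d x y <= e / 2" unfolding d_def linf_norm_def using e by (intro enn2real_leI) auto
   then show ?thesis using e by simp
  qed
  then show "EX U. openin (top_of_set ?B) U \<and> x \<in> U \<and> (\<forall>y\<in>U. d x y < e)" using o xU by blast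
 qed
qed

lemma coord_measurable:
 assumes s: "sets \<mu> = sets (borel_field T)" and c: "continuous_map T euclideanreal f"
 shows "f \<in> borel_measurable \<mu>"
proof (rule borel_measurableI)
 have P: "{U. openin T U} \<subseteq> Pow (topspace T)" using openin_subset by blast
 have sp: "space \<mu> = topspace T"
  using sets_eq_imp_space_eq[OF s] unfolding borel_field_def by (simp add: space_measure_of[OF P])
 fix S :: "real set" assume "open S"
 then have "openin T {x \<in> topspace T. f x \<in> S}" by (intro openin_continuous_map_preimage[OF c]) simp
 moreover have "f -` S \<inter> space \<mu> = {x \<in> topspace T. f x \<in> S}" unfolding sp by auto
 ultimately show "f -` S \<inter> space \<mu> \<in> sets \<mu>"
  unfolding s borel_field_def by (simp add: sets_measure_of[OF P])
qed

text \<open>The common form of the first two cases, with radii \<open>1 / (b c)\<close>: for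
  \<open>l^p\<close> the factors are the \<open>p\<close>-th roots of \<open>\<beta>\<close> and
  \<open>\<gamma>\<close>, for \<open>l^\<infinity>\<close> they are \<open>\<beta>\<close> and
  \<open>\<gamma>\<close> themselves.\<close>

lemma (in cond_density_setting) exhausted_weighted_boxes:
 assumes bc: "!!i. 0 < b i" "!!i. 0 < c i"
  and one: "measure \<mu> (\<Union>M\<in>{1::nat..}. {x \<in> space \<mu>. ALL i. \<bar>x i\<bar> <= real M * inverse (b i) * inverse (c i)}) = 1"
  and s: "summable (%i. (b i * c i) powr (\<alpha> + 1) * measure \<mu> {x \<in> space \<mu>. b i * \<bar>x i\<bar> > M0 * inverse (c i)})"
  and d: "\<forall>M\<ge>1. ALL i. density_bound \<mu> (\<rho> i)
    {- (6 * real M * inverse (b i) * inverse (c i)) .. 6 * real M * inverse (b i) * inverse (c i)} (L M i)"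
  and l: "l < \<infinity>" "(%M. ennreal (real M powr (- \<alpha>)) *
    (\<Sum>i. ennreal (L M i * (b i * c i) powr \<alpha> * measure \<mu> {x \<in> space \<mu>. b i * \<bar>x i\<bar> > real M * inverse (c i)}))) \<longlonglongrightarrow> l"
 shows "EX m. exhausted (%k. {x. ALL i. \<bar>x i\<bar> <= m k * (inverse (b i) * inverse (c i))})"
proof -
 define R where "R i = inverse (b i) * inverse (c i)" for i
 have R: "0 < R i" for i using bc[of i] by (simp add: R_def)
 have pw: "(b i * c i) powr t = R i powr (- t)" for i t
 proof -
  have "R i = (b i * c i) powr (- 1)" using bc[of i] by (simp add: R_def powr_minus)
  then have "R i powr (- t) = (b i * c i) powr (- 1 * - t)" by (simp only: powr_powr)
  then show ?thesis by simp
 qed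
 have set: "{x \<in> space \<mu>. b i * \<bar>x i\<bar> > t * inverse (c i)} = {x \<in> space \<mu>. t * R i < \<bar>x i\<bar>}" for i t
  using bc[of i] by (auto simp: R_def field_simps)
 have as: "t * inverse (b i) * inverse (c i) = t * R i" "6 * t * R i = 6 * (t * R i)" for t i by (simp_all add: R_def)
 show ?thesis
  using exhausted_boxes[OF R, where ?M0.0 = M0 and L = L and l = l] one s d l unfolding pw set as R_def[symmetric] by simp
qed

theorem theorem3:
  fixes \<alpha> :: real and \<beta> :: "nat \<Rightarrow> real"
    and T :: "(nat \<Rightarrow> real) topology" and \<mu> :: "(nat \<Rightarrow> real) measure"
    and \<kappa> :: "nat \<Rightarrow> (nat \<Rightarrow> real) \<Rightarrow> real measure"
    and \<rho> :: "nat \<Rightarrow> (nat \<Rightarrow> real) \<Rightarrow> real \<Rightarrow> real"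
    and \<phi> :: "(nat \<Rightarrow> real) \<Rightarrow> real"
  assumes alpha: "1 < \<alpha>" "\<alpha> < 2"
    and beta: "\<forall>i. 0 < \<beta> i"
    and space: "T \<in> {lp_topology p \<beta> | p. 1 \<le> p} \<union> {linf_topology \<beta>, RN_topology}"
    and prob: "prob_space \<mu>" "sets \<mu> = sets (borel_field T)"
    and cond: "\<forall>i. cond_distribution \<mu> i (\<kappa> i)"
    and dens: "\<forall>i. cond_density \<mu> i (\<kappa> i) (\<rho> i)"
    and bounded: "\<forall>i K. compact K \<longrightarrow> (\<exists>L. density_bound \<mu> (\<rho> i) K L)"
    and phi: "\<phi> \<in> L2_fun \<mu>" "\<forall>x\<in>space \<mu>. 0 < \<phi> x"
  shows
    "(\<forall>p \<gamma> M0 L.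
        1 \<le> p \<and> T = lp_topology p \<beta> \<and>
        (\<forall>i. 0 < \<gamma> i) \<and> summable (\<lambda>i. (\<gamma> i powr (- 1 / p)) powr p) \<and>
        measure \<mu> (\<Union>M\<in>{1::nat..}. {x \<in> space \<mu>. \<forall>i.
            \<bar>x i\<bar> \<le> real M * \<beta> i powr (- 1 / p) * \<gamma> i powr (- 1 / p)}) = 1 \<and>
        summable (\<lambda>i. (\<beta> i powr (1 / p) * \<gamma> i powr (1 / p)) powr (\<alpha> + 1) *
            measure \<mu> {x \<in> space \<mu>. \<beta> i powr (1 / p) * \<bar>x i\<bar> > M0 * \<gamma> i powr (- 1 / p)}) \<and>
        (\<forall>M\<ge>1. \<forall>i. density_bound \<mu> (\<rho> i)
            {- (6 * real M * \<beta> i powr (- 1 / p) * \<gamma> i powr (- 1 / p)) ..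
                6 * real M * \<beta> i powr (- 1 / p) * \<gamma> i powr (- 1 / p)} (L M i)) \<and>
        (\<exists>l::ennreal. l < \<infinity> \<and>
          (\<lambda>M. ennreal (real M powr (- \<alpha>)) *
            (\<Sum>i. ennreal (L M i * (\<beta> i powr (1 / p) * \<gamma> i powr (1 / p)) powr \<alpha> *
              measure \<mu> {x \<in> space \<mu>. \<beta> i powr (1 / p) * \<bar>x i\<bar> > real M * \<gamma> i powr (- 1 / p)})))
          \<longlonglongrightarrow> l)
        \<longrightarrow> strictly_quasi_regular_Dirichlet_form T \<mu> \<phi> (jump_dom \<alpha> \<mu> \<kappa>) (jump_form \<alpha> \<mu> \<kappa>))
     \<and>
     (\<forall>\<gamma> M0 L.
        T = linf_topology \<beta> \<and>
        0 < \<gamma> 0 \<and> mono \<gamma> \<and> filterlim \<gamma> at_top sequentially \<and>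
        summable (\<lambda>i. (\<beta> i * \<gamma> i) powr (\<alpha> + 1) *
            measure \<mu> {x \<in> space \<mu>. \<beta> i * \<bar>x i\<bar> > M0 * inverse (\<gamma> i)}) \<and>
        (\<forall>M\<ge>1. \<forall>i. density_bound \<mu> (\<rho> i)
            {- (6 * real M * inverse (\<beta> i) * inverse (\<gamma> i)) ..
                6 * real M * inverse (\<beta> i) * inverse (\<gamma> i)} (L M i)) \<and>
        (\<exists>l::ennreal. l < \<infinity> \<and>
          (\<lambda>M. ennreal (real M powr (- \<alpha>)) *
            (\<Sum>i. ennreal (L M i * (\<beta> i * \<gamma> i) powr \<alpha> *
              measure \<mu> {x \<in> space \<mu>. \<beta> i * \<bar>x i\<bar> > real M * inverse (\<gamma> i)})))
          \<longlonglongrightarrow> l) \<and>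
        measure \<mu> (\<Union>M\<in>{1::nat..}. {x \<in> space \<mu>. \<forall>i.
            \<bar>x i\<bar> \<le> real M * inverse (\<beta> i) * inverse (\<gamma> i)}) = 1
        \<longrightarrow> strictly_quasi_regular_Dirichlet_form T \<mu> \<phi> (jump_dom \<alpha> \<mu> \<kappa>) (jump_form \<alpha> \<mu> \<kappa>))
     \<and>
     (\<forall>\<gamma> L.
        T = RN_topology \<and>
        (\<forall>i. 0 < \<gamma> i) \<and>
        (\<forall>M\<ge>1. \<forall>i. density_bound \<mu> (\<rho> i) {- (6 * real M * \<gamma> i) .. 6 * real M * \<gamma> i} (L M i)) \<and>
        (\<exists>l::ennreal. l < \<infinity> \<and>
          (\<lambda>M. ennreal (real M powr (- \<alpha>)) *
            (\<Sum>i. ennreal (L M i * \<gamma> i powr (- \<alpha>) *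
              measure \<mu> {x \<in> space \<mu>. \<bar>x i\<bar> > real M * \<gamma> i})))
          \<longlonglongrightarrow> l)
        \<longrightarrow> strictly_quasi_regular_Dirichlet_form T \<mu> \<phi> (jump_dom \<alpha> \<mu> \<kappa>) (jump_form \<alpha> \<mu> \<kappa>))"
proof -
 \<comment> \<open>The exhausting sets are constructed within the locale, so their existence enters
   as an implication from it. The locale assumptions follow for any \<open>T\<close> with continuous
   coordinates.\<close>
 have main: "strictly_quasi_regular_Dirichlet_form T \<mu> \<phi> (jump_dom \<alpha> \<mu> \<kappa>) (jump_form \<alpha> \<mu> \<kappa>)"
  if T: "Hausdorff_space T" "!!i. continuous_map T euclideanreal (%x. x i)"
   and K: "cond_density_setting \<mu> \<kappa> \<rho> \<alpha> ==> EX K. (ALL k. compactin T (K k)) \<and> cond_density_setting.exhausted \<mu> \<kappa> \<alpha> K"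
 proof -
  interpret prob_space \<mu> by (rule prob(1))
  have setting: "cond_density_setting \<mu> \<kappa> \<rho> \<alpha>"
   by (intro cond_density_setting.intro cond_density_setting_axioms.intro prob_L2.intro prob(1))
    (use alpha coord_measurable[OF prob(2) T(2)] cond dens bounded in auto)
  obtain K where K: "!!k. compactin T (K k)" "cond_density_setting.exhausted \<mu> \<kappa> \<alpha> K" using K[OF setting] by blast
  have "topological_setting \<mu> \<kappa> \<rho> \<alpha> T K"
   by (intro topological_setting.intro topological_setting_axioms.intro setting T K prob(2))
  from topological_setting.strictly_quasi_regular_form[OF this phi] show ?thesis
   unfolding jump_dom_def jump_form_def .
 qed
 show ?thesis
 proof (intro conjI allI impI; elim conjE exE)
  fix p \<gamma> M0 L l
  assume p: "1 <= p" and T: "T = lp_topology p \<beta>" and g: "ALL i. 0 < \<gamma> i" and sg: "summable (%i. (\<gamma> i powr (- 1 / p)) powr p)"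
   and h: "measure \<mu> (\<Union>M\<in>{1::nat..}. {x \<in> space \<mu>. ALL i. \<bar>x i\<bar> <= real M * \<beta> i powr (- 1 / p) * \<gamma> i powr (- 1 / p)}) = 1"
    "summable (%i. (\<beta> i powr (1 / p) * \<gamma> i powr (1 / p)) powr (\<alpha> + 1) *
      measure \<mu> {x \<in> space \<mu>. \<beta> i powr (1 / p) * \<bar>x i\<bar> > M0 * \<gamma> i powr (- 1 / p)})"
    "\<forall>M\<ge>1. ALL i. density_bound \<mu> (\<rho> i)
      {- (6 * real M * \<beta> i powr (- 1 / p) * \<gamma> i powr (- 1 / p)) ..
        6 * real M * \<beta> i powr (- 1 / p) * \<gamma> i powr (- 1 / p)} (L M i)"
    "l < \<infinity>" "(%M. ennreal (real M powr (- \<alpha>)) *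
      (\<Sum>i. ennreal (L M i * (\<beta> i powr (1 / p) * \<gamma> i powr (1 / p)) powr \<alpha> *
       measure \<mu> {x \<in> space \<mu>. \<beta> i powr (1 / p) * \<bar>x i\<bar> > real M * \<gamma> i powr (- 1 / p)})))
     \<longlonglongrightarrow> l"
  have inv: "x powr (- 1 / p) = inverse (x powr (1 / p))" for x
   using powr_minus[of x "1 / p"] by simp
  note h' = h[unfolded inv]
  note props = lp_topology_props[OF p beta, folded T]
  show "strictly_quasi_regular_Dirichlet_form T \<mu> \<phi> (jump_dom \<alpha> \<mu> \<kappa>) (jump_form \<alpha> \<mu> \<kappa>)"
  proof (rule main[OF props(1,2)])
   assume "cond_density_setting \<mu> \<kappa> \<rho> \<alpha>"
   then interpret cond_density_setting \<mu> \<kappa> \<rho> \<alpha> .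
   have pos: "0 < \<beta> i powr (1 / p)" "0 < \<gamma> i powr (1 / p)" for i using beta[rule_format, of i] g[rule_format, of i] by simp_all
   obtain m where m: "exhausted (%k. {x. ALL i. \<bar>x i\<bar> <= m k * (inverse (\<beta> i powr (1 / p)) * inverse (\<gamma> i powr (1 / p)))})"
    using exhausted_weighted_boxes[OF pos h'] by blast
   \<comment> \<open>The weights cancel: the terms are a multiple of the \<open>p\<close>-th powers
     of the given \<open>l^p\<close> sequence, so the box is compact.\<close>
   have c: "summable (%i. \<beta> i * \<bar>m k * (inverse (\<beta> i powr (1 / p)) * inverse (\<gamma> i powr (1 / p)))\<bar> powr p)" for k
   proof -
    have "\<beta> i * \<bar>m k * (inverse (\<beta> i powr (1 / p)) * inverse (\<gamma> i powr (1 / p)))\<bar> powr p = \<bar>m k\<bar> powr p * (\<gamma> i powr (- 1 / p)) powr p" for i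
    proof -
     have bp: "0 < \<beta> i" by (rule beta[rule_format])
     have "\<bar>m k * (inverse (\<beta> i powr (1 / p)) * inverse (\<gamma> i powr (1 / p)))\<bar> powr p
       = \<bar>m k\<bar> powr p * (inverse (\<beta> i powr (1 / p)) powr p * inverse (\<gamma> i powr (1 / p)) powr p)"
      by (simp add: abs_mult powr_mult)
     moreover have "inverse (\<beta> i powr (1 / p)) powr p = inverse (\<beta> i)"
     proof -
      have "inverse (\<beta> i powr (1 / p)) powr p = \<beta> i powr (- (1 / p) * p)" by (simp only: powr_minus[symmetric] powr_powr)
      also have "- (1 / p) * p = - 1" using p by simp
      also have "\<beta> i powr - 1 = inverse (\<beta> i)" using bp by (simp add: powr_minus)
      finally show ?thesis .
     qed
     ultimately show ?thesis unfolding inv using bp by simp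
    qed
    then show ?thesis using summable_mult[OF sg, of "\<bar>m k\<bar> powr p"] by simp
   qed
   show "EX K. (ALL k. compactin T (K k)) \<and> exhausted K"
    by (rule exI, rule conjI[OF _ m], rule allI, rule props(3)[OF c])
  qed
 next
  fix \<gamma> M0 L l
  assume T: "T = linf_topology \<beta>" and g0: "0 < \<gamma> 0" and mono: "mono \<gamma>" and g: "filterlim \<gamma> at_top sequentially"
   and h: "measure \<mu> (\<Union>M\<in>{1::nat..}. {x \<in> space \<mu>. ALL i. \<bar>x i\<bar> <= real M * inverse (\<beta> i) * inverse (\<gamma> i)}) = 1"
    "summable (%i. (\<beta> i * \<gamma> i) powr (\<alpha> + 1) * measure \<mu> {x \<in> space \<mu>. \<beta> i * \<bar>x i\<bar> > M0 * inverse (\<gamma> i)})"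
    "\<forall>M\<ge>1. ALL i. density_bound \<mu> (\<rho> i)
      {- (6 * real M * inverse (\<beta> i) * inverse (\<gamma> i)) .. 6 * real M * inverse (\<beta> i) * inverse (\<gamma> i)} (L M i)"
    "l < \<infinity>" "(%M. ennreal (real M powr (- \<alpha>)) *
      (\<Sum>i. ennreal (L M i * (\<beta> i * \<gamma> i) powr \<alpha> *
       measure \<mu> {x \<in> space \<mu>. \<beta> i * \<bar>x i\<bar> > real M * inverse (\<gamma> i)})))
     \<longlonglongrightarrow> l"
  note props = linf_topology_props[OF beta, folded T]
  show "strictly_quasi_regular_Dirichlet_form T \<mu> \<phi> (jump_dom \<alpha> \<mu> \<kappa>) (jump_form \<alpha> \<mu> \<kappa>)"
  proof (rule main[OF props(1,2)])
   assume "cond_density_setting \<mu> \<kappa> \<rho> \<alpha>"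
   then interpret cond_density_setting \<mu> \<kappa> \<rho> \<alpha> .
   have pos: "0 < \<beta> i" "0 < \<gamma> i" for i using beta g0 monoD[OF mono, of 0 i] by auto
   obtain m where m: "exhausted (%k. {x. ALL i. \<bar>x i\<bar> <= m k * (inverse (\<beta> i) * inverse (\<gamma> i))})"
    using exhausted_weighted_boxes[OF pos h] by blast
   \<comment> \<open>Again the weights cancel, and the weighted radii tend to 0 because
     \<open>\<gamma>\<close> tends to infinity.\<close>
   have c: "(%i. \<beta> i * \<bar>m k * (inverse (\<beta> i) * inverse (\<gamma> i))\<bar>) \<longlonglongrightarrow> 0" for k
   proof -
    have "\<beta> i * \<bar>m k * (inverse (\<beta> i) * inverse (\<gamma> i))\<bar> = \<bar>m k\<bar> * inverse (\<gamma> i)" for i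
     using pos[of i] by (simp add: abs_mult)
    then show ?thesis using tendsto_mult_right_zero[OF tendsto_inverse_0_at_top[OF g], of "\<bar>m k\<bar>"] by simp
   qed
   show "EX K. (ALL k. compactin T (K k)) \<and> exhausted K"
    by (rule exI, rule conjI[OF _ m], rule allI, rule props(3)[OF c])
  qed
 next
  fix \<gamma> L l
  assume T: "T = RN_topology" and g: "ALL i. 0 < \<gamma> i"
   and h: "\<forall>M\<ge>1. ALL i. density_bound \<mu> (\<rho> i) {- (6 * real M * \<gamma> i) .. 6 * real M * \<gamma> i} (L M i)"
    "l < \<infinity>" "(%M. ennreal (real M powr (- \<alpha>)) *
      (\<Sum>i. ennreal (L M i * \<gamma> i powr (- \<alpha>) * measure \<mu> {x \<in> space \<mu>. \<bar>x i\<bar> > real M * \<gamma> i})))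
     \<longlonglongrightarrow> l"
  note props = RN_topology_props[folded T]
  show "strictly_quasi_regular_Dirichlet_form T \<mu> \<phi> (jump_dom \<alpha> \<mu> \<kappa>) (jump_form \<alpha> \<mu> \<kappa>)"
  proof (rule main[OF props(1,2)])
   assume "cond_density_setting \<mu> \<kappa> \<rho> \<alpha>"
   then interpret cond_density_setting \<mu> \<kappa> \<rho> \<alpha> .
   have "EX m. exhausted (%k. {x. ALL i. \<bar>x i\<bar> <= m k i})"
    by (rule exhausted_products[OF _ _ h(2,3)]) (use g h(1) in \<open>simp_all add: mult.assoc\<close>)
   then obtain m where m: "exhausted (%k. {x. ALL i. \<bar>x i\<bar> <= m k i})" by blast
   show "EX K. (ALL k. compactin T (K k)) \<and> exhausted K"
    by (rule exI, rule conjI[OF _ m], rule allI, rule props(3))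
  qed
 qed
qed

end
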